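(* Let $\xi$ be a random variable with values in $\{0,1,2,\dots\}$ such that $\mathbb{E}\xi=1$ and $0<\operatorname{Var}\xi<\infty$, and let $\mathcal{T}_n$ be the conditioned Galton--Watson tree of order $n$ with offspring distribution $\xi$. Let $R(T)$ and $S(T)$ denote the number of root subtrees and the number of (general, non-fringe) subtrees of a rooted tree $T$. Then there exist constants $\mu,\sigma^2>0$ such that, as $n\to\infty$, $$\frac{\log R(\mathcal{T}_n)-\mu n}{\sqrt n}\overset{\mathrm d}{\longrightarrow} N(0,\sigma^2),\qquad \frac{\log S(\mathcal{T}_n)-\mu n}{\sqrt n}\overset{\mathrm d}{\longrightarrow} N(0,\sigma^2),$$ where $N(0,\sigma^2)$ denotes the normal distribution with mean $0$ and variance $\sigma^2$. Furthermore, $$\mathbb{E}[\log R(\mathcal{T}_n)]=\mathbb{E}[\log S(\mathcal{T}_n)]+O(\log n)=n\mu+o(\sqrt n),$$ $$\operatorname{Var}[\log R(\mathcal{T}_n)]=\operatorname{Var}[\log S(\mathcal{T}_n)]+o(n)=n\sigma^2+o(n).$$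
   Context: All trees are rooted, ordered and finite; $|T|$ is the number of nodes of $T$. A (general, or "non-fringe") subtree of $T$ is a non-empty connected subset of the node set of $T$. A root subtree of $T$ is a subtree containing the root of $T$. $S(T)$ is the number of subtrees of $T$ and $R(T)$ is the number of root subtrees of $T$. A Galton--Watson tree $\mathcal{T}$ with offspring distribution $\xi$ is the random tree in which each node independently has a number of children distributed as $\xi$; the conditioned Galton--Watson tree $\mathcal{T}_n$ is $\mathcal{T}$ conditioned on $|\mathcal{T}|=n$. Only those $n$ with $\mathbb{P}(|\mathcal{T}|=n)>0$ are considered (also in limits $n\to\infty$). *)

theory Defs
  imports "HOL-Probability.Probability" "HOL-Library.Landau_Symbols"
begin

text \<open>
  Rooted ordered trees are represented by their node sets in Ulam--Harris coding: the root is
  \<open>[]\<close>, and the children of a node \<open>u\<close>, in order, are \<open>u @ [0]\<close>, \<open>u @ [1]\<close>, and so on.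
\<close>

type_synonym node = "nat list"

definition adjacent :: "node \<Rightarrow> node \<Rightarrow> bool" where
  "adjacent u v \<longleftrightarrow> (\<exists>i. v = u @ [i] \<or> u = v @ [i])"

definition connected_nodes :: "node set \<Rightarrow> bool" where
  "connected_nodes A \<longleftrightarrow>
     (\<forall>u\<in>A. \<forall>v\<in>A. (u, v) \<in> {(x, y). x \<in> A \<and> y \<in> A \<and> adjacent x y}\<^sup>*)"

definition subtrees :: "node set \<Rightarrow> node set set" where
  "subtrees T = {A. A \<subseteq> T \<and> A \<noteq> {} \<and> connected_nodes A}"

definition root_subtrees :: "node set \<Rightarrow> node set set" where
  "root_subtrees T = {A \<in> subtrees T. [] \<in> A}"

definition num_subtrees :: "node set \<Rightarrow> nat" where
  "num_subtrees T = card (subtrees T)"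

definition num_root_subtrees :: "node set \<Rightarrow> nat" where
  "num_root_subtrees T = card (root_subtrees T)"

text \<open>
  The tree in which every node \<open>u\<close> has \<open>c u\<close> children. The values of \<open>c\<close> outside the tree
  play no role. The tree may be infinite.
\<close>

inductive_set tree_of :: "(node \<Rightarrow> nat) \<Rightarrow> node set" for c :: "node \<Rightarrow> nat" where
  root: "[] \<in> tree_of c"
| child: "u \<in> tree_of c \<Longrightarrow> i < c u \<Longrightarrow> u @ [i] \<in> tree_of c"

text \<open>
  The Galton--Watson tree with offspring distribution \<open>p\<close> is the random variable \<^const>\<open>tree_of\<close>
  on the following space of independent, \<open>p\<close>-distributed numbers of children.
\<close>

definition offspring_space :: "nat pmf \<Rightarrow> (node \<Rightarrow> nat) measure" where
  "offspring_space p = Pi\<^sub>M UNIV (\<lambda>_. measure_pmf p)"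

definition size_event :: "nat pmf \<Rightarrow> nat \<Rightarrow> (node \<Rightarrow> nat) set" where
  "size_event p n = {c \<in> space (offspring_space p). finite (tree_of c) \<and> card (tree_of c) = n}"

text \<open>
  The conditioned Galton--Watson tree of order \<open>n\<close> is \<^const>\<open>tree_of\<close> under the conditional
  probability given \<open>size_event p n\<close>; note that \<^const>\<open>uniform_measure\<close> is the library's name for
  conditioning a measure on an event.
\<close>

definition conditioned_space :: "nat pmf \<Rightarrow> nat \<Rightarrow> (node \<Rightarrow> nat) measure" where
  "conditioned_space p n = uniform_measure (offspring_space p) (size_event p n)"

text \<open>The filter for \<open>n \<longlongrightarrow> \<infinity>\<close> restricted to the \<open>n\<close> that are possible sizes of the tree.\<close>

definition sizes_at_top :: "nat pmf \<Rightarrow> nat filter" where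
  "sizes_at_top p =
     inf at_top (principal {n. measure (offspring_space p) (size_event p n) > 0})"

text \<open>Convergence in distribution as in \<^const>\<open>weak_conv_m\<close>, but along an arbitrary filter.\<close>

definition weak_conv_along :: "'i filter \<Rightarrow> ('i \<Rightarrow> real measure) \<Rightarrow> real measure \<Rightarrow> bool" where
  "weak_conv_along F Ms M \<longleftrightarrow>
     (\<forall>x. isCont (cdf M) x \<longrightarrow> ((\<lambda>i. cdf (Ms i) x) \<longlongrightarrow> cdf M x) F)"

lemma weak_conv_along_sequentially:
  "weak_conv_along sequentially Ms M \<longleftrightarrow> weak_conv_m Ms M"
  by (simp add: weak_conv_along_def weak_conv_m_def weak_conv_def)

end

theory Submission
  imports Defs
begin

text \<open>
  A tree is read as the postorder word of its numbers of children. By the cycle lemma, the word of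
  the conditioned tree is a rotation of a bridge, that is, of an i.i.d. word conditioned on its sum.
  If \<open>R v\<close> denotes the number of subtrees with top node \<open>v\<close>, then \<open>R v\<close> is the product of
  \<open>1 + R c\<close> over the children \<open>c\<close> of \<open>v\<close>, so \<open>ln (1 + R)\<close> of the tree is the sum of
  \<open>ln (1 + 1 / R v)\<close> over all nodes. This sum extends to arbitrary words. The values \<open>R\<close> increase by
  at least one from a node to its parent, hence the extension is additive under
  concatenation and invariant under rotation up to an error of logarithmic order.

  For i.i.d. words, almost additivity gives the linear mean, the linear variance and the central
  limit theorem by cutting into blocks. After subtraction of a multiple of the random walk the
  functional is asymptotically independent of the walk, and Fourier inversion of the condition on
  the sum carries the limit over to bridges; bounded fourth moments give the convergence of mean and
  variance. The limit variance is positive because two subtrees with the same child numbers but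
  different values of \<open>R\<close> can be exchanged in linearly many places independently of the walk.
  Finally \<open>R \<le> S \<le> n * R\<close> extends all of this to \<open>S\<close>.
\<close>

text \<open>The toll \<open>ln (1 + 1 / R v)\<close> depends on the whole subtree of
  \<open>v\<close>, so independence is only available by cutting the word and paying for the cut;
  pieces of words are no tree codes, which forces the functional onto arbitrary words. A logarithmic
  price is far below the fluctuations of order \<open>sqrt n\<close>. The probabilistic part uses it
  only as an error of order \<open>fourth_root n\<close>, a scale that is multiplicative in
  \<open>n\<close> and therefore suits recursions by halving. The condition on the sum has
  probability of order \<open>1 / sqrt n\<close>, too small for a direct comparison with i.i.d.
  words. The prefix that omits a fixed proportion \<open>1 / Q\<close> of the letters, however, has
  a conditional characteristic function that is a quotient of two convergent Fourier integrals, and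
  the omitted suffix is small in mean under the bridge. The length tends to infinity for fixed
  \<open>Q\<close>, and \<open>Q\<close> afterwards. The offspring law has only two moments. Fourth
  moments are therefore taken of the functional itself, which is bounded by the word length, and
  never of its combination with the walk.\<close>

section \<open>Words of child numbers\<close>

text \<open>
  The stack holds the values \<open>R\<close> of the completed subtrees that still wait for their parent. An
  entry with more children than the stack provides gains nothing and empties the stack.
\<close>
definition stack_step :: "nat \<Rightarrow> real list \<Rightarrow> real list" where
  "stack_step d st = (if d \<le> length st then (\<Prod>x\<leftarrow>take d st. 1 + x) # drop d st else [])"

definition step_gain :: "nat \<Rightarrow> real list \<Rightarrow> real" where
  "step_gain d st = (if d \<le> length st then ln (1 + 1 / (\<Prod>x\<leftarrow>take d st. 1 + x)) else 0)"

primrec stack_after :: "nat list \<Rightarrow> real list \<Rightarrow> real list" where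
  "stack_after [] st = st"
| "stack_after (d # w) st = stack_after w (stack_step d st)"

primrec word_gain :: "nat list \<Rightarrow> real list \<Rightarrow> real" where
  "word_gain [] st = 0"
| "word_gain (d # w) st = step_gain d st + word_gain w (stack_step d st)"

lemma word_gain_append: "word_gain (x @ y) st = word_gain x st + word_gain y (stack_after x st)"
  by (induction x arbitrary: st) auto

lemma prod_list_one_plus_ge_1:
  "\<forall>x\<in>set xs. 1 \<le> x \<Longrightarrow> 1 \<le> (\<Prod>x\<leftarrow>xs. 1 + x :: real)"
proof (induction xs)
  case (Cons a xs)
  then have "1 * 1 \<le> (1 + a) * (\<Prod>x\<leftarrow>xs. 1 + x)" by (intro mult_mono) auto
  then show ?case by simp
qed simp

lemma prod_list_one_plus_ge_member:
  assumes "\<forall>x\<in>set xs. 1 \<le> x" "a \<in> set xs"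
  shows "1 + a \<le> (\<Prod>x\<leftarrow>xs. 1 + x :: real)"
  using assms
proof (induction xs)
  case (Cons b xs)
  show ?case
  proof (cases "a = b")
    case True
    have "(1 + b) * 1 \<le> (1 + b) * (\<Prod>x\<leftarrow>xs. 1 + x)"
      using Cons.prems prod_list_one_plus_ge_1[of xs] by (intro mult_left_mono) auto
    then show ?thesis using True by simp
  next
    case False
    then have "1 * (1 + a) \<le> (1 + b) * (\<Prod>x\<leftarrow>xs. 1 + x)"
      using Cons by (intro mult_mono) auto
    then show ?thesis by simp
  qed
qed simp

lemma stack_step_ge_1: "\<forall>x\<in>set st. 1 \<le> x \<Longrightarrow> \<forall>x\<in>set (stack_step d st). 1 \<le> x"
  using prod_list_one_plus_ge_1[of "take d st"]
  by (auto simp: stack_step_def dest: in_set_takeD in_set_dropD)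

lemma stack_after_ge_1: "\<forall>x\<in>set st. 1 \<le> x \<Longrightarrow> \<forall>x\<in>set (stack_after w st). 1 \<le> x"
proof (induction w arbitrary: st)
  case (Cons d w)
  from Cons.IH[OF stack_step_ge_1[OF Cons.prems]] show ?case by simp
qed simp

lemma step_gain_bounds:
  assumes "\<forall>x\<in>set st. 1 \<le> x"
  shows "0 \<le> step_gain d st" "step_gain d st \<le> 1"
proof -
  let ?P = "\<Prod>x\<leftarrow>take d st. 1 + x"
  have P: "1 \<le> ?P" using prod_list_one_plus_ge_1[of "take d st"] assms by (auto dest: in_set_takeD)
  then show "0 \<le> step_gain d st" by (auto simp: step_gain_def)
  have "ln (1 + 1 / ?P) \<le> 1 / ?P" by (rule ln_add_one_self_le_self) (use P in auto)
  also have "\<dots> \<le> 1" using P by simp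
  finally show "step_gain d st \<le> 1" by (simp add: step_gain_def)
qed

lemma word_gain_bounds:
  assumes "\<forall>x\<in>set st. 1 \<le> x"
  shows "0 \<le> word_gain w st \<and> word_gain w st \<le> length w"
  using assms
proof (induction w arbitrary: st)
  case (Cons d w)
  show ?case
    using Cons.IH[OF stack_step_ge_1[OF Cons.prems, of d]]
      step_gain_bounds(1)[OF Cons.prems, of d] step_gain_bounds(2)[OF Cons.prems, of d] by simp
qed simp

text \<open>
  Only entries whose subtree reaches below \<open>s\<close> are affected by \<open>z\<close>. They form a chain of
  ancestors, so their values increase by at least one each time, and the sum telescopes.
\<close>
lemma word_gain_stack_extension:
  assumes "\<forall>x\<in>set s. 1 \<le> x" "\<forall>x\<in>set z. 1 \<le> x" "z = [] \<or> k \<le> hd z" "0 \<le> k"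
  shows "0 \<le> word_gain w (s @ z) - word_gain w s \<and>
    word_gain w (s @ z) - word_gain w s \<le> ln ((k + length w + 1) / (k + 1))"
  using assms
proof (induction w arbitrary: s z k)
  case (Cons d w)
  have mono: "ln ((k + length w + 1) / (k + 1)) \<le> ln ((k + length (d # w) + 1) / (k + 1))"
    using \<open>0 \<le> k\<close> by (simp add: divide_right_mono)
  have nn: "0 \<le> ln ((k + length (d # w) + 1) / (k + 1))" using \<open>0 \<le> k\<close> by simp
  consider "d \<le> length s" | "length s < d" "d \<le> length s + length z" | "length s + length z < d"
    by linarith
  then show ?case
  proof cases
    case 1
    have "\<forall>x\<in>set (stack_step d s). 1 \<le> x" using Cons.prems(1) by (rule stack_step_ge_1)
    moreover have "stack_step d (s @ z) = stack_step d s @ z" "step_gain d (s @ z) = step_gain d s"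
      using 1 by (auto simp: stack_step_def step_gain_def)
    ultimately have "0 \<le> word_gain (d # w) (s @ z) - word_gain (d # w) s"
      "word_gain (d # w) (s @ z) - word_gain (d # w) s \<le> ln ((k + length w + 1) / (k + 1))"
      using Cons.IH[of "stack_step d s" z k] Cons.prems by auto
    then show ?thesis using mono by linarith
  next
    case 2
    \<comment> \<open>This is the only case in which the two runs differ: the short stack is emptied
      without gain, while on the long one a node is created above the entry \<open>hd z\<close>. Its
      value is at least \<open>k + 1\<close>, so the induction continues with an empty upper part
      and \<open>k + 1\<close> in place of \<open>k\<close>. Its gain is at most
      \<open>ln ((k + 2) / (k + 1))\<close>, the factor by which the two logarithmic bounds
      differ.\<close>
    define P where "P = (\<Prod>x\<leftarrow>take d (s @ z). 1 + x)"
    define z' where "z' = P # drop d (s @ z)"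
    have z: "z \<noteq> []" using 2 by auto
    have szge: "\<forall>x\<in>set (s @ z). 1 \<le> x" using Cons.prems by auto
    have "hd z \<in> set (take d (s @ z))"
      using 2 z by (cases z; cases "d - length s") auto
    then have P: "1 + hd z \<le> P" unfolding P_def
      using szge by (intro prod_list_one_plus_ge_member) (auto dest: in_set_takeD)
    have hz: "k \<le> hd z" "1 \<le> hd z" using z Cons.prems by auto
    have step: "stack_step d s = []" "step_gain d s = 0" "stack_step d (s @ z) = [] @ z'"
      "step_gain d (s @ z) = ln (1 + 1 / P)"
      using 2 by (auto simp: stack_step_def step_gain_def P_def z'_def)
    have "\<forall>x\<in>set z'. 1 \<le> x" using stack_step_ge_1[OF szge, of d] step(3) by simp
    moreover have "k + 1 \<le> hd z'" using P hz by (simp add: z'_def)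
    ultimately have IH: "0 \<le> word_gain w ([] @ z') - word_gain w []"
      "word_gain w ([] @ z') - word_gain w [] \<le> ln ((k + 1 + length w + 1) / (k + 1 + 1))"
      using Cons.IH[of "[]" z' "k + 1"] Cons.prems by auto
    have "ln (1 + 1 / P) \<le> ln ((k + 2) / (k + 1))"
    proof (rule ln_mono)
      have "1 / P \<le> 1 / (k + 1)" using P hz \<open>0 \<le> k\<close> by (intro divide_left_mono) auto
      then show "1 + 1 / P \<le> (k + 2) / (k + 1)" using \<open>0 \<le> k\<close> by (simp add: field_simps)
    qed (use P hz in \<open>auto simp: add_pos_nonneg\<close>)
    moreover have "ln ((k + 2) / (k + 1)) + ln ((k + 1 + length w + 1) / (k + 1 + 1))
        = ln ((k + length (d # w) + 1) / (k + 1))"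
      using \<open>0 \<le> k\<close> by (simp add: ln_div algebra_simps)
    moreover have "0 \<le> ln (1 + 1 / P)" using P hz by simp
    ultimately show ?thesis using IH step by simp
  next
    case 3
    then have "stack_step d s = stack_step d (s @ z)" "step_gain d s = step_gain d (s @ z)"
      by (auto simp: stack_step_def step_gain_def)
    then show ?thesis using nn by simp
  qed
qed simp

text \<open>The word \<open>y\<close> is read on the stack left by \<open>x\<close> instead of the
  empty one. This is the stack extension with \<open>s = []\<close>, where already the weak lower
  bound \<open>k = 0\<close> for the top entry gives the logarithm of
  \<open>1 + length y\<close>.\<close>

lemma word_gain_almost_additive:
  "word_gain x [] + word_gain y [] \<le> word_gain (x @ y) []"
  "word_gain (x @ y) [] \<le> word_gain x [] + word_gain y [] + ln (1 + real (length y))"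
proof -
  have "\<forall>r\<in>set (stack_after x []). 1 \<le> r" by (rule stack_after_ge_1) simp
  moreover from this have "stack_after x [] = [] \<or> 0 \<le> hd (stack_after x [])"
    by (metis hd_in_set order.trans zero_le_one)
  ultimately have "0 \<le> word_gain y ([] @ stack_after x []) - word_gain y [] \<and>
    word_gain y ([] @ stack_after x []) - word_gain y [] \<le> ln ((0 + real (length y) + 1) / (0 + 1))"
    by (intro word_gain_stack_extension) auto
  then show "word_gain x [] + word_gain y [] \<le> word_gain (x @ y) []"
    "word_gain (x @ y) [] \<le> word_gain x [] + word_gain y [] + ln (1 + real (length y))"
    by (auto simp: word_gain_append add.commute)
qed

text \<open>A rotation exchanges two pieces \<open>u\<close> and \<open>v\<close>. Both orders gain
  at least what the pieces gain separately and exceed it by at most a logarithm, so the two values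
  lie in a common short interval.\<close>

lemma word_gain_rotate:
  "\<bar>word_gain (rotate j w) [] - word_gain w []\<bar> \<le> ln (1 + real (length w))"
proof -
  define u v where "u = take (j mod length w) w" and "v = drop (j mod length w) w"
  have w: "w = u @ v" "rotate j w = v @ u" by (auto simp: u_def v_def rotate_drop_take)
  have "ln (1 + real (length u)) \<le> ln (1 + real (length w))" "ln (1 + real (length v)) \<le> ln (1 + real (length w))"
    by (simp_all add: w)
  then show ?thesis
    using word_gain_almost_additive[of u v] word_gain_almost_additive[of v u] unfolding w(2)
    by (subst w(1)) linarith
qed

section \<open>Plane trees, their postorder words and parsing\<close>

datatype plane_tree = Node (children: "plane_tree list")

fun tree_word :: "plane_tree \<Rightarrow> nat list" where
  "tree_word (Node ts) = concat (map tree_word ts) @ [length ts]"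

fun root_count :: "plane_tree \<Rightarrow> nat" where
  "root_count (Node ts) = (\<Prod>t\<leftarrow>ts. 1 + root_count t)"

lemma root_count_pos: "1 \<le> root_count t"
proof (induction t)
  case (Node ts)
  have "0 < (\<Prod>t\<leftarrow>ts. 1 + root_count t)" by (induction ts) auto
  then show ?case by simp
qed

text \<open>The assumptions are the induction hypothesis of \<open>tree_word_stack\<close> for the
  children. The last sibling ends on top of the stack, hence the reversed order of the
  values.\<close>

lemma stack_forest:
  assumes "\<And>t v st. t \<in> set ts \<Longrightarrow> stack_after (tree_word t @ v) st = stack_after v (real (root_count t) # st)"
    and "\<And>t v st. t \<in> set ts \<Longrightarrow> word_gain (tree_word t @ v) st
        = ln (1 + real (root_count t)) + word_gain v (real (root_count t) # st)"
  shows "stack_after (concat (map tree_word ts) @ v) st = stack_after v (rev (map (real \<circ> root_count) ts) @ st) \<and>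
    word_gain (concat (map tree_word ts) @ v) st
        = (\<Sum>t\<leftarrow>ts. ln (1 + real (root_count t))) + word_gain v (rev (map (real \<circ> root_count) ts) @ st)"
  using assms by (induction ts arbitrary: st) auto

lemma prod_list_rev: "prod_list (rev (xs :: 'a :: comm_monoid_mult list)) = prod_list xs"
  by (induction xs) (auto simp: ac_simps)

lemma ln_prod_list: "(\<And>x. x \<in> set xs \<Longrightarrow> 0 < f x) \<Longrightarrow> ln (\<Prod>x\<leftarrow>xs. f x) = (\<Sum>x\<leftarrow>xs. ln (f x :: real))
   \<and> 0 < (\<Prod>x\<leftarrow>xs. f x)"
  by (induction xs) (auto simp: ln_mult_pos)

text \<open>The entries of a tree word never reach below the height at which the word starts. The
  root turns the total \<open>ln P\<close> of its children into
  \<open>ln P + ln (1 + 1 / P) = ln (1 + P)\<close>, so the gains of all nodes telescope to the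
  single logarithm at the root.\<close>

lemma tree_word_stack:
  "stack_after (tree_word t @ v) st = stack_after v (real (root_count t) # st) \<and>
   word_gain (tree_word t @ v) st = ln (1 + real (root_count t)) + word_gain v (real (root_count t) # st)"
proof (induction t arbitrary: v st)
  case (Node ts)
  let ?P = "\<Prod>t\<leftarrow>ts. 1 + real (root_count t)"
  have P: "real (root_count (Node ts)) = ?P"
    by (simp, induction ts) (auto simp: algebra_simps)
  have P': "(\<Prod>x\<leftarrow>take (length ts) (rev (map (real \<circ> root_count) ts) @ st). 1 + x) = ?P"
    by (simp add: rev_map[symmetric] prod_list_rev o_def del: rev_map)
  have len: "length (rev (map (real \<circ> root_count) ts)) = length ts" by simp
  have step: "stack_step (length ts) (rev (map (real \<circ> root_count) ts) @ st) = ?P # st"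
    "step_gain (length ts) (rev (map (real \<circ> root_count) ts) @ st) = ln (1 + 1 / ?P)"
    unfolding stack_step_def step_gain_def P' by auto
  have ln: "ln ?P = (\<Sum>t\<leftarrow>ts. ln (1 + real (root_count t))) \<and> 0 < ?P"
    by (rule ln_prod_list) auto
  then have "(\<Sum>t\<leftarrow>ts. ln (1 + real (root_count t))) + ln (1 + 1 / ?P) = ln (1 + ?P)"
    by (auto simp: ln_div add_divide_eq_if_simps add.commute)
  then show ?case
    using stack_forest[of ts "[length ts] @ v" st] Node.IH step P by (simp del: root_count.simps)
qed

lemma word_gain_tree_word: "word_gain (tree_word t) [] = ln (1 + real (root_count t))"
  using tree_word_stack[of t "[]" "[]"] by simp

text \<open>The number \<open>h\<close> is the height of the stack, that is, the number of completed
  subtrees that wait for a parent. Tree words are the words that lead from height 0 to height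
  1.\<close>

fun valid_from :: "nat list \<Rightarrow> nat \<Rightarrow> bool" where
  "valid_from [] h \<longleftrightarrow> h = 1"
| "valid_from (d # w) h \<longleftrightarrow> d \<le> h \<and> valid_from w (h + 1 - d)"

lemma valid_from_tree_word: "valid_from (tree_word t @ v) h = valid_from v (h + 1)"
proof (induction t arbitrary: v h)
  case (Node ts)
  then have "valid_from (concat (map tree_word ts) @ v) h = valid_from v (h + length ts)" for v h
    by (induction ts arbitrary: h) auto
  from this[of "length ts # v"] show ?case by simp
qed

text \<open>The list \<open>ts\<close> is the stack of trees parsed so far with the latest one at
  the head, so the part of the word already read is the concatenation of their words in reversed
  order.\<close>

lemma valid_from_parse:
  "valid_from w (length ts) \<Longrightarrow> \<exists>t. concat (map tree_word (rev ts)) @ w = tree_word t"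
proof (induction w arbitrary: ts)
  case Nil
  then obtain t where "ts = [t]" by (auto simp: length_Suc_conv)
  then show ?case by auto
next
  case (Cons d w)
  define ts' where "ts' = Node (rev (take d ts)) # drop d ts"
  have d: "d \<le> length ts" using Cons.prems by auto
  have "valid_from w (length ts')" using Cons.prems by (auto simp: ts'_def Suc_diff_le)
  then obtain t where t: "concat (map tree_word (rev ts')) @ w = tree_word t" using Cons.IH by blast
  have "concat (map tree_word (rev (drop d ts))) @ concat (map tree_word (rev (take d ts)))
      = concat (map tree_word (rev ts))"
    by (metis append_take_drop_id concat_append map_append rev_append)
  then have "concat (map tree_word (rev ts')) @ w = concat (map tree_word (rev ts)) @ d # w"
    using d by (simp add: ts'_def min_def)
  then show ?case using t by (metis append.assoc append_Cons append_Nil)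
qed

lemma range_tree_word: "range tree_word = {w. valid_from w 0}"
proof (intro equalityI subsetI)
  fix w assume "w \<in> range tree_word"
  then obtain t where "w = tree_word t" by auto
  then show "w \<in> {w. valid_from w 0}" using valid_from_tree_word[of t "[]" 0] by simp
next
  fix w assume "w \<in> {w. valid_from w 0}"
  then show "w \<in> range tree_word" using valid_from_parse[of w "[]"] by auto
qed

text \<open>A left inverse of \<open>tree_word\<close> that carries a stack of trees; it serves only
  to prove injectivity.\<close>

primrec parse :: "nat list \<Rightarrow> plane_tree list \<Rightarrow> plane_tree list" where
  "parse [] st = st"
| "parse (d # w) st = parse w (Node (rev (take d st)) # drop d st)"

lemma parse_tree_word: "parse (tree_word t @ v) st = parse v (t # st)"
proof (induction t arbitrary: v st)
  case (Node ts)
  then have "parse (concat (map tree_word ts) @ v) st = parse v (rev ts @ st)" for v st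
    by (induction ts arbitrary: st) auto
  from this[of "length ts # v"] show ?case by simp
qed

lemma inj_tree_word: "inj tree_word"
proof (rule injI)
  fix s t assume "tree_word s = tree_word t"
  then show "s = t" using parse_tree_word[of s "[]" "[]"] parse_tree_word[of t "[]" "[]"] by simp
qed

section \<open>Stack heights and the cycle lemma\<close>

definition excess :: "nat list \<Rightarrow> int" where
  "excess w = (\<Sum>d\<leftarrow>w. 1 - int d)"

lemma excess_simps [simp]:
  "excess [] = 0" "excess (d # w) = 1 - int d + excess w" "excess (x @ y) = excess x + excess y"
  by (auto simp: excess_def)

lemma excess_eq: "excess w = int (length w) - int (sum_list w)"
  by (induction w) auto

text \<open>\<open>excess\<close> is the change of the stack height. The test
  \<open>d \<le> h\<close> amounts to a height of at least 1 after the letter is read, which is why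
  the indices start at 1 and not at 0.\<close>

lemma valid_from_iff:
  "valid_from w h \<longleftrightarrow> (\<forall>i\<in>{1..length w}. 1 \<le> int h + excess (take i w)) \<and> int h + excess w = 1"
proof (induction w arbitrary: h)
  case (Cons d w)
  show ?case
  proof (cases "d \<le> h")
    case False
    then have "\<not> 1 \<le> int h + excess (take 1 (d # w))" by simp
    then show ?thesis using False by force
  next
    case True
    have range: "{1..length (d # w)} = insert 1 (Suc ` {1..length w})"
      by (auto simp: image_Suc_atLeastAtMost)
    have split: "(\<forall>i\<in>{1..length (d # w)}. Q i) \<longleftrightarrow> Q 1 \<and> (\<forall>i\<in>{1..length w}. Q (Suc i))" for Q
      unfolding range by blast
    show ?thesis unfolding split using Cons.IH[of "h + 1 - d"] True
      by (auto simp: algebra_simps of_nat_diff)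
  qed
qed simp

text \<open>A prefix of the rotated word stays inside \<open>drop j w\<close> or wraps around. After
  wrapping, the end of \<open>w\<close> has been passed, which contributes the total height
  1.\<close>

lemma excess_take_rotate:
  assumes "j < length w" "i \<le> length w" "excess w = 1"
  shows "excess (take i (drop j w @ take j w)) =
    (if i \<le> length w - j then excess (take (j + i) w) - excess (take j w)
     else 1 + excess (take (i + j - length w) w) - excess (take j w))"
proof (cases "i \<le> length w - j")
  case True
  have "take (j + i) w = take j w @ take i (drop j w)" by (rule take_add)
  then show ?thesis using True by simp
next
  case False
  have "excess w = excess (take j w) + excess (drop j w)"
    by (metis append_take_drop_id excess_simps(3))
  moreover have "i - (length w - j) = i + j - length w" "i + j - length w \<le> j"
    using False assms by auto
  ultimately show ?thesis using False assms(3) by (simp add: min_def)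
qed

text \<open>The cycle lemma: the rotation has to start after the last minimum of the partial sums.\<close>
lemma cycle_lemma:
  assumes "excess w = 1"
  shows "\<exists>!j. j < length w \<and> valid_from (rotate j w) 0"
proof -
  define f where "f i = excess (take i w)" for i
  define n where "n = length w"
  have "w \<noteq> []" using assms by auto
  then have n: "0 < n" by (simp add: n_def)
  have fn: "f n = 1" "f 0 = 0" using assms by (auto simp: f_def n_def)
  \<comment> \<open>Validity of the rotation means that \<open>j\<close> is the last minimum of the
    partial sums on the indices below \<open>n\<close>. Later indices have to be strictly higher,
    while earlier ones may tie, since they are reached only after the wrap, which adds 1.\<close>
  have valid: "valid_from (rotate j w) 0 \<longleftrightarrow> (\<forall>i<j. f j \<le> f i) \<and> (\<forall>i\<in>{j<..<n}. f j < f i)"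
    (is "_ \<longleftrightarrow> ?R") if j: "j < n" for j
  proof -
    have rot: "rotate j w = drop j w @ take j w" using j by (simp add: rotate_drop_take n_def)
    have "excess (rotate j w) = 1" using assms unfolding rot
      by (metis add.commute append_take_drop_id excess_simps(3))
    moreover have "length (rotate j w) = n" by (simp add: n_def)
    ultimately have "valid_from (rotate j w) 0 \<longleftrightarrow> (\<forall>i\<in>{1..n}. 1 \<le> excess (take i (rotate j w)))"
      unfolding valid_from_iff by simp
    then have "valid_from (rotate j w) 0 \<longleftrightarrow> (\<forall>i\<in>{1..n}. 1 \<le> excess (take i (drop j w @ take j w)))"
      by (simp only: rot)
    also have "\<dots> \<longleftrightarrow> (\<forall>i\<in>{1..n}. 1 \<le> (if i \<le> n - j then f (j + i) - f j else 1 + f (i + j - n) - f j))"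
      using j assms by (intro ball_cong refl, subst excess_take_rotate) (auto simp: f_def n_def)
    also have "\<dots> \<longleftrightarrow> ?R"
    proof
      assume L: "\<forall>i\<in>{1..n}. 1 \<le> (if i \<le> n - j then f (j + i) - f j else 1 + f (i + j - n) - f j)"
      show ?R
      proof (intro conjI allI impI ballI)
        fix i assume i: "i < j"
        show "f j \<le> f i"
        proof (cases "i = 0")
          case True then show ?thesis using bspec[OF L, of "n - j"] j fn by auto
        next
          case False
          then have "n + i - j + j - n = i" "\<not> n + i - j \<le> n - j" "n + i - j \<in> {1..n}" using i j by auto
          then show ?thesis using bspec[OF L, of "n + i - j"] by simp
        qed
      next
        fix i assume "i \<in> {j<..<n}"
        then have "j + (i - j) = i" "i - j \<le> n - j" "i - j \<in> {1..n}" by auto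
        then show "f j < f i" using bspec[OF L, of "i - j"] by simp
      qed
    next
      assume R: ?R
      \<comment> \<open>This covers the prefix of length \<open>n - j\<close>, which ends exactly at
        the seam and has height \<open>f n - f j = 1 - f j\<close>.\<close>
      have j0: "f j \<le> 0" using R fn by (cases "j = 0") auto
      show "\<forall>i\<in>{1..n}. 1 \<le> (if i \<le> n - j then f (j + i) - f j else 1 + f (i + j - n) - f j)"
      proof
        fix i assume i: "i \<in> {1..n}"
        consider "i < n - j" | "i = n - j" | "i > n - j" "i < n" | "i = n" "0 < j" using i j by force
        then show "1 \<le> (if i \<le> n - j then f (j + i) - f j else 1 + f (i + j - n) - f j)"
        proof cases
          case 1
          then have "f j < f (j + i)" using R i by auto
          then show ?thesis using 1 by auto
        next
          case 2 then show ?thesis using j0 fn j by auto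
        next
          case 3
          then have "f j \<le> f (i + j - n)" using R by auto
          then show ?thesis using 3 by auto
        next
          case 4 then show ?thesis using j by auto
        qed
      qed
    qed
    finally show ?thesis .
  qed
  define m where "m = Min (f ` {..<n})"
  define A where "A = {i. i < n \<and> f i = m}"
  have fin: "finite (f ` {..<n})" "f ` {..<n} \<noteq> {}" using n by auto
  have "m \<in> f ` {..<n}" unfolding m_def by (rule Min_in[OF fin])
  then have A: "A \<noteq> {}" "finite A" by (auto simp: A_def)
  have le: "m \<le> f i" if "i < n" for i unfolding m_def using that fin by (intro Min_le) auto
  define j where "j = Max A"
  have jA: "j \<in> A" unfolding j_def by (rule Max_in[OF A(2,1)])
  show ?thesis
  proof (rule ex1I[of _ j])
    have "f j < f i" if i: "i \<in> {j<..<n}" for i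
    proof -
      have "i \<notin> A" using Max_ge[OF A(2), of i] i by (auto simp: j_def)
      then have "f i \<noteq> m" using i by (auto simp: A_def)
      then show ?thesis using le[of i] i jA by (auto simp: A_def)
    qed
    moreover have "f j \<le> f i" if "i < j" for i using that le[of i] jA by (auto simp: A_def)
    ultimately show "j < length w \<and> valid_from (rotate j w) 0"
      using valid[of j] jA by (auto simp: A_def n_def)
  next
    fix i assume i: "i < length w \<and> valid_from (rotate i w) 0"
    then have i': "i < n" "\<forall>k<i. f i \<le> f k" "\<forall>k\<in>{i<..<n}. f i < f k"
      using valid[of i] by (auto simp: n_def)
    have jn: "j < n" "f j = m" using jA by (auto simp: A_def)
    show "i = j"
    proof (rule linorder_cases[of i j])
      assume "i < j"
      then have "f i < f j" using i'(3) jn(1) by auto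
      then show ?thesis using jn(2) le[OF i'(1)] by simp
    next
      assume "j < i"
      then have "f i \<le> m" using i' jn by auto
      then have "i \<in> A" using le[of i] i' by (auto simp: A_def)
      then show ?thesis using Max_ge[OF A(2), of i] \<open>j < i\<close> by (auto simp: j_def)
    qed
  qed
qed

section \<open>Node sets of plane trees\<close>

primrec in_tree :: "node \<Rightarrow> plane_tree \<Rightarrow> bool" where
  "in_tree [] t \<longleftrightarrow> True"
| "in_tree (i # u) t \<longleftrightarrow> i < length (children t) \<and> in_tree u (children t ! i)"

primrec arity :: "node \<Rightarrow> plane_tree \<Rightarrow> nat" where
  "arity [] t = length (children t)"
| "arity (i # u) t = arity u (children t ! i)"

definition nodes :: "plane_tree \<Rightarrow> node set" where
  "nodes t = {u. in_tree u t}"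

lemma nodes_simps [simp]:
  "[] \<in> nodes t" "i # u \<in> nodes t \<longleftrightarrow> i < length (children t) \<and> u \<in> nodes (children t ! i)"
  by (auto simp: nodes_def)

lemma nodes_snoc: "u @ [i] \<in> nodes t \<longleftrightarrow> u \<in> nodes t \<and> i < arity u t"
  by (induction u arbitrary: t) auto

lemma nodes_Node: "nodes (Node ts) = insert [] (\<Union>i<length ts. (#) i ` nodes (ts ! i))"
proof (rule set_eqI)
  fix u show "u \<in> nodes (Node ts) \<longleftrightarrow> u \<in> insert [] (\<Union>i<length ts. (#) i ` nodes (ts ! i))"
    by (cases u) auto
qed

lemma nodes_inj: "nodes s = nodes t \<Longrightarrow> s = t"
proof (induction s arbitrary: t)
  case (Node ts)
  obtain ts' where t: "t = Node ts'" by (cases t)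
  have mem: "u \<in> nodes (Node ts) \<longleftrightarrow> u \<in> nodes (Node ts')" for u using Node.prems t by simp
  have "i < length ts \<longleftrightarrow> i < length ts'" for i using mem[of "[i]"] by simp
  then have len: "length ts = length ts'" by (metis linorder_neq_iff)
  have "ts ! i = ts' ! i" if "i < length ts" for i
  proof (rule Node.IH)
    show "ts ! i \<in> set ts" using that by simp
    show "nodes (ts ! i) = nodes (ts' ! i)" using mem[of "i # _"] that len by auto
  qed
  then show ?case using t len by (auto intro: nth_equalityI)
qed

text \<open>All three follow from one recursion over the children. The product identity, used with
  \<open>g = pmf p\<close>, connects the law of the offspring family, a product over nodes, with the
  law of an i.i.d. word, a product over letters.\<close>

lemma finite_nodes: "finite (nodes t)" and card_nodes: "card (nodes t) = length (tree_word t)"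
  and prod_nodes: "(\<Prod>u\<in>nodes t. g (arity u t)) = (\<Prod>d\<leftarrow>tree_word t. g d :: 'a :: comm_monoid_mult)"
proof -
  have "finite (nodes t) \<and> card (nodes t) = length (tree_word t) \<and>
    (\<Prod>u\<in>nodes t. g (arity u t)) = (\<Prod>d\<leftarrow>tree_word t. g d)"
  proof (induction t)
    case (Node ts)
    let ?U = "\<Union>i<length ts. (#) i ` nodes (ts ! i)"
    have IH: "finite (nodes (ts ! i))" "card (nodes (ts ! i)) = length (tree_word (ts ! i))"
      "(\<Prod>u\<in>nodes (ts ! i). g (arity u (ts ! i))) = (\<Prod>d\<leftarrow>tree_word (ts ! i). g d)"
      if "i < length ts" for i using Node[of "ts ! i"] that by auto
    have fin: "finite ?U" using IH by auto
    have "card ?U = (\<Sum>i<length ts. card ((#) i ` nodes (ts ! i)))"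
      by (rule card_UN_disjoint) (use IH in auto)
    also have "\<dots> = (\<Sum>i<length ts. length (tree_word (ts ! i)))"
      by (intro sum.cong refl) (auto simp: card_image IH)
    also have "\<dots> = length (concat (map tree_word ts))"
      by (simp add: length_concat sum_list_sum_nth atLeast0LessThan o_def)
    finally have card: "card ?U = length (concat (map tree_word ts))" .
    have "(\<Prod>u\<in>?U. g (arity u (Node ts))) = (\<Prod>i<length ts. \<Prod>u\<in>(#) i ` nodes (ts ! i). g (arity u (Node ts)))"
      by (rule prod.UNION_disjoint) (use IH in auto)
    also have "\<dots> = (\<Prod>i<length ts. \<Prod>d\<leftarrow>tree_word (ts ! i). g d)"
      by (intro prod.cong refl) (auto simp: prod.reindex IH)
    also have "\<dots> = (\<Prod>d\<leftarrow>concat (map tree_word ts). g d)"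
    proof (induction ts rule: rev_induct)
      case (snoc a as)
      have "(\<Prod>i<length as. \<Prod>d\<leftarrow>tree_word ((as @ [a]) ! i). g d) = (\<Prod>i<length as. \<Prod>d\<leftarrow>tree_word (as ! i). g d)"
        by (intro prod.cong) (auto simp: nth_append)
      then show ?case using snoc by simp
    qed simp
    finally have prod: "(\<Prod>u\<in>?U. g (arity u (Node ts))) = (\<Prod>d\<leftarrow>concat (map tree_word ts). g d)" .
    have "[] \<notin> ?U" by auto
    then show ?case using fin card prod by (simp add: nodes_Node mult.commute)
  qed
  then show "finite (nodes t)" "card (nodes t) = length (tree_word t)"
    "(\<Prod>u\<in>nodes t. g (arity u t)) = (\<Prod>d\<leftarrow>tree_word t. g d)" by auto
qed

section \<open>Finite trees of an offspring family as plane trees\<close>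

lemma tree_of_snoc: "u @ [i] \<in> tree_of c \<longleftrightarrow> u \<in> tree_of c \<and> i < c u"
  by (auto intro: tree_of.child elim: tree_of.cases)

lemma tree_of_Cons: "i # u \<in> tree_of c \<longleftrightarrow> i < c [] \<and> u \<in> tree_of (\<lambda>v. c (i # v))"
proof (induction u rule: rev_induct)
  case Nil
  show ?case using tree_of_snoc[of "[]" i c] by (simp add: tree_of.root)
next
  case (snoc j u)
  show ?case using tree_of_snoc[of "i # u" j c] tree_of_snoc[of u j "\<lambda>v. c (i # v)"] snoc by auto
qed

text \<open>This exhibits the event that the tree has a given finite shape as a cylinder event: it
  prescribes the offspring numbers at the finitely many nodes of \<open>t\<close> and nothing
  else.\<close>

lemma tree_of_eq_nodes_iff: "tree_of c = nodes t \<longleftrightarrow> (\<forall>u\<in>nodes t. c u = arity u t)"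
proof
  assume eq: "tree_of c = nodes t"
  show "\<forall>u\<in>nodes t. c u = arity u t"
  proof
    fix u assume "u \<in> nodes t"
    then have "i < c u \<longleftrightarrow> i < arity u t" for i
      using tree_of_snoc[of u i c] nodes_snoc[of u i t] eq by auto
    then show "c u = arity u t" by (metis linorder_neq_iff)
  qed
next
  assume c: "\<forall>u\<in>nodes t. c u = arity u t"
  have "u \<in> tree_of c \<longleftrightarrow> u \<in> nodes t" for u
    by (induction u rule: rev_induct) (use c in \<open>auto simp: tree_of.root tree_of_snoc nodes_snoc\<close>)
  then show "tree_of c = nodes t" by auto
qed

text \<open>Induction on the number of nodes: the tree at a child, shifted back by
  \<open>(#) i\<close>, lies inside the whole tree and misses the root, so it is strictly
  smaller.\<close>

lemma finite_tree_of_ex: "finite (tree_of c) \<Longrightarrow> \<exists>t. tree_of c = nodes t"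
proof (induction "card (tree_of c)" arbitrary: c rule: less_induct)
  case less
  let ?c = "\<lambda>i v. c (i # v)"
  have "\<exists>t. tree_of (?c i) = nodes t" if "i < c []" for i
  proof -
    have "(#) i ` tree_of (?c i) \<subset> tree_of c"
      using that tree_of.root[of c] by (auto simp: tree_of_Cons)
    then have "finite ((#) i ` tree_of (?c i))" "card ((#) i ` tree_of (?c i)) < card (tree_of c)"
      using less.prems by (auto intro: finite_subset psubset_card_mono)
    then show ?thesis using less.hyps[of "?c i"] by (auto simp: card_image finite_image_iff)
  qed
  then obtain T where T: "tree_of (?c i) = nodes (T i)" if "i < c []" for i by metis
  have "u \<in> tree_of c \<longleftrightarrow> u \<in> nodes (Node (map T [0..<c []]))" for u
    by (cases u) (auto simp: tree_of.root tree_of_Cons T)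
  then show ?case by blast
qed

section \<open>Root subtrees and subtrees\<close>

definition prefix_closed :: "node set \<Rightarrow> bool" where
  "prefix_closed A \<longleftrightarrow> (\<forall>u i. u @ [i] \<in> A \<longrightarrow> u \<in> A)"

lemma prefix_closed_prefix: "prefix_closed A \<Longrightarrow> u @ v \<in> A \<Longrightarrow> u \<in> A"
proof (induction v rule: rev_induct)
  case (snoc i v)
  then have "(u @ v) @ [i] \<in> A" by simp
  then show ?case using snoc unfolding prefix_closed_def by blast
qed simp

lemma prefix_closed_tree_of: "prefix_closed (tree_of c)"
  by (auto simp: prefix_closed_def tree_of_snoc)

lemma prefix_closed_nodes: "prefix_closed (nodes t)"
  by (auto simp: prefix_closed_def nodes_snoc)

text \<open>A path inside \<open>A\<close> that starts at \<open>u @ [i]\<close> can leave the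
  descendants of this node only through \<open>u\<close>, which is not in \<open>A\<close>.\<close>

lemma connected_extends:
  assumes "connected_nodes A" "u @ [i] \<in> A" "u \<notin> A" "v \<in> A"
  shows "\<exists>s. v = u @ [i] @ s"
proof -
  have "(u @ [i], v) \<in> {(x, y). x \<in> A \<and> y \<in> A \<and> adjacent x y}\<^sup>*"
    using assms unfolding connected_nodes_def by blast
  then show ?thesis
  proof (induction rule: rtrancl_induct)
    case (step x y)
    then obtain s where x: "x = u @ [i] @ s" and y: "y \<in> A" and adj: "adjacent x y" by auto
    from adj show ?case unfolding adjacent_def
    proof (elim exE disjE)
      fix j assume "y = x @ [j]" then show ?thesis using x by auto
    next
      fix j assume e: "x = y @ [j]"
      show ?thesis
      proof (cases s rule: rev_cases)
        case Nil
        then have "y = u" using e x by simp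
        then show ?thesis using y assms(3) by simp
      next
        case (snoc s' j')
        then have "y = u @ [i] @ s'" using e x by simp
        then show ?thesis by blast
      qed
    qed
  qed auto
qed

text \<open>If \<open>A\<close> is connected, a missing parent would separate its child from the
  root; conversely every node is joined to the root through its prefixes. Prefix closure is the form
  of connectedness that splits over the children of a node.\<close>

lemma root_connected_iff:
  assumes "[] \<in> A"
  shows "connected_nodes A \<longleftrightarrow> prefix_closed A"
proof
  assume "connected_nodes A"
  then show "prefix_closed A"
    using connected_extends[of A _ _ "[]"] assms by (fastforce simp: prefix_closed_def)
next
  assume pc: "prefix_closed A"
  let ?R = "{(x, y). x \<in> A \<and> y \<in> A \<and> adjacent x y}"
  have "u \<in> A \<Longrightarrow> (u, []) \<in> ?R\<^sup>* \<and> ([], u) \<in> ?R\<^sup>*" for u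
  proof (induction u rule: rev_induct)
    case (snoc i u)
    then have u: "u \<in> A" using pc by (auto simp: prefix_closed_def)
    then have "(u @ [i], u) \<in> ?R" "(u, u @ [i]) \<in> ?R" using snoc.prems by (auto simp: adjacent_def)
    then show ?case using snoc.IH[OF u]
      by (meson converse_rtrancl_into_rtrancl rtrancl.rtrancl_into_rtrancl)
  qed auto
  then show "connected_nodes A" unfolding connected_nodes_def by (meson rtrancl_trans)
qed

lemma root_subtrees_eq: "root_subtrees T = {A. A \<subseteq> T \<and> prefix_closed A} - {{}}"
proof -
  have "[] \<in> A" if "prefix_closed A" "A \<noteq> {}" for A
    using that prefix_closed_prefix[of A "[]"] by auto
  then show ?thesis
    using root_connected_iff by (auto simp: root_subtrees_def subtrees_def)
qed

text \<open>A prefix closed set is empty or consists of the root and an independent choice of a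
  prefix closed set below each child. Counting the empty set as well gives the factors
  \<open>1 + R\<close> in the recursion for \<open>root_count\<close>.\<close>

lemma card_prefix_closed: "card {A. A \<subseteq> nodes t \<and> prefix_closed A} = 1 + root_count t"
proof (induction t)
  case (Node ts)
  define n where "n = length ts"
  define P where "P t = {A. A \<subseteq> nodes t \<and> prefix_closed A}" for t
  define g :: "(nat \<Rightarrow> node set) \<Rightarrow> node set" where "g f = insert [] (\<Union>i<n. (#) i ` f i)" for f
  let ?F = "Pi\<^sub>E {..<n} (\<lambda>i. P (ts ! i))"
  have finP: "finite (P t)" for t unfolding P_def
    by (rule finite_subset[of _ "Pow (nodes t)"]) (auto simp: finite_nodes)
  have g_Cons: "i # u \<in> g f \<longleftrightarrow> i < n \<and> u \<in> f i" for i u f by (auto simp: g_def)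
  have inj: "inj_on g ?F"
  proof (rule inj_onI)
    fix f f' assume f: "f \<in> ?F" "f' \<in> ?F" and eq: "g f = g f'"
    show "f = f'"
    proof (rule PiE_ext[OF f])
      fix i assume "i \<in> {..<n}"
      then show "f i = f' i" using g_Cons[of i _ f] g_Cons[of i _ f'] eq by auto
    qed
  qed
  have "P (Node ts) = insert {} (g ` ?F)"
  proof (intro equalityI subsetI)
    fix A assume A: "A \<in> P (Node ts)"
    show "A \<in> insert {} (g ` ?F)"
    proof (cases "A = {}")
      case False
      define f where "f = restrict (\<lambda>i. {u. i # u \<in> A}) {..<n}"
      have nil: "[] \<in> A" using A False prefix_closed_prefix[of A "[]"] by (auto simp: P_def)
      have "u \<in> A \<longleftrightarrow> u \<in> g f" for u
      proof (cases u)
        case Nil then show ?thesis using nil by (simp add: g_def)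
      next
        case (Cons i v)
        have "i < n" if "i # v \<in> A"
          using that A by (auto simp: P_def n_def)
        then show ?thesis using Cons by (auto simp: g_Cons f_def)
      qed
      then have "A = g f" by auto
      moreover have "f \<in> ?F"
      proof (rule PiE_I)
        fix i assume i: "i \<in> {..<n}"
        have "prefix_closed {u. i # u \<in> A}"
          using A unfolding P_def prefix_closed_def by (metis (mono_tags, lifting) append_Cons mem_Collect_eq)
        moreover have "{u. i # u \<in> A} \<subseteq> nodes (ts ! i)" using A i by (auto simp: P_def)
        ultimately show "f i \<in> P (ts ! i)" using i by (simp add: f_def P_def)
      qed (simp add: f_def)
      ultimately show ?thesis by blast
    qed simp
  next
    fix A assume "A \<in> insert {} (g ` ?F)"
    then show "A \<in> P (Node ts)"
    proof (elim insertE imageE)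
      fix f assume A: "A = g f" and f: "f \<in> ?F"
      have fi: "f i \<subseteq> nodes (ts ! i)" "prefix_closed (f i)" if "i < n" for i
        using f that by (auto simp: P_def PiE_def Pi_def)
      have "A \<subseteq> nodes (Node ts)" unfolding A g_def nodes_Node using fi(1) by (auto simp: n_def)
      moreover have "prefix_closed A" unfolding prefix_closed_def
      proof (intro allI impI)
        fix u j assume "u @ [j] \<in> A"
        then show "u \<in> A" using fi(2) by (cases u) (auto simp: A g_Cons prefix_closed_def, simp add: g_def)
      qed
      ultimately show ?thesis by (simp add: P_def)
    qed (simp add: P_def prefix_closed_def)
  qed
  moreover have "{} \<notin> g ` ?F" by (auto simp: g_def)
  moreover have "finite (g ` ?F)" using finP by (intro finite_imageI finite_PiE) auto
  ultimately have "card (P (Node ts)) = 1 + card ?F" by (simp add: card_image[OF inj])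
  also have "card ?F = (\<Prod>i<n. 1 + root_count (ts ! i))"
    unfolding card_PiE[OF finite_lessThan] using Node.IH
    by (intro prod.cong refl) (auto simp: P_def n_def)
  also have "\<dots> = (\<Prod>t\<leftarrow>ts. 1 + root_count t)" unfolding n_def
  proof (induction ts rule: rev_induct)
    case (snoc a as)
    have "(\<Prod>i<length as. 1 + root_count ((as @ [a]) ! i)) = (\<Prod>i<length as. 1 + root_count (as ! i))"
      by (intro prod.cong) (auto simp: nth_append)
    then show ?case using snoc by simp
  qed simp
  finally show ?case by (simp add: P_def)
qed

lemma num_root_subtrees_nodes: "num_root_subtrees (nodes t) = root_count t"
proof -
  have "finite {A. A \<subseteq> nodes t \<and> prefix_closed A}"
    by (rule finite_subset[of _ "Pow (nodes t)"]) (auto simp: finite_nodes)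
  then show ?thesis
    using card_prefix_closed[of t]
    by (simp add: num_root_subtrees_def root_subtrees_eq card_Diff_subset prefix_closed_def)
qed

lemma finite_subtrees: "finite T \<Longrightarrow> finite (subtrees T)"
  by (rule finite_subset[of _ "Pow T"]) (auto simp: subtrees_def)

lemma num_root_subtrees_le: "finite T \<Longrightarrow> num_root_subtrees T \<le> num_subtrees T"
  unfolding num_root_subtrees_def num_subtrees_def
  by (intro card_mono finite_subtrees) (auto simp: root_subtrees_def)

text \<open>A subtree is determined by its top node and its union with the path from the root.\<close>
lemma num_subtrees_le:
  assumes "finite T" "prefix_closed T"
  shows "num_subtrees T \<le> card T * num_root_subtrees T"
proof -
  have "\<exists>v\<in>A. (\<forall>u\<in>A. \<exists>s. u = v @ s) \<and> (\<forall>u i. u @ [i] \<in> A \<and> u @ [i] \<noteq> v \<longrightarrow> u \<in> A)"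
    if A: "A \<in> subtrees T" for A
  proof -
    have "A \<noteq> {}" and conn: "connected_nodes A" using A by (auto simp: subtrees_def)
    \<comment> \<open>A shortest node serves as the top: by minimality its parent is outside
      \<open>A\<close>, so that all of \<open>A\<close> lies below it by
      \<open>connected_extends\<close>.\<close>
    then obtain v where v: "v \<in> A" and min: "\<And>u. u \<in> A \<Longrightarrow> length v \<le> length u"
      using ex_has_least_nat[of "\<lambda>u. u \<in> A" _ length] by auto
    have ext: "\<exists>s. u = v @ s" if u: "u \<in> A" for u
    proof (cases v rule: rev_cases)
      case (snoc w i)
      have "w \<notin> A" using min[of w] snoc by auto
      then show ?thesis using connected_extends[OF conn _ _ u] v snoc by auto
    qed simp
    moreover have "u \<in> A" if u: "u @ [i] \<in> A" "u @ [i] \<noteq> v" for u i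
    proof (rule ccontr)
      assume "u \<notin> A"
      then obtain s where "v = u @ [i] @ s" using connected_extends[OF conn u(1) _ v] by blast
      moreover obtain s' where "u @ [i] = v @ s'" using ext[OF u(1)] by blast
      ultimately show False using u(2) by auto
    qed
    ultimately show ?thesis using v by blast
  qed
  then have "\<forall>A\<in>subtrees T. \<exists>v. v \<in> A \<and> (\<forall>u\<in>A. \<exists>s. u = v @ s) \<and> (\<forall>u i. u @ [i] \<in> A \<and> u @ [i] \<noteq> v \<longrightarrow> u \<in> A)"
    by blast
  from bchoice[OF this] obtain apex where "\<forall>A\<in>subtrees T. apex A \<in> A \<and> (\<forall>u\<in>A. \<exists>s. u = apex A @ s) \<and>
      (\<forall>u i. u @ [i] \<in> A \<and> u @ [i] \<noteq> apex A \<longrightarrow> u \<in> A)"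
    by blast
  then have apex: "\<And>A. A \<in> subtrees T \<Longrightarrow> apex A \<in> A"
    "\<And>A u. A \<in> subtrees T \<Longrightarrow> u \<in> A \<Longrightarrow> \<exists>s. u = apex A @ s"
    "\<And>A u i. A \<in> subtrees T \<Longrightarrow> u @ [i] \<in> A \<Longrightarrow> u @ [i] \<noteq> apex A \<Longrightarrow> u \<in> A"
    by blast+
  define g where "g A = (apex A, A \<union> {x. \<exists>s. x @ s = apex A})" for A
  have "inj_on g (subtrees T)"
  proof (rule inj_onI)
    fix A B assume A: "A \<in> subtrees T" and B: "B \<in> subtrees T" and eq: "g A = g B"
    \<comment> \<open>The added ancestors of the apex are proper prefixes of it and not extensions.
      Hence the original set is recovered as the part of the union that lies at or below the
      apex.\<close>
    have rec: "C = {u \<in> snd (g C). \<exists>s. u = fst (g C) @ s}" if "C \<in> subtrees T" for C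
      using apex[OF that] by (auto simp: g_def)
    show "A = B" using rec[OF A] rec[OF B] eq by simp
  qed
  moreover have "g ` subtrees T \<subseteq> T \<times> root_subtrees T"
  proof
    fix y assume "y \<in> g ` subtrees T"
    then obtain A where A: "A \<in> subtrees T" and y: "y = g A" by auto
    have AT: "A \<subseteq> T" using A by (auto simp: subtrees_def)
    have tT: "apex A \<in> T" using apex(1)[OF A] AT by auto
    have "A \<union> {x. \<exists>s. x @ s = apex A} \<subseteq> T"
      using AT tT prefix_closed_prefix[OF assms(2)] by (auto, metis)
    moreover have "prefix_closed (A \<union> {x. \<exists>s. x @ s = apex A})"
      unfolding prefix_closed_def
    proof (intro allI impI)
      fix u i assume "u @ [i] \<in> A \<union> {x. \<exists>s. x @ s = apex A}"
      then consider "u @ [i] \<in> A" "u @ [i] \<noteq> apex A" | "\<exists>s. u @ [i] @ s = apex A" by fastforce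
      then show "u \<in> A \<union> {x. \<exists>s. x @ s = apex A}"
        using apex(3)[OF A] by cases blast+
    qed
    moreover have "apex A \<in> A \<union> {x. \<exists>s. x @ s = apex A}" using apex(1)[OF A] by simp
    ultimately show "y \<in> T \<times> root_subtrees T" using tT by (auto simp: y g_def root_subtrees_eq)
  qed
  moreover have "finite (T \<times> root_subtrees T)"
    using assms(1) finite_subtrees[OF assms(1)] by (auto simp: root_subtrees_def)
  ultimately have "card (subtrees T) \<le> card (T \<times> root_subtrees T)" by (meson card_inj_on_le)
  then show ?thesis by (simp add: num_subtrees_def num_root_subtrees_def card_cartesian_product)
qed

text \<open>The paths from the root to the nodes form infinitely many root subtrees, and
  \<open>card\<close> is 0 on infinite sets. The case is settled so that both counts can be
  expressed through the code for every offspring family.\<close>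

lemma num_subtrees_infinite:
  assumes "infinite T" "prefix_closed T"
  shows "num_root_subtrees T = 0" "num_subtrees T = 0"
proof -
  define g where "g v = {x. \<exists>s. x @ s = (v :: node)}" for v
  have "inj g"
  proof (rule injI)
    fix v w assume "g v = g w"
    moreover have "v \<in> g v" "w \<in> g w" by (auto simp: g_def)
    ultimately have "v \<in> g w" "w \<in> g v" by auto
    then show "v = w" by (auto simp: g_def)
  qed
  moreover have "g ` T \<subseteq> root_subtrees T"
  proof
    fix A assume "A \<in> g ` T"
    then obtain v where v: "v \<in> T" and A: "A = g v" by auto
    have "A \<subseteq> T" using v prefix_closed_prefix[OF assms(2)] by (auto simp: A g_def)
    moreover have "prefix_closed A" by (force simp: A g_def prefix_closed_def)
    moreover have "v \<in> A" by (simp add: A g_def)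
    ultimately show "A \<in> root_subtrees T" by (auto simp: root_subtrees_eq)
  qed
  ultimately have inf: "infinite (root_subtrees T)"
    using assms(1) by (meson finite_imageD finite_subset inj_on_subset subset_UNIV)
  then show "num_root_subtrees T = 0" by (simp add: num_root_subtrees_def)
  have "infinite (subtrees T)" using inf finite_subset[of "root_subtrees T" "subtrees T"]
    by (auto simp: root_subtrees_def)
  then show "num_subtrees T = 0" by (simp add: num_subtrees_def)
qed

section \<open>The law of the conditioned tree\<close>

text \<open>All infinite trees receive the code \<open>[]\<close>, which is not the word of any
  tree. The map is total with values in a countable set, so that its law can be described by single
  words.\<close>

definition tree_code :: "(node \<Rightarrow> nat) \<Rightarrow> nat list" where
  "tree_code c = (if finite (tree_of c) then tree_word (THE t. nodes t = tree_of c) else [])"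

lemma tree_word_not_Nil: "tree_word t \<noteq> []"
  by (cases t) simp

lemma tree_code_eq_iff: "tree_code c = tree_word t \<longleftrightarrow> tree_of c = nodes t"
proof
  assume eq: "tree_code c = tree_word t"
  then have fin: "finite (tree_of c)" using tree_word_not_Nil[of t] by (auto simp: tree_code_def split: if_splits)
  then obtain s where s: "tree_of c = nodes s" using finite_tree_of_ex by blast
  then have "(THE t. nodes t = tree_of c) = s" by (auto intro: nodes_inj)
  then show "tree_of c = nodes t" using eq fin s inj_tree_word by (auto simp: tree_code_def dest: injD)
next
  assume eq: "tree_of c = nodes t"
  then have "(THE t. nodes t = tree_of c) = t" by (auto intro: nodes_inj)
  then show "tree_code c = tree_word t" using eq finite_nodes by (simp add: tree_code_def)
qed

lemma tree_code_cases: "tree_code c = [] \<or> tree_code c \<in> range tree_word"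
  by (auto simp: tree_code_def)

lemma tree_code_Nil_iff: "tree_code c = [] \<longleftrightarrow> infinite (tree_of c)"
  using tree_word_not_Nil by (auto simp: tree_code_def)

lemma length_tree_code: "finite (tree_of c) \<Longrightarrow> length (tree_code c) = card (tree_of c)"
  by (metis card_nodes finite_tree_of_ex tree_code_eq_iff)

text \<open>The value 0 outside the tree words agrees with \<open>card\<close> of an infinite set.
  Thus the counts factor through \<open>tree_code\<close> everywhere and not only almost
  surely.\<close>

definition code_root_subtrees :: "nat list \<Rightarrow> nat" where
  "code_root_subtrees w = (if w \<in> range tree_word then num_root_subtrees (nodes (inv tree_word w)) else 0)"

definition code_subtrees :: "nat list \<Rightarrow> nat" where
  "code_subtrees w = (if w \<in> range tree_word then num_subtrees (nodes (inv tree_word w)) else 0)"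

lemma inv_tree_word [simp]: "inv tree_word (tree_word t) = t"
  by (simp add: inj_tree_word)

lemma num_subtrees_tree_code:
  "num_root_subtrees (tree_of c) = code_root_subtrees (tree_code c)"
  "num_subtrees (tree_of c) = code_subtrees (tree_code c)"
proof -
  have "num_root_subtrees (tree_of c) = code_root_subtrees (tree_code c) \<and>
    num_subtrees (tree_of c) = code_subtrees (tree_code c)"
  proof (cases "finite (tree_of c)")
    case True
    then obtain t where "tree_of c = nodes t" using finite_tree_of_ex by blast
    moreover from this have "tree_code c = tree_word t" by (simp add: tree_code_eq_iff)
    ultimately show ?thesis by (simp add: code_root_subtrees_def code_subtrees_def)
  next
    case False
    then have "tree_code c = []" by (simp add: tree_code_Nil_iff)
    moreover have "[] \<notin> range tree_word" using tree_word_not_Nil by (metis rangeE)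
    ultimately show ?thesis using num_subtrees_infinite[OF False prefix_closed_tree_of]
      by (simp add: code_root_subtrees_def code_subtrees_def)
  qed
  then show "num_root_subtrees (tree_of c) = code_root_subtrees (tree_code c)"
    "num_subtrees (tree_of c) = code_subtrees (tree_code c)" by auto
qed

lemma code_subtrees_bounds:
  assumes "valid_from w 0"
  shows "1 \<le> code_root_subtrees w" "code_root_subtrees w \<le> code_subtrees w"
    "code_subtrees w \<le> length w * code_root_subtrees w"
    "word_gain w [] = ln (1 + real (code_root_subtrees w))"
proof -
  obtain t where w: "w = tree_word t" using assms range_tree_word by blast
  show "1 \<le> code_root_subtrees w" using root_count_pos
    by (simp add: w code_root_subtrees_def num_root_subtrees_nodes)
  show "code_root_subtrees w \<le> code_subtrees w"
    by (simp add: w code_root_subtrees_def code_subtrees_def num_root_subtrees_le finite_nodes)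
  show "code_subtrees w \<le> length w * code_root_subtrees w"
    using num_subtrees_le[OF finite_nodes prefix_closed_nodes]
    by (simp add: w code_root_subtrees_def code_subtrees_def card_nodes)
  show "word_gain w [] = ln (1 + real (code_root_subtrees w))"
    by (simp add: w word_gain_tree_word code_root_subtrees_def num_root_subtrees_nodes)
qed

lemma pmf_replicate_pmf:
  "pmf (replicate_pmf n p) w = (if length w = n then \<Prod>d\<leftarrow>w. pmf p d else 0)"
proof (induction n arbitrary: w)
  case (Suc n)
  have eq: "replicate_pmf (Suc n) p = map_pmf (\<lambda>(x, xs). x # xs) (pair_pmf p (replicate_pmf n p))"
    by (simp add: pair_pmf_def map_bind_pmf)
  show ?case
  proof (cases w)
    case Nil
    have "[] \<notin> set_pmf (replicate_pmf (Suc n) p)" by (simp add: set_replicate_pmf del: replicate_pmf.simps)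
    then show ?thesis using Nil by (simp add: set_pmf_iff del: replicate_pmf.simps)
  next
    case (Cons d v)
    have "inj (\<lambda>(x, xs). x # xs :: 'a list)" by (auto intro: injI)
    from pmf_map_inj'[OF this, of "pair_pmf p (replicate_pmf n p)" "(d, v)"]
    show ?thesis using Suc by (simp add: eq Cons pmf_pair del: replicate_pmf.simps)
  qed
qed (auto simp: pmf_return)

interpretation offspring: product_prob_space "\<lambda>_. measure_pmf p" "UNIV :: node set" for p :: "nat pmf"
  by unfold_locales

lemma space_offspring [simp]: "space (offspring_space p) = UNIV"
  by (simp add: offspring_space_def space_PiM PiE_UNIV_domain)

lemma prob_space_offspring: "prob_space (offspring_space p)"
  unfolding offspring_space_def by (rule prob_space_PiM) (rule prob_space_measure_pmf)

text \<open>The event fixes the values of finitely many independent coordinates, one for each node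
  of \<open>t\<close>; \<open>prod_nodes\<close> turns the product over the nodes into a product
  along the word.\<close>

lemma tree_event:
  "{c. tree_code c = tree_word t} \<in> sets (offspring_space p)"
  "emeasure (offspring_space p) {c. tree_code c = tree_word t} = ennreal (\<Prod>d\<leftarrow>tree_word t. pmf p d)"
proof -
  let ?M = "offspring_space p"
  have eq: "{c. tree_code c = tree_word t} = {c \<in> space ?M. \<forall>u\<in>nodes t. c u \<in> {arity u t}}"
    by (simp add: tree_code_eq_iff tree_of_eq_nodes_iff)
  have comp: "(\<lambda>c. c u) \<in> measurable ?M (count_space UNIV)" for u
  proof -
    have "(\<lambda>c. c u) \<in> measurable ?M (measure_pmf p)"
      unfolding offspring_space_def by (rule measurable_component_singleton) simp
    then show ?thesis by (simp add: measurable_def)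
  qed
  show "{c. tree_code c = tree_word t} \<in> sets ?M"
  proof -
    have "{c. tree_code c = tree_word t} = (\<Inter>u\<in>nodes t. (\<lambda>c. c u) -` {arity u t} \<inter> space ?M)"
      using finite_nodes[of t] unfolding eq by auto
    also have "\<dots> \<in> sets ?M"
      by (intro sets.finite_INT finite_nodes measurable_sets[OF comp])
        ((metis nodes_simps(1) empty_iff), simp)
    finally show ?thesis .
  qed
  have "emeasure ?M {c. tree_code c = tree_word t} = (\<Prod>u\<in>nodes t. emeasure (measure_pmf p) {arity u t})"
    unfolding eq unfolding offspring_space_def
    by (rule offspring.emeasure_PiM_Collect) (auto simp: finite_nodes)
  also have "\<dots> = ennreal (\<Prod>u\<in>nodes t. pmf p (arity u t))"
    by (simp add: emeasure_pmf_single prod_ennreal)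
  finally show "emeasure ?M {c. tree_code c = tree_word t} = ennreal (\<Prod>d\<leftarrow>tree_word t. pmf p d)"
    using prod_nodes[where t=t and g="pmf p"] by simp
qed

text \<open>There are countably many words, so it suffices to treat single ones. Tree words come
  from cylinder events, \<open>[]\<close> has the complement of their countable union as preimage,
  and other words are never attained.\<close>

lemma measurable_tree_code [measurable]:
  "tree_code \<in> measurable (offspring_space p) (count_space UNIV)"
proof (rule measurable_count_space_eq2_countable[THEN iffD2], safe)
  fix w :: "nat list"
  let ?M = "offspring_space p"
  have rng: "tree_code -` {w} \<inter> space ?M \<in> sets ?M" if w: "w \<in> range tree_word" for w
  proof -
    obtain t where "w = tree_word t" using w by auto
    then have "tree_code -` {w} \<inter> space ?M = {c. tree_code c = tree_word t}" by auto
    then show ?thesis using tree_event(1)[of t p] by simp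
  qed
  consider "w \<in> range tree_word" | "w = []" | "w \<notin> range tree_word" "w \<noteq> []" by blast
  then show "tree_code -` {w} \<inter> space ?M \<in> sets ?M"
  proof cases
    case 2
    have "tree_code -` {[]} \<inter> space ?M = space ?M - (\<Union>w\<in>range tree_word. tree_code -` {w} \<inter> space ?M)"
      using tree_code_cases tree_word_not_Nil by auto (metis rangeE)
    also have "\<dots> \<in> sets ?M" using rng by (intro sets.compl_sets sets.countable_UN') auto
    finally show ?thesis using 2 by simp
  next
    case 3
    then have "tree_code -` {w} \<inter> space ?M = {}" using tree_code_cases by auto
    then show ?thesis by simp
  qed (rule rng)
qed auto

lemma size_event_eq:
  "size_event p n = tree_code -` {w. valid_from w 0 \<and> length w = n} \<inter> space (offspring_space p)"
proof -
  have "finite (tree_of c) \<and> card (tree_of c) = n \<longleftrightarrow> valid_from (tree_code c) 0 \<and> length (tree_code c) = n" for c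
  proof (cases "finite (tree_of c)")
    case True
    then have "tree_code c \<in> range tree_word" using tree_code_cases tree_code_Nil_iff by metis
    then have "valid_from (tree_code c) 0" using range_tree_word by auto
    then show ?thesis using True by (simp add: length_tree_code)
  next
    case False
    then have "tree_code c = []" by (simp add: tree_code_Nil_iff)
    then show ?thesis using False by simp
  qed
  then show ?thesis by (auto simp: size_event_def)
qed

text \<open>Both measures give the same mass to each single tree word and the set is countable. The
  restriction to valid words matters, because an i.i.d. word of length \<open>n\<close> need not be
  the code of a tree.\<close>

lemma distr_tree_code:
  assumes "W \<subseteq> {w. valid_from w 0 \<and> length w = n}"
  shows "emeasure (offspring_space p) (tree_code -` W \<inter> space (offspring_space p))
    = emeasure (measure_pmf (replicate_pmf n p)) W"
proof -
  let ?D = "distr (offspring_space p) (count_space UNIV) tree_code"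
  have "emeasure ?D {w} = ennreal (pmf (replicate_pmf n p) w)" if w: "w \<in> W" for w
  proof -
    have "w \<in> range tree_word" using assms w range_tree_word by auto
    then obtain t where t: "w = tree_word t" by auto
    have "tree_code -` {w} \<inter> space (offspring_space p) = {c. tree_code c = tree_word t}" using t by auto
    moreover have "length w = n" using assms w by auto
    ultimately show ?thesis using tree_event(2)[where t=t] by (simp add: emeasure_distr pmf_replicate_pmf t)
  qed
  then have "(\<integral>\<^sup>+w. emeasure ?D {w} \<partial>count_space W) = (\<integral>\<^sup>+w. pmf (replicate_pmf n p) w \<partial>count_space W)"
    by (intro nn_integral_cong) auto
  moreover have "emeasure ?D W = (\<integral>\<^sup>+w. emeasure ?D {w} \<partial>count_space W)"
    by (rule emeasure_countable_singleton) auto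
  ultimately show ?thesis by (simp add: emeasure_distr nn_integral_pmf)
qed

text \<open>The event of size \<open>n\<close> and the event that the i.i.d. word is valid have
  equal mass, and so have their intersections with any set of words; hence the conditional laws
  agree. From here on the trees themselves are replaced by words.\<close>

lemma conditioned_law:
  assumes "0 < measure (offspring_space p) (size_event p n)"
  shows "set_pmf (replicate_pmf n p) \<inter> {w. valid_from w 0} \<noteq> {}"
    and "distr (conditioned_space p n) (count_space UNIV) tree_code
      = measure_pmf (cond_pmf (replicate_pmf n p) {w. valid_from w 0})"
proof -
  interpret prob_space "offspring_space p" by (rule prob_space_offspring)
  let ?M = "offspring_space p" and ?L = "replicate_pmf n p"
  let ?V = "{w. valid_from w 0}" and ?W = "{w. valid_from w 0 \<and> length w = n}"
  \<comment> \<open>The length is automatic under \<open>replicate_pmf n p\<close>, so the validity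
    condition alone describes the size event.\<close>
  have L: "emeasure ?L (?V \<inter> A) = emeasure ?L (?W \<inter> A)" for A
    by (rule emeasure_eq_AE) (auto simp: AE_measure_pmf_iff set_replicate_pmf)
  have size: "emeasure ?M (size_event p n) = emeasure ?L ?V"
    using distr_tree_code[of ?W n p] L[of UNIV] by (simp add: size_event_eq)
  have size_sets: "size_event p n \<in> sets ?M"
    unfolding size_event_eq by (rule measurable_sets[OF measurable_tree_code]) simp
  have "0 < emeasure ?M (size_event p n)" unfolding emeasure_eq_measure using assms by simp
  then have pos: "0 < emeasure ?L ?V" unfolding size .
  then show ne: "set_pmf ?L \<inter> ?V \<noteq> {}"
    by (metis less_irrefl emeasure_Int_set_pmf emeasure_empty inf_commute)
  show "distr (conditioned_space p n) (count_space UNIV) tree_code = measure_pmf (cond_pmf ?L ?V)"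
  proof (rule measure_eqI)
    fix A
    have m: "tree_code \<in> measurable (conditioned_space p n) (count_space UNIV)"
      unfolding conditioned_space_def by simp
    have sp: "space (conditioned_space p n) = space ?M" by (simp add: conditioned_space_def)
    have "emeasure (distr (conditioned_space p n) (count_space UNIV) tree_code) A
        = emeasure (conditioned_space p n) (tree_code -` A \<inter> space ?M)"
      using m sp by (simp add: emeasure_distr)
    also have "\<dots> = emeasure ?M (size_event p n \<inter> (tree_code -` A \<inter> space ?M)) / emeasure ?M (size_event p n)"
      unfolding conditioned_space_def
      by (rule emeasure_uniform_measure[OF size_sets measurable_sets[OF measurable_tree_code]]) simp
    also have "size_event p n \<inter> (tree_code -` A \<inter> space ?M) = tree_code -` (?W \<inter> A) \<inter> space ?M"
      by (auto simp: size_event_eq)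
    also have "emeasure ?M (tree_code -` (?W \<inter> A) \<inter> space ?M) = emeasure ?L (?V \<inter> A)"
      by (subst distr_tree_code[of _ n]) (auto simp: L)
    also have "emeasure ?L (?V \<inter> A) / emeasure ?M (size_event p n) = emeasure (cond_pmf ?L ?V) A"
      unfolding size cond_pmf.rep_eq[OF ne] by (subst emeasure_uniform_measure) auto
    finally show "emeasure (distr (conditioned_space p n) (count_space UNIV) tree_code) A
      = emeasure (cond_pmf ?L ?V) A" .
  qed simp
qed

section \<open>Square-integrable functions of discrete random variables\<close>

text \<open>This identification makes Fubini for product measures available for pairs of independent
  discrete variables.\<close>

lemma pair_measure_pmf:
  fixes A :: "'a :: countable pmf" and B :: "'b :: countable pmf"
  shows "measure_pmf A \<Otimes>\<^sub>M measure_pmf B = measure_pmf (pair_pmf A B)"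
proof (rule measure_eqI_countable[of _ UNIV])
  have "sets (measure_pmf A \<Otimes>\<^sub>M measure_pmf B) = sets (count_space (UNIV :: 'a set) \<Otimes>\<^sub>M count_space (UNIV :: 'b set))"
    by (intro sets_pair_measure_cong) auto
  also have "count_space (UNIV :: 'a set) \<Otimes>\<^sub>M count_space (UNIV :: 'b set) = count_space (UNIV \<times> UNIV)"
    by (rule pair_measure_countable) auto
  finally show "sets (measure_pmf A \<Otimes>\<^sub>M measure_pmf B) = Pow UNIV" by simp
  fix x :: "'a \<times> 'b"
  obtain a b where x: "x = (a, b)" by (cases x)
  have "emeasure (measure_pmf A \<Otimes>\<^sub>M measure_pmf B) ({a} \<times> {b}) = emeasure (measure_pmf A) {a} * emeasure (measure_pmf B) {b}"
    by (rule measure_pmf.emeasure_pair_measure_Times) auto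
  then show "emeasure (measure_pmf A \<Otimes>\<^sub>M measure_pmf B) {x} = emeasure (measure_pmf (pair_pmf A B)) {x}"
    by (simp add: x emeasure_pmf_single pmf_pair ennreal_mult)
qed auto

lemma expectation_pair_pmf:
  fixes A :: "'a :: countable pmf" and B :: "'b :: countable pmf"
    and f :: "'a \<times> 'b \<Rightarrow> 'c :: {banach, second_countable_topology}"
  assumes "integrable (measure_pmf (pair_pmf A B)) f"
  shows "measure_pmf.expectation (pair_pmf A B) f
    = measure_pmf.expectation A (\<lambda>a. measure_pmf.expectation B (\<lambda>b. f (a, b)))"
proof -
  interpret pair_sigma_finite "measure_pmf A" "measure_pmf B" by unfold_locales
  show ?thesis using integral_fst'[of f] assms by (simp add: pair_measure_pmf)
qed

lemma integrable_pair_pmf_mult: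
  fixes A :: "'a :: countable pmf" and B :: "'b :: countable pmf"
    and f :: "'a \<Rightarrow> 'c :: {real_normed_field, banach, second_countable_topology}"
  assumes "integrable (measure_pmf A) f" "integrable (measure_pmf B) g"
  shows "integrable (measure_pmf (pair_pmf A B)) (\<lambda>z. f (fst z) * g (snd z))"
proof -
  interpret pair_sigma_finite "measure_pmf A" "measure_pmf B" by unfold_locales
  have "integrable (measure_pmf A \<Otimes>\<^sub>M measure_pmf B) (\<lambda>z. f (fst z) * g (snd z))"
  proof (rule Fubini_integrable)
    show "(\<lambda>z. f (fst z) * g (snd z)) \<in> borel_measurable (measure_pmf A \<Otimes>\<^sub>M measure_pmf B)"
      by (simp add: pair_measure_pmf)
    show "integrable (measure_pmf A) (\<lambda>x. LINT y|measure_pmf B. norm (f (fst (x, y)) * g (snd (x, y))))"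
      using assms by (simp add: norm_mult)
    show "AE x in measure_pmf A. integrable (measure_pmf B) (\<lambda>y. f (fst (x, y)) * g (snd (x, y)))"
      using assms by simp
  qed
  then show ?thesis by (simp add: pair_measure_pmf)
qed

lemma expectation_pair_pmf_mult:
  fixes A :: "'a :: countable pmf" and B :: "'b :: countable pmf"
    and f :: "'a \<Rightarrow> 'c :: {real_normed_field, banach, second_countable_topology}"
  assumes "integrable (measure_pmf A) f" "integrable (measure_pmf B) g"
  shows "measure_pmf.expectation (pair_pmf A B) (\<lambda>z. f (fst z) * g (snd z))
    = measure_pmf.expectation A f * measure_pmf.expectation B g"
  by (subst expectation_pair_pmf[OF integrable_pair_pmf_mult[OF assms]]) (use assms in simp)

lemma integrable_pmf_fst_snd:
  fixes f :: "'a \<Rightarrow> 'c :: {banach, second_countable_topology}"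
    and g :: "'b \<Rightarrow> 'd :: {banach, second_countable_topology}"
  shows "integrable (measure_pmf A) f \<Longrightarrow> integrable (measure_pmf (pair_pmf A B)) (\<lambda>z. f (fst z))"
    and "integrable (measure_pmf B) g \<Longrightarrow> integrable (measure_pmf (pair_pmf A B)) (\<lambda>z. g (snd z))"
  using integrable_map_pmf_eq[of fst "pair_pmf A B" f] integrable_map_pmf_eq[of snd "pair_pmf A B" g]
  by (simp_all add: map_fst_pair_pmf map_snd_pair_pmf)

definition sq_int :: "'a pmf \<Rightarrow> ('a \<Rightarrow> real) \<Rightarrow> bool" where
  "sq_int M f \<longleftrightarrow> integrable (measure_pmf M) (\<lambda>x. (f x)\<^sup>2)"

lemma sq_int_bound:
  assumes "sq_int M g" "\<And>x. x \<in> set_pmf M \<Longrightarrow> \<bar>f x\<bar> \<le> \<bar>g x\<bar>"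
  shows "sq_int M f"
  using assms(1) unfolding sq_int_def
proof (rule Bochner_Integration.integrable_bound)
  show "AE x in measure_pmf M. norm ((f x)\<^sup>2) \<le> norm ((g x)\<^sup>2)"
  proof (rule AE_pmfI)
    fix x assume "x \<in> set_pmf M"
    from power_mono[OF assms(2)[OF this], of 2] show "norm ((f x)\<^sup>2) \<le> norm ((g x)\<^sup>2)"
      by (simp only: power2_abs real_norm_def abs_of_nonneg zero_le_power2)
  qed
qed simp

lemma sq_int_mult:
  assumes "sq_int M f" "sq_int M g"
  shows "integrable (measure_pmf M) (\<lambda>x. f x * g x)"
proof -
  have "integrable (measure_pmf M) (\<lambda>x. (f x)\<^sup>2 + (g x)\<^sup>2)" using assms by (auto simp: sq_int_def)
  then show ?thesis
  proof (rule Bochner_Integration.integrable_bound)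
    have "\<bar>a * b\<bar> \<le> \<bar>a\<^sup>2 + b\<^sup>2\<bar>" for a b :: real
    proof -
      have "2 * (\<bar>a\<bar> * \<bar>b\<bar>) \<le> a\<^sup>2 + b\<^sup>2"
        using sum_squares_bound[of "\<bar>a\<bar>" "\<bar>b\<bar>"] by simp
      moreover have "0 \<le> \<bar>a\<bar> * \<bar>b\<bar>" by simp
      ultimately show ?thesis unfolding abs_mult by linarith
    qed
    then show "AE x in measure_pmf M. norm (f x * g x) \<le> norm ((f x)\<^sup>2 + (g x)\<^sup>2)"
      by (intro AE_I2) (simp only: real_norm_def)
  qed simp
qed

lemma sq_int_const [simp]: "sq_int M (\<lambda>_. c)"
  by (simp add: sq_int_def)

lemma sq_int_integrable: "sq_int M f \<Longrightarrow> integrable (measure_pmf M) f"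
  using sq_int_mult[of M f "\<lambda>_. 1"] by simp

lemma sq_int_add: "sq_int M f \<Longrightarrow> sq_int M g \<Longrightarrow> sq_int M (\<lambda>x. f x + g x)"
  using sq_int_mult[of M f g] by (auto simp: sq_int_def power2_sum mult.assoc)

lemma sq_int_cmult: "sq_int M f \<Longrightarrow> sq_int M (\<lambda>x. c * f x)"
  by (auto simp: sq_int_def power_mult_distrib)

lemma sq_int_diff: "sq_int M f \<Longrightarrow> sq_int M g \<Longrightarrow> sq_int M (\<lambda>x. f x - g x)"
  using sq_int_add[of M f "\<lambda>x. - 1 * g x"] sq_int_cmult[of M g "- 1"] by simp

lemma sq_int_map: "sq_int (map_pmf h M) f \<longleftrightarrow> sq_int M (\<lambda>x. f (h x))"
  by (simp add: sq_int_def integrable_map_pmf_eq)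

lemma sq_int_pair:
  "sq_int A f \<Longrightarrow> sq_int (pair_pmf A B) (\<lambda>z. f (fst z))"
  "sq_int B g \<Longrightarrow> sq_int (pair_pmf A B) (\<lambda>z. g (snd z))"
  by (simp_all add: sq_int_def integrable_pmf_fst_snd(1)[where f="\<lambda>x. (f x)\<^sup>2"]
      integrable_pmf_fst_snd(2)[where g="\<lambda>x. (g x)\<^sup>2"])

section \<open>Quadratic norms and standard deviations\<close>

definition l2 :: "'a pmf \<Rightarrow> ('a \<Rightarrow> real) \<Rightarrow> real" where
  "l2 M f = sqrt (measure_pmf.expectation M (\<lambda>x. (f x)\<^sup>2))"

lemma l2_nonneg [simp]: "0 \<le> l2 M f"
  by (simp add: l2_def)

lemma l2_sq: "(l2 M f)\<^sup>2 = measure_pmf.expectation M (\<lambda>x. (f x)\<^sup>2)"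
  by (simp add: l2_def)

lemma l2_Cauchy_Schwarz:
  assumes f: "sq_int M f" and g: "sq_int M g"
  shows "measure_pmf.expectation M (\<lambda>x. f x * g x) \<le> l2 M f * l2 M g"
proof -
  define a b c where "a = measure_pmf.expectation M (\<lambda>x. (f x)\<^sup>2)"
    and "b = measure_pmf.expectation M (\<lambda>x. f x * g x)" and "c = measure_pmf.expectation M (\<lambda>x. (g x)\<^sup>2)"
  have ac: "0 \<le> a" "0 \<le> c" by (auto simp: a_def c_def)
  have q: "0 \<le> a - 2 * t * b + t\<^sup>2 * c" for t
  proof -
    have "(f x - t * g x)\<^sup>2 = (f x)\<^sup>2 - 2 * t * (f x * g x) + t\<^sup>2 * (g x)\<^sup>2" for x
      by (simp add: power2_eq_square algebra_simps)
    moreover have "0 \<le> measure_pmf.expectation M (\<lambda>x. (f x - t * g x)\<^sup>2)" by simp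
    ultimately show ?thesis
      using f g sq_int_mult[OF f g] by (simp add: sq_int_def a_def b_def c_def)
  qed
  have "b\<^sup>2 \<le> a * c"
  proof (cases "c = 0")
    case True
    show ?thesis
    proof (cases "b = 0")
      case False
      \<comment> \<open>With \<open>c = 0\<close> the quadratic is the linear function
        \<open>a - 2 * t * b\<close>, and this \<open>t\<close> gives it the value
        \<open>- 1\<close>, a contradiction.\<close>
      then show ?thesis using q[of "(a + 1) / (2 * b)"] True by (simp add: field_simps)
    qed (use True in simp)
  next
    case False
    then have "0 < c" using ac by simp
    then show ?thesis using q[of "b / c"] by (simp add: field_simps power2_eq_square)
  qed
  then have "\<bar>b\<bar> \<le> sqrt (a * c)" by (simp add: real_le_rsqrt)
  then show ?thesis by (simp add: l2_def a_def b_def c_def real_sqrt_mult)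
qed

lemma l2_triangle:
  assumes f: "sq_int M f" and g: "sq_int M g"
  shows "l2 M (\<lambda>x. f x + g x) \<le> l2 M f + l2 M g"
proof (rule power2_le_imp_le)
  have "(l2 M (\<lambda>x. f x + g x))\<^sup>2 = measure_pmf.expectation M (\<lambda>x. (f x)\<^sup>2 + (g x)\<^sup>2 + 2 * (f x * g x))"
    by (simp add: l2_sq power2_sum mult.assoc)
  also have "\<dots> = (l2 M f)\<^sup>2 + (l2 M g)\<^sup>2 + 2 * measure_pmf.expectation M (\<lambda>x. f x * g x)"
    using f g sq_int_mult[OF f g] by (simp add: sq_int_def l2_sq)
  also have "\<dots> \<le> (l2 M f + l2 M g)\<^sup>2"
    using l2_Cauchy_Schwarz[OF f g] by (simp add: power2_sum)
  finally show "(l2 M (\<lambda>x. f x + g x))\<^sup>2 \<le> (l2 M f + l2 M g)\<^sup>2" .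
qed simp

lemma l2_bound:
  assumes "0 \<le> c" "\<And>x. x \<in> set_pmf M \<Longrightarrow> \<bar>f x\<bar> \<le> c"
  shows "l2 M f \<le> c"
proof -
  have "measure_pmf.expectation M (\<lambda>x. (f x)\<^sup>2) \<le> measure_pmf.expectation M (\<lambda>x. c\<^sup>2)"
  proof (rule integral_mono_AE)
    show "integrable (measure_pmf M) (\<lambda>x. (f x)\<^sup>2)"
      using sq_int_bound[of M "\<lambda>_. c" f] assms by (simp add: sq_int_def)
    show "AE x in measure_pmf M. (f x)\<^sup>2 \<le> c\<^sup>2"
    proof (rule AE_pmfI)
      fix x assume "x \<in> set_pmf M"
      from power_mono[OF assms(2)[OF this], of 2] show "(f x)\<^sup>2 \<le> c\<^sup>2" by simp
    qed
  qed simp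
  then show ?thesis using assms(1) by (simp add: l2_def real_le_lsqrt)
qed

lemma expectation_abs_le_l2:
  assumes "sq_int M f"
  shows "measure_pmf.expectation M (\<lambda>x. \<bar>f x\<bar>) \<le> l2 M f"
proof -
  have "sq_int M (\<lambda>x. \<bar>f x\<bar>)" using assms by (simp add: sq_int_def)
  from l2_Cauchy_Schwarz[OF this, of "\<lambda>_. 1"] show ?thesis by (simp add: l2_def)
qed

text \<open>Preferred to the variance because of the triangle inequality: perturbations can be
  estimated without control of covariances.\<close>

definition sd :: "'a pmf \<Rightarrow> ('a \<Rightarrow> real) \<Rightarrow> real" where
  "sd M f = sqrt (measure_pmf.variance M f)"

lemma sd_nonneg [simp]: "0 \<le> sd M f"
  by (simp add: sd_def)

lemma sd_sq: "(sd M f)\<^sup>2 = measure_pmf.variance M f"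
  by (simp add: sd_def)

lemma sd_eq_l2: "sd M f = l2 M (\<lambda>x. f x - measure_pmf.expectation M f)"
  by (simp add: sd_def l2_def)

lemma sd_triangle:
  assumes f: "sq_int M f" and g: "sq_int M g"
  shows "sd M (\<lambda>x. f x + g x) \<le> sd M f + sd M g"
proof -
  have "sd M (\<lambda>x. f x + g x)
      = l2 M (\<lambda>x. (f x - measure_pmf.expectation M f) + (g x - measure_pmf.expectation M g))"
    using f g by (simp add: sd_eq_l2 sq_int_integrable algebra_simps)
  also have "\<dots> \<le> sd M f + sd M g"
    unfolding sd_eq_l2 using f g by (intro l2_triangle sq_int_diff) auto
  finally show ?thesis .
qed

lemma variance_eq_sq: "sq_int M f \<Longrightarrow>
  measure_pmf.variance M f = measure_pmf.expectation M (\<lambda>x. (f x)\<^sup>2) - (measure_pmf.expectation M f)\<^sup>2"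
  by (rule measure_pmf.variance_eq) (auto simp: sq_int_integrable sq_int_def)

lemma sd_le_l2: "sq_int M f \<Longrightarrow> sd M f \<le> l2 M f"
  by (simp add: sd_def l2_def variance_eq_sq)

lemma sd_diff_le:
  assumes f: "sq_int M f" and g: "sq_int M g"
    and c: "0 \<le> c" "\<And>x. x \<in> set_pmf M \<Longrightarrow> \<bar>f x - g x\<bar> \<le> c"
  shows "\<bar>sd M f - sd M g\<bar> \<le> c"
proof -
  have fg: "sq_int M (\<lambda>x. f x - g x)" "sq_int M (\<lambda>x. g x - f x)" using f g by (auto intro: sq_int_diff)
  have "sd M (\<lambda>x. f x - g x) \<le> c" "sd M (\<lambda>x. g x - f x) \<le> c"
    using sd_le_l2[OF fg(1)] sd_le_l2[OF fg(2)] l2_bound[of c M "\<lambda>x. f x - g x"] l2_bound[of c M "\<lambda>x. g x - f x"] c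
    by (auto simp: abs_minus_commute intro: order_trans)
  then show ?thesis using sd_triangle[OF g fg(1)] sd_triangle[OF f fg(2)] by simp
qed

lemma variance_pair:
  fixes A :: "'a :: countable pmf" and B :: "'b :: countable pmf"
  assumes u: "sq_int A u" and v: "sq_int B v"
  shows "measure_pmf.variance (pair_pmf A B) (\<lambda>z. u (fst z) + v (snd z))
    = measure_pmf.variance A u + measure_pmf.variance B v"
proof -
  define u' where "u' x = u x - measure_pmf.expectation A u" for x
  define v' where "v' x = v x - measure_pmf.expectation B v" for x
  have u': "sq_int A u'" and v': "sq_int B v'" unfolding u'_def v'_def using u v by (auto intro: sq_int_diff)
  have int: "integrable A u" "integrable B v" "integrable A u'" "integrable B v'"
    using u v u' v' by (auto intro: sq_int_integrable)
  let ?P = "pair_pmf A B"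
  have "measure_pmf.expectation ?P (\<lambda>z. u (fst z) + v (snd z)) = measure_pmf.expectation A u + measure_pmf.expectation B v"
    using int integrable_pmf_fst_snd(1)[of A u B] integrable_pmf_fst_snd(2)[of B v A] by simp
  then have "measure_pmf.variance ?P (\<lambda>z. u (fst z) + v (snd z))
      = measure_pmf.expectation ?P (\<lambda>z. (u' (fst z))\<^sup>2 + (v' (snd z))\<^sup>2 + 2 * (u' (fst z) * v' (snd z)))"
    by (simp add: u'_def v'_def power2_eq_square algebra_simps)
  also have "\<dots> = measure_pmf.expectation A (\<lambda>x. (u' x)\<^sup>2) + measure_pmf.expectation B (\<lambda>x. (v' x)\<^sup>2)
      + 2 * (measure_pmf.expectation A u' * measure_pmf.expectation B v')"
    using sq_int_pair(1)[OF u', of B] sq_int_pair(2)[OF v', of A] integrable_pair_pmf_mult[OF int(3,4)]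
      expectation_pair_pmf_mult[OF int(3,4)]
      expectation_pair_pmf_fst[of A B "\<lambda>x. (u' x)\<^sup>2"] expectation_pair_pmf_snd[of A B "\<lambda>x. (v' x)\<^sup>2"]
    by (simp add: sq_int_def)
  also have "measure_pmf.expectation A u' = 0" unfolding u'_def using int by simp
  finally show ?thesis by (simp add: u'_def v'_def)
qed

section \<open>Independent letters and characteristic functions\<close>

lemma replicate_pmf_add:
  "replicate_pmf (m + n) p = map_pmf (\<lambda>z. fst z @ snd z) (pair_pmf (replicate_pmf m p) (replicate_pmf n p))"
  by (simp add: replicate_pmf_distrib pair_pmf_def map_bind_pmf)

lemma replicate_pmf_Suc:
  "replicate_pmf (Suc n) p = map_pmf (\<lambda>z. fst z # snd z) (pair_pmf p (replicate_pmf n p))"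
  by (simp add: pair_pmf_def map_bind_pmf)

lemma length_replicate_pmf: "w \<in> set_pmf (replicate_pmf n p) \<Longrightarrow> length w = n"
  by (simp add: set_replicate_pmf)

lemma integrable_pmf_bounded:
  fixes f :: "'a \<Rightarrow> 'b :: {banach, second_countable_topology}"
  assumes "\<And>x. x \<in> set_pmf M \<Longrightarrow> norm (f x) \<le> B"
  shows "integrable (measure_pmf M) f"
  by (rule measure_pmf.integrable_const_bound[where B=B]) (use assms in \<open>auto simp: AE_measure_pmf_iff\<close>)

lemma integrable_cis [simp]: "integrable (measure_pmf M) (\<lambda>x. cis (f x))"
  by (rule integrable_pmf_bounded[of _ _ 1]) simp

lemma norm_expectation_le_1:
  fixes f :: "'a \<Rightarrow> 'b :: {banach, second_countable_topology}"
  assumes "\<And>x. x \<in> set_pmf M \<Longrightarrow> norm (f x) \<le> 1"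
  shows "norm (measure_pmf.expectation M f) \<le> 1"
proof -
  have "norm (measure_pmf.expectation M f) \<le> measure_pmf.expectation M (\<lambda>x. norm (f x))" by simp
  also have "\<dots> \<le> measure_pmf.expectation M (\<lambda>x. 1)"
    by (rule integral_mono_AE) (use assms in \<open>auto simp: AE_measure_pmf_iff intro!: integrable_norm integrable_pmf_bounded\<close>)
  finally show ?thesis by simp
qed

lemma norm_expectation_cis_le: "cmod (measure_pmf.expectation M (\<lambda>x. cis (f x))) \<le> 1"
  by (rule norm_expectation_le_1) simp

lemma norm_cis_diff_le: "cmod (cis a - cis b) \<le> \<bar>a - b\<bar>"
proof -
  have "cis a - cis b = cis b * (cis (a - b) - 1)" by (simp add: cis_mult algebra_simps)
  then have "cmod (cis a - cis b) = cmod (cis (a - b) - 1)" by (simp add: norm_mult)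
  also have "\<dots> \<le> \<bar>a - b\<bar>"
    using iexp_approx1[of "a - b" 0] by (simp add: cis_conv_exp)
  finally show ?thesis .
qed

text \<open>The function \<open>cis\<close> is 1-Lipschitz and a first absolute moment is at most
  the quadratic norm. Every approximation in quadratic mean thus carries over to characteristic
  functions.\<close>

lemma norm_expectation_cis_diff_le:
  assumes "sq_int M (\<lambda>x. f x - g x)"
  shows "cmod (measure_pmf.expectation M (\<lambda>x. cis (f x)) - measure_pmf.expectation M (\<lambda>x. cis (g x)))
    \<le> l2 M (\<lambda>x. f x - g x)"
proof -
  have "measure_pmf.expectation M (\<lambda>x. cis (f x)) - measure_pmf.expectation M (\<lambda>x. cis (g x))
      = measure_pmf.expectation M (\<lambda>x. cis (f x) - cis (g x))" by simp
  also have "cmod \<dots> \<le> measure_pmf.expectation M (\<lambda>x. cmod (cis (f x) - cis (g x)))"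
    by (rule integral_norm_bound)
  also have "\<dots> \<le> measure_pmf.expectation M (\<lambda>x. \<bar>f x - g x\<bar>)"
    using sq_int_integrable[OF assms] by (intro integral_mono) (auto simp: norm_cis_diff_le)
  also have "\<dots> \<le> l2 M (\<lambda>x. f x - g x)" by (rule expectation_abs_le_l2[OF assms])
  finally show ?thesis .
qed

section \<open>Almost additive sequences\<close>

text \<open>The common error scale. It dominates the logarithm, is multiplicative, and doubling its
  argument multiplies it by less than \<open>sqrt 2\<close>, the corresponding factor for the
  fluctuations.\<close>

definition fourth_root :: "nat \<Rightarrow> real" where
  "fourth_root n = sqrt (sqrt (real n))"

lemma fourth_root_nonneg [simp]: "0 \<le> fourth_root n"
  by (simp add: fourth_root_def)

lemma fourth_root_mult: "fourth_root (m * n) = fourth_root m * fourth_root n"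
  by (simp add: fourth_root_def real_sqrt_mult)

lemma fourth_root_power: "fourth_root (m ^ k) = fourth_root m ^ k"
  by (induction k) (simp_all add: fourth_root_mult, simp add: fourth_root_def)

lemma fourth_root_mono: "m \<le> n \<Longrightarrow> fourth_root m \<le> fourth_root n"
  by (simp add: fourth_root_def)

lemma fourth_root_ge_1: "1 \<le> n \<Longrightarrow> 1 \<le> fourth_root n"
  by (simp add: fourth_root_def)

lemma fourth_root_sq: "(fourth_root n)\<^sup>2 = sqrt (real n)"
  by (simp add: fourth_root_def)

lemma fourth_root_pow4: "fourth_root n ^ 4 = real n"
proof -
  have "fourth_root n ^ 4 = ((fourth_root n)\<^sup>2)\<^sup>2" by (simp flip: power_mult)
  then show ?thesis by (simp add: fourth_root_sq)
qed

text \<open>Since \<open>(7 / 6) ^ 4 < 2\<close>; this lower bound is exactly what the constant 12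
  in \<open>halving_recursion\<close> requires.\<close>

lemma fourth_root_2: "7 / 6 \<le> fourth_root 2" "fourth_root 2 < 2"
proof -
  have "(7 / 6) ^ 4 \<le> fourth_root 2 ^ 4" "fourth_root 2 ^ 4 < 2 ^ 4"
    unfolding fourth_root_pow4 by (simp_all add: power_divide)
  then show "7 / 6 \<le> fourth_root 2" "fourth_root 2 < 2"
    using power_mono_iff[of "7 / 6" "fourth_root 2" 4] power_less_imp_less_base[of "fourth_root 2" 4 2] by auto
qed

text \<open>With \<open>y = fourth_root n\<close> one has
  \<open>1 + n = 1 + y ^ 4 \<le> (1 + y) ^ 4\<close>, and \<open>ln (1 + y) \<le> y\<close>.\<close>

lemma ln_le_fourth_root: "ln (1 + real n) \<le> 4 * fourth_root n"
proof -
  let ?y = "fourth_root n"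
  have "1 + real n = 1 + ?y ^ 4" by (simp add: fourth_root_pow4)
  also have "\<dots> \<le> (1 + ?y) ^ 4"
    using fourth_root_nonneg[of n] by (simp add: power4_eq_xxxx algebra_simps)
  finally have "ln (1 + real n) \<le> ln ((1 + ?y) ^ 4)" by (intro ln_mono) (auto intro!: add_pos_nonneg)
  also have "\<dots> = 4 * ln (1 + ?y)" by (simp add: ln_realpow add_pos_nonneg)
  also have "\<dots> \<le> 4 * ?y" using ln_add_one_self_le_self[of ?y] by simp
  finally show ?thesis .
qed

lemma fourth_root_div_sqrt_tendsto: "(\<lambda>n. fourth_root n / sqrt (real n)) \<longlonglongrightarrow> 0"
proof -
  have "(\<lambda>n. inverse (sqrt (sqrt (real n)))) \<longlonglongrightarrow> 0"
    by (intro tendsto_inverse_0_at_top filterlim_compose[OF sqrt_at_top] filterlim_real_sequentially)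
  moreover have "inverse (sqrt (sqrt (real n))) = fourth_root n / sqrt (real n)" for n
    using fourth_root_sq[of n] by (cases "n = 0") (auto simp: fourth_root_def field_simps power2_eq_square)
  ultimately show ?thesis by simp
qed

text \<open>Along \<open>2 ^ k * n\<close> the quotients form a Cauchy sequence whose limit is exactly additive in \<open>n\<close>.\<close>
lemma almost_additive_linear:
  fixes a :: "nat \<Rightarrow> real"
  assumes C: "\<And>m n. \<bar>a (m + n) - a m - a n\<bar> \<le> C * fourth_root (m + n)"
  shows "\<exists>\<mu> K. \<forall>n. \<bar>a n - \<mu> * real n\<bar> \<le> K * fourth_root n"
proof -
  \<comment> \<open>A doubling multiplies the admissible defect by \<open>fourth_root 2\<close> and
    the normalisation by 2, so the increments of \<open>b n\<close> decay geometrically with this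
    ratio.\<close>
  define r where "r = fourth_root 2 / 2"
  have r: "0 \<le> r" "r < 1" using fourth_root_2 by (auto simp: r_def)
  have C0: "0 \<le> C" using order_trans[OF abs_ge_zero C[of 0 1]] by (simp add: fourth_root_def)
  define b where "b n k = a (2 ^ k * n) / 2 ^ k" for n k
  have step: "\<bar>b n (Suc k) - b n k\<bar> \<le> C * fourth_root n * r ^ Suc k" for n k
  proof -
    have "b n (Suc k) - b n k = (a (2 ^ k * n + 2 ^ k * n) - a (2 ^ k * n) - a (2 ^ k * n)) / 2 ^ Suc k"
    proof -
      have "2 ^ Suc k * n = 2 ^ k * n + 2 ^ k * n" by simp
      then have "b n (Suc k) = a (2 ^ k * n + 2 ^ k * n) / 2 ^ Suc k" by (simp only: b_def)
      then show ?thesis by (simp add: b_def field_simps)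
    qed
    then have "\<bar>b n (Suc k) - b n k\<bar> = \<bar>a (2 ^ k * n + 2 ^ k * n) - a (2 ^ k * n) - a (2 ^ k * n)\<bar> / 2 ^ Suc k"
      by (simp add: abs_divide)
    also have "\<dots> \<le> C * fourth_root (2 ^ k * n + 2 ^ k * n) / 2 ^ Suc k"
      by (intro divide_right_mono C) simp
    also have "2 ^ k * n + 2 ^ k * n = 2 ^ Suc k * n" by simp
    also have "C * fourth_root (2 ^ Suc k * n) / 2 ^ Suc k = C * fourth_root n * r ^ Suc k"
      unfolding fourth_root_mult fourth_root_power r_def power_divide by simp
    finally show ?thesis .
  qed
  have geo: "summable (\<lambda>k. C * fourth_root n * r ^ Suc k)" for n
    using r by (intro summable_mult summable_mult2) (simp add: summable_geometric)
  have sum: "summable (\<lambda>k. b n (Suc k) - b n k)" for n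
    by (rule summable_comparison_test'[OF geo[of n], of 0]) (use step in simp)
  define A where "A n = a n + (\<Sum>k. b n (Suc k) - b n k)" for n
  have lim: "b n \<longlonglongrightarrow> A n" for n
  proof -
    have "(\<lambda>K. a n + (\<Sum>k<K. b n (Suc k) - b n k)) \<longlonglongrightarrow> A n"
      unfolding A_def by (intro tendsto_add tendsto_const summable_LIMSEQ sum)
    moreover have "a n + (\<Sum>k<K. b n (Suc k) - b n k) = b n K" for K
      by (subst sum_lessThan_telescope) (simp add: b_def)
    ultimately show ?thesis by simp
  qed
  define K where "K = C * (\<Sum>k. r ^ Suc k)"
  have near: "\<bar>A n - a n\<bar> \<le> K * fourth_root n" for n
  proof -
    have sabs: "summable (\<lambda>k. \<bar>b n (Suc k) - b n k\<bar>)"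
      by (rule summable_comparison_test'[OF geo[of n], of 0]) (use step in simp)
    have "\<bar>A n - a n\<bar> \<le> (\<Sum>k. \<bar>b n (Suc k) - b n k\<bar>)"
      unfolding A_def using summable_rabs[OF sabs] by simp
    also have "\<dots> \<le> (\<Sum>k. C * fourth_root n * r ^ Suc k)"
      by (intro suminf_le sabs geo step)
    also have "\<dots> = C * fourth_root n * (\<Sum>k. r ^ Suc k)"
      using r by (intro suminf_mult) (simp add: summable_mult summable_geometric)
    finally show ?thesis by (simp add: K_def mult_ac)
  qed
  have add: "A (m + n) = A m + A n" for m n
  proof -
    have "(\<lambda>k. b (m + n) k - b m k - b n k) \<longlonglongrightarrow> A (m + n) - A m - A n"
      by (intro tendsto_diff lim)
    moreover have "(\<lambda>k. b (m + n) k - b m k - b n k) \<longlonglongrightarrow> 0"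
    proof (rule tendsto_rabs_zero_cancel, rule tendsto_sandwich[OF _ _ tendsto_const])
      show "\<forall>\<^sub>F k in sequentially. \<bar>b (m + n) k - b m k - b n k\<bar> \<le> C * fourth_root (m + n) * r ^ k"
      proof (intro always_eventually allI)
        fix k
        have "\<bar>b (m + n) k - b m k - b n k\<bar> = \<bar>a (2 ^ k * m + 2 ^ k * n) - a (2 ^ k * m) - a (2 ^ k * n)\<bar> / 2 ^ k"
          unfolding b_def by (simp add: distrib_left abs_divide flip: diff_divide_distrib)
        also have "\<dots> \<le> C * fourth_root (2 ^ k * m + 2 ^ k * n) / 2 ^ k"
          by (intro divide_right_mono C) simp
        also have "2 ^ k * m + 2 ^ k * n = 2 ^ k * (m + n)" by (simp add: algebra_simps)
        also have "C * fourth_root (2 ^ k * (m + n)) / 2 ^ k = C * fourth_root (m + n) * r ^ k"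
          unfolding fourth_root_mult fourth_root_power r_def power_divide by simp
        finally show "\<bar>b (m + n) k - b m k - b n k\<bar> \<le> C * fourth_root (m + n) * r ^ k" .
      qed
      have "(\<lambda>k. C * fourth_root (m + n) * r ^ k) \<longlonglongrightarrow> C * fourth_root (m + n) * 0"
        using r by (intro tendsto_mult tendsto_const LIMSEQ_power_zero) simp
      then show "(\<lambda>k. C * fourth_root (m + n) * r ^ k) \<longlonglongrightarrow> 0" by simp
    qed simp
    ultimately have "A (m + n) - A m - A n = 0" by (rule LIMSEQ_unique)
    then show ?thesis by simp
  qed
  have "A 0 = 0" using add[of 0 0] by simp
  have lin: "A n = A 1 * real n" for n
  proof (induction n)
    case (Suc n)
    then show ?case using add[of n 1] by (simp add: distrib_left)
  qed (use \<open>A 0 = 0\<close> in simp)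
  have "\<bar>a n - A 1 * real n\<bar> \<le> K * fourth_root n" for n
    using near[of n] unfolding lin[of n] by (simp add: abs_minus_commute)
  then show ?thesis by blast
qed

text \<open>The subtracted \<open>fourth_root M\<close> is what closes the induction. Doubling
  reproduces \<open>sqrt M\<close> exactly and leaves no room for an error, but it multiplies the
  subtracted term by \<open>sqrt 2\<close> where only \<open>fourth_root 2\<close> is required; the
  surplus pays for the cut and for an odd letter block.\<close>

lemma halving_recursion:
  fixes e :: "nat \<Rightarrow> real"
  assumes c: "0 \<le> c" and e1: "e 1 \<le> 0"
    and even: "\<And>m. 1 \<le> m \<Longrightarrow> e (2 * m) \<le> sqrt 2 * e m + c * fourth_root (2 * m)"
    and odd: "\<And>m. 1 \<le> m \<Longrightarrow> e (2 * m + 1) \<le> e (2 * m) + c * fourth_root (2 * m + 1)"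
    and M: "1 \<le> M"
  shows "e M \<le> 12 * c * (sqrt M - fourth_root M)"
  using M
proof (induction M rule: less_induct)
  case (less M)
  show ?case
  proof (cases "M = 1")
    case True
    then show ?thesis using e1 by (simp add: fourth_root_def)
  next
    case False
    define m where "m = M div 2"
    have m: "1 \<le> m" "m < M" "2 * m \<le> M" "M = 2 * m \<or> M = 2 * m + 1"
      using False less.prems by (auto simp: m_def)
    define h y z where "h = fourth_root 2" and "y = fourth_root M" and "z = fourth_root m"
    have z: "1 \<le> z" using m by (simp add: z_def fourth_root_ge_1)
    have h: "7 / 6 \<le> h" "h\<^sup>2 = sqrt 2" using fourth_root_2 fourth_root_sq[of 2] by (auto simp: h_def)
    have hy: "h * z \<le> y" using fourth_root_mono[OF m(3)] by (simp add: h_def z_def y_def fourth_root_mult)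
    have hz: "1 \<le> h * z" using mult_mono[of 1 h 1 z] h z by simp
    have "e M \<le> sqrt 2 * e m + 2 * (c * y)"
    proof -
      have "c * fourth_root (2 * m) \<le> c * y" unfolding y_def
        using c fourth_root_mono[OF m(3)] by (intro mult_left_mono)
      moreover have "0 \<le> c * y" using c by (simp add: y_def)
      ultimately show ?thesis using even[OF m(1)] odd[OF m(1)] m(4) by (auto simp: y_def)
    qed
    also have "\<dots> \<le> sqrt 2 * (12 * c * (z\<^sup>2 - z)) + 2 * (c * y)"
      using less.IH[OF m(2,1)] by (simp add: z_def fourth_root_sq)
    also have "\<dots> = c * (12 * h\<^sup>2 * (z\<^sup>2 - z) + 2 * y)" by (simp add: h(2) algebra_simps)
    also have "\<dots> \<le> c * (12 * (y\<^sup>2 - y))"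
    proof (rule mult_left_mono[OF _ c])
      \<comment> \<open>The first inequality reduces the claim from \<open>y\<close> to the smallest
        possible value \<open>h * z\<close>; the second one is the remaining case
        \<open>y = h * z\<close> and uses \<open>h \<ge> 7 / 6\<close>.\<close>
      have "0 \<le> (y - h * z) * (12 * (y + h * z) - 14)" using hy hz by (intro mult_nonneg_nonneg) auto
      moreover have "0 \<le> 2 * h * z * (6 * h - 7)" using h z by (intro mult_nonneg_nonneg) auto
      ultimately show "12 * h\<^sup>2 * (z\<^sup>2 - z) + 2 * y \<le> 12 * (y\<^sup>2 - y)"
        by (simp add: power2_eq_square algebra_simps)
    qed
    finally show ?thesis by (simp add: y_def fourth_root_sq mult_ac)
  qed
qed

lemma tendsto_div_ratio:
  assumes "0 < b"
  shows "(\<lambda>n. real (n div b) / real n) \<longlonglongrightarrow> 1 / real b"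
proof (rule tendsto_sandwich)
  have bound: "real n / real b - 1 \<le> real (n div b)" "real (n div b) \<le> real n / real b" for n
  proof -
    have "real n = real (b * (n div b) + n mod b)" by simp
    also have "\<dots> = real b * real (n div b) + real (n mod b)" by (simp only: of_nat_add of_nat_mult)
    finally have e: "real n = real b * real (n div b) + real (n mod b)" .
    have "real (n mod b) < real b" using assms by simp
    then show "real n / real b - 1 \<le> real (n div b)" "real (n div b) \<le> real n / real b"
      using assms e by (auto simp: field_simps)
  qed
  show "\<forall>\<^sub>F n in sequentially. 1 / real b - 1 / real n \<le> real (n div b) / real n"
  proof (rule eventually_mono[OF eventually_gt_at_top[of 0]])
    fix n :: nat assume "0 < n"
    then show "1 / real b - 1 / real n \<le> real (n div b) / real n"
      using divide_right_mono[OF bound(1)[of n], of "real n"] by (simp add: diff_divide_distrib)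
  qed
  show "\<forall>\<^sub>F n in sequentially. real (n div b) / real n \<le> 1 / real b"
  proof (rule eventually_mono[OF eventually_gt_at_top[of 0]])
    fix n :: nat assume "0 < n"
    then show "real (n div b) / real n \<le> 1 / real b"
      using divide_right_mono[OF bound(2)[of n], of "real n"] by simp
  qed
  have "(\<lambda>n. 1 / real b - 1 / real n) \<longlonglongrightarrow> 1 / real b - 0"
    by (intro tendsto_diff tendsto_const lim_1_over_n)
  then show "(\<lambda>n. 1 / real b - 1 / real n) \<longlonglongrightarrow> 1 / real b" by simp
qed simp

text \<open>The comparison is with \<open>exp (z n - 1)\<close> and avoids complex logarithms. Both
  numbers have norm at most 1, so their powers differ by at most \<open>k n\<close> times their
  distance. That distance is quadratic in \<open>z n - 1\<close>, which is of order
  \<open>1 / n\<close>.\<close>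

lemma power_tendsto_exp:
  fixes z :: "nat \<Rightarrow> complex" and k :: "nat \<Rightarrow> nat"
  assumes z: "\<And>n. cmod (z n) \<le> 1"
    and lim: "(\<lambda>n. real n * (z n - 1)) \<longlonglongrightarrow> L" and k: "(\<lambda>n. real (k n) / real n) \<longlonglongrightarrow> \<kappa>"
  shows "(\<lambda>n. z n ^ k n) \<longlonglongrightarrow> exp (\<kappa> * L)"
proof -
  have "(\<lambda>n. of_real (real (k n) / real n) * (real n * (z n - 1))) \<longlonglongrightarrow> of_real \<kappa> * L"
    by (intro tendsto_mult tendsto_of_real k lim)
  then have kz: "(\<lambda>n. of_nat (k n) * (z n - 1)) \<longlonglongrightarrow> of_real \<kappa> * L"
    by (rule Lim_transform_eventually) (rule eventually_mono[OF eventually_gt_at_top[of 0]], simp)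
  have "(\<lambda>n. (real n * (z n - 1)) * of_real (1 / real n)) \<longlonglongrightarrow> L * of_real 0"
    by (intro tendsto_mult lim tendsto_of_real lim_1_over_n)
  then have z0: "(\<lambda>n. z n - 1) \<longlonglongrightarrow> 0"
    unfolding of_real_0 mult_zero_right
    by (rule Lim_transform_eventually) (rule eventually_mono[OF eventually_gt_at_top[of 0]], simp)
  have ex: "(\<lambda>n. exp (z n - 1) ^ k n) \<longlonglongrightarrow> exp (of_real \<kappa> * L)"
    using tendsto_exp[OF kz] by (simp add: exp_of_nat_mult)
  have "(\<lambda>n. z n ^ k n - exp (z n - 1) ^ k n) \<longlonglongrightarrow> 0"
  proof (rule Lim_null_comparison)
    have "(\<lambda>n. exp 1 * (cmod (of_nat (k n) * (z n - 1)) * cmod (z n - 1))) \<longlonglongrightarrow> exp 1 * (cmod (of_real \<kappa> * L) * cmod 0)"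
      by (intro tendsto_mult tendsto_const tendsto_norm kz z0)
    then show "(\<lambda>n. exp 1 * (cmod (of_nat (k n) * (z n - 1)) * cmod (z n - 1))) \<longlonglongrightarrow> 0" by simp
    have "\<forall>\<^sub>F n in sequentially. cmod (z n - 1) < 1"
      using tendsto_norm[OF z0] by (auto dest: order_tendstoD(2)[where a=1])
    then show "\<forall>\<^sub>F n in sequentially. cmod (z n ^ k n - exp (z n - 1) ^ k n)
        \<le> exp 1 * (cmod (of_nat (k n) * (z n - 1)) * cmod (z n - 1))"
    proof eventually_elim
      case (elim n)
      define h where "h = z n - 1"
      have "Re (z n) \<le> 1" using complex_Re_le_cmod[of "z n"] z[of n] by simp
      then have "cmod (exp h) \<le> 1" by (simp add: h_def)
      then have "cmod (z n ^ k n - exp h ^ k n) \<le> real (k n) * cmod (z n - exp h)"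
        using z[of n] by (intro norm_power_diff)
      also have "real (k n) * cmod (z n - exp h) \<le> real (k n) * (exp 1 * cmod h ^ 2)"
      proof (rule mult_left_mono)
        have "cmod (exp h - (\<Sum>i\<le>1. h ^ i / fact i)) \<le> exp \<bar>Re h\<bar> * cmod h ^ Suc 1 / fact 1"
          by (rule Taylor_exp)
        moreover have "exp h - (\<Sum>i\<le>1. h ^ i / fact i) = exp h - z n"
        proof -
          have "z n = 1 + h" by (simp add: h_def)
          then show ?thesis by simp
        qed
        moreover have "exp \<bar>Re h\<bar> \<le> exp 1" using elim abs_Re_le_cmod[of h] by (simp add: h_def)
        ultimately show "cmod (z n - exp h) \<le> exp 1 * cmod h ^ 2"
          using mult_right_mono[of "exp \<bar>Re h\<bar>" "exp 1" "cmod h ^ 2"]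
          by (simp only: norm_minus_commute[of "z n"] power2_eq_square) (simp add: power2_eq_square)
      qed simp
      finally show ?case
        by (simp add: h_def norm_mult power2_eq_square mult_ac)
    qed
  qed
  from tendsto_add[OF this ex] show ?thesis by simp
qed

text \<open>After multiplication by \<open>n\<close>, the Taylor remainder of \<open>cis\<close>
  beyond the linear term is at most \<open>(t * f x) ^ 2\<close> uniformly in \<open>n\<close> and
  tends to \<open>- (t * f x) ^ 2 / 2\<close> pointwise, so dominated convergence works with a
  second moment. The linear term subtracted in \<open>s\<close> has mean zero.\<close>

lemma characteristic_second_order:
  assumes f: "sq_int M f" and mean: "measure_pmf.expectation M f = 0"
  shows "(\<lambda>n. real n * (measure_pmf.expectation M (\<lambda>x. cis (t / sqrt (real n) * f x)) - 1))
    \<longlonglongrightarrow> complex_of_real (- t\<^sup>2 * measure_pmf.variance M f / 2)"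
proof -
  define s where "s n x = complex_of_real (real n) * (cis (t / sqrt (real n) * f x) - 1 - \<i> * of_real (t / sqrt (real n) * f x))"
    for n x
  have sq: "real n * (t / sqrt (real n) * f x)\<^sup>2 = (t * f x)\<^sup>2" if "0 < n" for n x
    using that by (simp add: power_mult_distrib power_divide)
  have "(\<lambda>n. measure_pmf.expectation M (s n)) \<longlonglongrightarrow> measure_pmf.expectation M (\<lambda>x. complex_of_real (- (t * f x)\<^sup>2 / 2))"
  proof (rule integral_dominated_convergence[where w="\<lambda>x. (t * f x)\<^sup>2"])
    show "integrable (measure_pmf M) (\<lambda>x. (t * f x)\<^sup>2)"
      using sq_int_cmult[OF f, of t] by (simp add: sq_int_def)
    show "AE x in measure_pmf M. norm (s n x) \<le> (t * f x)\<^sup>2" for n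
    proof (rule AE_I2)
      fix x
      show "norm (s n x) \<le> (t * f x)\<^sup>2"
      proof (cases "n = 0")
        case False
        define y where "y = t / sqrt (real n) * f x"
        have "cmod (iexp y - (\<Sum>k\<le>1. (\<i> * y) ^ k / fact k)) \<le> \<bar>y\<bar> ^ Suc 1 / fact (Suc 1)"
          by (rule iexp_approx1)
        then have "cmod (cis y - 1 - \<i> * y) \<le> y\<^sup>2 / 2"
          by (simp add: cis_conv_exp algebra_simps power2_eq_square)
        from mult_left_mono[OF this, of "real n"] have "norm (s n x) \<le> real n * (y\<^sup>2 / 2)"
          unfolding s_def y_def[symmetric] norm_mult by simp
        also have "\<dots> \<le> (t * f x)\<^sup>2" using sq[of n x] False by (simp add: y_def)
        finally show ?thesis .
      qed (simp add: s_def)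
    qed
    show "AE x in measure_pmf M. (\<lambda>n. s n x) \<longlonglongrightarrow> complex_of_real (- (t * f x)\<^sup>2 / 2)"
    proof (rule AE_I2)
      fix x
      have "(\<lambda>n. s n x - complex_of_real (- (t * f x)\<^sup>2 / 2)) \<longlonglongrightarrow> 0"
      proof (rule Lim_null_comparison)
        have "(\<lambda>n. \<bar>t * f x\<bar> ^ 3 * inverse (sqrt (real n))) \<longlonglongrightarrow> \<bar>t * f x\<bar> ^ 3 * 0"
          by (intro tendsto_mult tendsto_const tendsto_inverse_0_at_top filterlim_compose[OF sqrt_at_top]
              filterlim_real_sequentially)
        then show "(\<lambda>n. \<bar>t * f x\<bar> ^ 3 * inverse (sqrt (real n))) \<longlonglongrightarrow> 0" by simp
        show "\<forall>\<^sub>F n in sequentially. norm (s n x - complex_of_real (- (t * f x)\<^sup>2 / 2))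
            \<le> \<bar>t * f x\<bar> ^ 3 * inverse (sqrt (real n))"
        proof (rule eventually_mono[OF eventually_gt_at_top[of 0]])
          fix n :: nat assume n: "0 < n"
          define y where "y = t / sqrt (real n) * f x"
          have "cmod (cis y - (\<Sum>k\<le>2. (\<i> * y) ^ k / fact k)) \<le> \<bar>y\<bar> ^ Suc 2 / fact (Suc 2)"
            unfolding cis_conv_exp by (rule iexp_approx1)
          moreover have "(\<Sum>k\<le>2. (\<i> * y) ^ k / fact k) = 1 + \<i> * y - y\<^sup>2 / 2"
            by (simp add: numeral_2_eq_2 power2_eq_square algebra_simps)
          moreover have "\<bar>y\<bar> ^ Suc 2 / fact (Suc 2) = \<bar>y\<bar> ^ 3 / 6"
            by (simp add: eval_nat_numeral)
          ultimately have "cmod (cis y - (1 + \<i> * y - y\<^sup>2 / 2)) \<le> \<bar>y\<bar> ^ 3 / 6" by metis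
          then have "cmod (cis y - 1 - \<i> * y + y\<^sup>2 / 2) \<le> \<bar>y\<bar> ^ 3 / 6" by (simp add: algebra_simps)
          moreover have "s n x - complex_of_real (- (t * f x)\<^sup>2 / 2) = real n * (cis y - 1 - \<i> * y + y\<^sup>2 / 2)"
            unfolding s_def sq[OF n, symmetric] y_def by (simp add: algebra_simps)
          ultimately have "norm (s n x - complex_of_real (- (t * f x)\<^sup>2 / 2)) = real n * cmod (cis y - 1 - \<i> * y + y\<^sup>2 / 2)"
            by (simp only: norm_mult norm_of_real abs_of_nat)
          moreover have "real n * cmod (cis y - 1 - \<i> * y + y\<^sup>2 / 2) \<le> real n * (\<bar>y\<bar> ^ 3 / 6)"
            by (rule mult_left_mono) (fact, simp)
          moreover have "real n * (\<bar>y\<bar> ^ 3 / 6) = real n * y\<^sup>2 * \<bar>y\<bar> / 6"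
            by (simp add: power3_eq_cube power2_eq_square abs_mult)
          moreover have "real n * y\<^sup>2 * \<bar>y\<bar> = \<bar>t * f x\<bar> ^ 3 * inverse (sqrt (real n))"
            using sq[OF n, of x] by (simp add: y_def power3_eq_cube power2_eq_square abs_mult field_simps)
          moreover have "0 \<le> \<bar>t * f x\<bar> ^ 3 * inverse (sqrt (real n))" by simp
          ultimately show "norm (s n x - complex_of_real (- (t * f x)\<^sup>2 / 2)) \<le> \<bar>t * f x\<bar> ^ 3 * inverse (sqrt (real n))"
            by linarith
        qed
      qed
      then show "(\<lambda>n. s n x) \<longlonglongrightarrow> complex_of_real (- (t * f x)\<^sup>2 / 2)" by (rule LIM_zero_cancel)
    qed
  qed auto
  moreover have "measure_pmf.expectation M (s n)
      = real n * (measure_pmf.expectation M (\<lambda>x. cis (t / sqrt (real n) * f x)) - 1)" for n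
  proof -
    have i: "integrable (measure_pmf M) (\<lambda>x. complex_of_real (f x))" using sq_int_integrable[OF f] by simp
    have lin: "measure_pmf.expectation M (\<lambda>x. a * g x - a - k * h x)
        = a * measure_pmf.expectation M g - a - k * measure_pmf.expectation M h"
      if "integrable (measure_pmf M) g" "integrable (measure_pmf M) h" for a k :: complex and g h
      using that by simp
    have "s n = (\<lambda>x. real n * cis (t / sqrt (real n) * f x) - real n - (real n * \<i> * (t / sqrt (real n))) * f x)"
      by (simp add: s_def fun_eq_iff algebra_simps)
    then have "measure_pmf.expectation M (s n) = real n * measure_pmf.expectation M (\<lambda>x. cis (t / sqrt (real n) * f x))
       - real n - (real n * \<i> * (t / sqrt (real n))) * measure_pmf.expectation M (\<lambda>x. complex_of_real (f x))"
      using lin[OF integrable_cis[of M "\<lambda>x. t / sqrt (real n) * f x"] i] by (simp only:)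
    then show ?thesis using mean by (simp add: algebra_simps)
  qed
  moreover have "measure_pmf.expectation M (\<lambda>x. complex_of_real (- (t * f x)\<^sup>2 / 2))
      = complex_of_real (- t\<^sup>2 * measure_pmf.variance M f / 2)"
    unfolding integral_complex_of_real by (simp add: mean power_mult_distrib)
  ultimately show ?thesis by simp
qed

section \<open>The central limit theorem for almost additive functionals\<close>

lemma sd_uminus: "sd M (\<lambda>x. - 1 * f x) = sd M f"
proof -
  have e: "measure_pmf.expectation M (\<lambda>x. - 1 * f x) = - measure_pmf.expectation M f" by simp
  have "(- 1 * f x - - measure_pmf.expectation M f)\<^sup>2 = (f x - measure_pmf.expectation M f)\<^sup>2" for x
    by (simp add: power2_eq_square algebra_simps)
  then show ?thesis unfolding sd_def e by (simp only:)
qed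

lemma l2_cmult: "l2 M (\<lambda>x. c * f x) = \<bar>c\<bar> * l2 M f"
  by (simp add: l2_def power_mult_distrib real_sqrt_mult)

text \<open>The bound by sum plus length admits the gain, which is bounded by the length, as well as
  the walk, and it implies square integrability under \<open>W n\<close> from the second moment of
  the offspring law.\<close>

definition linear_growth :: "(nat list \<Rightarrow> real) \<Rightarrow> bool" where
  "linear_growth Y \<longleftrightarrow> (\<exists>C. \<forall>w. \<bar>Y w\<bar> \<le> C * (real (sum_list w) + real (length w)))"

lemma linear_growth_combination:
  assumes "linear_growth Y" "linear_growth Z"
  shows "linear_growth (\<lambda>w. a * Y w + b * Z w)"
proof -
  obtain C D where C: "\<And>w. \<bar>Y w\<bar> \<le> C * (real (sum_list w) + real (length w))"
    and D: "\<And>w. \<bar>Z w\<bar> \<le> D * (real (sum_list w) + real (length w))"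
    using assms unfolding linear_growth_def by blast
  have "\<bar>a * Y w + b * Z w\<bar> \<le> (\<bar>a\<bar> * C + \<bar>b\<bar> * D) * (real (sum_list w) + real (length w))" for w
  proof -
    have "\<bar>a * Y w + b * Z w\<bar> \<le> \<bar>a\<bar> * \<bar>Y w\<bar> + \<bar>b\<bar> * \<bar>Z w\<bar>"
      by (rule order_trans[OF abs_triangle_ineq]) (simp add: abs_mult)
    also have "\<dots> \<le> \<bar>a\<bar> * (C * (real (sum_list w) + real (length w))) + \<bar>b\<bar> * (D * (real (sum_list w) + real (length w)))"
      by (intro add_mono mult_left_mono C D) auto
    finally show ?thesis by (simp add: algebra_simps)
  qed
  then show ?thesis unfolding linear_growth_def by blast
qed

text \<open>A class closed under linear combinations. It contains the gain and the walk, so their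
  joint limit can be read off from the limits of the combinations.\<close>

definition almost_additive :: "(nat list \<Rightarrow> real) \<Rightarrow> bool" where
  "almost_additive Y \<longleftrightarrow> linear_growth Y \<and>
    (\<exists>C. \<forall>x y. \<bar>Y (x @ y) - Y x - Y y\<bar> \<le> C * fourth_root (length x + length y))"

lemma almost_additive_combination:
  assumes "almost_additive Y" "almost_additive Z"
  shows "almost_additive (\<lambda>w. a * Y w + b * Z w)"
proof -
  obtain C D where C: "\<And>x y. \<bar>Y (x @ y) - Y x - Y y\<bar> \<le> C * fourth_root (length x + length y)"
    and D: "\<And>x y. \<bar>Z (x @ y) - Z x - Z y\<bar> \<le> D * fourth_root (length x + length y)"
    using assms unfolding almost_additive_def by blast
  have "\<bar>(a * Y (x @ y) + b * Z (x @ y)) - (a * Y x + b * Z x) - (a * Y y + b * Z y)\<bar>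
    \<le> (\<bar>a\<bar> * C + \<bar>b\<bar> * D) * fourth_root (length x + length y)" (is "?l \<le> ?r") for x y
  proof -
    have "?l = \<bar>a * (Y (x @ y) - Y x - Y y) + b * (Z (x @ y) - Z x - Z y)\<bar>" by (simp add: algebra_simps)
    also have "\<dots> \<le> \<bar>a\<bar> * \<bar>Y (x @ y) - Y x - Y y\<bar> + \<bar>b\<bar> * \<bar>Z (x @ y) - Z x - Z y\<bar>"
      by (rule order_trans[OF abs_triangle_ineq]) (simp add: abs_mult)
    also have "\<dots> \<le> \<bar>a\<bar> * (C * fourth_root (length x + length y)) + \<bar>b\<bar> * (D * fourth_root (length x + length y))"
      by (intro add_mono mult_left_mono C D) auto
    finally show ?thesis by (simp add: algebra_simps)
  qed
  then show ?thesis
    using assms linear_growth_combination unfolding almost_additive_def by blast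
qed

section \<open>Decomposition of words into independent blocks\<close>

definition block_sum :: "nat \<Rightarrow> (nat list \<Rightarrow> real) \<Rightarrow> nat \<Rightarrow> nat list \<Rightarrow> real" where
  "block_sum b Y M w = (\<Sum>j<M. Y (take b (drop (j * b) w)))"

lemma block_sum_append:
  assumes "length x = M * b" "length y = N * b"
  shows "block_sum b Y (M + N) (x @ y) = block_sum b Y M x + block_sum b Y N y"
proof -
  have split: "(\<Sum>j<M + N. f j) = (\<Sum>j<M. f j) + (\<Sum>j<N. f (M + j))" for f :: "nat \<Rightarrow> real"
    by (induction N) auto
  have "take b (drop (j * b) (x @ y)) = take b (drop (j * b) x)" if "j < M" for j
  proof -
    have "j * b + b \<le> M * b" using mult_le_mono1[of "Suc j" M b] that by simp
    then show ?thesis using assms by simp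
  qed
  moreover have "take b (drop ((M + j) * b) (x @ y)) = take b (drop (j * b) y)" for j
    using assms by (simp add: add_mult_distrib)
  ultimately show ?thesis unfolding block_sum_def split by (simp del: take_append drop_append)
qed

lemma block_sum_1: "length w = b \<Longrightarrow> block_sum b Y 1 w = Y w"
  by (simp add: block_sum_def)

lemma linear_growth_block_sum:
  assumes "linear_growth Y"
  shows "linear_growth (block_sum b Y M)"
proof -
  obtain C where C: "\<And>w. \<bar>Y w\<bar> \<le> C * (real (sum_list w) + real (length w))"
    using assms unfolding linear_growth_def by blast
  have C0: "0 \<le> C" using order_trans[OF abs_ge_zero C[of "[0]"]] by simp
  have "\<bar>block_sum b Y M w\<bar> \<le> (real M * C) * (real (sum_list w) + real (length w))" for w
  proof -
    have part: "sum_list (take b (drop k w)) \<le> sum_list w" for k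
    proof -
      have "sum_list w = sum_list (take k w) + (sum_list (take b (drop k w)) + sum_list (drop b (drop k w)))"
        by (metis append_take_drop_id sum_list_append)
      then show ?thesis by simp
    qed
    have "\<bar>block_sum b Y M w\<bar> \<le> (\<Sum>j<M. \<bar>Y (take b (drop (j * b) w))\<bar>)"
      unfolding block_sum_def by (rule sum_abs)
    also have "\<dots> \<le> (\<Sum>j<M. C * (real (sum_list w) + real (length w)))"
    proof (rule sum_mono)
      fix j
      show "\<bar>Y (take b (drop (j * b) w))\<bar> \<le> C * (real (sum_list w) + real (length w))"
        using part[of "j * b"] C0
        by (intro order_trans[OF C] mult_left_mono add_mono) auto
    qed
    finally show ?thesis by simp
  qed
  then show ?thesis unfolding linear_growth_def by blast
qed

locale offspring_pmf =
  fixes p :: "nat pmf"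
  assumes second_moment: "integrable (measure_pmf p) (\<lambda>k. (real k)\<^sup>2)"
begin

abbreviation W :: "nat \<Rightarrow> nat list pmf" where
  "W n \<equiv> replicate_pmf n p"

abbreviation E :: "nat \<Rightarrow> (nat list \<Rightarrow> real) \<Rightarrow> real" where
  "E n f \<equiv> measure_pmf.expectation (W n) f"

lemma sq_int_size: "sq_int (W n) (\<lambda>w. real (sum_list w) + real (length w))"
proof (induction n)
  case 0
  show ?case unfolding sq_int_def by (rule integrable_pmf_bounded[of _ _ 0]) simp
next
  case (Suc n)
  have "sq_int p (\<lambda>d. real d + 1)" using second_moment by (intro sq_int_add) (auto simp: sq_int_def)
  from sq_int_add[OF sq_int_pair(1)[OF this] sq_int_pair(2)[OF Suc]]
  show ?case unfolding replicate_pmf_Suc sq_int_map by (simp add: algebra_simps)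
qed

lemma sq_int_linear_growth:
  assumes "linear_growth Y"
  shows "sq_int (W n) Y"
proof -
  obtain C where C: "\<And>w. \<bar>Y w\<bar> \<le> C * (real (sum_list w) + real (length w))"
    using assms unfolding linear_growth_def by blast
  show ?thesis
    by (rule sq_int_bound[OF sq_int_cmult[OF sq_int_size, of n C]])
      (meson C abs_ge_self order_trans)
qed

lemma expectation_append:
  fixes f :: "nat list \<Rightarrow> 'c :: {banach, second_countable_topology}"
  shows "measure_pmf.expectation (W (m + n)) f
    = measure_pmf.expectation (pair_pmf (W m) (W n)) (\<lambda>z. f (fst z @ snd z))"
  by (simp add: replicate_pmf_add)

text \<open>The two pieces of the word are independent, so the variances of \<open>u\<close> and
  \<open>v\<close> add, and a perturbation bounded by \<open>c\<close> moves the standard deviation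
  by at most \<open>c\<close>.\<close>

lemma sd_append:
  assumes f: "sq_int (W (m + n)) f" and u: "sq_int (W m) u" and v: "sq_int (W n) v" and c: "0 \<le> c"
    and bound: "\<And>x y. length x = m \<Longrightarrow> length y = n \<Longrightarrow> \<bar>f (x @ y) - (u x + v y)\<bar> \<le> c"
  shows "\<bar>sd (W (m + n)) f - sqrt ((sd (W m) u)\<^sup>2 + (sd (W n) v)\<^sup>2)\<bar> \<le> c"
proof -
  let ?P = "pair_pmf (W m) (W n)"
  have "sd (W (m + n)) f = sd ?P (\<lambda>z. f (fst z @ snd z))" unfolding sd_def expectation_append ..
  moreover have "sd ?P (\<lambda>z. u (fst z) + v (snd z)) = sqrt ((sd (W m) u)\<^sup>2 + (sd (W n) v)\<^sup>2)"
    unfolding sd_sq by (simp add: sd_def variance_pair[OF u v])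
  moreover have "\<bar>sd ?P (\<lambda>z. f (fst z @ snd z)) - sd ?P (\<lambda>z. u (fst z) + v (snd z))\<bar> \<le> c"
  proof (rule sd_diff_le[OF _ _ c])
    show "sq_int ?P (\<lambda>z. f (fst z @ snd z))" using f unfolding replicate_pmf_add sq_int_map .
    show "sq_int ?P (\<lambda>z. u (fst z) + v (snd z))" by (intro sq_int_add sq_int_pair u v)
    fix z assume "z \<in> set_pmf ?P"
    then show "\<bar>f (fst z @ snd z) - (u (fst z) + v (snd z))\<bar> \<le> c"
      by (intro bound) (auto dest: length_replicate_pmf)
  qed
  ultimately show ?thesis by simp
qed

lemma block_sum_law:
  assumes Y: "linear_growth Y"
  shows "measure_pmf.expectation (W (M * b)) (block_sum b Y M) = M * E b Y"
    and "measure_pmf.variance (W (M * b)) (block_sum b Y M) = M * measure_pmf.variance (W b) Y"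
    and "measure_pmf.expectation (W (M * b)) (\<lambda>w. cis (\<theta> * block_sum b Y M w))
      = measure_pmf.expectation (W b) (\<lambda>w. cis (\<theta> * Y w)) ^ M"
proof -
  have "measure_pmf.expectation (W (M * b)) (block_sum b Y M) = M * E b Y
    \<and> measure_pmf.variance (W (M * b)) (block_sum b Y M) = M * measure_pmf.variance (W b) Y
    \<and> measure_pmf.expectation (W (M * b)) (\<lambda>w. cis (\<theta> * block_sum b Y M w))
      = measure_pmf.expectation (W b) (\<lambda>w. cis (\<theta> * Y w)) ^ M"
  proof (induction M)
    case 0
    have "block_sum b Y 0 = (\<lambda>w. 0)" by (simp add: block_sum_def fun_eq_iff)
    then show ?case by simp
  next
    case (Suc M)
    have IH1: "E (M * b) (block_sum b Y M) = M * E b Y" using Suc by blast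
    have IH2: "E (M * b) (\<lambda>x. (block_sum b Y M x - M * E b Y)\<^sup>2) = M * measure_pmf.variance (W b) Y"
      using Suc unfolding IH1 by blast
    let ?P = "pair_pmf (W b) (W (M * b))"
    have sq: "sq_int (W b) Y" "sq_int (W (M * b)) (block_sum b Y M)"
      by (intro sq_int_linear_growth linear_growth_block_sum Y)+
    have SM: "Suc M * b = b + M * b" by simp
    have split: "block_sum b Y (Suc M) (fst z @ snd z) = Y (fst z) + block_sum b Y M (snd z)"
      if "z \<in> set_pmf ?P" for z
    proof -
      have len: "length (fst z) = b" "length (snd z) = M * b" using that by (auto dest: length_replicate_pmf)
      have "block_sum b Y (1 + M) (fst z @ snd z) = block_sum b Y 1 (fst z) + block_sum b Y M (snd z)"
        by (rule block_sum_append) (use len in auto)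
      then show ?thesis using block_sum_1[OF len(1)] by simp
    qed
    have cong: "measure_pmf.expectation ?P (\<lambda>z. g (block_sum b Y (Suc M) (fst z @ snd z)))
        = measure_pmf.expectation ?P (\<lambda>z. g (Y (fst z) + block_sum b Y M (snd z)))"
      for g :: "real \<Rightarrow> 'c :: {banach, second_countable_topology}"
      by (rule integral_cong_AE) (auto simp: AE_measure_pmf_iff split simp del: set_pair_pmf)
    have e: "measure_pmf.expectation (W (Suc M * b)) (block_sum b Y (Suc M))
        = measure_pmf.expectation ?P (\<lambda>z. Y (fst z) + block_sum b Y M (snd z))"
      unfolding SM expectation_append using cong[of "\<lambda>x. x"] by simp
    have "measure_pmf.expectation (W (Suc M * b)) (block_sum b Y (Suc M)) = Suc M * E b Y"
      unfolding e using sq_int_integrable[OF sq_int_pair(1)[OF sq(1), of "W (M * b)"]]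
        sq_int_integrable[OF sq_int_pair(2)[OF sq(2), of "W b"]] IH1
      by (simp add: algebra_simps)
    moreover have "measure_pmf.variance (W (Suc M * b)) (block_sum b Y (Suc M)) = Suc M * measure_pmf.variance (W b) Y"
      unfolding e unfolding SM expectation_append
      using cong[of "\<lambda>x. (x - measure_pmf.expectation ?P (\<lambda>z. Y (fst z) + block_sum b Y M (snd z)))\<^sup>2"]
        variance_pair[OF sq] IH1 IH2 by (simp add: algebra_simps)
    moreover have "measure_pmf.expectation (W (Suc M * b)) (\<lambda>w. cis (\<theta> * block_sum b Y (Suc M) w))
      = measure_pmf.expectation (W b) (\<lambda>w. cis (\<theta> * Y w)) ^ Suc M"
      unfolding SM expectation_append using cong[of "\<lambda>x. cis (\<theta> * x)"] Suc
        expectation_pair_pmf_mult[OF integrable_cis[of "W b" "\<lambda>w. \<theta> * Y w"] integrable_cis[of "W (M * b)" "\<lambda>w. \<theta> * block_sum b Y M w"]]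
      by (simp add: distrib_left flip: cis_mult)
    ultimately show ?case by blast
  qed
  then show "measure_pmf.expectation (W (M * b)) (block_sum b Y M) = M * E b Y"
    "measure_pmf.variance (W (M * b)) (block_sum b Y M) = M * measure_pmf.variance (W b) Y"
    "measure_pmf.expectation (W (M * b)) (\<lambda>w. cis (\<theta> * block_sum b Y M w))
      = measure_pmf.expectation (W b) (\<lambda>w. cis (\<theta> * Y w)) ^ M" by auto
qed

lemma mean_almost_additive:
  assumes "almost_additive Y"
  shows "\<exists>\<mu> K. \<forall>n. \<bar>E n Y - \<mu> * real n\<bar> \<le> K * fourth_root n"
proof -
  have Y: "linear_growth Y" using assms by (simp add: almost_additive_def)
  obtain C where C: "\<And>x y. \<bar>Y (x @ y) - Y x - Y y\<bar> \<le> C * fourth_root (length x + length y)"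
    using assms by (auto simp: almost_additive_def)
  show ?thesis
  proof (rule almost_additive_linear[of _ C])
    fix m n
    let ?P = "pair_pmf (W m) (W n)"
    have i: "integrable ?P (\<lambda>z. Y (fst z @ snd z))"
      using sq_int_integrable[OF sq_int_linear_growth[OF Y, of "m + n"]]
      unfolding replicate_pmf_add integrable_map_pmf_eq .
    have i': "integrable ?P (\<lambda>z. Y (fst z))" "integrable ?P (\<lambda>z. Y (snd z))"
      using sq_int_integrable[OF sq_int_pair(1)[OF sq_int_linear_growth[OF Y]]]
        sq_int_integrable[OF sq_int_pair(2)[OF sq_int_linear_growth[OF Y]]] by auto
    have "E (m + n) Y - E m Y - E n Y = measure_pmf.expectation ?P (\<lambda>z. Y (fst z @ snd z) - Y (fst z) - Y (snd z))"
      unfolding expectation_append using i i' by simp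
    also have "\<bar>\<dots>\<bar> \<le> measure_pmf.expectation ?P (\<lambda>z. \<bar>Y (fst z @ snd z) - Y (fst z) - Y (snd z)\<bar>)"
      by (rule integral_abs_bound)
    also have "\<dots> \<le> measure_pmf.expectation ?P (\<lambda>z. C * fourth_root (m + n))"
    proof (rule integral_mono_AE)
      show "AE z in ?P. \<bar>Y (fst z @ snd z) - Y (fst z) - Y (snd z)\<bar> \<le> C * fourth_root (m + n)"
      proof (rule AE_pmfI)
        fix z assume "z \<in> set_pmf ?P"
        then have "length (fst z) = m" "length (snd z) = n" by (auto dest: length_replicate_pmf)
        then show "\<bar>Y (fst z @ snd z) - Y (fst z) - Y (snd z)\<bar> \<le> C * fourth_root (m + n)"
          using C[of "fst z" "snd z"] by simp
      qed
    qed (use i i' in auto)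
    finally show "\<bar>E (m + n) Y - E m Y - E n Y\<bar> \<le> C * fourth_root (m + n)" by simp
  qed
qed

context
  fixes Y :: "nat list \<Rightarrow> real" and C :: real
  assumes Y: "linear_growth Y"
    and C: "\<And>x y. \<bar>Y (x @ y) - Y x - Y y\<bar> \<le> C * fourth_root (length x + length y)"
begin

definition block_error :: "nat \<Rightarrow> nat \<Rightarrow> nat list \<Rightarrow> real" where
  "block_error b M w = Y w - block_sum b Y M w"

lemma C_nonneg: "0 \<le> C"
  using order_trans[OF abs_ge_zero C[of "[0]" "[]"]] by (simp add: fourth_root_def)

lemma linear_growth_block_error: "linear_growth (block_error b M)"
  using linear_growth_combination[OF Y linear_growth_block_sum[OF Y], of 1 "- 1" b M]
  by (simp add: block_error_def[abs_def])

lemma block_error_append: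
  assumes "length x = M * b" "length y = N * b"
  shows "\<bar>block_error b (M + N) (x @ y) - (block_error b M x + block_error b N y)\<bar>
    \<le> C * fourth_root b * fourth_root (M + N)"
proof -
  have "block_error b (M + N) (x @ y) - (block_error b M x + block_error b N y) = Y (x @ y) - Y x - Y y"
    by (simp add: block_error_def block_sum_append[OF assms])
  moreover have "fourth_root (length x + length y) = fourth_root b * fourth_root (M + N)"
    unfolding fourth_root_mult[symmetric] using assms by (simp add: algebra_simps)
  ultimately show ?thesis using C[of x y] by (simp add: mult.assoc)
qed

text \<open>
  Halving: at each scale the errors made at the cuts are independent, so that the standard
  deviation only grows like the square root of the number of blocks.
\<close>
lemma sd_block_error:
  assumes "1 \<le> M"
  shows "sd (W (M * b)) (block_error b M) \<le> 12 * (C * fourth_root b) * sqrt M"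
proof -
  define e where "e M = sd (W (M * b)) (block_error b M)" for M
  have sq: "sq_int (W n) (block_error b M)" for n M
    by (rule sq_int_linear_growth[OF linear_growth_block_error])
  have cb: "0 \<le> C * fourth_root b" using C_nonneg by simp
  have step: "\<bar>e (M + N) - sqrt ((e M)\<^sup>2 + (e N)\<^sup>2)\<bar> \<le> C * fourth_root b * fourth_root (M + N)" for M N
    unfolding e_def add_mult_distrib
    by (rule sd_append[OF sq sq sq]) (use cb block_error_append in auto)
  \<comment> \<open>A single block has no cut and hence no error, so that appending one block to an
    even number costs only the price of one cut.\<close>
  have e1: "e 1 = 0"
  proof -
    have "l2 (W (1 * b)) (block_error b 1) \<le> 0"
    proof (rule l2_bound)
      fix w assume "w \<in> set_pmf (W (1 * b))"
      then have "block_sum b Y 1 w = Y w" by (intro block_sum_1) (auto dest: length_replicate_pmf)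
      then show "\<bar>block_error b 1 w\<bar> \<le> 0" by (simp add: block_error_def)
    qed simp
    then show ?thesis using sd_le_l2[OF sq, of "1 * b" 1] sd_nonneg[of "W (1 * b)" "block_error b 1"]
      unfolding e_def by linarith
  qed
  have e0: "0 \<le> e M" for M by (simp add: e_def)
  have "e M \<le> 12 * (C * fourth_root b) * (sqrt M - fourth_root M)"
  proof (rule halving_recursion[OF cb _ _ _ assms])
    show "e 1 \<le> 0" using e1 by simp
    fix m :: nat
    have "sqrt ((e m)\<^sup>2 + (e m)\<^sup>2) = sqrt (2 * (e m)\<^sup>2)" by (simp only: mult_2)
    also have "\<dots> = sqrt 2 * e m" using e0[of m] by (simp add: real_sqrt_mult)
    finally have "\<bar>e (m + m) - sqrt 2 * e m\<bar> \<le> C * fourth_root b * fourth_root (m + m)"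
      using step[of m m] by (simp only:)
    then show "e (2 * m) \<le> sqrt 2 * e m + C * fourth_root b * fourth_root (2 * m)"
      unfolding mult_2[of m] by linarith
    show "e (2 * m + 1) \<le> e (2 * m) + C * fourth_root b * fourth_root (2 * m + 1)"
      using step[of "2 * m" 1] e1 e0[of "2 * m"] by simp
  qed
  also have "\<dots> \<le> 12 * (C * fourth_root b) * sqrt M"
    using cb by (intro mult_left_mono) auto
  finally show ?thesis by (simp add: e_def)
qed

text \<open>A bound for the incomplete last block that does not depend on \<open>n\<close>; the sum
  over all possible lengths is a convenient substitute for the maximum.\<close>

definition remainder_sd :: "nat \<Rightarrow> real" where
  "remainder_sd b = (\<Sum>r<b. sd (W r) Y)"

lemma sd_remainder: "sd (W (n mod b)) Y \<le> remainder_sd b" if "0 < b"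
  unfolding remainder_sd_def using that by (intro member_le_sum) auto

lemma sd_word_minus_blocks:
  assumes b: "0 < b" "b \<le> n"
  shows "sd (pair_pmf (W (n div b * b)) (W (n mod b))) (\<lambda>z. Y (fst z @ snd z) - block_sum b Y (n div b) (fst z))
    \<le> 12 * (C * fourth_root b) * sqrt (n div b) + remainder_sd b + C * fourth_root n"
proof -
  let ?M = "n div b" and ?P = "pair_pmf (W (n div b * b)) (W (n mod b))"
  have M: "1 \<le> ?M" using b by (simp add: Suc_le_eq div_greater_zero_iff)
  have n: "?M * b + n mod b = n" by simp
  have sq: "sq_int (W k) Y" "sq_int (W k) (block_error b ?M)" "sq_int (W k) (block_sum b Y ?M)" for k
    by (intro sq_int_linear_growth Y linear_growth_block_error linear_growth_block_sum)+
  have cn: "0 \<le> C * fourth_root n" using C_nonneg by simp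
  have "sq_int ?P (\<lambda>z. Y (fst z @ snd z))"
    using sq(1)[of "?M * b + n mod b"] unfolding replicate_pmf_add sq_int_map .
  then have sqH: "sq_int ?P (\<lambda>z. Y (fst z @ snd z) - block_sum b Y ?M (fst z))"
    by (intro sq_int_diff sq_int_pair sq)
  have bound: "\<bar>(Y (fst z @ snd z) - block_sum b Y ?M (fst z)) - (block_error b ?M (fst z) + Y (snd z))\<bar> \<le> C * fourth_root n"
    if "z \<in> set_pmf ?P" for z
  proof -
    have "length (fst z) + length (snd z) = n" using that n by (auto dest!: length_replicate_pmf)
    then show ?thesis using C[of "fst z" "snd z"] by (simp add: block_error_def)
  qed
  have "\<bar>sd ?P (\<lambda>z. Y (fst z @ snd z) - block_sum b Y ?M (fst z)) - sd ?P (\<lambda>z. block_error b ?M (fst z) + Y (snd z))\<bar> \<le> C * fourth_root n"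
    by (rule sd_diff_le[OF sqH _ cn bound]) (auto intro!: sq_int_add sq_int_pair sq)
  moreover have "sd ?P (\<lambda>z. block_error b ?M (fst z) + Y (snd z)) \<le> sd (W (?M * b)) (block_error b ?M) + sd (W (n mod b)) Y"
  proof (rule order_trans[OF sd_triangle[OF sq_int_pair(1)[OF sq(2)] sq_int_pair(2)[OF sq(1)]]])
    show "sd ?P (\<lambda>z. block_error b ?M (fst z)) + sd ?P (\<lambda>z. Y (snd z)) \<le> sd (W (?M * b)) (block_error b ?M) + sd (W (n mod b)) Y"
      unfolding sd_def
      using expectation_pair_pmf_fst[of "W (?M * b)" "W (n mod b)" "\<lambda>x. (block_error b ?M x - E (?M * b) (block_error b ?M))\<^sup>2"]
        expectation_pair_pmf_snd[of "W (?M * b)" "W (n mod b)" "\<lambda>x. (Y x - E (n mod b) Y)\<^sup>2"]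
      by simp
  qed
  ultimately show ?thesis using sd_block_error[OF M, of b] sd_remainder[OF b(1), of n] by simp
qed

text \<open>The distance between the functional and its block sum on the scale
  \<open>sqrt n\<close>. For \<open>n\<close> to infinity it tends to
  \<open>12 * C / fourth_root b\<close>, which vanishes as \<open>b\<close> grows: the errors of the
  about \<open>n / b\<close> cuts add up in quadratic mean only.\<close>

definition asym_error :: "nat \<Rightarrow> nat \<Rightarrow> real" where
  "asym_error b n = 12 * (C * fourth_root b) * sqrt (real (n div b) / real n)
     + remainder_sd b / sqrt n + C * (fourth_root n / sqrt n)"

lemma asym_error_eq:
  "asym_error b n = (12 * (C * fourth_root b) * sqrt (n div b) + remainder_sd b + C * fourth_root n) / sqrt n"
  by (simp add: asym_error_def real_sqrt_divide add_divide_distrib)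

lemma asym_error_tendsto:
  assumes "0 < b"
  shows "asym_error b \<longlonglongrightarrow> 12 * C / fourth_root b"
proof -
  have "(\<lambda>n. remainder_sd b / sqrt (real n)) \<longlonglongrightarrow> 0"
    by (rule real_tendsto_divide_at_top[OF tendsto_const])
      (intro filterlim_compose[OF sqrt_at_top] filterlim_real_sequentially)
  then have "asym_error b \<longlonglongrightarrow> 12 * (C * fourth_root b) * sqrt (1 / real b) + 0 + C * 0"
    unfolding asym_error_def
    by (intro tendsto_add tendsto_mult tendsto_const tendsto_real_sqrt tendsto_div_ratio assms fourth_root_div_sqrt_tendsto)
  moreover have "fourth_root b * sqrt (1 / real b) = 1 / fourth_root b"
    using fourth_root_sq[of b] fourth_root_ge_1[of b] assms
    by (simp add: real_sqrt_divide field_simps power2_eq_square)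
  ultimately show ?thesis by (simp add: mult.assoc)
qed

lemma sd_asym:
  assumes b: "0 < b" "b \<le> n"
  shows "\<bar>sd (W n) Y / sqrt n - sd (W b) Y * sqrt (real (n div b) / real n)\<bar> \<le> asym_error b n"
proof -
  let ?M = "n div b" and ?P = "pair_pmf (W (n div b * b)) (W (n mod b))"
  have n0: "0 < n" using b by simp
  have n: "?M * b + n mod b = n" by simp
  have sq: "sq_int (W k) Y" "sq_int (W k) (block_sum b Y ?M)" for k
    by (intro sq_int_linear_growth Y linear_growth_block_sum)+
  have sq1: "sq_int ?P (\<lambda>z. Y (fst z @ snd z))"
    using sq(1)[of "?M * b + n mod b"] unfolding replicate_pmf_add sq_int_map .
  have sq2: "sq_int ?P (\<lambda>z. block_sum b Y ?M (fst z))" by (intro sq_int_pair sq)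
  have 1: "sd (W n) Y = sd ?P (\<lambda>z. Y (fst z @ snd z))"
    unfolding sd_def using expectation_append[of "?M * b" "n mod b" Y]
      expectation_append[of "?M * b" "n mod b" "\<lambda>w. (Y w - E n Y)\<^sup>2"] by simp
  have v: "measure_pmf.variance ?P (\<lambda>z. block_sum b Y ?M (fst z)) = measure_pmf.variance (W (?M * b)) (block_sum b Y ?M)"
    using expectation_pair_pmf_fst[of "W (?M * b)" "W (n mod b)" "\<lambda>x. (block_sum b Y ?M x - E (?M * b) (block_sum b Y ?M))\<^sup>2"]
    by simp
  have 2: "sd ?P (\<lambda>z. block_sum b Y ?M (fst z)) = sd (W b) Y * sqrt ?M"
    unfolding sd_def v block_sum_law(2)[OF Y] real_sqrt_mult by (rule mult.commute)
  let ?H = "\<lambda>z. Y (fst z @ snd z) - block_sum b Y ?M (fst z)"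
  have "sd ?P (\<lambda>z. Y (fst z @ snd z)) \<le> sd ?P ?H + sd ?P (\<lambda>z. block_sum b Y ?M (fst z))"
    using sd_triangle[OF sq_int_diff[OF sq1 sq2] sq2] by simp
  moreover have "sd ?P (\<lambda>z. block_sum b Y ?M (fst z)) \<le> sd ?P ?H + sd ?P (\<lambda>z. Y (fst z @ snd z))"
  proof -
    have "sd ?P (\<lambda>z. - 1 * ?H z) = sd ?P ?H" by (rule sd_uminus)
    then show ?thesis using sd_triangle[OF sq_int_cmult[OF sq_int_diff[OF sq1 sq2], of "- 1"] sq1] by simp
  qed
  ultimately have "\<bar>sd (W n) Y - sd (W b) Y * sqrt ?M\<bar> \<le> sd ?P ?H" unfolding 1 2 by linarith
  also note sd_word_minus_blocks[OF b]
  finally have "\<bar>sd (W n) Y - sd (W b) Y * sqrt ?M\<bar> / sqrt n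
    \<le> (12 * (C * fourth_root b) * sqrt ?M + remainder_sd b + C * fourth_root n) / sqrt n"
    by (intro divide_right_mono) auto
  moreover have "sd (W n) Y / sqrt n - sd (W b) Y * sqrt (real ?M / real n) = (sd (W n) Y - sd (W b) Y * sqrt ?M) / sqrt n"
    by (simp add: real_sqrt_divide diff_divide_distrib)
  ultimately show ?thesis by (simp add: asym_error_eq abs_divide)
qed

text \<open>The functional is replaced by the sum over complete blocks, at the price of the standard
  deviation of the difference; the blocks are i.i.d., so the characteristic function of their sum is
  a power.\<close>

lemma cis_asym:
  assumes b: "0 < b" "b \<le> n"
  shows "cmod (measure_pmf.expectation (W n) (\<lambda>w. cis (t / sqrt n * (Y w - E n Y)))
    - measure_pmf.expectation (W b) (\<lambda>w. cis (t / sqrt n * (Y w - E b Y))) ^ (n div b)) \<le> \<bar>t\<bar> * asym_error b n"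
proof -
  let ?M = "n div b" and ?P = "pair_pmf (W (n div b * b)) (W (n mod b))" and ?s = "t / sqrt n"
  let ?H = "\<lambda>z. Y (fst z @ snd z) - block_sum b Y ?M (fst z)"
  have n0: "0 < n" using b by simp
  have n: "?M * b + n mod b = n" by simp
  have sq: "sq_int (W k) Y" "sq_int (W k) (block_sum b Y ?M)" for k
    by (intro sq_int_linear_growth Y linear_growth_block_sum)+
  have sq1: "sq_int ?P (\<lambda>z. Y (fst z @ snd z))"
    using sq(1)[of "?M * b + n mod b"] unfolding replicate_pmf_add sq_int_map .
  have sq2: "sq_int ?P (\<lambda>z. block_sum b Y ?M (fst z))" by (intro sq_int_pair sq)
  define f where "f z = ?s * (Y (fst z @ snd z) - E n Y)" for z
  define g where "g z = ?s * (block_sum b Y ?M (fst z) - ?M * E b Y)" for z :: "nat list \<times> nat list"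
  have EH: "measure_pmf.expectation ?P ?H = E n Y - ?M * E b Y"
  proof -
    have "measure_pmf.expectation ?P ?H = measure_pmf.expectation ?P (\<lambda>z. Y (fst z @ snd z))
        - measure_pmf.expectation ?P (\<lambda>z. block_sum b Y ?M (fst z))"
      using sq_int_integrable[OF sq1] sq_int_integrable[OF sq2] by simp
    then show ?thesis using expectation_append[of "?M * b" "n mod b" Y] block_sum_law(1)[OF Y] by simp
  qed
  have fg: "f z - g z = ?s * (?H z - measure_pmf.expectation ?P ?H)" for z
    unfolding EH by (simp add: f_def g_def algebra_simps)
  have l2: "l2 ?P (\<lambda>z. f z - g z) = \<bar>?s\<bar> * sd ?P ?H"
    unfolding fg sd_eq_l2 by (rule l2_cmult)
  have "sq_int ?P (\<lambda>z. f z - g z)"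
    unfolding fg by (intro sq_int_cmult sq_int_diff[OF _ sq_int_const] sq_int_diff[OF sq1 sq2])
  then have "cmod (measure_pmf.expectation ?P (\<lambda>z. cis (f z)) - measure_pmf.expectation ?P (\<lambda>z. cis (g z))) \<le> \<bar>?s\<bar> * sd ?P ?H"
    unfolding l2[symmetric] by (rule norm_expectation_cis_diff_le)
  also have "\<dots> \<le> \<bar>?s\<bar> * (12 * (C * fourth_root b) * sqrt ?M + remainder_sd b + C * fourth_root n)"
    by (intro mult_left_mono sd_word_minus_blocks[OF b]) simp
  also have "\<dots> = \<bar>t\<bar> * asym_error b n"
    by (simp add: asym_error_eq abs_divide)
  also have "measure_pmf.expectation ?P (\<lambda>z. cis (f z)) = measure_pmf.expectation (W n) (\<lambda>w. cis (?s * (Y w - E n Y)))"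
    using expectation_append[of "?M * b" "n mod b" "\<lambda>w. cis (?s * (Y w - E n Y))"] by (simp add: f_def)
  also have "measure_pmf.expectation ?P (\<lambda>z. cis (g z)) = measure_pmf.expectation (W b) (\<lambda>w. cis (?s * (Y w - E b Y))) ^ ?M"
  proof -
    have "measure_pmf.expectation ?P (\<lambda>z. cis (g z)) = measure_pmf.expectation (W (?M * b))
        (\<lambda>x. cis (?s * block_sum b Y ?M x) * cis (- ?s * (?M * E b Y)))"
      unfolding g_def by (subst expectation_pair_pmf_fst) (simp add: cis_mult algebra_simps)
    also have "\<dots> = measure_pmf.expectation (W (?M * b)) (\<lambda>x. cis (?s * block_sum b Y ?M x)) * cis (- ?s * (?M * E b Y))"
      by (rule integral_mult_left_zero)
    also have "cis (- ?s * (?M * E b Y)) = cis (- ?s * E b Y) ^ ?M"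
      unfolding Complex.DeMoivre by (rule arg_cong[of _ _ cis]) (simp add: mult_ac)
    also have "measure_pmf.expectation (W (?M * b)) (\<lambda>x. cis (?s * block_sum b Y ?M x))
        = measure_pmf.expectation (W b) (\<lambda>w. cis (?s * Y w)) ^ ?M"
      by (rule block_sum_law(3)[OF Y])
    also have "measure_pmf.expectation (W b) (\<lambda>w. cis (?s * Y w)) ^ ?M * cis (- ?s * E b Y) ^ ?M
        = (measure_pmf.expectation (W b) (\<lambda>w. cis (?s * Y w)) * cis (- ?s * E b Y)) ^ ?M"
      by (simp add: power_mult_distrib)
    also have "measure_pmf.expectation (W b) (\<lambda>w. cis (?s * Y w)) * cis (- ?s * E b Y)
        = measure_pmf.expectation (W b) (\<lambda>w. cis (?s * Y w) * cis (- ?s * E b Y))" by simp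
    finally show ?thesis by (simp add: cis_mult algebra_simps)
  qed
  finally show ?thesis .
qed

end

text \<open>For a fixed block length the classical argument applies to the block sums, with an error
  that is controlled as \<open>n\<close> tends to infinity and disappears only when the block length
  grows. The same comparison shows that the normalised standard deviations form a Cauchy sequence,
  and this is where \<open>s\<close> comes from. It may be 0 at this stage.\<close>

theorem almost_additive_CLT:
  assumes "almost_additive Y"
  shows "\<exists>s. 0 \<le> s \<and> (\<lambda>n. sd (W n) Y / sqrt n) \<longlonglongrightarrow> s \<and>
    (\<forall>t. (\<lambda>n. measure_pmf.expectation (W n) (\<lambda>w. cis (t / sqrt n * (Y w - E n Y))))
      \<longlonglongrightarrow> exp (- (complex_of_real (t\<^sup>2 * s\<^sup>2 / 2))))"
proof -
  have Y: "linear_growth Y" using assms by (simp add: almost_additive_def)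
  obtain C where C: "\<And>x y. \<bar>Y (x @ y) - Y x - Y y\<bar> \<le> C * fourth_root (length x + length y)"
    using assms by (auto simp: almost_additive_def)
  note C0 = C_nonneg[OF Y C]
  define \<sigma> where "\<sigma> n = sd (W n) Y / sqrt n" for n
  have fr: "filterlim fourth_root at_top sequentially"
    unfolding fourth_root_def
    by (intro filterlim_compose[OF sqrt_at_top] filterlim_compose[OF sqrt_at_top] filterlim_real_sequentially)
  have small: "(\<lambda>b. K / fourth_root b) \<longlonglongrightarrow> 0" for K
    by (rule real_tendsto_divide_at_top[OF tendsto_const fr])
  have asym: "\<forall>\<^sub>F n in sequentially. \<bar>\<sigma> n - \<sigma> b\<bar> < \<epsilon>" if b: "0 < b" and \<epsilon>: "12 * C / fourth_root b < \<epsilon>" for b \<epsilon>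
  proof -
    have "(\<lambda>n. asym_error Y C b n + \<bar>sd (W b) Y * sqrt (real (n div b) / real n) - \<sigma> b\<bar>)
      \<longlonglongrightarrow> 12 * C / fourth_root b + \<bar>sd (W b) Y * sqrt (1 / real b) - \<sigma> b\<bar>"
      by (intro tendsto_add asym_error_tendsto[OF Y C b] tendsto_rabs tendsto_diff tendsto_mult tendsto_const
          tendsto_real_sqrt tendsto_div_ratio b)
    moreover have "sd (W b) Y * sqrt (1 / real b) = \<sigma> b" by (simp add: \<sigma>_def real_sqrt_divide)
    ultimately have "\<forall>\<^sub>F n in sequentially. asym_error Y C b n + \<bar>sd (W b) Y * sqrt (real (n div b) / real n) - \<sigma> b\<bar> < \<epsilon>"
      using \<epsilon> by (intro order_tendstoD(2)) auto
    then show ?thesis using eventually_ge_at_top[of b]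
    proof eventually_elim
      case (elim n)
      then show ?case using sd_asym[OF Y C b elim(2)] by (simp add: \<sigma>_def)
    qed
  qed
  have "Cauchy \<sigma>"
  proof (rule CauchyI')
    fix \<epsilon> :: real assume "0 < \<epsilon>"
    then have "\<forall>\<^sub>F b in sequentially. 12 * C / fourth_root b < \<epsilon> / 2"
      using small[of "12 * C"] by (intro order_tendstoD(2)) auto
    then have "\<forall>\<^sub>F b in sequentially. 12 * C / fourth_root b < \<epsilon> / 2 \<and> 0 < b"
      using eventually_gt_at_top[of 0] by (rule eventually_conj)
    then obtain b where b: "0 < b" "12 * C / fourth_root b < \<epsilon> / 2"
      by (auto simp: eventually_sequentially)
    obtain N where N: "\<And>n. N \<le> n \<Longrightarrow> \<bar>\<sigma> n - \<sigma> b\<bar> < \<epsilon> / 2"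
      using asym[OF b] by (auto simp: eventually_sequentially)
    have "dist (\<sigma> m) (\<sigma> n) < \<epsilon>" if "N \<le> m" "m < n" for m n
    proof -
      have "\<bar>\<sigma> m - \<sigma> b\<bar> < \<epsilon> / 2" "\<bar>\<sigma> n - \<sigma> b\<bar> < \<epsilon> / 2" using N that by auto
      then show ?thesis unfolding dist_real_def by linarith
    qed
    then show "\<exists>M. \<forall>m\<ge>M. \<forall>n>m. dist (\<sigma> m) (\<sigma> n) < \<epsilon>" by blast
  qed
  then obtain s where s: "\<sigma> \<longlonglongrightarrow> s" by (auto simp: Cauchy_convergent_iff convergent_def)
  have s0: "0 \<le> s" by (rule LIMSEQ_le_const[OF s]) (auto simp: \<sigma>_def)
  have "(\<lambda>n. measure_pmf.expectation (W n) (\<lambda>w. cis (t / sqrt n * (Y w - E n Y))))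
      \<longlonglongrightarrow> exp (- (complex_of_real (t\<^sup>2 * s\<^sup>2 / 2)))" for t
  proof -
    define \<psi> where "\<psi> n = measure_pmf.expectation (W n) (\<lambda>w. cis (t / sqrt n * (Y w - E n Y)))" for n
    define L where "L b = exp (complex_of_real (- (t\<^sup>2 * (\<sigma> b)\<^sup>2 / 2)))" for b
    have Llim: "L \<longlonglongrightarrow> exp (- (complex_of_real (t\<^sup>2 * s\<^sup>2 / 2)))"
      unfolding L_def of_real_minus[symmetric]
      by (intro tendsto_exp tendsto_of_real tendsto_minus tendsto_divide tendsto_mult tendsto_power tendsto_const s) simp
    have blk: "(\<lambda>n. measure_pmf.expectation (W b) (\<lambda>w. cis (t / sqrt n * (Y w - E b Y))) ^ (n div b)) \<longlonglongrightarrow> L b"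
      if b: "0 < b" for b
    proof -
      let ?z = "\<lambda>n. measure_pmf.expectation (W b) (\<lambda>w. cis (t / sqrt (real n) * (Y w - E b Y)))"
      have sq: "sq_int (W b) (\<lambda>w. Y w - E b Y)" by (intro sq_int_diff sq_int_linear_growth Y sq_int_const)
      have m0: "E b (\<lambda>w. Y w - E b Y) = 0"
        using sq_int_integrable[OF sq_int_linear_growth[OF Y, of b]] by simp
      have "(\<lambda>n. ?z n ^ (n div b)) \<longlonglongrightarrow> exp (of_real (1 / b) * complex_of_real (- t\<^sup>2 * measure_pmf.variance (W b) (\<lambda>w. Y w - E b Y) / 2))"
        by (rule power_tendsto_exp[OF norm_expectation_cis_le characteristic_second_order[OF sq m0] tendsto_div_ratio[OF b]])
      moreover have "measure_pmf.variance (W b) (\<lambda>w. Y w - E b Y) = b * (\<sigma> b)\<^sup>2"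
        using b by (simp add: m0 \<sigma>_def power_divide sd_sq)
      ultimately show ?thesis using b by (simp add: L_def mult.assoc)
    qed
    have "\<psi> \<longlonglongrightarrow> exp (- (complex_of_real (t\<^sup>2 * s\<^sup>2 / 2)))" (is "_ \<longlonglongrightarrow> ?l")
    proof (rule tendstoI)
      fix \<epsilon> :: real assume \<epsilon>: "0 < \<epsilon>"
      have "\<forall>\<^sub>F b in sequentially. \<bar>t\<bar> * (12 * C) / fourth_root b < \<epsilon> / 3"
        using small[of "\<bar>t\<bar> * (12 * C)"] \<epsilon> by (intro order_tendstoD(2)) auto
      moreover have "\<forall>\<^sub>F b in sequentially. dist (L b) ?l < \<epsilon> / 3"
        using tendstoD[OF Llim, of "\<epsilon> / 3"] \<epsilon> by simp
      ultimately have "\<forall>\<^sub>F b in sequentially. \<bar>t\<bar> * (12 * C) / fourth_root b < \<epsilon> / 3 \<and> dist (L b) ?l < \<epsilon> / 3 \<and> 0 < b"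
        using eventually_gt_at_top[of 0] by eventually_elim auto
      then obtain b where b: "\<bar>t\<bar> * (12 * C) / fourth_root b < \<epsilon> / 3" "dist (L b) ?l < \<epsilon> / 3" "0 < b"
        by (auto simp: eventually_sequentially)
      have "(\<lambda>n. \<bar>t\<bar> * asym_error Y C b n) \<longlonglongrightarrow> \<bar>t\<bar> * (12 * C / fourth_root b)"
        by (intro tendsto_mult tendsto_const asym_error_tendsto[OF Y C b(3)])
      then have "\<forall>\<^sub>F n in sequentially. \<bar>t\<bar> * asym_error Y C b n < \<epsilon> / 3"
        using b(1) by (intro order_tendstoD(2)) auto
      moreover have "\<forall>\<^sub>F n in sequentially. dist (measure_pmf.expectation (W b) (\<lambda>w. cis (t / sqrt n * (Y w - E b Y))) ^ (n div b)) (L b) < \<epsilon> / 3"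
        using tendstoD[OF blk[OF b(3)], of "\<epsilon> / 3"] \<epsilon> by simp
      ultimately show "\<forall>\<^sub>F n in sequentially. dist (\<psi> n) ?l < \<epsilon>"
        using eventually_ge_at_top[of b]
      proof eventually_elim
        case (elim n)
        let ?z = "measure_pmf.expectation (W b) (\<lambda>w. cis (t / sqrt n * (Y w - E b Y))) ^ (n div b)"
        have "dist (\<psi> n) ?l \<le> dist (\<psi> n) ?z + dist ?z (L b) + dist (L b) ?l"
          using dist_triangle[of "\<psi> n" ?l ?z] dist_triangle[of ?z ?l "L b"] by linarith
        moreover have "dist (\<psi> n) ?z \<le> \<bar>t\<bar> * asym_error Y C b n"
          unfolding \<psi>_def dist_norm by (rule cis_asym[OF Y C b(3) elim(3)])
        ultimately show ?case using elim b by linarith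
      qed
    qed
    then show ?thesis unfolding \<psi>_def[abs_def] .
  qed
  then show ?thesis using s s0 unfolding \<sigma>_def by blast
qed

end

section \<open>Fourier inversion for the step distribution\<close>

text \<open>For nonzero \<open>a = d * l\<close> the interval contains a whole number of periods of
  the integrand, so the primitive has equal values at both ends.\<close>

lemma integral_cis_period:
  fixes d :: nat and a :: int
  assumes d: "0 < d" and dvd: "int d dvd a"
  shows "(LINT u|lborel. indicator {- pi / d..pi / d} u *\<^sub>R cis (u * real_of_int a))
    = (if a = 0 then complex_of_real (2 * pi / d) else 0)"
proof (cases "a = 0")
  case True
  have "(LINT u|lborel. indicator {- pi / d..pi / d} u *\<^sub>R (1 :: complex)) = complex_of_real (2 * pi / d)"
    using d by (simp add: scaleR_conv_of_real field_simps)
  then show ?thesis using True by simp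
next
  case False
  obtain l where l: "a = int d * l" using dvd by blast
  define F where "F u = (- \<i> / of_int a) * cis (u * real_of_int a)" for u
  have "(LINT u|lborel. indicator {- pi / d..pi / d} u *\<^sub>R cis (u * real_of_int a)) = F (pi / d) - F (- pi / d)"
  proof (rule integral_FTC_Icc)
    show "- pi / real d \<le> pi / real d" using d by (simp add: divide_right_mono)
    fix u :: real
    have "((\<lambda>u. cis (u * real_of_int a)) has_vector_derivative real_of_int a *\<^sub>R (\<i> * cis (u * real_of_int a))) (at u)"
      unfolding cis_conv_exp
      by (auto intro!: derivative_eq_intros has_vector_derivative_real_field simp: scaleR_conv_of_real)
    then have "(F has_vector_derivative (- \<i> / of_int a) * (real_of_int a *\<^sub>R (\<i> * cis (u * real_of_int a)))) (at u)"
      unfolding F_def by (rule has_vector_derivative_mult_right)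
    then show "(F has_vector_derivative cis (u * real_of_int a)) (at u within {- pi / d..pi / d})"
      using False by (auto simp: scaleR_conv_of_real intro: has_vector_derivative_at_within)
  qed (intro continuous_intros)
  also have "F (pi / d) - F (- pi / d) = (- \<i> / of_int a) * (cis (pi * l) - cis (- (pi * l)))"
    using d by (simp add: F_def l algebra_simps)
  also have "cis (pi * l) - cis (- (pi * l)) = 0"
    by (simp add: complex_eq_iff sin_zero_iff_int2 mult.commute)
  finally show ?thesis using False by simp
qed

text \<open>The indicator of \<open>s x = 0\<close> is an average of \<open>cis (u * s x)\<close>
  over one period, and Fubini exchanges the average with the expectation. The divisor
  \<open>d\<close> shortens the period; with the full span, the characteristic function of a step
  has modulus 1 on the interval only at 0.\<close>

lemma lattice_inversion:
  fixes M :: "'a pmf" and s :: "'a \<Rightarrow> int" and f :: "'a \<Rightarrow> complex"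
  assumes d: "0 < d" and dvd: "\<And>x. x \<in> set_pmf M \<Longrightarrow> int d dvd s x"
    and f: "\<And>x. cmod (f x) \<le> 1"
  shows "measure_pmf.expectation M (\<lambda>x. f x * of_bool (s x = 0))
    = of_real (d / (2 * pi)) * (LINT u|lborel. indicator {- pi / d..pi / d} u *\<^sub>R
        measure_pmf.expectation M (\<lambda>x. f x * cis (u * real_of_int (s x))))"
proof -
  let ?I = "{- pi / real d..pi / real d}"
  interpret pair_sigma_finite "lborel :: real measure" "measure_pmf M" by unfold_locales
  have norm_le: "cmod (indicator ?I u *\<^sub>R (f x * cis (u * real_of_int (s x)))) \<le> indicator ?I u" for u x
    using f[of x] by (auto simp: norm_mult indicator_def)
  have int_I: "integrable lborel (indicator ?I :: real \<Rightarrow> real)" by simp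
  have "integrable (lborel \<Otimes>\<^sub>M measure_pmf M) (\<lambda>z. indicator ?I (fst z) *\<^sub>R (f (snd z) * cis (fst z * real_of_int (s (snd z)))))"
  proof (rule Fubini_integrable)
    have [measurable]: "cis \<in> borel_measurable borel"
      by (intro borel_measurable_continuous_onI continuous_intros)
    have [measurable]: "(\<lambda>z. f (snd z)) \<in> borel_measurable (lborel \<Otimes>\<^sub>M measure_pmf M)"
      "(\<lambda>z. real_of_int (s (snd z))) \<in> borel_measurable (lborel \<Otimes>\<^sub>M measure_pmf M)"
      by (rule measurable_compose[OF measurable_snd], simp)+
    show m: "(\<lambda>z. indicator ?I (fst z) *\<^sub>R (f (snd z) * cis (fst z * real_of_int (s (snd z)))))
        \<in> borel_measurable (lborel \<Otimes>\<^sub>M measure_pmf M)"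
      by measurable
    have "(\<lambda>u. LINT x|M. cmod (indicator ?I (fst (u, x)) *\<^sub>R (f (snd (u, x)) * cis (fst (u, x) * real_of_int (s (snd (u, x)))))))
        \<in> borel_measurable lborel"
      by (rule measure_pmf.borel_measurable_lebesgue_integral)
        (use measurable_compose[OF m borel_measurable_norm] in \<open>simp add: case_prod_beta'\<close>)
    then show "integrable lborel (\<lambda>u. LINT x|M. cmod (indicator ?I (fst (u, x)) *\<^sub>R (f (snd (u, x)) * cis (fst (u, x) * real_of_int (s (snd (u, x)))))))"
    proof (rule Bochner_Integration.integrable_bound[OF int_I])
      have le: "(LINT x|M. cmod (indicator ?I u *\<^sub>R (f x * cis (u * real_of_int (s x))))) \<le> (LINT x|M. indicator ?I u)" for u
        by (rule integral_mono) (auto intro!: integrable_pmf_bounded[where B=1] norm_le simp: indicator_def norm_mult f)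
      show "AE u in lborel. norm (LINT x|M. cmod (indicator ?I (fst (u, x)) *\<^sub>R (f (snd (u, x)) * cis (fst (u, x) * real_of_int (s (snd (u, x))))))) \<le> norm (indicator ?I u :: real)"
        using le by (intro AE_I2) (simp add: abs_of_nonneg integral_nonneg)
    qed
    show "AE u in lborel. integrable (measure_pmf M) (\<lambda>x. indicator ?I (fst (u, x)) *\<^sub>R (f (snd (u, x)) * cis (fst (u, x) * real_of_int (s (snd (u, x))))))"
      by (intro AE_I2 integrable_pmf_bounded[where B=1]) (auto simp: indicator_def norm_mult f)
  qed
  then have "integrable (lborel \<Otimes>\<^sub>M measure_pmf M) (case_prod (\<lambda>u x. indicator ?I u *\<^sub>R (f x * cis (u * real_of_int (s x)))))"
    by (simp add: case_prod_beta')
  from Fubini_integral[OF this]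
  have "(LINT u|lborel. indicator ?I u *\<^sub>R measure_pmf.expectation M (\<lambda>x. f x * cis (u * real_of_int (s x))))
    = measure_pmf.expectation M (\<lambda>x. LINT u|lborel. f x * (indicator ?I u *\<^sub>R cis (u * real_of_int (s x))))"
    by (simp add: mult_scaleR_right)
  also have "\<dots> = measure_pmf.expectation M (\<lambda>x. f x * (LINT u|lborel. (indicator ?I u *\<^sub>R cis (u * real_of_int (s x)))))"
    by (simp only: integral_mult_right_zero)
  also have "\<dots> = measure_pmf.expectation M (\<lambda>x. of_real (2 * pi / d) * (f x * of_bool (s x = 0)))"
  proof (rule integral_cong_AE)
    show "AE x in M. f x * (LINT u|lborel. (indicator ?I u *\<^sub>R cis (u * real_of_int (s x))))
        = of_real (2 * pi / d) * (f x * of_bool (s x = 0))"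
    proof (rule AE_pmfI)
      fix x assume "x \<in> set_pmf M"
      note period = integral_cis_period[OF d dvd[OF this]]
      show "f x * (LINT u|lborel. (indicator ?I u *\<^sub>R cis (u * real_of_int (s x))))
        = of_real (2 * pi / d) * (f x * of_bool (s x = 0))"
        unfolding period by (simp add: scaleR_conv_of_real)
    qed
  qed simp_all
  also have "\<dots> = of_real (2 * pi / d) * measure_pmf.expectation M (\<lambda>x. f x * of_bool (s x = 0))"
    by (rule integral_mult_right_zero)
  finally show ?thesis using d by (simp add: field_simps)
qed

text \<open>The Taylor remainder is at most \<open>|x| ^ 3 / 6 \<le> x ^ 2 / 6\<close>, and
  \<open>1 / 2 - 1 / 6 = 1 / 3\<close>.\<close>

lemma cos_le_quadratic:
  assumes "\<bar>x\<bar> \<le> (1 :: real)"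
  shows "cos x \<le> 1 - x\<^sup>2 / 3"
proof -
  have "cmod (cis x - (\<Sum>k\<le>2. (\<i> * x) ^ k / fact k)) \<le> \<bar>x\<bar> ^ Suc 2 / fact (Suc 2)"
    unfolding cis_conv_exp by (rule iexp_approx1)
  moreover have "(\<Sum>k\<le>2. (\<i> * x) ^ k / fact k) = 1 + \<i> * x - x\<^sup>2 / 2"
    by (simp add: numeral_2_eq_2 power2_eq_square algebra_simps)
  moreover have "\<bar>x\<bar> ^ Suc 2 / fact (Suc 2) = \<bar>x\<bar> ^ 3 / 6" by (simp add: eval_nat_numeral)
  ultimately have "cmod (cis x - (1 + \<i> * x - x\<^sup>2 / 2)) \<le> \<bar>x\<bar> ^ 3 / 6" by metis
  moreover have "Re (cis x - (1 + \<i> * x - x\<^sup>2 / 2)) = cos x - 1 + x\<^sup>2 / 2"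
    by (simp flip: of_real_power)
  ultimately have "cos x - 1 + x\<^sup>2 / 2 \<le> \<bar>x\<bar> ^ 3 / 6"
    using abs_Re_le_cmod[of "cis x - (1 + \<i> * x - x\<^sup>2 / 2)"] by linarith
  also have "\<bar>x\<bar> ^ 3 = x\<^sup>2 * \<bar>x\<bar>" by (simp add: power3_eq_cube power2_eq_square abs_mult)
  also have "x\<^sup>2 * \<bar>x\<bar> \<le> x\<^sup>2 * 1" using assms by (intro mult_left_mono) auto
  finally show ?thesis by simp
qed

section \<open>The step distribution and the decay of its characteristic function\<close>

locale critical_offspring = offspring_pmf +
  assumes mean: "measure_pmf.expectation p real = 1"
    and var_pos: "0 < measure_pmf.variance p real"
begin

definition step_var :: real where
  "step_var = measure_pmf.variance p real"

text \<open>As 0 belongs to the support, the greatest common divisor of the support itself is the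
  span of the lattice generated by differences of steps.\<close>

definition step_span :: nat where
  "step_span = Gcd (set_pmf p)"

definition walk :: "nat list \<Rightarrow> real" where
  "walk w = real (sum_list w) - real (length w)"

definition step_char :: "real \<Rightarrow> complex" where
  "step_char u = measure_pmf.expectation p (\<lambda>k. cis (u * (real k - 1)))"

lemma sq_int_step: "sq_int p (\<lambda>k. real k - 1)"
  using second_moment by (intro sq_int_diff sq_int_const) (simp add: sq_int_def)

lemma integrable_offspring: "integrable (measure_pmf p) real"
  using second_moment sq_int_integrable[of p real] by (simp add: sq_int_def)

lemma mean_step: "measure_pmf.expectation p (\<lambda>k. real k - 1) = 0"
  using integrable_offspring mean by simp

lemma variance_step: "measure_pmf.variance p (\<lambda>k. real k - 1) = step_var"
  unfolding mean_step by (simp add: step_var_def mean)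

lemma not_degenerate: "\<not> (\<forall>k\<in>set_pmf p. k = 1)"
proof
  assume "\<forall>k\<in>set_pmf p. k = 1"
  then have "measure_pmf.variance p real = measure_pmf.expectation p (\<lambda>_. 0)"
    by (intro integral_cong_AE) (auto simp: AE_measure_pmf_iff mean)
  then show False using var_pos by simp
qed

text \<open>Otherwise \<open>real k - 1\<close> would be nonnegative with mean zero and hence vanish
  almost surely, against the positive variance. The same argument with the opposite sign yields an
  atom that is at least 2.\<close>

lemma zero_in_support: "0 \<in> set_pmf p"
proof (rule ccontr)
  assume "0 \<notin> set_pmf p"
  then have ge: "k \<in> set_pmf p \<Longrightarrow> 1 \<le> k" for k by (cases k) auto
  have "(\<integral>k. real k - 1 \<partial>measure_pmf p) = 0 \<longleftrightarrow> (AE k in measure_pmf p. real k - 1 = 0)"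
    by (rule integral_nonneg_eq_0_iff_AE) (auto simp: integrable_offspring AE_measure_pmf_iff dest: ge)
  then show False using mean_step not_degenerate by (auto simp: AE_measure_pmf_iff)
qed

lemma ex_support_ge_2: "\<exists>k\<in>set_pmf p. 2 \<le> k"
proof (rule ccontr)
  assume "\<not> (\<exists>k\<in>set_pmf p. 2 \<le> k)"
  then have le: "k \<in> set_pmf p \<Longrightarrow> k \<le> 1" for k by fastforce
  have "(\<integral>k. 1 - real k \<partial>measure_pmf p) = 0 \<longleftrightarrow> (AE k in measure_pmf p. 1 - real k = 0)"
    by (rule integral_nonneg_eq_0_iff_AE) (auto simp: integrable_offspring AE_measure_pmf_iff dest: le)
  moreover have "(\<integral>k. 1 - real k \<partial>measure_pmf p) = 0" using integrable_offspring mean by simp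
  ultimately show False using not_degenerate by (auto simp: AE_measure_pmf_iff)
qed

lemma step_span_pos: "0 < step_span"
proof -
  obtain k where "k \<in> set_pmf p" "2 \<le> k" using ex_support_ge_2 by blast
  moreover from this have "step_span dvd k" by (simp add: step_span_def)
  ultimately show ?thesis by (auto intro!: Nat.gr0I)
qed

lemma step_span_dvd_sum_list: "w \<in> set_pmf (W n) \<Longrightarrow> step_span dvd sum_list w"
proof -
  assume "w \<in> set_pmf (W n)"
  then have "\<forall>k\<in>set w. step_span dvd k" by (auto simp: set_replicate_pmf step_span_def)
  then show ?thesis by (induction w) auto
qed

text \<open>Two atoms suffice. With weights \<open>a\<close>, \<open>b\<close> and angle
  \<open>\<theta>\<close> the squared modulus of their part is
  \<open>(a + b) ^ 2 - 2 * a * b * (1 - cos \<theta>)\<close>, and all other atoms contribute at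
  most \<open>1 - a - b\<close>.\<close>

lemma step_char_le:
  assumes k: "k \<in> set_pmf p" "0 < k"
  shows "cmod (step_char u) \<le> 1 - pmf p 0 * pmf p k * (1 - cos (u * real k))"
proof -
  define a b \<theta> where "a = pmf p 0" and "b = pmf p k" and "\<theta> = u * real k"
  have ab: "0 \<le> a" "0 \<le> b" by (simp_all add: a_def b_def)
  have "a + b = measure (measure_pmf p) {0, k}" using k by (simp add: a_def b_def measure_measure_pmf_finite)
  then have ab1: "a + b \<le> 1" by simp
  have "step_char u = cis (- u) * measure_pmf.expectation p (\<lambda>k. cis (u * real k))"
    unfolding step_char_def by (subst integral_mult_right_zero[symmetric]) (simp add: cis_mult algebra_simps)
  then have "cmod (step_char u) = cmod (measure_pmf.expectation p (\<lambda>k. cis (u * real k)))"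
    by (simp add: norm_mult)
  also have "measure_pmf.expectation p (\<lambda>j. cis (u * real j))
      = measure_pmf.expectation p (\<lambda>j. indicator {0, k} j *\<^sub>R cis (u * real j))
        + measure_pmf.expectation p (\<lambda>j. indicator (- {0, k}) j *\<^sub>R cis (u * real j))"
    by (subst Bochner_Integration.integral_add[symmetric])
      (auto intro!: integrable_pmf_bounded[where B=1] Bochner_Integration.integral_cong simp: indicator_def)
  also have "measure_pmf.expectation p (\<lambda>j. indicator {0, k} j *\<^sub>R cis (u * real j)) = of_real a + of_real b * cis \<theta>"
    using k by (subst integral_measure_pmf[of "{0, k}"]) (auto simp: a_def b_def \<theta>_def scaleR_conv_of_real split: split_indicator_asm)
  also have "cmod (of_real a + of_real b * cis \<theta> + measure_pmf.expectation p (\<lambda>j. indicator (- {0, k}) j *\<^sub>R cis (u * real j)))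
      \<le> cmod (of_real a + of_real b * cis \<theta>) + (1 - (a + b))"
  proof (rule order_trans[OF norm_triangle_ineq add_left_mono])
    have "cmod (measure_pmf.expectation p (\<lambda>j. indicator (- {0, k}) j *\<^sub>R cis (u * real j)))
        \<le> measure_pmf.expectation p (\<lambda>j. cmod (indicator (- {0, k}) j *\<^sub>R cis (u * real j)))"
      by (rule integral_norm_bound)
    also have "\<dots> = measure_pmf.expectation p (indicator (- {0, k}))" by simp
    also have "\<dots> = measure (measure_pmf p) (- {0, k})" by simp
    also have "\<dots> = 1 - (a + b)" using \<open>a + b = _\<close> by (simp add: measure_pmf.prob_compl[of "{0, k}" p, simplified] Compl_eq_Diff_UNIV)
    finally show "cmod (measure_pmf.expectation p (\<lambda>j. indicator (- {0, k}) j *\<^sub>R cis (u * real j))) \<le> 1 - (a + b)" .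
  qed
  also have "cmod (of_real a + of_real b * cis \<theta>) \<le> a + b - a * b * (1 - cos \<theta>)"
  proof (rule power2_le_imp_le)
    have "(cmod (of_real a + of_real b * cis \<theta>))\<^sup>2 = (a + b * cos \<theta>)\<^sup>2 + (b * sin \<theta>)\<^sup>2"
      by (simp add: cmod_power2)
    also have "(a + b * c)\<^sup>2 + (b * s)\<^sup>2 = a\<^sup>2 + 2 * a * b * c + b\<^sup>2 * (c\<^sup>2 + s\<^sup>2)" for c s
      by (simp add: power2_eq_square algebra_simps)
    also have "a\<^sup>2 + 2 * a * b * cos \<theta> + b\<^sup>2 * ((cos \<theta>)\<^sup>2 + (sin \<theta>)\<^sup>2) = (a + b)\<^sup>2 - 2 * (a * b * (1 - cos \<theta>))"
    proof -
      have "(cos \<theta>)\<^sup>2 + (sin \<theta>)\<^sup>2 = 1" by simp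
      then show ?thesis by (simp only:) (simp add: power2_eq_square algebra_simps)
    qed
    \<comment> \<open>The factor \<open>a + b \<le> 1\<close> is inserted in order to complete the
      square.\<close>
    also have "\<dots> \<le> (a + b)\<^sup>2 - 2 * (a + b) * (a * b * (1 - cos \<theta>))"
    proof -
      have "(a + b) * (a * b * (1 - cos \<theta>)) \<le> 1 * (a * b * (1 - cos \<theta>))"
        using ab ab1 by (intro mult_right_mono) auto
      moreover have "2 * (a + b) * t = 2 * ((a + b) * t)" for t by simp
      ultimately show ?thesis by (simp only: mult_1_left)
    qed
    also have "\<dots> \<le> (a + b - a * b * (1 - cos \<theta>))\<^sup>2"
      by (simp add: power2_diff) 
    finally show "(cmod (of_real a + of_real b * cis \<theta>))\<^sup>2 \<le> (a + b - a * b * (1 - cos \<theta>))\<^sup>2" .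
    have "a * b * (1 - cos \<theta>) \<le> a * b * 2"
      using ab by (intro mult_left_mono) (auto simp: abs_le_iff intro: order_trans[OF _ cos_ge_minus_one])
    moreover have "a * b \<le> a * 1" "a * b \<le> 1 * b" 
      using ab ab1 mult_left_mono[of b 1 a] mult_right_mono[of a 1 b] by auto
    ultimately show "0 \<le> a + b - a * b * (1 - cos \<theta>)" by linarith
  qed
  finally show ?thesis by (simp add: a_def b_def \<theta>_def)
qed

text \<open>If every atom \<open>k\<close> satisfied \<open>cos (u * k) = 1\<close>, then
  \<open>x = u / (2 * pi)\<close> would have integral multiples at all atoms. The least positive
  \<open>g\<close> with \<open>x * g\<close> integral divides every atom and hence the span, so
  \<open>x\<close> times the span would be a nonzero integer, although its modulus is at most
  \<open>1 / 2\<close>.\<close>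

lemma step_char_less_1:
  assumes u: "u \<noteq> 0" "\<bar>u\<bar> \<le> pi / step_span"
  shows "cmod (step_char u) < 1"
proof -
  have "\<exists>k\<in>set_pmf p. cos (u * real k) \<noteq> 1"
  proof (rule ccontr)
    assume trivial: "\<not> (\<exists>k\<in>set_pmf p. cos (u * real k) \<noteq> 1)"
    define x where "x = u / (2 * pi)"
    define A where "A = {g :: nat. x * real g \<in> \<int>}"
    have supp: "set_pmf p \<subseteq> A"
    proof
      fix k assume "k \<in> set_pmf p"
      then have "cos (u * real k) = 1" using trivial by blast
      then obtain j :: int where "u * real k = j * 2 * pi" by (auto simp: cos_one_2pi_int)
      then have "x * real k = j" by (simp add: x_def field_simps)
      then show "k \<in> A" by (simp add: A_def)
    qed
    obtain k where k: "k \<in> set_pmf p" "2 \<le> k" using ex_support_ge_2 by blast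
    define g where "g = (LEAST g. 0 < g \<and> g \<in> A)"
    have g: "0 < g \<and> g \<in> A" unfolding g_def by (rule LeastI[of _ k]) (use k supp in auto)
    have "g dvd l" if "l \<in> set_pmf p" for l
    proof -
      have "x * real (l mod g) = x * real l - x * real g * real (l div g)"
      proof -
        have "real l = real (g * (l div g) + l mod g)" by simp
        then show ?thesis by (simp only: of_nat_add of_nat_mult) (simp add: algebra_simps)
      qed
      also have "\<dots> \<in> \<int>"
      proof -
        have "x * real l \<in> \<int>" "x * real g \<in> \<int>" using supp that g by (auto simp: A_def)
        then show ?thesis by (rule Ints_diff[OF _ Ints_mult]) simp_all
      qed
      finally have "l mod g \<in> A" by (simp add: A_def)
      moreover have "l mod g < g" using g by simp
      ultimately have "\<not> 0 < l mod g" using not_less_Least[of "l mod g" "\<lambda>g. 0 < g \<and> g \<in> A"] by (auto simp: g_def)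
      then show ?thesis by (simp add: dvd_eq_mod_eq_0)
    qed
    then have "g dvd step_span" by (simp add: step_span_def dvd_Gcd_iff)
    then obtain q where q: "step_span = g * q" by blast
    have "x * real step_span = x * real g * real q" by (simp add: q)
    also have "\<dots> \<in> \<int>"
    proof -
      have "x * real g \<in> \<int>" using g by (simp add: A_def)
      then show ?thesis by (rule Ints_mult) simp
    qed
    finally have "x * real step_span \<in> \<int>" .
    moreover have "x * real step_span \<noteq> 0" using u step_span_pos by (simp add: x_def)
    ultimately have "1 \<le> \<bar>x * real step_span\<bar>" by (rule Ints_nonzero_abs_ge1)
    then have "2 * pi \<le> \<bar>u\<bar> * real step_span" by (simp add: x_def abs_mult field_simps)
    also have "\<dots> \<le> pi" using u(2) step_span_pos by (simp add: field_simps)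
    finally show False using pi_gt_zero by linarith
  qed
  then obtain k where k: "k \<in> set_pmf p" "cos (u * real k) \<noteq> 1" by blast
  then have "cos (u * real k) < 1" using cos_le_one[of "u * real k"] by linarith
  moreover have "0 < k" using k by (intro Nat.gr0I) auto
  moreover have "0 < pmf p 0 * pmf p k" using zero_in_support k by (simp add: pmf_positive)
  ultimately have "0 < pmf p 0 * pmf p k * (1 - cos (u * real k))" "0 < k" by (auto intro!: mult_pos_pos)
  then show ?thesis using step_char_le[OF k(1), of u] by linarith
qed

text \<open>Near 0 the two-atom bound is quadratic; on the compact rest of the period the continuous
  modulus attains a maximum below 1. The Gaussian shape is preserved by powers and by the scaling
  with \<open>sqrt n\<close>, and so provides an integrable bound that does not depend on
  \<open>n\<close>.\<close>

lemma step_char_bound: "\<exists>c>0. \<forall>u. \<bar>u\<bar> \<le> pi / step_span \<longrightarrow> cmod (step_char u) \<le> exp (- c * u\<^sup>2)"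
proof -
  obtain k where k: "k \<in> set_pmf p" "2 \<le> k" using ex_support_ge_2 by blast
  define c1 where "c1 = pmf p 0 * pmf p k * (real k)\<^sup>2 / 3"
  have c1: "0 < c1" using zero_in_support k by (simp add: c1_def pmf_positive)
  have near: "cmod (step_char u) \<le> 1 - c1 * u\<^sup>2" if "\<bar>u\<bar> \<le> 1 / k" for u
  proof -
    have "\<bar>u * real k\<bar> \<le> 1" using that k by (simp add: abs_mult field_simps)
    from cos_le_quadratic[OF this] have "(u * real k)\<^sup>2 / 3 \<le> 1 - cos (u * real k)" by simp
    then have "pmf p 0 * pmf p k * ((u * real k)\<^sup>2 / 3) \<le> pmf p 0 * pmf p k * (1 - cos (u * real k))"
      by (intro mult_left_mono) auto
    then show ?thesis using step_char_le[OF k(1), of u] k(2) by (simp add: c1_def power_mult_distrib mult_ac)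
  qed
  define S where "S = {u :: real. 1 / k \<le> \<bar>u\<bar> \<and> \<bar>u\<bar> \<le> pi / step_span}"
  have cont: "continuous_on UNIV (\<lambda>u. cmod (step_char u))"
  proof (rule continuous_on_norm, rule continuous_at_imp_continuous_on, rule ballI)
    fix u :: real
    have "(\<lambda>v. step_char v - step_char u) \<midarrow>u\<rightarrow> 0"
    proof (rule Lim_null_comparison)
      show "\<forall>\<^sub>F v in at u. cmod (step_char v - step_char u) \<le> \<bar>v - u\<bar> * l2 p (\<lambda>k. real k - 1)"
      proof (intro always_eventually allI)
        fix v
        have eq: "v * (real k - 1) - u * (real k - 1) = (v - u) * (real k - 1)" for k by (simp add: algebra_simps)
        have "sq_int p (\<lambda>k. v * (real k - 1) - u * (real k - 1))" unfolding eq by (rule sq_int_cmult[OF sq_int_step])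
        from norm_expectation_cis_diff_le[OF this] show "cmod (step_char v - step_char u) \<le> \<bar>v - u\<bar> * l2 p (\<lambda>k. real k - 1)"
          unfolding eq l2_cmult step_char_def .
      qed
      have "(\<lambda>v. \<bar>v - u\<bar> * l2 p (\<lambda>k. real k - 1)) \<midarrow>u\<rightarrow> \<bar>u - u\<bar> * l2 p (\<lambda>k. real k - 1)"
        by (intro tendsto_intros)
      then show "(\<lambda>v. \<bar>v - u\<bar> * l2 p (\<lambda>k. real k - 1)) \<midarrow>u\<rightarrow> 0" by simp
    qed
    then show "isCont step_char u" unfolding isCont_def by (rule LIM_zero_cancel)
  qed
  have "\<exists>\<rho><1. \<forall>u\<in>S. cmod (step_char u) \<le> \<rho>"
  proof (cases "S = {}")
    case True
    then show ?thesis by (intro exI[of _ 0]) auto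
  next
    case False
    have split: "q \<le> \<bar>u\<bar> \<and> \<bar>u\<bar> \<le> P \<longleftrightarrow> (- P \<le> u \<and> u \<le> - q) \<or> (q \<le> u \<and> u \<le> P)"
      if "0 < q" for q u P :: real using that by arith
    have "0 < 1 / real k" using k by simp
    from split[OF this] have "u \<in> S \<longleftrightarrow> u \<in> {- (pi / step_span)..- (1 / k)} \<union> {1 / k..pi / step_span}" for u
      unfolding S_def by simp
    then have "S = {- (pi / step_span)..- (1 / k)} \<union> {1 / k..pi / step_span}" by blast
    then have "compact S" by (simp add: compact_Un)
    from continuous_attains_sup[OF this False continuous_on_subset[OF cont subset_UNIV]]
    obtain v where v: "v \<in> S" "\<forall>u\<in>S. cmod (step_char u) \<le> cmod (step_char v)" by blast
    have "0 < 1 / real k" using k by simp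
    then have "v \<noteq> 0" using v(1) by (auto simp: S_def)
    then have "cmod (step_char v) < 1" using v(1) by (intro step_char_less_1) (auto simp: S_def)
    then show ?thesis using v(2) by blast
  qed
  then obtain \<rho> where \<rho>: "\<rho> < 1" "\<And>u. u \<in> S \<Longrightarrow> cmod (step_char u) \<le> \<rho>" by blast
  \<comment> \<open>Chosen such that \<open>c2 * u ^ 2 \<le> 1 - \<rho>\<close> on the whole
    period.\<close>
  define c2 where "c2 = (1 - \<rho>) / (pi / step_span)\<^sup>2"
  have c2: "0 < c2" using \<rho>(1) step_span_pos by (simp add: c2_def)
  show ?thesis
  proof (intro exI[of _ "min c1 c2"] conjI allI impI)
    show "0 < min c1 c2" using c1 c2 by simp
    fix u assume u: "\<bar>u\<bar> \<le> pi / step_span"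
    have "cmod (step_char u) \<le> 1 - min c1 c2 * u\<^sup>2"
    proof (cases "\<bar>u\<bar> \<le> 1 / k")
      case True
      have "min c1 c2 * u\<^sup>2 \<le> c1 * u\<^sup>2" by (intro mult_right_mono) auto
      then show ?thesis using near[OF True] by linarith
    next
      case False
      have "u\<^sup>2 \<le> (pi / step_span)\<^sup>2" using power_mono[OF u, of 2] by simp
      then have "c2 * u\<^sup>2 \<le> c2 * (pi / step_span)\<^sup>2" using c2 by (intro mult_left_mono) auto
      also have "\<dots> = 1 - \<rho>" using step_span_pos by (simp add: c2_def)
      finally have "min c1 c2 * u\<^sup>2 \<le> 1 - \<rho>"
        by (rule order_trans[rotated]) (intro mult_right_mono, auto)
      moreover have "cmod (step_char u) \<le> \<rho>" using False u by (intro \<rho>(2)) (auto simp: S_def)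
      ultimately show ?thesis by linarith
    qed
    also have "\<dots> \<le> exp (- min c1 c2 * u\<^sup>2)" using exp_ge_add_one_self[of "- min c1 c2 * u\<^sup>2"] by simp
    finally show "cmod (step_char u) \<le> exp (- min c1 c2 * u\<^sup>2)" .
  qed
qed

end

lemma expectation_cond_pmf:
  fixes f :: "'a \<Rightarrow> 'c :: {banach, second_countable_topology}"
  assumes "set_pmf M \<inter> A \<noteq> {}"
  shows "measure_pmf.expectation (cond_pmf M A) f
    = measure_pmf.expectation M (\<lambda>x. indicator A x *\<^sub>R f x) /\<^sub>R measure (measure_pmf M) A"
proof -
  have "measure (measure_pmf M) A \<noteq> 0"
    using assms by (simp add: measure_pmf_zero_iff)
  then have pos: "0 < measure (measure_pmf M) A" by (simp add: less_le)
  have "measure_pmf (cond_pmf M A) = density (measure_pmf M) (\<lambda>x. ennreal (indicator A x / measure (measure_pmf M) A))"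
    unfolding cond_pmf.rep_eq[OF assms] uniform_measure_def measure_pmf.emeasure_eq_measure
    by (intro arg_cong2[where f=density] refl ext) (use pos in \<open>simp add: divide_ennreal flip: ennreal_indicator\<close>)
  then have "measure_pmf.expectation (cond_pmf M A) f
      = measure_pmf.expectation M (\<lambda>x. (indicator A x / measure (measure_pmf M) A) *\<^sub>R f x)"
    by (simp add: integral_density)
  also have "\<dots> = measure_pmf.expectation M (\<lambda>x. (1 / measure (measure_pmf M) A) *\<^sub>R (indicator A x *\<^sub>R f x))"
    by simp
  finally show ?thesis by (simp only: integral_scaleR_right divide_inverse mult_1_left)
qed

lemma gaussian_integral:
  fixes a :: real
  assumes "0 < a"
  shows "integrable lborel (\<lambda>v. exp (- a * v\<^sup>2))" and "(LINT v|lborel. exp (- a * v\<^sup>2)) = sqrt (pi / a)"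
proof -
  define \<sigma> where "\<sigma> = sqrt (1 / (2 * a))"
  have \<sigma>: "0 < \<sigma>" "\<sigma>\<^sup>2 = 1 / (2 * a)" using assms by (auto simp: \<sigma>_def)
  have eq: "exp (- a * v\<^sup>2) = sqrt (pi / a) * normal_density 0 \<sigma> v" for v
    using assms by (simp add: normal_density_def \<sigma>(2) real_sqrt_divide)
  show "integrable lborel (\<lambda>v. exp (- a * v\<^sup>2))" unfolding eq by (intro integrable_mult_right integrable_normal_density \<sigma>)
  show "(LINT v|lborel. exp (- a * v\<^sup>2)) = sqrt (pi / a)"
    unfolding eq using \<sigma>(1) by simp
qed

section \<open>Fourier representation of words conditioned on their sum\<close>

context critical_offspring
begin

lemma step_var_pos: "0 < step_var"
  using var_pos by (simp add: step_var_def)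

lemma walk_append: "walk (x @ y) = walk x + walk y"
  by (simp add: walk_def)

lemma almost_additive_walk: "almost_additive walk"
proof -
  have "\<bar>walk w\<bar> \<le> 1 * (real (sum_list w) + real (length w))" for w by (simp add: walk_def)
  then have "linear_growth walk" unfolding linear_growth_def by blast
  moreover have "\<bar>walk (x @ y) - walk x - walk y\<bar> \<le> 0 * fourth_root (length x + length y)" for x y
    by (simp add: walk_append)
  ultimately show ?thesis unfolding almost_additive_def by blast
qed

lemma sq_int_walk: "sq_int (W n) walk"
  using almost_additive_walk by (intro sq_int_linear_growth) (simp add: almost_additive_def)

lemma walk_law:
  "E n walk = 0" "measure_pmf.variance (W n) walk = n * step_var"
  "measure_pmf.expectation (W n) (\<lambda>w. cis (u * walk w)) = step_char u ^ n"
proof -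
  have "E n walk = 0 \<and> measure_pmf.variance (W n) walk = n * step_var \<and>
    measure_pmf.expectation (W n) (\<lambda>w. cis (u * walk w)) = step_char u ^ n"
  proof (induction n)
    case 0
    show ?case by (simp add: walk_def)
  next
    case (Suc n)
    have IH: "E n walk = 0" "E n (\<lambda>w. (walk w)\<^sup>2) = n * step_var"
      using Suc by auto
    have w: "walk (d # w) = (real d - 1) + walk w" for d w by (simp add: walk_def)
    let ?P = "pair_pmf p (W n)"
    have "measure_pmf.expectation ?P (\<lambda>z. (real (fst z) - 1) + walk (snd z)) = 0"
      using sq_int_integrable[OF sq_int_pair(1)[OF sq_int_step, of "W n"]]
        sq_int_integrable[OF sq_int_pair(2)[OF sq_int_walk, of p]] Suc
        expectation_pair_pmf_fst[of p "W n" "\<lambda>k. real k - 1"] mean_step by simp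
    then have e: "E (Suc n) walk = 0" unfolding replicate_pmf_Suc integral_map_pmf w .
    moreover have "measure_pmf.variance (W (Suc n)) walk = Suc n * step_var"
      unfolding e unfolding replicate_pmf_Suc integral_map_pmf w
      using variance_pair[OF sq_int_step sq_int_walk, of n] variance_step IH e
      unfolding replicate_pmf_Suc integral_map_pmf w by (simp add: algebra_simps)
    moreover have "measure_pmf.expectation (W (Suc n)) (\<lambda>w. cis (u * walk w)) = step_char u ^ Suc n"
      unfolding replicate_pmf_Suc integral_map_pmf w
      using expectation_pair_pmf_mult[OF integrable_cis[of p "\<lambda>k. u * (real k - 1)"] integrable_cis[of "W n" "\<lambda>w. u * walk w"]] Suc
      by (simp only: distrib_left cis_mult[symmetric] step_char_def) simp
    ultimately show ?case by blast
  qed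
  then show "E n walk = 0" "measure_pmf.variance (W n) walk = n * step_var"
    "measure_pmf.expectation (W n) (\<lambda>w. cis (u * walk w)) = step_char u ^ n" by auto
qed

text \<open>For words of length \<open>n\<close> this is the condition that the walk ends at
  \<open>- 1\<close>, as it does for every tree word.\<close>

definition slice :: "nat \<Rightarrow> nat list set" where
  "slice n = {w. sum_list w + 1 = n}"

text \<open>The inversion integrand after the substitution \<open>u = v / sqrt n\<close>. Only the
  first \<open>m\<close> letters enter \<open>f\<close>; the remaining ones contribute the power of
  \<open>step_char\<close>, and the last factor reflects the end point \<open>- 1\<close> of the
  walk.\<close>

definition fourier_integrand :: "nat \<Rightarrow> nat \<Rightarrow> (nat list \<Rightarrow> complex) \<Rightarrow> real \<Rightarrow> complex" where
  "fourier_integrand n m f v = indicator {- pi * sqrt n / step_span..pi * sqrt n / step_span} v *\<^sub>R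
     (measure_pmf.expectation (W m) (\<lambda>x. f x * cis (v / sqrt n * walk x)) * step_char (v / sqrt n) ^ (n - m) * cis (v / sqrt n))"

text \<open>Lattice inversion applied to \<open>sum_list w + 1 - n\<close>, which is a multiple of
  the span because \<open>n - 1\<close> and the sum are. The factor \<open>sqrt n\<close> on the
  left compensates the change of variables.\<close>

lemma slice_inversion:
  fixes f :: "nat list \<Rightarrow> complex"
  assumes n: "1 \<le> n" "step_span dvd n - 1" and m: "m \<le> n" and f: "\<And>x. cmod (f x) \<le> 1"
  shows "sqrt n * measure_pmf.expectation (W n) (\<lambda>w. indicator (slice n) w *\<^sub>R f (take m w))
    = of_real (real step_span / (2 * pi)) * (LINT v|lborel. fourier_integrand n m f v)"
proof -
  define s where "s w = int (sum_list w) + 1 - int n" for w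
  let ?I = "{- pi / step_span..pi / step_span}"
  have dvd: "int step_span dvd s w" if "w \<in> set_pmf (W n)" for w
  proof -
    have "int step_span dvd int (sum_list w) - int (n - 1)"
      using step_span_dvd_sum_list[OF that] n(2) by (intro dvd_diff) auto
    then show ?thesis using n(1) by (simp add: s_def of_nat_diff algebra_simps)
  qed
  define g where "g u = indicator ?I u *\<^sub>R measure_pmf.expectation (W n) (\<lambda>w. f (take m w) * cis (u * real_of_int (s w)))" for u
  have "measure_pmf.expectation (W n) (\<lambda>w. indicator (slice n) w *\<^sub>R f (take m w))
      = measure_pmf.expectation (W n) (\<lambda>w. f (take m w) * of_bool (s w = 0))"
    by (intro Bochner_Integration.integral_cong refl) (auto simp: slice_def s_def indicator_def)
  also have "\<dots> = of_real (real step_span / (2 * pi)) * (LINT u|lborel. g u)"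
    unfolding g_def by (rule lattice_inversion[OF step_span_pos dvd f])
  also have "(LINT u|lborel. g u) = \<bar>1 / sqrt n\<bar> *\<^sub>R (LINT v|lborel. g (0 + 1 / sqrt n * v))"
    by (rule lborel_integral_real_affine) (use n in simp)
  also have "(LINT v|lborel. g (0 + 1 / sqrt n * v)) = (LINT v|lborel. fourier_integrand n m f v)"
  proof (intro Bochner_Integration.integral_cong refl)
    fix v
    let ?u = "v / sqrt n"
    have nm: "n = m + (n - m)" using m by simp
    have "measure_pmf.expectation (W n) (\<lambda>w. f (take m w) * cis (?u * real_of_int (s w)))
        = measure_pmf.expectation (pair_pmf (W m) (W (n - m))) (\<lambda>z. f (take m (fst z @ snd z)) * cis (?u * real_of_int (s (fst z @ snd z))))"
      by (subst nm) (rule expectation_append)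
    also have "\<dots> = measure_pmf.expectation (pair_pmf (W m) (W (n - m)))
        (\<lambda>z. (f (fst z) * cis (?u * walk (fst z))) * (cis (?u * walk (snd z)) * cis ?u))"
    proof (rule integral_cong_AE)
      show "AE z in pair_pmf (W m) (W (n - m)). f (take m (fst z @ snd z)) * cis (?u * real_of_int (s (fst z @ snd z)))
          = (f (fst z) * cis (?u * walk (fst z))) * (cis (?u * walk (snd z)) * cis ?u)"
      proof (rule AE_pmfI)
        fix z assume "z \<in> set_pmf (pair_pmf (W m) (W (n - m)))"
        then have len: "length (fst z) = m" "length (snd z) = n - m" by (auto dest: length_replicate_pmf)
        have "real_of_int (s (fst z @ snd z)) = walk (fst z) + walk (snd z) + 1"
          using len m by (simp add: s_def walk_def of_nat_diff)
        then have "?u * real_of_int (s (fst z @ snd z)) = ?u * walk (fst z) + (?u * walk (snd z) + ?u)"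
          by (simp only: distrib_left mult_1_right add.assoc)
        then show "f (take m (fst z @ snd z)) * cis (?u * real_of_int (s (fst z @ snd z)))
          = (f (fst z) * cis (?u * walk (fst z))) * (cis (?u * walk (snd z)) * cis ?u)"
          using len by (simp only: cis_mult[symmetric] mult.assoc) simp
      qed
    qed simp_all
    also have "\<dots> = measure_pmf.expectation (W m) (\<lambda>x. f x * cis (?u * walk x)) * (step_char ?u ^ (n - m) * cis ?u)"
    proof (subst expectation_pair_pmf_mult)
      show "integrable (measure_pmf (W m)) (\<lambda>x. f x * cis (?u * walk x))"
        by (rule integrable_pmf_bounded[of _ _ 1]) (simp add: norm_mult f)
      show "integrable (measure_pmf (W (n - m))) (\<lambda>x. cis (?u * walk x) * cis ?u)"
        by (rule integrable_pmf_bounded[of _ _ 1]) (simp add: norm_mult)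
      show "measure_pmf.expectation (W m) (\<lambda>x. f x * cis (?u * walk x)) * measure_pmf.expectation (W (n - m)) (\<lambda>x. cis (?u * walk x) * cis ?u)
        = measure_pmf.expectation (W m) (\<lambda>x. f x * cis (?u * walk x)) * (step_char ?u ^ (n - m) * cis ?u)"
        by (simp only: integral_mult_left_zero walk_law(3))
    qed
    finally have "measure_pmf.expectation (W n) (\<lambda>w. f (take m w) * cis (?u * real_of_int (s w)))
      = measure_pmf.expectation (W m) (\<lambda>x. f x * cis (?u * walk x)) * step_char ?u ^ (n - m) * cis ?u"
      by (simp only: mult.assoc)
    moreover have "indicator ?I ?u = (indicator {- pi * sqrt n / step_span..pi * sqrt n / step_span} v :: real)"
      using n step_span_pos by (auto simp: indicator_def field_simps)
    ultimately show "g (0 + 1 / sqrt n * v) = fourier_integrand n m f v"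
      by (simp add: g_def fourier_integrand_def)
  qed
  finally show ?thesis using n by (simp add: scaleR_conv_of_real field_simps)
qed

lemma measurable_char [measurable]:
  fixes f :: "'b \<Rightarrow> complex"
  assumes "\<And>x. cmod (f x) \<le> 1"
  shows "(\<lambda>u. measure_pmf.expectation M (\<lambda>x. f x * cis (c * u * h x))) \<in> borel_measurable borel"
proof -
  have [measurable]: "cis \<in> borel_measurable borel"
    by (intro borel_measurable_continuous_onI continuous_intros)
  have [measurable]: "(\<lambda>z. f (snd z)) \<in> borel_measurable (borel \<Otimes>\<^sub>M measure_pmf M)"
    "(\<lambda>z. h (snd z)) \<in> borel_measurable (borel \<Otimes>\<^sub>M measure_pmf M)"
    by (rule measurable_compose[OF measurable_snd], simp)+
  have "(\<lambda>z. f (snd z) * cis (c * fst z * h (snd z))) \<in> borel_measurable (borel \<Otimes>\<^sub>M measure_pmf M)"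
    by measurable
  then show ?thesis
    by (intro measure_pmf.borel_measurable_lebesgue_integral) (simp add: case_prod_beta')
qed

lemma measurable_fourier_integrand:
  assumes "\<And>x. cmod (f x) \<le> 1"
  shows "fourier_integrand n m f \<in> borel_measurable lborel"
proof -
  have [measurable]: "cis \<in> borel_measurable borel"
    by (intro borel_measurable_continuous_onI continuous_intros)
  have [measurable]: "(\<lambda>v. measure_pmf.expectation (W m) (\<lambda>x. f x * cis (v / sqrt n * walk x))) \<in> borel_measurable borel"
    using measurable_char[OF assms, where c="1 / sqrt n" and M="W m" and h=walk] by simp
  have [measurable]: "(\<lambda>v. step_char (v / sqrt n)) \<in> borel_measurable borel"
    unfolding step_char_def using measurable_char[of "\<lambda>_. 1", where c="1 / sqrt n" and M=p and h="\<lambda>k. real k - 1"] by simp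
  show ?thesis unfolding fourier_integrand_def[abs_def] by measurable
qed

text \<open>The expectation over the first \<open>m\<close> letters has norm at most 1, and the
  \<open>n - m\<close> other letters, at least the proportion \<open>\<kappa>\<close> of all,
  provide Gaussian decay. The bound depends on neither \<open>n\<close> nor
  \<open>f\<close>.\<close>

lemma norm_fourier_integrand_le:
  assumes c: "0 < c" "\<And>u. \<bar>u\<bar> \<le> pi / step_span \<Longrightarrow> cmod (step_char u) \<le> exp (- c * u\<^sup>2)"
    and f: "\<And>x. cmod (f x) \<le> 1" and \<kappa>: "\<kappa> * real n \<le> real (n - m)" "0 < \<kappa>"
  shows "cmod (fourier_integrand n m f v) \<le> exp (- (c * \<kappa>) * v\<^sup>2)"
proof (cases "v \<in> {- pi * sqrt n / step_span..pi * sqrt n / step_span}")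
  case True
  show ?thesis
  proof (cases "n = 0")
    case True': True
    have "cmod (measure_pmf.expectation (W m) (\<lambda>x. f x * cis 0)) \<le> 1"
      by (rule norm_expectation_le_1) (simp add: f)
    then show ?thesis using True True' \<kappa> by (simp add: fourier_integrand_def)
  next
    case False
    let ?u = "v / sqrt n"
    have E1: "cmod (measure_pmf.expectation (W m) (\<lambda>x. f x * cis (?u * walk x))) \<le> 1"
      by (rule norm_expectation_le_1) (simp add: norm_mult f)
    have "\<bar>v\<bar> \<le> pi * sqrt n / step_span" using True by (auto simp: abs_le_iff)
    then have "\<bar>?u\<bar> \<le> pi / step_span" using False step_span_pos by (simp add: abs_divide field_simps)
    then have "cmod (step_char ?u) ^ (n - m) \<le> exp (- c * ?u\<^sup>2) ^ (n - m)"
      by (intro power_mono c) auto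
    also have "\<dots> = exp (real (n - m) * (- c * ?u\<^sup>2))" by (simp only: exp_of_nat_mult)
    also have "\<dots> \<le> exp (- (c * \<kappa>) * v\<^sup>2)"
    proof -
      have "c * v\<^sup>2 / n * (\<kappa> * real n) \<le> c * v\<^sup>2 / n * real (n - m)"
        by (rule mult_left_mono[OF \<kappa>(1)]) (use c in simp)
      then show ?thesis using False by (simp add: power_divide mult_ac)
    qed
    finally have "cmod (step_char ?u) ^ (n - m) \<le> exp (- (c * \<kappa>) * v\<^sup>2)" .
    then have "cmod (measure_pmf.expectation (W m) (\<lambda>x. f x * cis (?u * walk x))) * cmod (step_char ?u) ^ (n - m)
        \<le> 1 * exp (- (c * \<kappa>) * v\<^sup>2)"
      by (intro mult_mono E1) auto
    then show ?thesis using True by (simp add: fourier_integrand_def norm_mult norm_power)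
  qed
next
  case False
  then show ?thesis by (simp add: fourier_integrand_def)
qed

text \<open>Dominated convergence, with the limit \<open>g\<close> of the prefix factor left open.
  The constant \<open>\<kappa>'\<close> bounds the proportion of free letters from below for every
  \<open>n\<close> and serves the domination, while the limiting proportion \<open>\<kappa>\<close>
  determines the Gaussian factor.\<close>

lemma fourier_integral_tendsto:
  assumes k: "\<And>n. k n \<le> n" "\<And>n. \<kappa>' * real n \<le> real (k n)" "0 < \<kappa>'" "(\<lambda>n. real (k n) / real n) \<longlonglongrightarrow> \<kappa>"
    and f: "\<And>n x. cmod (f n x) \<le> 1"
    and g: "\<And>v. (\<lambda>n. measure_pmf.expectation (W (n - k n)) (\<lambda>x. f n x * cis (v / sqrt n * walk x))) \<longlonglongrightarrow> g v"
  shows "(\<lambda>n. LINT v|lborel. fourier_integrand n (n - k n) (f n) v)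
    \<longlonglongrightarrow> (LINT v|lborel. g v * exp (complex_of_real (- (\<kappa> * step_var / 2) * v\<^sup>2)))"
proof -
  obtain c where c: "0 < c" "\<And>u. \<bar>u\<bar> \<le> pi / step_span \<Longrightarrow> cmod (step_char u) \<le> exp (- c * u\<^sup>2)"
    using step_char_bound by blast
  have lim: "(\<lambda>n. fourier_integrand n (n - k n) (f n) v) \<longlonglongrightarrow> g v * exp (complex_of_real (- (\<kappa> * step_var / 2) * v\<^sup>2))" for v
  proof -
    have sc: "(\<lambda>n. step_char (v / sqrt n) ^ k n) \<longlonglongrightarrow> exp (of_real \<kappa> * complex_of_real (- v\<^sup>2 * step_var / 2))"
      unfolding variance_step[symmetric] step_char_def
      by (rule power_tendsto_exp[OF norm_expectation_cis_le characteristic_second_order[OF sq_int_step mean_step] k(4)])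
    have "(\<lambda>n. v / sqrt (real n)) \<longlonglongrightarrow> 0"
      by (rule real_tendsto_divide_at_top[OF tendsto_const])
        (intro filterlim_compose[OF sqrt_at_top] filterlim_real_sequentially)
    then have c1: "(\<lambda>n. cis (v / sqrt (real n))) \<longlonglongrightarrow> cis 0"
    proof (rule isCont_tendsto_compose[rotated])
      have "continuous_on UNIV cis" by (intro continuous_intros)
      then show "isCont cis 0" by (simp add: continuous_on_eq_continuous_at)
    qed
    have "(\<lambda>n. measure_pmf.expectation (W (n - k n)) (\<lambda>x. f n x * cis (v / sqrt n * walk x)) * step_char (v / sqrt n) ^ k n * cis (v / sqrt n))
        \<longlonglongrightarrow> g v * exp (of_real \<kappa> * complex_of_real (- v\<^sup>2 * step_var / 2)) * cis 0"
      by (intro tendsto_mult g sc c1)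
    moreover have "exp (of_real \<kappa> * complex_of_real (- v\<^sup>2 * step_var / 2)) = exp (complex_of_real (- (\<kappa> * step_var / 2) * v\<^sup>2))"
      by (simp add: mult_ac)
    ultimately have "(\<lambda>n. measure_pmf.expectation (W (n - k n)) (\<lambda>x. f n x * cis (v / sqrt n * walk x)) * step_char (v / sqrt n) ^ k n * cis (v / sqrt n))
        \<longlonglongrightarrow> g v * exp (complex_of_real (- (\<kappa> * step_var / 2) * v\<^sup>2))" by simp
    then show ?thesis
    proof (rule Lim_transform_eventually)
      have "filterlim (\<lambda>n. pi / step_span * sqrt (real n)) at_top sequentially"
        using step_span_pos
        by (intro filterlim_tendsto_pos_mult_at_top[OF tendsto_const] filterlim_compose[OF sqrt_at_top] filterlim_real_sequentially) simp
      then have "\<forall>\<^sub>F n in sequentially. \<bar>v\<bar> \<le> pi / step_span * sqrt (real n)"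
        by (simp add: filterlim_at_top)
      then show "\<forall>\<^sub>F n in sequentially. measure_pmf.expectation (W (n - k n)) (\<lambda>x. f n x * cis (v / sqrt n * walk x))
          * step_char (v / sqrt n) ^ k n * cis (v / sqrt n) = fourier_integrand n (n - k n) (f n) v"
      proof eventually_elim
        case (elim n)
        then have "v \<in> {- pi * sqrt n / step_span..pi * sqrt n / step_span}" by (auto simp: abs_le_iff)
        then show ?case using k(1)[of n] by (simp add: fourier_integrand_def)
      qed
    qed
  qed
  show ?thesis
  proof (rule integral_dominated_convergence[where w="\<lambda>v. exp (- (c * \<kappa>') * v\<^sup>2)"])
    show "fourier_integrand n (n - k n) (f n) \<in> borel_measurable lborel" for n
      by (rule measurable_fourier_integrand[OF f])
    then show "(\<lambda>v. g v * exp (complex_of_real (- (\<kappa> * step_var / 2) * v\<^sup>2))) \<in> borel_measurable lborel"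
      using lim by (rule borel_measurable_LIMSEQ_metric)
    show "integrable lborel (\<lambda>v. exp (- (c * \<kappa>') * v\<^sup>2))"
      using c k(3) by (intro gaussian_integral) simp
    show "AE v in lborel. (\<lambda>n. fourier_integrand n (n - k n) (f n) v)
        \<longlonglongrightarrow> g v * exp (complex_of_real (- (\<kappa> * step_var / 2) * v\<^sup>2))"
      using lim by simp
    show "AE v in lborel. cmod (fourier_integrand n (n - k n) (f n) v) \<le> exp (- (c * \<kappa>') * v\<^sup>2)" for n
      using k by (intro AE_I2 norm_fourier_integrand_le c f) auto
  qed
qed

text \<open>The local limit theorem at the single point that is needed.\<close>
lemma slice_integral_tendsto:
  "(\<lambda>n. LINT v|lborel. fourier_integrand n 0 (\<lambda>_. 1) v) \<longlonglongrightarrow> complex_of_real (sqrt (2 * pi / step_var))"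
proof -
  have "(\<lambda>n. LINT v|lborel. fourier_integrand n (n - n) (\<lambda>_. 1) v)
    \<longlonglongrightarrow> (LINT v|lborel. 1 * exp (complex_of_real (- (1 * step_var / 2) * v\<^sup>2)))"
  proof (rule fourier_integral_tendsto[where \<kappa>' = 1])
    show "(\<lambda>n. real n / real n) \<longlonglongrightarrow> 1"
      by (rule tendsto_eventually) (auto intro!: eventually_mono[OF eventually_gt_at_top[of 0]])
  qed (auto simp: walk_def)
  also have "(LINT v|lborel. 1 * exp (complex_of_real (- (1 * step_var / 2) * v\<^sup>2)))
      = complex_of_real (LINT v|lborel. exp (- (step_var / 2) * v\<^sup>2))"
    by (simp only: exp_of_real mult_1_left integral_complex_of_real)
  also have "(LINT v|lborel. exp (- (step_var / 2) * v\<^sup>2)) = sqrt (2 * pi / step_var)"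
    using gaussian_integral(2)[of "step_var / 2"] step_var_pos by (simp add: mult.commute)
  finally show ?thesis by simp
qed

lemma slice_prob:
  assumes n: "1 \<le> n" "step_span dvd n - 1"
  shows "sqrt n * measure_pmf.prob (W n) (slice n) = real step_span / (2 * pi) * Re (LINT v|lborel. fourier_integrand n 0 (\<lambda>_. 1) v)"
    and "sqrt n * measure_pmf.prob (W n) (slice n) = of_real (real step_span / (2 * pi)) * (LINT v|lborel. fourier_integrand n 0 (\<lambda>_. 1) v)"
proof -
  have "measure_pmf.expectation (W n) (\<lambda>w. indicator (slice n) w *\<^sub>R (1 :: complex)) = of_real (measure_pmf.prob (W n) (slice n))"
    by (simp add: scaleR_conv_of_real)
  then show 2: "sqrt n * measure_pmf.prob (W n) (slice n) = of_real (real step_span / (2 * pi)) * (LINT v|lborel. fourier_integrand n 0 (\<lambda>_. 1) v)"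
    using slice_inversion[OF n, of 0 "\<lambda>_. 1"] by simp
  show "sqrt n * measure_pmf.prob (W n) (slice n) = real step_span / (2 * pi) * Re (LINT v|lborel. fourier_integrand n 0 (\<lambda>_. 1) v)"
    using arg_cong[OF 2, of Re] by simp
qed

text \<open>A different target \<open>j\<close> changes the integrand only by a factor of modulus 1,
  so the Gaussian bound for the power of \<open>step_char\<close>, whose integral is of order
  \<open>1 / sqrt n\<close>, is uniform in \<open>j\<close>.\<close>

lemma point_prob_bound: "\<exists>C>0. \<forall>n\<ge>1. \<forall>j. measure_pmf.prob (W n) {w. sum_list w = j} \<le> C / sqrt n"
proof -
  obtain c where c: "0 < c" "\<And>u. \<bar>u\<bar> \<le> pi / step_span \<Longrightarrow> cmod (step_char u) \<le> exp (- c * u\<^sup>2)"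
    using step_char_bound by blast
  define C where "C = real step_span / (2 * pi) * sqrt (pi / c)"
  have C: "0 < C" using c step_span_pos by (simp add: C_def)
  have "measure_pmf.prob (W n) {w. sum_list w = j} \<le> C / sqrt n" if n: "1 \<le> n" for n j
  proof (cases "step_span dvd j")
    case False
    have "measure_pmf.prob (W n) {w. sum_list w = j} = 0"
      using step_span_dvd_sum_list[of _ n] False by (auto simp: measure_pmf_zero_iff)
    then show ?thesis using C by simp
  next
    case True
    let ?I = "{- pi / step_span..pi / step_span}"
    define s where "s w = int (sum_list w) - int j" for w
    define h where "h u = indicator ?I u *\<^sub>R measure_pmf.expectation (W n) (\<lambda>w. 1 * cis (u * real_of_int (s w)))" for u
    have "of_real (measure_pmf.prob (W n) {w. sum_list w = j}) = measure_pmf.expectation (W n) (\<lambda>w. indicator {w. sum_list w = j} w *\<^sub>R (1 :: complex))"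
      by (simp add: scaleR_conv_of_real)
    also have "\<dots> = measure_pmf.expectation (W n) (\<lambda>w. 1 * of_bool (s w = 0))"
      by (intro Bochner_Integration.integral_cong refl) (auto simp: s_def indicator_def)
    also have "\<dots> = of_real (real step_span / (2 * pi)) * (LINT u|lborel. h u)"
      unfolding h_def
      by (rule lattice_inversion[OF step_span_pos])
        (use True step_span_dvd_sum_list in \<open>auto simp: s_def intro!: dvd_diff\<close>)
    finally have "measure_pmf.prob (W n) {w. sum_list w = j} = cmod (of_real (real step_span / (2 * pi)) * (LINT u|lborel. h u))"
      by (metis abs_of_nonneg measure_nonneg norm_of_real)
    also have "\<dots> = real step_span / (2 * pi) * cmod (LINT u|lborel. h u)" by (simp add: norm_mult norm_divide)
    also have "\<dots> \<le> real step_span / (2 * pi) * (LINT u|lborel. exp (- (c * n) * u\<^sup>2))"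
    proof (rule mult_left_mono)
      have int: "integrable lborel (\<lambda>u. exp (- (c * n) * u\<^sup>2))" using c n by (intro gaussian_integral) simp
      have le: "cmod (h u) \<le> exp (- (c * n) * u\<^sup>2)" for u
      proof (cases "u \<in> ?I")
        case True
        have "measure_pmf.expectation (W n) (\<lambda>w. cis (u * real_of_int (s w)))
            = measure_pmf.expectation (W n) (\<lambda>w. cis (u * walk w) * cis (u * (real n - real j)))"
        proof (rule integral_cong_AE)
          show "AE w in W n. cis (u * real_of_int (s w)) = cis (u * walk w) * cis (u * (real n - real j))"
            by (rule AE_pmfI) (auto dest!: length_replicate_pmf simp: s_def walk_def cis_mult algebra_simps)
        qed simp_all
        also have "\<dots> = step_char u ^ n * cis (u * (real n - real j))"
          by (simp only: integral_mult_left_zero walk_law(3))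
        finally have "cmod (h u) = cmod (step_char u) ^ n" using True by (simp add: h_def norm_mult norm_power)
        also have "\<dots> \<le> exp (- c * u\<^sup>2) ^ n" using True by (intro power_mono c) (auto simp: abs_le_iff)
        also have "\<dots> = exp (- (c * n) * u\<^sup>2)" by (simp add: mult_ac flip: exp_of_nat_mult)
        finally show ?thesis .
      qed (simp add: h_def)
      have "h \<in> borel_measurable lborel"
      proof -
        have [measurable]: "(\<lambda>u. measure_pmf.expectation (W n) (\<lambda>w. 1 * cis (1 * u * real_of_int (s w)))) \<in> borel_measurable borel"
          by (rule measurable_char) simp
        show ?thesis unfolding h_def[abs_def] using \<open>_ \<in> borel_measurable borel\<close> by simp
      qed
      then have "integrable lborel h"
        by (rule Bochner_Integration.integrable_bound[OF int]) (use le in simp)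
      then have "(LINT u|lborel. cmod (h u)) \<le> (LINT u|lborel. exp (- (c * n) * u\<^sup>2))"
        using int le by (intro integral_mono) auto
      then show "cmod (LINT u|lborel. h u) \<le> (LINT u|lborel. exp (- (c * n) * u\<^sup>2))"
        by (rule order_trans[OF integral_norm_bound])
    qed simp
    also have "(LINT u|lborel. exp (- (c * n) * u\<^sup>2)) = sqrt (pi / (c * n))"
      using c n by (intro gaussian_integral) simp
    finally have "measure_pmf.prob (W n) {w. sum_list w = j} \<le> real step_span / (2 * pi) * sqrt (pi / (c * n))"
      .
    also have "\<dots> = C / sqrt n" by (simp add: C_def real_sqrt_divide real_sqrt_mult)
    finally show ?thesis .
  qed
  then show ?thesis using C by blast
qed

end

section \<open>Fourth moments and decorrelation from the walk\<close>

text \<open>Bridges exist only for certain \<open>n\<close>. Sequences are completed by their limit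
  at all other \<open>n\<close>, so that results about ordinary sequences apply.\<close>

lemma tendsto_if_const:
  assumes "(f \<longlongrightarrow> L) F"
  shows "((\<lambda>n. if P n then f n else L) \<longlongrightarrow> L) F"
proof (rule topological_tendstoI)
  fix S assume "open S" "L \<in> S"
  with topological_tendstoD[OF assms this] show "\<forall>\<^sub>F n in F. (if P n then f n else L) \<in> S"
    by (auto elim: eventually_mono)
qed

text \<open>The cases are separated by \<open>|x| = 12 * |y|\<close>, with
  \<open>(13 / 12) ^ 4 \<le> 3 / 2\<close> and \<open>13 ^ 4 = 28561\<close>. The factor
  \<open>3 / 2\<close> has to be close to 1 so that the recursion in \<open>fourth_moment\<close>
  contracts; the size of the other constant is irrelevant.\<close>

lemma power4_add_le: "(x + y) ^ 4 \<le> 3 / 2 * x ^ 4 + 28561 * (y :: real) ^ 4"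
proof (cases "12 * \<bar>y\<bar> \<le> \<bar>x\<bar>")
  case True
  then have "\<bar>x + y\<bar> \<le> 13 / 12 * \<bar>x\<bar>" by linarith
  then have "\<bar>x + y\<bar> ^ 4 \<le> (13 / 12 * \<bar>x\<bar>) ^ 4" by (intro power_mono) auto
  also have "\<dots> = (13 / 12) ^ 4 * x ^ 4" by (simp only: power_mult_distrib power_even_abs_numeral even_numeral)
  also have "\<dots> \<le> 3 / 2 * x ^ 4" by (intro mult_right_mono) (auto simp: power_divide)
  finally have "(x + y) ^ 4 \<le> 3 / 2 * x ^ 4" by (simp only: power_even_abs_numeral even_numeral)
  moreover have "0 \<le> 28561 * y ^ 4" by simp
  ultimately show ?thesis by linarith
next
  case False
  then have "\<bar>x + y\<bar> \<le> 13 * \<bar>y\<bar>" by linarith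
  then have "\<bar>x + y\<bar> ^ 4 \<le> (13 * \<bar>y\<bar>) ^ 4" by (intro power_mono) auto
  also have "\<dots> = 13 ^ 4 * y ^ 4" by (simp only: power_mult_distrib power_even_abs_numeral even_numeral)
  finally have "(x + y) ^ 4 \<le> 28561 * y ^ 4" by (simp only: power_even_abs_numeral even_numeral) simp
  moreover have "0 \<le> 3 / 2 * x ^ 4" by simp
  ultimately show ?thesis by linarith
qed

context offspring_pmf
begin

lemma sd_le_sqrt:
  assumes "almost_additive Y"
  shows "\<exists>S\<ge>0. \<forall>n. sd (W n) Y \<le> S * sqrt n"
proof -
  obtain s where s: "(\<lambda>n. sd (W n) Y / sqrt n) \<longlonglongrightarrow> s" using almost_additive_CLT[OF assms] by blast
  have "Bseq (\<lambda>n. sd (W n) Y / sqrt n)" using s by (intro convergent_imp_Bseq) (auto simp: convergent_def)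
  then obtain S where S: "0 < S" "\<And>n. norm (sd (W n) Y / sqrt n) \<le> S" by (auto simp: Bseq_def)
  have "sd (W n) Y \<le> S * sqrt n" for n
  proof (cases "n = 0")
    case True
    then show ?thesis by (simp add: sd_def)
  next
    case False
    have "sd (W n) Y / sqrt n \<le> S" using S(2)[of n] by simp
    then show ?thesis using False by (simp add: field_simps)
  qed
  then show ?thesis using S(1) by (intro exI[of _ S]) auto
qed

text \<open>The word is cut in the middle. For independent centred halves the odd mixed terms vanish
  and the even one is a product of two linearly bounded variances, while the defect at the cut has a
  fourth power of order \<open>n\<close>. The factor \<open>3 / 2\<close> of
  \<open>power4_add_le\<close> and the factor \<open>5 / 8\<close> of the halving give
  \<open>15 / 16 < 1\<close>. The bound by the word length ensures that the moments exist.\<close>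

lemma fourth_moment:
  fixes B :: real
  assumes Y: "almost_additive Y" and B: "\<And>w. \<bar>Y w\<bar> \<le> B * length w"
  shows "\<exists>K\<ge>0. \<forall>n. E n (\<lambda>w. (Y w - E n Y) ^ 4) \<le> K * (real n)\<^sup>2"
proof -
  obtain C where C: "\<And>x y. \<bar>Y (x @ y) - Y x - Y y\<bar> \<le> C * fourth_root (length x + length y)"
    using Y by (auto simp: almost_additive_def)
  obtain S where S: "0 \<le> S" "\<And>n. sd (W n) Y \<le> S * sqrt n" using sd_le_sqrt[OF Y] by blast
  have C0: "0 \<le> C" using order_trans[OF abs_ge_zero C[of "[0]" "[]"]] by (simp add: fourth_root_def)
  define c where "c n w = Y w - E n Y" for n w
  define q where "q n = E n (\<lambda>w. (c n w) ^ 4)" for n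
  have bdd: "\<exists>D. \<forall>w\<in>set_pmf (W n). \<bar>c n w\<bar> \<le> D" for n
  proof (intro exI ballI)
    fix w assume "w \<in> set_pmf (W n)"
    then have "\<bar>Y w\<bar> \<le> B * n" using B[of w] by (simp add: length_replicate_pmf)
    then show "\<bar>c n w\<bar> \<le> B * n + \<bar>E n Y\<bar>" by (simp add: c_def)
  qed
  have int: "integrable (W n) (\<lambda>w. (c n w) ^ i)" for n i
  proof -
    obtain D where "\<forall>w\<in>set_pmf (W n). \<bar>c n w\<bar> \<le> D" using bdd by blast
    then show ?thesis by (intro integrable_pmf_bounded[where B="D ^ i"]) (auto simp: power_abs intro!: power_mono)
  qed
  have intY: "integrable (W n) Y" for n
    using Y by (intro sq_int_integrable sq_int_linear_growth) (simp add: almost_additive_def)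
  have c0: "E n (\<lambda>w. c n w) = 0" for n using intY by (simp add: c_def)
  have c2: "E n (\<lambda>w. (c n w)\<^sup>2) \<le> S\<^sup>2 * n" for n
  proof -
    have "E n (\<lambda>w. (c n w)\<^sup>2) = (sd (W n) Y)\<^sup>2" by (simp add: c_def sd_sq)
    also have "\<dots> \<le> (S * sqrt n)\<^sup>2" by (intro power_mono S sd_nonneg)
    finally show ?thesis by (simp add: power_mult_distrib)
  qed
  have step: "q (m + k) \<le> 3 / 2 * (q m + q k + 6 * (S\<^sup>2 * m) * (S\<^sup>2 * k)) + 28561 * (2 * C) ^ 4 * real (m + k)" for m k
  proof -
    let ?P = "pair_pmf (W m) (W k)"
    define A where "A z = c m (fst z) + c k (snd z)" for z
    define D where "D z = Y (fst z @ snd z) - Y (fst z) - Y (snd z)" for z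
    have D: "\<bar>D z\<bar> \<le> C * fourth_root (m + k)" if "z \<in> set_pmf ?P" for z
      using C[of "fst z" "snd z"] that unfolding D_def by (auto dest!: length_replicate_pmf)
    have iP: "integrable ?P (\<lambda>z. Y (fst z))" "integrable ?P (\<lambda>z. Y (snd z))" "integrable ?P (\<lambda>z. Y (fst z @ snd z))"
    proof -
      show "integrable ?P (\<lambda>z. Y (fst z))" "integrable ?P (\<lambda>z. Y (snd z))"
        using integrable_pmf_fst_snd(1)[OF intY] integrable_pmf_fst_snd(2)[OF intY] by auto
      show "integrable ?P (\<lambda>z. Y (fst z @ snd z))"
        using intY[of "m + k"] unfolding replicate_pmf_add integrable_map_pmf_eq .
    qed
    have ED: "measure_pmf.expectation ?P D = E (m + k) Y - E m Y - E k Y"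
      unfolding D_def expectation_append using iP by simp
    have "\<bar>measure_pmf.expectation ?P D\<bar> \<le> C * fourth_root (m + k)"
    proof -
      have "\<bar>measure_pmf.expectation ?P D\<bar> \<le> measure_pmf.expectation ?P (\<lambda>z. \<bar>D z\<bar>)" by (rule integral_abs_bound)
      also have "\<dots> \<le> measure_pmf.expectation ?P (\<lambda>z. C * fourth_root (m + k))"
      proof (rule integral_mono_AE)
        show "AE z in ?P. \<bar>D z\<bar> \<le> C * fourth_root (m + k)" by (rule AE_pmfI) (rule D)
        show "integrable ?P (\<lambda>z. \<bar>D z\<bar>)" unfolding D_def using iP by auto
      qed simp
      finally show ?thesis by simp
    qed
    then have bound: "(c (m + k) (fst z @ snd z)) ^ 4 \<le> 3 / 2 * A z ^ 4 + 28561 * (2 * C) ^ 4 * real (m + k)"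
      if "z \<in> set_pmf ?P" for z
    proof -
      define R where "R = D z - measure_pmf.expectation ?P D"
      have "c (m + k) (fst z @ snd z) = A z + R" unfolding R_def ED by (simp add: c_def A_def D_def)
      then have "(c (m + k) (fst z @ snd z)) ^ 4 \<le> 3 / 2 * A z ^ 4 + 28561 * R ^ 4" by (simp only: power4_add_le)
      moreover have "R ^ 4 \<le> (2 * C) ^ 4 * real (m + k)"
      proof -
        have "\<bar>R\<bar> \<le> 2 * C * fourth_root (m + k)" using D[OF that] \<open>\<bar>measure_pmf.expectation ?P D\<bar> \<le> _\<close> unfolding R_def by linarith
        then have "\<bar>R\<bar> ^ 4 \<le> (2 * C * fourth_root (m + k)) ^ 4" by (intro power_mono) auto
        then show ?thesis by (simp only: power_mult_distrib fourth_root_pow4 power_even_abs_numeral even_numeral)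
      qed
      ultimately show ?thesis by linarith
    qed
    have A4: "A z ^ 4 = (c m (fst z)) ^ 4 * 1 + 4 * ((c m (fst z)) ^ 3 * c k (snd z) ^ 1) + 6 * ((c m (fst z)) ^ 2 * (c k (snd z)) ^ 2)
        + 4 * ((c m (fst z)) ^ 1 * (c k (snd z)) ^ 3) + 1 * (c k (snd z)) ^ 4" for z
      by (simp add: A_def power2_eq_square power3_eq_cube power4_eq_xxxx algebra_simps)
    have ip: "integrable ?P (\<lambda>z. (c m (fst z)) ^ i * (c k (snd z)) ^ j)" for i j
      by (rule integrable_pair_pmf_mult[OF int int])
    have ep: "measure_pmf.expectation ?P (\<lambda>z. (c m (fst z)) ^ i * (c k (snd z)) ^ j) = E m (\<lambda>w. (c m w) ^ i) * E k (\<lambda>w. (c k w) ^ j)" for i j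
      by (rule expectation_pair_pmf_mult[OF int int])
    have "measure_pmf.expectation ?P (\<lambda>z. A z ^ 4) = q m + 6 * (E m (\<lambda>w. (c m w)\<^sup>2) * E k (\<lambda>w. (c k w)\<^sup>2)) + q k"
      unfolding A4 using ip[of 4 0] ip[of 3 1] ip[of 2 2] ip[of 1 3] ip[of 0 4] ep[of 4 0] ep[of 3 1] ep[of 2 2] ep[of 1 3] ep[of 0 4]
      by (simp add: c0 q_def)
    also have "\<dots> \<le> q m + 6 * ((S\<^sup>2 * m) * (S\<^sup>2 * k)) + q k"
      by (intro add_mono mult_mono c2 order_refl) auto
    finally have EA: "measure_pmf.expectation ?P (\<lambda>z. A z ^ 4) \<le> q m + 6 * ((S\<^sup>2 * m) * (S\<^sup>2 * k)) + q k" .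
    have iA: "integrable ?P (\<lambda>z. A z ^ 4)"
      unfolding A4 using ip[of 4 0] ip[of 3 1] ip[of 2 2] ip[of 1 3] ip[of 0 4] by (intro Bochner_Integration.integrable_add integrable_mult_right) (simp_all)
    have "q (m + k) = measure_pmf.expectation ?P (\<lambda>z. (c (m + k) (fst z @ snd z)) ^ 4)"
      unfolding q_def by (rule expectation_append)
    also have "\<dots> \<le> measure_pmf.expectation ?P (\<lambda>z. 3 / 2 * A z ^ 4 + 28561 * (2 * C) ^ 4 * real (m + k))"
    proof (rule integral_mono_AE)
      show "integrable ?P (\<lambda>z. (c (m + k) (fst z @ snd z)) ^ 4)"
        using int[of "m + k" 4] unfolding replicate_pmf_add integrable_map_pmf_eq .
      show "AE z in ?P. (c (m + k) (fst z @ snd z)) ^ 4 \<le> 3 / 2 * A z ^ 4 + 28561 * (2 * C) ^ 4 * real (m + k)"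
        by (rule AE_pmfI) (rule bound)
    qed (use iA in auto)
    also have "\<dots> = 3 / 2 * measure_pmf.expectation ?P (\<lambda>z. A z ^ 4) + 28561 * (2 * C) ^ 4 * real (m + k)"
      using iA by simp
    also have "\<dots> \<le> 3 / 2 * (q m + 6 * ((S\<^sup>2 * m) * (S\<^sup>2 * k)) + q k) + 28561 * (2 * C) ^ 4 * real (m + k)"
      using EA by (intro add_right_mono mult_left_mono) auto
    finally show ?thesis by (simp add: algebra_simps)
  qed
  define L where "L = 3 / 2 * 6 * (S\<^sup>2 * S\<^sup>2) + 28561 * (2 * C) ^ 4"
  have L0: "0 \<le> L" by (simp add: L_def)
  \<comment> \<open>The multiple of \<open>L\<close> absorbs the inhomogeneous term, since then
    \<open>15 / 16 * K + L \<le> K\<close>; the summand \<open>q 1\<close> covers the start of the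
    recursion.\<close>
  define K where "K = 16 * L + q 1 + q 0"
  have q0: "0 \<le> q n" for n by (simp add: q_def)
  have "q n \<le> K * (real n)\<^sup>2" for n
  proof (induction n rule: less_induct)
    case (less n)
    consider "n = 0" | "n = 1" | "2 \<le> n" by linarith
    then show ?case
    proof cases
      case 1
      have "q 0 = 0" by (simp add: q_def c_def)
      then show ?thesis using 1 by simp
    next
      case 2
      then show ?thesis using L0 q0[of 0] by (simp add: K_def)
    next
      case 3
      define m k where "m = n div 2" and "k = n - n div 2"
      have mk: "m < n" "k < n" "n = m + k" "real k \<le> real m + 1" "real m \<le> real k" using 3 by (auto simp: m_def k_def)
      have n: "real n = real m + real k" using mk by simp
      \<comment> \<open>The halves differ by at most 1, and \<open>1 \<le> n / 2\<close>; hence the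
        sum of squares is at most \<open>(1 + 1 / 4) / 2\<close> times \<open>n ^ 2\<close>.\<close>
      have sq: "(real m)\<^sup>2 + (real k)\<^sup>2 \<le> 5 / 8 * (real n)\<^sup>2"
      proof -
        have "(real k - real m)\<^sup>2 \<le> 1\<^sup>2" using mk by (intro power_mono) auto
        moreover have "2\<^sup>2 \<le> (real n)\<^sup>2" using 3 by (intro power_mono) auto
        moreover have "(real m)\<^sup>2 + (real k)\<^sup>2 = ((real n)\<^sup>2 + (real k - real m)\<^sup>2) / 2"
          unfolding n by (simp add: power2_eq_square algebra_simps)
        ultimately show ?thesis by simp
      qed
      have prod: "real m * real k \<le> (real n)\<^sup>2" unfolding n by (simp add: power2_eq_square algebra_simps)
      have lin: "real n \<le> (real n)\<^sup>2" using 3 by (simp add: power2_eq_square)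
      have K0: "0 \<le> K" using L0 q0[of 1] q0[of 0] by (simp add: K_def)
      have "q n \<le> 3 / 2 * (q m + q k + 6 * (S\<^sup>2 * m) * (S\<^sup>2 * k)) + 28561 * (2 * C) ^ 4 * real n"
        unfolding mk(3) by (rule step)
      also have "\<dots> \<le> 3 / 2 * (K * (real m)\<^sup>2 + K * (real k)\<^sup>2) + (3 / 2 * 6 * (S\<^sup>2 * S\<^sup>2) * (real m * real k) + 28561 * (2 * C) ^ 4 * real n)"
        using less.IH[OF mk(1)] less.IH[OF mk(2)] by (simp add: algebra_simps)
      also have "\<dots> \<le> 3 / 2 * (K * (5 / 8 * (real n)\<^sup>2)) + (3 / 2 * 6 * (S\<^sup>2 * S\<^sup>2) * (real n)\<^sup>2 + 28561 * (2 * C) ^ 4 * (real n)\<^sup>2)"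
      proof (intro add_mono mult_left_mono prod lin)
        show "K * (real m)\<^sup>2 + K * (real k)\<^sup>2 \<le> K * (5 / 8 * (real n)\<^sup>2)"
          using mult_left_mono[OF sq K0] by (simp add: distrib_left)
      qed auto
      also have "\<dots> = (15 / 16 * K + L) * (real n)\<^sup>2" by (simp add: L_def algebra_simps)
      also have "\<dots> \<le> K * (real n)\<^sup>2"
      proof (rule mult_right_mono)
        have "16 * L \<le> K" using q0[of 0] q0[of 1] by (simp add: K_def)
        then show "15 / 16 * K + L \<le> K" by linarith
      qed simp
      finally show ?thesis .
    qed
  qed
  moreover have "0 \<le> K" using L0 q0[of 1] q0[of 0] by (simp add: K_def)
  ultimately show ?thesis unfolding q_def c_def by blast
qed

end

context critical_offspring
begin

text \<open>Here \<open>lam\<close> is the asymptotic regression coefficient of \<open>G\<close> on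
  the walk. The central limit theorem gives limits of the normalised variances of \<open>G\<close>
  and of \<open>G\<close> plus the walk, and polarisation yields the limiting covariance
  \<open>cc\<close>. All other variances are quadratic forms in these quantities, and the choice
  \<open>lam = cc / step_var\<close> removes the mixed term.\<close>

lemma decorrelation:
  assumes G: "almost_additive G"
  shows "\<exists>lam \<sigma>. 0 \<le> \<sigma> \<and> (\<forall>a b. (\<lambda>n. (sd (W n) (\<lambda>w. a * (G w - lam * walk w) + b * walk w) / sqrt n)\<^sup>2)
    \<longlonglongrightarrow> a\<^sup>2 * \<sigma>\<^sup>2 + b\<^sup>2 * step_var)"
proof -
  define Vr where "Vr n Y = (sd (W n) Y / sqrt n)\<^sup>2" for n Y
  have lg: "linear_growth G" "linear_growth walk" using G almost_additive_walk by (auto simp: almost_additive_def)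
  have sq: "sq_int (W n) G" "sq_int (W n) walk" for n using lg by (auto intro: sq_int_linear_growth)
  define cv where "cv n = E n (\<lambda>w. (G w - E n G) * walk w)" for n
  have comb: "measure_pmf.variance (W n) (\<lambda>w. x * G w + y * walk w)
      = x\<^sup>2 * measure_pmf.variance (W n) G + y\<^sup>2 * (n * step_var) + 2 * x * y * cv n" for n x y
  proof -
    have m: "E n (\<lambda>w. x * G w + y * walk w) = x * E n G"
      using sq_int_integrable[OF sq(1)] sq_int_integrable[OF sq(2)] by (simp add: walk_law)
    have i: "integrable (W n) (\<lambda>w. (G w - E n G)\<^sup>2)" "integrable (W n) (\<lambda>w. (walk w)\<^sup>2)"
      "integrable (W n) (\<lambda>w. (G w - E n G) * walk w)"
      using sq_int_diff[OF sq(1) sq_int_const] sq sq_int_mult[OF sq_int_diff[OF sq(1) sq_int_const] sq(2)]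
      by (auto simp: sq_int_def)
    have "measure_pmf.variance (W n) (\<lambda>w. x * G w + y * walk w)
      = E n (\<lambda>w. x\<^sup>2 * (G w - E n G)\<^sup>2 + y\<^sup>2 * (walk w)\<^sup>2 + (2 * x * y) * ((G w - E n G) * walk w))"
      unfolding m by (intro Bochner_Integration.integral_cong refl) (simp add: power2_eq_square algebra_simps)
    also have "\<dots> = x\<^sup>2 * measure_pmf.variance (W n) G + y\<^sup>2 * E n (\<lambda>w. (walk w)\<^sup>2) + 2 * x * y * cv n"
      using i by (simp add: cv_def)
    also have "E n (\<lambda>w. (walk w)\<^sup>2) = n * step_var" using walk_law(2)[of n] unfolding walk_law(1) by simp
    finally show ?thesis .
  qed
  have Vr_eq: "Vr n Y = measure_pmf.variance (W n) Y / n" for n Y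
    by (simp add: Vr_def power_divide sd_sq)
  obtain s1 where s1: "(\<lambda>n. sd (W n) G / sqrt n) \<longlonglongrightarrow> s1" using almost_additive_CLT[OF G] by blast
  obtain s2 where s2: "(\<lambda>n. sd (W n) (\<lambda>w. 1 * G w + 1 * walk w) / sqrt n) \<longlonglongrightarrow> s2"
    using almost_additive_CLT[OF almost_additive_combination[OF G almost_additive_walk]] by blast
  have V1: "(\<lambda>n. Vr n G) \<longlonglongrightarrow> s1\<^sup>2" and V2: "(\<lambda>n. Vr n (\<lambda>w. 1 * G w + 1 * walk w)) \<longlonglongrightarrow> s2\<^sup>2"
    unfolding Vr_def by (intro tendsto_power s1 s2)+
  define cc where "cc = (s2\<^sup>2 - s1\<^sup>2 - step_var) / 2"
  have c: "(\<lambda>n. cv n / n) \<longlonglongrightarrow> cc"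
  proof (rule Lim_transform_eventually)
    show "(\<lambda>n. (Vr n (\<lambda>w. 1 * G w + 1 * walk w) - Vr n G - step_var) / 2) \<longlonglongrightarrow> cc"
      unfolding cc_def by (intro tendsto_divide tendsto_diff V1 V2 tendsto_const) simp
    show "\<forall>\<^sub>F n in sequentially. (Vr n (\<lambda>w. 1 * G w + 1 * walk w) - Vr n G - step_var) / 2 = cv n / n"
      using eventually_gt_at_top[of 0]
      by eventually_elim (simp only: Vr_eq comb, simp add: field_simps)
  qed
  define lam where "lam = cc / step_var"
  have lim: "(\<lambda>n. Vr n (\<lambda>w. a * (G w - lam * walk w) + b * walk w)) \<longlonglongrightarrow> a\<^sup>2 * (s1\<^sup>2 - cc\<^sup>2 / step_var) + b\<^sup>2 * step_var" for a b
  proof (rule Lim_transform_eventually)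
    have f: "(\<lambda>w. a * (G w - lam * walk w) + b * walk w) = (\<lambda>w. a * G w + (b - a * lam) * walk w)"
      by (simp add: fun_eq_iff algebra_simps)
    show "\<forall>\<^sub>F n in sequentially. a\<^sup>2 * Vr n G + (b - a * lam)\<^sup>2 * step_var + 2 * a * (b - a * lam) * (cv n / n) = Vr n (\<lambda>w. a * (G w - lam * walk w) + b * walk w)"
      using eventually_gt_at_top[of 0]
      by eventually_elim (simp only: Vr_eq f comb, simp add: add_divide_distrib)
    have "(\<lambda>n. a\<^sup>2 * Vr n G + (b - a * lam)\<^sup>2 * step_var + 2 * a * (b - a * lam) * (cv n / n))
      \<longlonglongrightarrow> a\<^sup>2 * s1\<^sup>2 + (b - a * lam)\<^sup>2 * step_var + 2 * a * (b - a * lam) * cc"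
      by (intro tendsto_intros V1 c)
    also have "a\<^sup>2 * s1\<^sup>2 + (b - a * lam)\<^sup>2 * step_var + 2 * a * (b - a * lam) * cc = a\<^sup>2 * (s1\<^sup>2 - cc\<^sup>2 / step_var) + b\<^sup>2 * step_var"
      using step_var_pos unfolding lam_def by (simp add: power2_eq_square field_simps)
    finally show "(\<lambda>n. a\<^sup>2 * Vr n G + (b - a * lam)\<^sup>2 * step_var + 2 * a * (b - a * lam) * (cv n / n))
      \<longlonglongrightarrow> a\<^sup>2 * (s1\<^sup>2 - cc\<^sup>2 / step_var) + b\<^sup>2 * step_var" .
  qed
  have nonneg: "0 \<le> s1\<^sup>2 - cc\<^sup>2 / step_var"
  proof -
    have "0 \<le> 1\<^sup>2 * (s1\<^sup>2 - cc\<^sup>2 / step_var) + 0\<^sup>2 * step_var"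
      by (rule LIMSEQ_le_const[OF lim]) (auto simp: Vr_def)
    then show ?thesis by simp
  qed
  show ?thesis
    by (rule exI[of _ lam], rule exI[of _ "sqrt (s1\<^sup>2 - cc\<^sup>2 / step_var)"])
      (use lim nonneg in \<open>simp add: Vr_def\<close>)
qed

context
  fixes Z :: "nat list \<Rightarrow> real" and \<sigma> :: real
  assumes Z: "almost_additive Z"
    and var: "\<And>a b. (\<lambda>n. (sd (W n) (\<lambda>w. a * Z w + b * walk w) / sqrt n)\<^sup>2) \<longlonglongrightarrow> a\<^sup>2 * \<sigma>\<^sup>2 + b\<^sup>2 * step_var"
begin

lemma sq_int_Z: "sq_int (W n) Z"
  using Z by (intro sq_int_linear_growth) (simp add: almost_additive_def)

text \<open>For constant coefficients this is the central limit theorem for the almost additive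
  combination \<open>a * Z + b * walk\<close>. Varying coefficients cost their change times a
  bounded normalised deviation; they occur later because a prefix of length \<open>m n\<close> is
  scaled by the square root of \<open>n\<close>.\<close>

lemma joint_char:
  assumes m: "filterlim m at_top sequentially" and a: "a' \<longlonglongrightarrow> a" and b: "b' \<longlonglongrightarrow> b"
  shows "(\<lambda>n. measure_pmf.expectation (W (m n)) (\<lambda>w. cis (a' n / sqrt (m n) * (Z w - E (m n) Z) + b' n / sqrt (m n) * walk w)))
    \<longlonglongrightarrow> exp (complex_of_real (- ((a\<^sup>2 * \<sigma>\<^sup>2 + b\<^sup>2 * step_var) / 2)))"
proof -
  define Y where "Y w = a * Z w + b * walk w" for w
  have Y: "almost_additive Y" unfolding Y_def by (rule almost_additive_combination[OF Z almost_additive_walk])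
  obtain s where s: "(\<lambda>n. sd (W n) Y / sqrt n) \<longlonglongrightarrow> s"
    and ch: "\<And>t. (\<lambda>n. measure_pmf.expectation (W n) (\<lambda>w. cis (t / sqrt n * (Y w - E n Y)))) \<longlonglongrightarrow> exp (- (complex_of_real (t\<^sup>2 * s\<^sup>2 / 2)))"
    using almost_additive_CLT[OF Y] by blast
  have "s\<^sup>2 = a\<^sup>2 * \<sigma>\<^sup>2 + b\<^sup>2 * step_var"
    using LIMSEQ_unique[OF tendsto_power[OF s, of 2]] var[of a b] unfolding Y_def by blast
  then have lim: "(\<lambda>n. measure_pmf.expectation (W (m n)) (\<lambda>w. cis (1 / sqrt (m n) * (Y w - E (m n) Y))))
      \<longlonglongrightarrow> exp (complex_of_real (- ((a\<^sup>2 * \<sigma>\<^sup>2 + b\<^sup>2 * step_var) / 2)))"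
    using filterlim_compose[OF ch[of 1] m] by simp
  have EY: "E n Y = a * E n Z" for n
    unfolding Y_def using sq_int_integrable[OF sq_int_Z] sq_int_integrable[OF sq_int_walk] by (simp add: walk_law)
  have "(\<lambda>n. measure_pmf.expectation (W (m n)) (\<lambda>w. cis (a' n / sqrt (m n) * (Z w - E (m n) Z) + b' n / sqrt (m n) * walk w))
      - measure_pmf.expectation (W (m n)) (\<lambda>w. cis (1 / sqrt (m n) * (Y w - E (m n) Y)))) \<longlonglongrightarrow> 0"
  proof (rule Lim_null_comparison)
    let ?e = "\<lambda>n. \<bar>a' n - a\<bar> * (sd (W (m n)) Z / sqrt (m n)) + \<bar>b' n - b\<bar> * (sd (W (m n)) walk / sqrt (m n))"
    show "\<forall>\<^sub>F n in sequentially. cmod (measure_pmf.expectation (W (m n)) (\<lambda>w. cis (a' n / sqrt (m n) * (Z w - E (m n) Z) + b' n / sqrt (m n) * walk w))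
      - measure_pmf.expectation (W (m n)) (\<lambda>w. cis (1 / sqrt (m n) * (Y w - E (m n) Y)))) \<le> ?e n"
    proof (intro always_eventually allI)
      fix n
      let ?m = "m n"
      have d: "(a' n / sqrt ?m * (Z w - E ?m Z) + b' n / sqrt ?m * walk w) - 1 / sqrt ?m * (Y w - E ?m Y)
          = ((a' n - a) / sqrt ?m) * (Z w - E ?m Z) + ((b' n - b) / sqrt ?m) * walk w" for w
        unfolding EY Y_def by (simp add: algebra_simps diff_divide_distrib add_divide_distrib)
      have sqs: "sq_int (W ?m) (\<lambda>w. ((a' n - a) / sqrt ?m) * (Z w - E ?m Z))" "sq_int (W ?m) (\<lambda>w. ((b' n - b) / sqrt ?m) * walk w)"
        by (intro sq_int_cmult sq_int_diff sq_int_Z sq_int_const sq_int_walk)+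
      have "cmod (measure_pmf.expectation (W ?m) (\<lambda>w. cis (a' n / sqrt ?m * (Z w - E ?m Z) + b' n / sqrt ?m * walk w))
        - measure_pmf.expectation (W ?m) (\<lambda>w. cis (1 / sqrt ?m * (Y w - E ?m Y))))
        \<le> l2 (W ?m) (\<lambda>w. ((a' n - a) / sqrt ?m) * (Z w - E ?m Z) + ((b' n - b) / sqrt ?m) * walk w)"
        unfolding d[symmetric] by (rule norm_expectation_cis_diff_le) (use sq_int_add[OF sqs] in \<open>simp only: d\<close>)
      also have "\<dots> \<le> l2 (W ?m) (\<lambda>w. ((a' n - a) / sqrt ?m) * (Z w - E ?m Z)) + l2 (W ?m) (\<lambda>w. ((b' n - b) / sqrt ?m) * walk w)"
        by (rule l2_triangle[OF sqs])
      also have "\<dots> = \<bar>(a' n - a) / sqrt ?m\<bar> * sd (W ?m) Z + \<bar>(b' n - b) / sqrt ?m\<bar> * sd (W ?m) walk"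
        unfolding l2_cmult sd_eq_l2 walk_law(1) by simp
      also have "\<dots> = ?e n" by (simp add: abs_divide)
      finally show "cmod (measure_pmf.expectation (W ?m) (\<lambda>w. cis (a' n / sqrt ?m * (Z w - E ?m Z) + b' n / sqrt ?m * walk w))
        - measure_pmf.expectation (W ?m) (\<lambda>w. cis (1 / sqrt ?m * (Y w - E ?m Y)))) \<le> ?e n" .
    qed
    obtain z1 where z1: "(\<lambda>n. sd (W n) Z / sqrt n) \<longlonglongrightarrow> z1" using almost_additive_CLT[OF Z] by blast
    obtain z2 where z2: "(\<lambda>n. sd (W n) walk / sqrt n) \<longlonglongrightarrow> z2" using almost_additive_CLT[OF almost_additive_walk] by blast
    have "?e \<longlonglongrightarrow> \<bar>a - a\<bar> * z1 + \<bar>b - b\<bar> * z2"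
      by (intro tendsto_add tendsto_mult tendsto_rabs tendsto_diff a b tendsto_const
          filterlim_compose[OF z1 m] filterlim_compose[OF z2 m])
    then show "?e \<longlonglongrightarrow> 0" by simp
  qed
  from tendsto_add[OF this lim] show ?thesis by simp
qed

end

end

section \<open>Positivity of the asymptotic variance\<close>

text \<open>Concavity of the logarithm: \<open>(1 + b') / (1 + b)\<close> is the mean of
  \<open>b' / b\<close> and 1 with weights \<open>b / (1 + b)\<close> and
  \<open>1 / (1 + b)\<close>. The left factor is the damping when a change of value passes to the
  parent.\<close>

lemma ln_ratio_contraction:
  fixes b b' :: real
  assumes "0 < b" "b \<le> b'"
  shows "b / (1 + b) * ln (b' / b) \<le> ln ((1 + b') / (1 + b))"
proof -
  define \<theta> y z where "\<theta> = b / (1 + b)" and "y = b' / b" and "z = (1 + b') / (1 + b)"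
  have pos: "0 < y" "0 < z" "0 \<le> \<theta>" "0 \<le> 1 - \<theta>" using assms by (auto simp: y_def z_def \<theta>_def field_simps)
  have z: "z = \<theta> * y + (1 - \<theta>)" using assms by (simp add: y_def z_def \<theta>_def field_simps)
  have "\<theta> * ln (y / z) + (1 - \<theta>) * ln (1 / z) \<le> \<theta> * (y / z - 1) + (1 - \<theta>) * (1 / z - 1)"
    using pos by (intro add_mono mult_left_mono ln_le_minus_one) auto
  also have "\<dots> = (\<theta> * y + (1 - \<theta>)) / z - 1" using pos by (simp add: field_simps)
  also have "\<dots> = 0" using pos by (simp flip: z)
  finally have "\<theta> * ln y \<le> ln z" using pos by (simp add: ln_div algebra_simps)
  then show ?thesis by (simp add: \<theta>_def y_def z_def)
qed

lemma prod_list_one_plus_ge_power2: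
  "\<forall>x\<in>set xs. 1 \<le> x \<Longrightarrow> 2 ^ length xs \<le> (\<Prod>x\<leftarrow>xs. 1 + x :: real)"
proof (induction xs)
  case (Cons a xs)
  then have "2 * 2 ^ length xs \<le> (1 + a) * (\<Prod>x\<leftarrow>xs. 1 + x)" by (intro mult_mono) auto
  then show ?case by simp
qed simp

lemma sum_list_tree_word: "sum_list (tree_word t) + 1 = length (tree_word t)"
proof -
  have "valid_from (tree_word t) 0" using valid_from_tree_word[of t "[]" 0] by simp
  then have "excess (tree_word t) = 1" by (simp add: valid_from_iff)
  then show ?thesis by (simp add: excess_eq)
qed

abbreviation word_total :: "nat list \<Rightarrow> real" where
  "word_total w \<equiv> word_gain w []"

lemma almost_additive_word_total: "almost_additive word_total"
proof -
  have "\<bar>word_total w\<bar> \<le> 1 * (real (sum_list w) + real (length w))" for w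
    using word_gain_bounds[of "[]" w] by simp
  then have "linear_growth word_total" unfolding linear_growth_def by blast
  moreover have "\<bar>word_total (x @ y) - word_total x - word_total y\<bar> \<le> 4 * fourth_root (length x + length y)" for x y
  proof -
    have "ln (1 + real (length y)) \<le> 4 * fourth_root (length y)" by (rule ln_le_fourth_root)
    also have "\<dots> \<le> 4 * fourth_root (length x + length y)" by (simp add: fourth_root_mono)
    finally show ?thesis using word_gain_almost_additive[of x y] by linarith
  qed
  ultimately show ?thesis unfolding almost_additive_def by blast
qed

context critical_offspring
begin

definition branching_prob :: real where
  "branching_prob = measure_pmf.prob p {2..}"

lemma branching_prob_pos: "0 < branching_prob" and branching_prob_le_1: "branching_prob \<le> 1"
proof -
  have "branching_prob \<noteq> 0" using ex_support_ge_2 by (auto simp: branching_prob_def measure_pmf_zero_iff)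
  then show "0 < branching_prob" by (simp add: branching_prob_def less_le)
qed (simp add: branching_prob_def)

lemma integrable_word_gain:
  assumes "\<forall>x\<in>set s. 1 \<le> x"
  shows "integrable (W n) (\<lambda>w. word_gain w s)"
  by (rule integrable_pmf_bounded[where B="real n"])
    (use word_gain_bounds[OF assms] in \<open>fastforce simp: abs_le_iff dest!: length_replicate_pmf\<close>)

text \<open>
  The difference is transported along the chain of ancestors of the changed entry. Each ancestor
  \<open>b\<close> damps it by at most the factor \<open>b / (1 + b)\<close>, and \<open>b\<close> doubles with probability at least
  \<open>branching_prob\<close>, which makes \<open>1 - K / b\<close> a submartingale weight.
\<close>
lemma expected_gain_difference:
  fixes K :: real
  assumes K: "K = 2 / branching_prob"
    and st: "\<forall>x\<in>set (pre @ a # post). 1 \<le> x" and a: "K \<le> a" "a \<le> a'"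
  shows "- (ln ((1 + a') / (1 + a)) * (K / a)) \<le> E n (\<lambda>w. word_gain w (pre @ a' # post) - word_gain w (pre @ a # post))"
  using st a
proof (induction n arbitrary: pre a a' post)
  case 0
  have "2 \<le> K" unfolding K using branching_prob_pos branching_prob_le_1 by (simp add: le_divide_eq)
  moreover have "0 \<le> ln ((1 + a') / (1 + a))" using 0 \<open>2 \<le> K\<close> by (simp add: field_simps)
  ultimately show ?case using 0 by simp
next
  case (Suc n)
  define s s' where "s = pre @ a # post" and "s' = pre @ a' # post"
  define l where "l = ln ((1 + a') / (1 + a))"
  have K2: "2 \<le> K" unfolding K using branching_prob_pos branching_prob_le_1 by (simp add: le_divide_eq)
  have a0: "0 < a" "0 < K" using Suc.prems K2 by auto
  have l0: "0 \<le> l" using Suc.prems a0 by (simp add: l_def field_simps)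
  have ge: "\<forall>x\<in>set s. 1 \<le> x" "\<forall>x\<in>set s'. 1 \<le> x" using Suc.prems K2 by (auto simp: s_def s'_def)
  \<comment> \<open>The expected later effect of the change, conditioned on the next letter
    \<open>d\<close>.\<close>
  define h where "h d = step_gain d s' - step_gain d s + E n (\<lambda>w. word_gain w (stack_step d s') - word_gain w (stack_step d s))" for d
  have step_ge: "\<forall>x\<in>set (stack_step d s). 1 \<le> x" "\<forall>x\<in>set (stack_step d s'). 1 \<le> x" for d
    using stack_step_ge_1[OF ge(1)] stack_step_ge_1[OF ge(2)] by auto
  have Eq: "E (Suc n) (\<lambda>w. word_gain w s' - word_gain w s) = measure_pmf.expectation p h"
  proof -
    have "integrable (pair_pmf p (W n)) (\<lambda>z. word_gain (fst z # snd z) s' - word_gain (fst z # snd z) s)"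
      using Bochner_Integration.integrable_diff[OF integrable_word_gain[OF ge(2), of "Suc n"] integrable_word_gain[OF ge(1), of "Suc n"]]
      unfolding replicate_pmf_Suc integrable_map_pmf_eq .
    then have "E (Suc n) (\<lambda>w. word_gain w s' - word_gain w s)
        = measure_pmf.expectation p (\<lambda>d. E n (\<lambda>w. word_gain (d # w) s' - word_gain (d # w) s))"
      unfolding replicate_pmf_Suc integral_map_pmf by (subst expectation_pair_pmf) auto
    also have "(\<lambda>d. E n (\<lambda>w. word_gain (d # w) s' - word_gain (d # w) s)) = h"
    proof
      fix d
      have "E n (\<lambda>w. word_gain (d # w) s' - word_gain (d # w) s)
          = E n (\<lambda>w. (step_gain d s' - step_gain d s) + (word_gain w (stack_step d s') - word_gain w (stack_step d s)))"
        by (simp add: algebra_simps)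
      also have "\<dots> = h d" unfolding h_def
        using integrable_word_gain[OF step_ge(1), of n d] integrable_word_gain[OF step_ge(2), of n d] by simp
      finally show "E n (\<lambda>w. word_gain (d # w) s' - word_gain (d # w) s) = h d" .
    qed
    finally show ?thesis .
  qed
  have small: "- (l * (K / a)) \<le> h d" if "d \<le> length pre" for d
  proof -
    define pre' where "pre' = (\<Prod>x\<leftarrow>take d pre. 1 + x) # drop d pre"
    have st: "stack_step d s = pre' @ a # post" "stack_step d s' = pre' @ a' # post" "step_gain d s' = step_gain d s"
      using that by (auto simp: s_def s'_def stack_step_def step_gain_def pre'_def)
    show ?thesis
      unfolding h_def st l_def using Suc.IH[of pre' a post a'] step_ge(1)[of d] Suc.prems(2,3) by (simp add: st)
  qed
  \<comment> \<open>The letter takes the changed entry as a child and replaces it by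
    \<open>b = c * (1 + a)\<close>. Its own gain changes by \<open>lb - l\<close>, since
    \<open>l\<close> is also the logarithm of \<open>b' / b\<close>. The induction hypothesis for
    \<open>b\<close> and \<open>ln_ratio_contraction\<close> then bound the loss by the fraction
    \<open>(K + 1) / (b + 1)\<close> of \<open>l\<close>.\<close>
  have absorb: "- (l * ((K + 1) / (c * (1 + a) + 1))) \<le> h d"
    if d: "length pre < d" "d \<le> length s" and c: "c = (\<Prod>x\<leftarrow>pre. 1 + x) * (\<Prod>x\<leftarrow>take (d - length pre - 1) post. 1 + x)" for d c
  proof -
    define e where "e = d - length pre - 1"
    have de: "d = length pre + Suc e" using d by (simp add: e_def)
    have "1 * 1 \<le> c" unfolding c using Suc.prems
      by (intro mult_mono prod_list_one_plus_ge_1) (auto dest: in_set_takeD intro: order_trans[OF _ prod_list_one_plus_ge_1])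
    then have c1: "1 \<le> c" by simp
    define b b' where "b = c * (1 + a)" and "b' = c * (1 + a')"
    have "1 * (1 + a) \<le> b" unfolding b_def using c1 a0 by (intro mult_right_mono) auto
    then have b: "1 + a \<le> b" "b \<le> b'" "0 < b" using c1 Suc.prems a0 by (auto simp: b_def b'_def)
    have len: "d \<le> length s" "d \<le> length s'" using d by (auto simp: s_def s'_def)
    have tk: "take d (pre @ x # post) = pre @ x # take e post" "drop d (pre @ x # post) = drop e post" for x
      by (auto simp: de)
    have prods: "(\<Prod>x\<leftarrow>take d s. 1 + x) = b" "(\<Prod>x\<leftarrow>take d s'. 1 + x) = b'"
      unfolding s_def s'_def tk b_def b'_def c e_def[symmetric] by (simp_all add: mult_ac)
    have st: "stack_step d s = [] @ b # drop e post" "stack_step d s' = [] @ b' # drop e post"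
      "step_gain d s = ln (1 + 1 / b)" "step_gain d s' = ln (1 + 1 / b')"
      using len by (simp_all add: stack_step_def step_gain_def prods)
        (simp_all add: s_def s'_def tk del: drop_append take_append)
    define lb where "lb = ln ((1 + b') / (1 + b))"
    have lb0: "0 \<le> lb" using b by (simp add: lb_def field_simps)
    have "- (lb * (K / b)) \<le> E n (\<lambda>w. word_gain w (stack_step d s') - word_gain w (stack_step d s))"
      unfolding st(1,2) lb_def using step_ge(1)[of d] b a(1) Suc.prems(2) by (intro Suc.IH) (auto simp: st)
    moreover have "ln (1 + 1 / b') - ln (1 + 1 / b) = lb - l"
    proof -
      have "l = ln (b' / b)" using c1 by (simp add: l_def b_def b'_def)
      moreover have "1 + 1 / b' = (1 + b') / b'" "1 + 1 / b = (1 + b) / b" using b by (auto simp: field_simps)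
      ultimately show ?thesis using b by (simp add: lb_def ln_div)
    qed
    ultimately have "lb * (1 - K / b) - l \<le> h d" unfolding h_def st(3,4) by (simp add: algebra_simps)
    moreover have "l * (1 - (K + 1) / (b + 1)) \<le> lb * (1 - K / b)"
    proof -
      have "b / (1 + b) * l \<le> lb"
        using ln_ratio_contraction[of b b'] b c1 by (simp add: lb_def l_def b_def b'_def)
      then have "b / (1 + b) * l * (1 - K / b) \<le> lb * (1 - K / b)"
        using b Suc.prems a0 by (intro mult_right_mono) (auto simp: field_simps)
      moreover have "b / (1 + b) * (1 - K / b) = 1 - (K + 1) / (b + 1)"
      proof -
        have "b / (1 + b) * (1 - K / b) = (b - K) / (1 + b)" using b by (simp add: right_diff_distrib diff_divide_distrib)
        moreover have "1 - (K + 1) / (b + 1) = (b - K) / (1 + b)" using b a0 by (simp add: field_simps)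
        ultimately show ?thesis by simp
      qed
      ultimately show ?thesis by (metis mult.commute mult.assoc)
    qed
    ultimately show ?thesis by (simp add: b_def algebra_simps)
  qed
  have clear: "h d = 0" if "length s < d" for d
  proof -
    have "stack_step d s = stack_step d s'" "step_gain d s = step_gain d s'"
      using that by (auto simp: stack_step_def step_gain_def s_def s'_def)
    then show ?thesis by (simp add: h_def)
  qed
  \<comment> \<open>A parent with at least two children has a sibling factor of at least 2 next to
    \<open>1 + a\<close>.\<close>
  have absorb2: "- (l * ((K + 1) / (2 * a + 3))) \<le> h d" if d: "length pre < d" "2 \<le> d" for d
  proof (cases "d \<le> length s")
    case True
    define c where "c = (\<Prod>x\<leftarrow>pre. 1 + x) * (\<Prod>x\<leftarrow>take (d - length pre - 1) post. 1 + x)"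
    have "2 ^ length pre * 2 ^ length (take (d - length pre - 1) post) \<le> c" unfolding c_def
      using Suc.prems
      by (intro mult_mono prod_list_one_plus_ge_power2) (auto dest: in_set_takeD intro: order_trans[OF _ prod_list_one_plus_ge_1])
    moreover have "length pre + length (take (d - length pre - 1) post) = d - 1"
      using True d by (simp add: s_def)
    ultimately have "2 ^ (d - 1) \<le> c" by (metis power_add)
    moreover have "(2 :: real) ^ 1 \<le> 2 ^ (d - 1)" using d by (intro power_increasing) auto
    ultimately have "2 \<le> c" by simp
    then have "2 * (1 + a) \<le> c * (1 + a)" using a0 by (intro mult_right_mono) auto
    then have "(K + 1) / (c * (1 + a) + 1) \<le> (K + 1) / (2 * a + 3)"
      using a0 by (intro divide_left_mono) (auto intro!: mult_pos_pos add_pos_pos)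
    then have "l * ((K + 1) / (c * (1 + a) + 1)) \<le> l * ((K + 1) / (2 * a + 3))"
      using l0 by (intro mult_left_mono)
    then show ?thesis using absorb[OF d(1) True c_def] by linarith
  next
    case False
    then show ?thesis using clear[of d] l0 a0 by simp
  qed
  have "integrable p h"
  proof (rule integrable_pmf_bounded)
    fix d
    have "\<bar>E n (\<lambda>w. word_gain w (stack_step d s') - word_gain w (stack_step d s))\<bar> \<le> E n (\<lambda>w. real n)"
    proof (rule order_trans[OF integral_abs_bound integral_mono_AE])
      show "AE w in W n. \<bar>word_gain w (stack_step d s') - word_gain w (stack_step d s)\<bar> \<le> real n"
      proof (rule AE_pmfI)
        fix w assume "w \<in> set_pmf (W n)"
        then show "\<bar>word_gain w (stack_step d s') - word_gain w (stack_step d s)\<bar> \<le> real n"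
          using word_gain_bounds[OF step_ge(1)[of d], of w] word_gain_bounds[OF step_ge(2)[of d], of w]
          by (auto simp: abs_le_iff dest!: length_replicate_pmf)
      qed
    qed (use integrable_word_gain[OF step_ge(1)] integrable_word_gain[OF step_ge(2)] in auto)
    then show "norm (h d) \<le> 1 + real n"
      using step_gain_bounds[OF ge(1), of d] step_gain_bounds[OF ge(2), of d]
      unfolding h_def by simp
  qed
  note inth = this
  have "- (l * (K / a)) \<le> measure_pmf.expectation p h"
  proof (cases "pre = []")
    case False
    have "- (l * (K / a)) \<le> h d" for d
    proof (cases "d \<le> length pre")
      case False
      with \<open>pre \<noteq> []\<close> have "2 \<le> d" by (cases pre) auto
      have "1 * a \<le> K * a" using a0 K2 by (intro mult_right_mono) auto
      then have "a \<le> K * a + K * 3" using a0 by linarith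
      then have "(K + 1) / (2 * a + 3) \<le> K / a" using a0 by (simp add: field_simps)
      then have "l * ((K + 1) / (2 * a + 3)) \<le> l * (K / a)" using l0 by (intro mult_left_mono)
      then show ?thesis using absorb2[of d] False \<open>2 \<le> d\<close> by simp
    qed (rule small)
    then have "measure_pmf.expectation p (\<lambda>_. - (l * (K / a))) \<le> measure_pmf.expectation p h"
      using inth by (intro integral_mono) auto
    then show ?thesis by simp
  next
    case True
    \<comment> \<open>The changed entry is on top. A letter 0 leaves it alone, a letter 1 raises the
      cost slightly to at most \<open>(K + 1) / a\<close>, and larger letters halve that cost. Only
      the average over the letter is good enough: \<open>K * branching_prob = 2\<close> makes the
      saving from branching outweigh the extra 1 in \<open>K + 1\<close>.\<close>
    define r where "r d = K / a * indicator {0} d + (K + 1) / a * indicator {1} d + (K + 1) / (2 * a) * indicator {2..} d" for d :: nat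
    have "- (l * r d) \<le> h d" for d
    proof -
      consider "d = 0" | "d = 1" | "2 \<le> d" by linarith
      then show ?thesis
      proof cases
        case 1 then show ?thesis using small[of 0] by (simp add: r_def)
      next
        case 2
        have "- (l * ((K + 1) / (1 * (1 + a) + 1))) \<le> h 1"
          by (rule absorb) (simp_all add: True s_def)
        moreover have "l * ((K + 1) / (1 * (1 + a) + 1)) \<le> l * ((K + 1) / a)"
          using l0 a0 by (intro mult_left_mono divide_left_mono) auto
        ultimately show ?thesis using 2 by (simp add: r_def)
      next
        case 3
        have "l * ((K + 1) / (2 * a + 3)) \<le> l * ((K + 1) / (2 * a))"
          using l0 a0 by (intro mult_left_mono divide_left_mono) auto
        then show ?thesis using absorb2[of d] 3 True by (simp add: r_def)
      qed
    qed
    moreover have ind: "integrable p (indicator A :: nat \<Rightarrow> real)" for A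
      by (rule integrable_pmf_bounded[of _ _ 1]) (simp add: indicator_def)
    have intr: "integrable p (\<lambda>d. - (l * r d))"
      unfolding r_def by (intro integrable_minus integrable_mult_right Bochner_Integration.integrable_add ind)
    ultimately have "measure_pmf.expectation p (\<lambda>d. - (l * r d)) \<le> measure_pmf.expectation p h"
      using inth intr by (intro integral_mono) auto
    moreover have "measure_pmf.expectation p (\<lambda>d. - (l * r d)) = - (l * measure_pmf.expectation p r)" by simp
    moreover have "measure_pmf.expectation p r \<le> K / a"
    proof -
      define p0 p1 where "p0 = measure_pmf.prob p {0}" and "p1 = measure_pmf.prob p {1}"
      have "{0} \<union> {1} \<union> {2..} = (UNIV :: nat set)" by auto
      then have tot: "p0 + p1 + branching_prob = 1"
        unfolding p0_def p1_def branching_prob_def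
        by (subst measure_pmf.finite_measure_Union[symmetric], auto)+
      have "measure_pmf.expectation p r = K / a * p0 + (K + 1) / a * p1 + (K + 1) / (2 * a) * branching_prob"
        unfolding r_def p0_def p1_def branching_prob_def using ind[of "{0}"] ind[of "{1}"] ind[of "{2..}"] by simp
      also have "\<dots> = (K * p0 + (K + 1) * (p1 + branching_prob / 2)) / a" using a0 by (simp add: field_simps)
      also have "(K + 1) * (p1 + branching_prob / 2) \<le> K * (p1 + branching_prob)"
      proof -
        have "K * branching_prob = 2" using K branching_prob_pos by simp
        then have "(K + 1) * (p1 + branching_prob / 2) = K * p1 + 1 + p1 + branching_prob / 2"
          "K * (p1 + branching_prob) = K * p1 + 2" by (simp_all add: algebra_simps)
        moreover have "0 \<le> p0" by (simp add: p0_def)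
        then have "p1 + branching_prob / 2 \<le> 1" using tot branching_prob_pos by linarith
        ultimately show ?thesis by linarith
      qed
      also have "K * p0 + K * (p1 + branching_prob) = K" using tot by (simp flip: distrib_left add: add.assoc)
      finally show ?thesis using a0 by (simp add: divide_right_mono)
    qed
    then have "l * measure_pmf.expectation p r \<le> l * (K / a)" using l0 by (intro mult_left_mono)
    ultimately show ?thesis by linarith
  qed
  then show ?case using Eq by (simp add: l_def s_def s'_def)
qed

end

section \<open>A pair of exchangeable trees\<close>

definition chain_tree :: "nat \<Rightarrow> plane_tree \<Rightarrow> plane_tree" where
  "chain_tree k t = Node (t # replicate (k - 1) (Node []))"

lemma concat_leaves: "concat (map tree_word (replicate m (Node []))) = replicate m 0"
  by (induction m) auto

lemma prod_list_leaves: "(\<Prod>t\<leftarrow>replicate m (Node []). Suc (root_count t)) = 2 ^ m"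
  by (induction m) auto

lemma chain_tree_simps:
  assumes "1 \<le> k"
  shows "tree_word (chain_tree k t) = tree_word t @ replicate (k - 1) 0 @ [k]"
    and "root_count (chain_tree k t) = (1 + root_count t) * 2 ^ (k - 1)"
  using assms by (simp_all add: chain_tree_def concat_leaves prod_list_leaves del: map_replicate)

text \<open>Both trees have three inner nodes with \<open>k\<close> children each, arranged in
  \<open>t\<close> as a path and in \<open>t'\<close> as a root with two inner children. With
  \<open>y = 2 ^ (k - 2)\<close> the values of \<open>R\<close> differ by
  \<open>4 * y ^ 2 - y > 0\<close>. Grafting both onto the same chains makes the values as large as
  desired, and keeps the lengths equal and the order strict.\<close>

lemma ex_exchangeable_trees:
  assumes k: "2 \<le> k"
  shows "\<exists>t t'. set (tree_word t) \<subseteq> {0, k} \<and> set (tree_word t') \<subseteq> {0, k} \<and>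
    length (tree_word t) = length (tree_word t') \<and> N < root_count t \<and> root_count t < root_count t'"
proof -
  obtain i where i: "k = Suc (Suc i)" using k by (metis add_2_eq_Suc le_Suc_ex)
  define y :: nat where "y = 2 ^ i"
  have y: "1 \<le> y" by (simp add: y_def)
  define c where "c = Node (replicate k (Node []))"
  have c: "tree_word c = replicate k 0 @ [k]" "root_count c = 4 * y"
    by (simp_all add: c_def concat_leaves prod_list_leaves i y_def del: map_replicate)
  define t where "t = chain_tree k (chain_tree k c)"
  define t' where "t' = Node (c # c # replicate i (Node []))"
  have t: "set (tree_word t) \<subseteq> {0, k}" "length (tree_word t) = 3 * k + 1" "root_count t = (1 + (1 + 4 * y) * (2 * y)) * (2 * y)"
    using k unfolding t_def by (auto simp: chain_tree_simps c y_def i)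
  have t': "set (tree_word t') \<subseteq> {0, k}" "length (tree_word t') = 3 * k + 1" "root_count t' = (1 + 4 * y) * ((1 + 4 * y) * y)"
    unfolding t'_def by (auto simp: c concat_leaves prod_list_leaves i y_def simp del: map_replicate)
  have lt: "root_count t < root_count t'"
  proof -
    have "0 < y * y * 2 + y * (2 * y - 1)" using y by simp
    then have "(1 + (1 + 4 * y) * (2 * y)) * (2 * y) < (1 + 4 * y) * ((1 + 4 * y) * y)"
      using y by (cases y) (auto simp: algebra_simps)
    then show ?thesis by (simp add: t t')
  qed
  define T T' where "T j = (chain_tree k ^^ j) t" and "T' j = (chain_tree k ^^ j) t'" for j
  have "set (tree_word (T j)) \<subseteq> {0, k} \<and> set (tree_word (T' j)) \<subseteq> {0, k} \<and>
    length (tree_word (T j)) = length (tree_word (T' j)) \<and> j \<le> root_count (T j) \<and> root_count (T j) < root_count (T' j)" for j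
  proof (induction j)
    case 0
    show ?case using t t' lt by (simp add: T_def T'_def)
  next
    case (Suc j)
    have eq: "T (Suc j) = chain_tree k (T j)" "T' (Suc j) = chain_tree k (T' j)" by (simp_all add: T_def T'_def)
    have "(1 + root_count (T j)) * 1 \<le> (1 + root_count (T j)) * 2 ^ (k - 1)" by (intro mult_left_mono) auto
    then show ?case using Suc k unfolding eq by (auto simp: chain_tree_simps)
  qed
  from this[of "Suc N"] show ?thesis by (metis Suc_le_lessD)
qed

context critical_offspring
begin

text \<open>The exchange itself gains the logarithm of \<open>(1 + a') / (1 + a)\<close>, and by
  \<open>expected_gain_difference\<close> the random letters that follow destroy at most the
  fraction \<open>2 / branching_prob / a\<close> of it in the mean. The prefix \<open>v\<close> is
  arbitrary, so the estimate holds conditionally on the past.\<close>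

lemma expected_exchange:
  assumes len: "length (tree_word t) = length (tree_word t')"
    and lt: "2 / branching_prob < root_count t" "root_count t < root_count t'"
  defines "a \<equiv> real (root_count t)" and "a' \<equiv> real (root_count t')"
  shows "ln ((1 + a') / (1 + a)) * (1 - 2 / branching_prob / a)
    \<le> E n (\<lambda>u. word_total (v @ tree_word t' @ u) - word_total (v @ tree_word t @ u))"
proof -
  define st where "st = stack_after v []"
  have st: "\<forall>x\<in>set st. 1 \<le> x" unfolding st_def by (rule stack_after_ge_1) simp
  have a1: "1 \<le> a" "1 \<le> a'" using root_count_pos[of t] root_count_pos[of t'] by (auto simp: a_def a'_def)
  have split: "word_total (v @ tree_word t' @ u) - word_total (v @ tree_word t @ u)
    = ln ((1 + a') / (1 + a)) + (word_gain u ([] @ a' # st) - word_gain u ([] @ a # st))" for u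
    using a1 tree_word_stack[of t' u st] tree_word_stack[of t u st]
    by (simp add: word_gain_append[of v] st_def[symmetric] a_def a'_def ln_div)
  have "- (ln ((1 + a') / (1 + a)) * (2 / branching_prob / a)) \<le> E n (\<lambda>u. word_gain u ([] @ a' # st) - word_gain u ([] @ a # st))"
    by (rule expected_gain_difference) (use st a1 lt in \<open>auto simp: a_def a'_def\<close>)
  moreover have "E n (\<lambda>u. word_total (v @ tree_word t' @ u) - word_total (v @ tree_word t @ u))
    = ln ((1 + a') / (1 + a)) + E n (\<lambda>u. word_gain u ([] @ a' # st) - word_gain u ([] @ a # st))"
    unfolding split using integrable_word_gain[of "a' # st" n] integrable_word_gain[of "a # st" n] st a1 by simp
  ultimately show ?thesis by (simp add: algebra_simps)
qed

text \<open>
  Cauchy--Schwarz against the block sum of a function \<open>\<phi>\<close> that has mean zero, is orthogonal to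
  the walk, and compares the two exchangeable trees.
\<close>
lemma sd_lower_bound:
  "\<exists>b c. 0 < b \<and> 0 < c \<and> (\<forall>M. c * sqrt (real M) \<le> sd (W (M * b)) (\<lambda>w. word_total w - lam * walk w))"
proof -
  obtain k where k: "k \<in> set_pmf p" "2 \<le> k" using ex_support_ge_2 by blast
  obtain N :: nat where N: "2 / branching_prob < N" using reals_Archimedean2 by blast
  obtain t t' where tt: "set (tree_word t) \<subseteq> {0, k}" "set (tree_word t') \<subseteq> {0, k}"
    "length (tree_word t) = length (tree_word t')" "N < root_count t" "root_count t < root_count t'"
    using ex_exchangeable_trees[OF k(2), of N] by (elim exE conjE)
  define x x' b where "x = tree_word t" and "x' = tree_word t'" and "b = length x"
  have Nt: "2 / branching_prob < root_count t" using N tt(4) by linarith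
  define \<delta> where "\<delta> = ln ((1 + real (root_count t')) / (1 + real (root_count t))) * (1 - 2 / branching_prob / real (root_count t))"
  have \<delta>: "0 < \<delta>" unfolding \<delta>_def
    using Nt tt(5) branching_prob_pos by (intro mult_pos_pos) (auto simp: field_simps)
  have b: "0 < b" "length x = b" "length x' = b" using tt(3) by (auto simp: b_def x_def x'_def) (cases t, simp)
  have xx: "x \<noteq> x'" using tt(5) inj_tree_word by (auto simp: x_def x'_def dest: injD)
  have walk_x: "walk x = - 1" "walk x' = - 1"
  proof -
    have "real (sum_list x) + 1 = real (length x)" "real (sum_list x') + 1 = real (length x')"
      unfolding x_def x'_def using sum_list_tree_word by (metis of_nat_1 of_nat_add)+
    then show "walk x = - 1" "walk x' = - 1" by (simp_all add: walk_def)
  qed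
  define \<pi> \<pi>' where "\<pi> = pmf (W b) x" and "\<pi>' = pmf (W b) x'"
  have "x \<in> set_pmf (W b)" "x' \<in> set_pmf (W b)"
    using tt(1,2) k zero_in_support b by (auto simp: set_replicate_pmf x_def x'_def)
  then have \<pi>: "0 < \<pi>" "0 < \<pi>'" by (auto simp: \<pi>_def \<pi>'_def pmf_positive)
  \<comment> \<open>The weights are inverse probabilities, so that pairing with
    \<open>\<phi>\<close> evaluates a function at \<open>x'\<close> minus its value at
    \<open>x\<close>.\<close>
  define \<phi> where "\<phi> y = (if y = x' then 1 / \<pi>' else if y = x then - (1 / \<pi>) else 0)" for y
  have E\<phi>: "measure_pmf.expectation (W b) (\<lambda>y. \<phi> y * g y) = g x' - g x" for g
    using \<pi> xx by (subst integral_measure_pmf_real[of "{x, x'}"]) (auto simp: \<phi>_def \<pi>_def \<pi>'_def split: if_splits)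
  have \<phi>lg: "linear_growth \<phi>"
  proof -
    have "\<bar>\<phi> w\<bar> \<le> (1 / \<pi> + 1 / \<pi>') * (real (sum_list w) + real (length w))" for w
    proof (cases "w = x \<or> w = x'")
      case True
      then have "length w = b" using b by auto
      then have "1 \<le> real (length w)" using b(1) by simp
      then have "1 \<le> real (sum_list w) + real (length w)" by linarith
      moreover have "\<bar>\<phi> w\<bar> \<le> 1 / \<pi> + 1 / \<pi>'" using \<pi> by (auto simp: \<phi>_def)
      moreover have "0 \<le> 1 / \<pi> + 1 / \<pi>'" using \<pi> by simp
      ultimately have "(1 / \<pi> + 1 / \<pi>') * 1 \<le> (1 / \<pi> + 1 / \<pi>') * (real (sum_list w) + real (length w))"
        by (intro mult_left_mono)
      then show ?thesis unfolding mult_1_right by (rule order_trans[OF \<open>\<bar>\<phi> w\<bar> \<le> 1 / \<pi> + 1 / \<pi>'\<close>])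
    next
      case False
      then show ?thesis using \<pi> by (simp add: \<phi>_def)
    qed
    then show ?thesis unfolding linear_growth_def by blast
  qed
  have \<phi>mean: "E b \<phi> = 0" using E\<phi>[of "\<lambda>_. 1"] by simp
  define v where "v = measure_pmf.variance (W b) \<phi>"
  define Z where "Z w = word_total w - lam * walk w" for w
  have Zlg: "linear_growth Z"
    using linear_growth_combination[of word_total walk 1 "- lam"] almost_additive_word_total almost_additive_walk
    unfolding Z_def by (simp add: almost_additive_def)
  obtain C where C: "\<And>w. \<bar>Z w\<bar> \<le> C * (real (sum_list w) + real (length w))"
    using Zlg unfolding linear_growth_def by blast
  have shift: "sq_int (W n) (\<lambda>r. Z (l @ r))" for l n
  proof (rule sq_int_bound)
    show "sq_int (W n) (\<lambda>r. \<bar>C\<bar> * ((real (sum_list r) + real (length r)) + (real (sum_list l) + real (length l))))"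
      by (intro sq_int_cmult sq_int_add[OF sq_int_size] sq_int_const)
    fix r
    have "\<bar>Z (l @ r)\<bar> \<le> C * (real (sum_list (l @ r)) + real (length (l @ r)))" by (rule C)
    also have "\<dots> \<le> \<bar>C\<bar> * ((real (sum_list r) + real (length r)) + (real (sum_list l) + real (length l)))"
      by (intro mult_mono) auto
    also have "\<dots> \<le> \<bar>\<bar>C\<bar> * ((real (sum_list r) + real (length r)) + (real (sum_list l) + real (length l)))\<bar>"
      by (rule abs_ge_self)
    finally show "\<bar>Z (l @ r)\<bar> \<le> \<bar>\<bar>C\<bar> * ((real (sum_list r) + real (length r)) + (real (sum_list l) + real (length l)))\<bar>" .
  qed
  have block: "\<delta> \<le> E n (\<lambda>w. Z w * \<phi> (take b (drop i w)))" and block_int: "integrable (W n) (\<lambda>w. Z w * \<phi> (take b (drop i w)))"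
    if n: "n = i + (b + m)" for n i m
  proof -
    have \<phi>sq: "sq_int (W n) (\<lambda>w. \<phi> (h w))" for h :: "nat list \<Rightarrow> nat list" and n
      by (rule sq_int_bound[of _ "\<lambda>_. 1 / \<pi> + 1 / \<pi>'"]) (use \<pi> in \<open>auto simp: \<phi>_def\<close>)
    show int: "integrable (W n) (\<lambda>w. Z w * \<phi> (take b (drop i w)))"
      by (intro sq_int_mult sq_int_linear_growth Zlg \<phi>sq)
    have "E n (\<lambda>w. Z w * \<phi> (take b (drop i w)))
        = E i (\<lambda>l. E (b + m) (\<lambda>r. Z (l @ r) * \<phi> (take b (drop i (l @ r)))))"
      using int unfolding n replicate_pmf_add[of i] integrable_map_pmf_eq integral_map_pmf
      by (subst expectation_pair_pmf) auto
    also have "\<dots> \<ge> E i (\<lambda>l. \<delta>)"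
    proof (rule integral_mono_AE)
      show "integrable (W i) (\<lambda>l. E (b + m) (\<lambda>r. Z (l @ r) * \<phi> (take b (drop i (l @ r)))))"
      proof -
        interpret pair_sigma_finite "measure_pmf (W i)" "measure_pmf (W (b + m))" by unfold_locales
        have "integrable (pair_pmf (W i) (W (b + m))) (\<lambda>z. Z (fst z @ snd z) * \<phi> (take b (drop i (fst z @ snd z))))"
          using int unfolding n replicate_pmf_add[of i] integrable_map_pmf_eq .
        then show ?thesis using integrable_fst'[of "\<lambda>z. Z (fst z @ snd z) * \<phi> (take b (drop i (fst z @ snd z)))"]
          by (simp add: pair_measure_pmf)
      qed
      show "AE l in W i. \<delta> \<le> E (b + m) (\<lambda>r. Z (l @ r) * \<phi> (take b (drop i (l @ r))))"
      proof (rule AE_pmfI)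
        fix l assume "l \<in> set_pmf (W i)"
        then have l: "length l = i" by (rule length_replicate_pmf)
        have int1: "integrable (W (b + m)) (\<lambda>r. Z (l @ r) * \<phi> (take b r))"
          by (intro sq_int_mult shift \<phi>sq)
        have "E (b + m) (\<lambda>r. Z (l @ r) * \<phi> (take b (drop i (l @ r)))) = E (b + m) (\<lambda>r. Z (l @ r) * \<phi> (take b r))"
          using l by simp
        also have "\<dots> = E b (\<lambda>y. E m (\<lambda>u. Z (l @ y @ u) * \<phi> (take b (y @ u))))"
          using int1 unfolding replicate_pmf_add[of b] integrable_map_pmf_eq integral_map_pmf
          by (subst expectation_pair_pmf) auto
        also have "\<dots> = E b (\<lambda>y. \<phi> y * E m (\<lambda>u. Z (l @ y @ u)))"
        proof (rule integral_cong_AE)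
          show "AE y in W b. E m (\<lambda>u. Z (l @ y @ u) * \<phi> (take b (y @ u))) = \<phi> y * E m (\<lambda>u. Z (l @ y @ u))"
            by (rule AE_pmfI) (auto dest!: length_replicate_pmf simp: mult.commute)
        qed simp_all
        also have "\<dots> = E m (\<lambda>u. Z (l @ x' @ u)) - E m (\<lambda>u. Z (l @ x @ u))" by (rule E\<phi>)
        also have "\<dots> = E m (\<lambda>u. Z (l @ x' @ u) - Z (l @ x @ u))"
          using sq_int_integrable[OF shift[of m "l @ x'"]] sq_int_integrable[OF shift[of m "l @ x"]] by simp
        \<comment> \<open>The two tree words have the same walk, hence the multiple
          \<open>lam\<close> of the walk cancels and the final bound does not depend on it.\<close>
        also have "(\<lambda>u. Z (l @ x' @ u) - Z (l @ x @ u)) = (\<lambda>u. word_total (l @ x' @ u) - word_total (l @ x @ u))"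
          by (simp add: fun_eq_iff Z_def walk_append walk_x)
        also have "E m (\<lambda>u. word_total (l @ x' @ u) - word_total (l @ x @ u)) \<ge> \<delta>"
          unfolding \<delta>_def x_def x'_def by (rule expected_exchange[OF tt(3) Nt tt(5)])
        finally show "\<delta> \<le> E (b + m) (\<lambda>r. Z (l @ r) * \<phi> (take b (drop i (l @ r))))" .
      qed
    qed simp
    finally show "\<delta> \<le> E n (\<lambda>w. Z w * \<phi> (take b (drop i w)))" by simp
  qed
  \<comment> \<open>Each of the \<open>M\<close> blocks contributes at least \<open>\<delta>\<close>
    to the pairing, whereas the block sum of \<open>\<phi>\<close> consists of independent centred
    terms and has norm \<open>sqrt (M * v)\<close> only. The comparison forces the deviation of
    \<open>Z\<close> up to order \<open>sqrt M\<close>.\<close>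
  have main: "M * \<delta> \<le> sd (W (M * b)) Z * sqrt (M * v)" for M
  proof -
    let ?Y = "block_sum b \<phi> M"
    have sqY: "sq_int (W (M * b)) ?Y" by (intro sq_int_linear_growth linear_growth_block_sum \<phi>lg)
    have sqZ: "sq_int (W (M * b)) Z" by (rule sq_int_linear_growth[OF Zlg])
    have EY: "E (M * b) ?Y = 0" using block_sum_law(1)[OF \<phi>lg] \<phi>mean by simp
    have VY: "l2 (W (M * b)) ?Y = sqrt (M * v)"
      using block_sum_law(2)[OF \<phi>lg, of M b] unfolding EY by (simp add: l2_def v_def)
    have split: "M * b = j * b + (b + (M - Suc j) * b)" if "j < M" for j
    proof -
      have "M = j + (1 + (M - Suc j))" using that by simp
      then have "M * b = (j + (1 + (M - Suc j))) * b" by simp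
      then show ?thesis by (simp only: add_mult_distrib mult_1)
    qed
    have "M * \<delta> = (\<Sum>j<M. \<delta>)" by simp
    also have "\<dots> \<le> (\<Sum>j<M. E (M * b) (\<lambda>w. Z w * \<phi> (take b (drop (j * b) w))))"
      using block[OF split] by (intro sum_mono) auto
    also have "\<dots> = E (M * b) (\<lambda>w. \<Sum>j<M. Z w * \<phi> (take b (drop (j * b) w)))"
      using block_int[OF split] by (subst Bochner_Integration.integral_sum) auto
    also have "\<dots> = E (M * b) (\<lambda>w. Z w * ?Y w)" by (simp add: block_sum_def sum_distrib_left)
    also have "\<dots> = E (M * b) (\<lambda>w. (Z w - E (M * b) Z) * ?Y w)"
      using sq_int_mult[OF sqZ sqY] sq_int_integrable[OF sqY] EY by (simp add: left_diff_distrib)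
    also have "\<dots> \<le> l2 (W (M * b)) (\<lambda>w. Z w - E (M * b) Z) * l2 (W (M * b)) ?Y"
      by (intro l2_Cauchy_Schwarz sq_int_diff sqZ sq_int_const sqY)
    finally show ?thesis by (simp add: sd_eq_l2 VY)
  qed
  have v: "0 < v"
  proof -
    have "0 \<le> v" by (simp add: v_def)
    moreover have "v \<noteq> 0" using main[of 1] \<delta> by auto
    ultimately show ?thesis by simp
  qed
  have "\<delta> / sqrt v * sqrt M \<le> sd (W (M * b)) Z" for M
  proof (cases "M = 0")
    case False
    have "real M = sqrt M * sqrt M" by simp
    then have "sqrt M * (sqrt M * \<delta>) \<le> sqrt M * (sd (W (M * b)) Z * sqrt v)"
      using main[of M] by (simp add: real_sqrt_mult mult_ac)
    then have "sqrt M * \<delta> \<le> sd (W (M * b)) Z * sqrt v" using False by (simp add: mult_le_cancel_left)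
    then show ?thesis using v by (simp add: field_simps)
  qed simp
  then show ?thesis using b(1) \<delta> v unfolding Z_def by (intro exI[of _ b] exI[of _ "\<delta> / sqrt v"]) auto
qed

lemma asymptotic_sd_pos:
  assumes "(\<lambda>n. sd (W n) (\<lambda>w. word_total w - lam * walk w) / sqrt n) \<longlonglongrightarrow> s"
  shows "0 < s"
proof -
  obtain b c where bc: "0 < b" "0 < c" "\<And>M. c * sqrt (real M) \<le> sd (W (M * b)) (\<lambda>w. word_total w - lam * walk w)"
    using sd_lower_bound[of lam] by blast
  have "filterlim (\<lambda>M. M * b) at_top sequentially"
    using bc(1) by (intro filterlim_subseq) (auto simp: strict_mono_def)
  from filterlim_compose[OF assms this] have lim: "(\<lambda>M. sd (W (M * b)) (\<lambda>w. word_total w - lam * walk w) / sqrt (M * b)) \<longlonglongrightarrow> s"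
    by simp
  have "c / sqrt b \<le> s"
  proof (rule LIMSEQ_le_const[OF lim], intro exI[of _ 1] allI impI)
    fix M :: nat assume "1 \<le> M"
    then have "c / sqrt b = c * sqrt M / sqrt (M * b)" by (simp add: real_sqrt_mult)
    also have "\<dots> \<le> sd (W (M * b)) (\<lambda>w. word_total w - lam * walk w) / sqrt (M * b)"
      by (intro divide_right_mono bc(3)) simp
    finally show "c / sqrt b \<le> sd (W (M * b)) (\<lambda>w. word_total w - lam * walk w) / sqrt (M * b)" .
  qed
  then show ?thesis using bc by (auto intro: less_le_trans[of 0 "c / sqrt b"])
qed

end

section \<open>The central limit theorem for bridges\<close>

lemma integrable_cond_pmf:
  fixes f :: "'a \<Rightarrow> real"
  assumes "set_pmf M \<inter> A \<noteq> {}" "integrable (measure_pmf M) f"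
  shows "integrable (measure_pmf (cond_pmf M A)) f"
proof -
  have "measure (measure_pmf M) A \<noteq> 0" using assms(1) by (simp add: measure_pmf_zero_iff)
  then have pos: "0 < measure (measure_pmf M) A" by (simp add: less_le)
  have d: "measure_pmf (cond_pmf M A) = density (measure_pmf M) (\<lambda>x. ennreal (indicator A x / measure (measure_pmf M) A))"
    unfolding cond_pmf.rep_eq[OF assms(1)] uniform_measure_def measure_pmf.emeasure_eq_measure
    by (intro arg_cong2[where f=density] refl ext) (use pos in \<open>simp add: divide_ennreal flip: ennreal_indicator\<close>)
  have "integrable (measure_pmf M) (\<lambda>x. (indicator A x / measure (measure_pmf M) A) *\<^sub>R f x)"
  proof (rule Bochner_Integration.integrable_bound)
    show "integrable (measure_pmf M) (\<lambda>x. (1 / measure (measure_pmf M) A) * f x)" using assms(2) by simp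
  qed (auto simp: indicator_def abs_mult)
  then show ?thesis unfolding d by (subst integrable_density) auto
qed

text \<open>The second component is integrated out first. In the application the relation says that
  prefix and suffix have the prescribed total, and \<open>c\<close> is a bound for point
  probabilities.\<close>

lemma pair_relation_bound:
  fixes A :: "'a :: countable pmf" and B :: "'b :: countable pmf"
  assumes R: "\<And>a. measure_pmf.prob B {b. R a b} \<le> c" and g: "\<And>a. 0 \<le> g a" "integrable A g"
  shows "measure_pmf.expectation (pair_pmf A B) (\<lambda>z. of_bool (R (fst z) (snd z)) * g (fst z)) \<le> c * measure_pmf.expectation A g"
    and "measure_pmf.expectation (pair_pmf B A) (\<lambda>z. of_bool (R (snd z) (fst z)) * g (snd z)) \<le> c * measure_pmf.expectation A g"
proof -
  have int: "integrable (pair_pmf A B) (\<lambda>z. of_bool (R (fst z) (snd z)) * g (fst z))"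
    by (rule Bochner_Integration.integrable_bound[OF integrable_pmf_fst_snd(1)[OF g(2)]]) auto
  have pr: "measure_pmf.expectation B (\<lambda>b. of_bool (R a b)) = measure_pmf.prob B {b. R a b}" for a
  proof -
    have "(\<lambda>b. of_bool (R a b) :: real) = indicator {b. R a b}" by (simp add: fun_eq_iff indicator_def)
    then show ?thesis by simp
  qed
  have "measure_pmf.expectation (pair_pmf A B) (\<lambda>z. of_bool (R (fst z) (snd z)) * g (fst z))
      = measure_pmf.expectation A (\<lambda>a. measure_pmf.prob B {b. R a b} * g a)"
    unfolding expectation_pair_pmf[OF int] by (simp add: pr)
  also have "\<dots> \<le> measure_pmf.expectation A (\<lambda>a. c * g a)"
  proof (rule integral_mono)
    show "integrable A (\<lambda>a. measure_pmf.prob B {b. R a b} * g a)"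
      by (rule Bochner_Integration.integrable_bound[OF g(2)]) (auto simp: abs_mult g(1) intro!: mult_left_le_one_le)
  qed (use g R in \<open>auto intro: mult_right_mono\<close>)
  finally show 1: "measure_pmf.expectation (pair_pmf A B) (\<lambda>z. of_bool (R (fst z) (snd z)) * g (fst z)) \<le> c * measure_pmf.expectation A g"
    by simp
  have "measure_pmf.expectation (pair_pmf B A) (\<lambda>z. of_bool (R (snd z) (fst z)) * g (snd z))
      = measure_pmf.expectation (pair_pmf A B) (\<lambda>z. of_bool (R (fst z) (snd z)) * g (fst z))"
    by (subst pair_commute_pmf) (simp add: case_prod_beta)
  then show "measure_pmf.expectation (pair_pmf B A) (\<lambda>z. of_bool (R (snd z) (fst z)) * g (snd z)) \<le> c * measure_pmf.expectation A g"
    using 1 by simp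
qed

text \<open>Rounding up guarantees at least the proportion \<open>1 / Q\<close> of cut letters for
  every \<open>n\<close>, as the dominating function requires.\<close>

definition ceil_div :: "nat \<Rightarrow> nat \<Rightarrow> nat" where
  "ceil_div Q n = n div Q + (if Q dvd n then 0 else 1)"

lemma ceil_div_bounds:
  assumes "1 \<le> Q"
  shows "ceil_div Q n \<le> n" "1 / real Q * real n \<le> real (ceil_div Q n)" "real (ceil_div Q n) \<le> 1 / real Q * real n + 1"
proof -
  have c: "ceil_div Q n = n div Q + (if Q dvd n then 0 else 1)" by (simp add: ceil_div_def)
  have e: "real n = real Q * real (n div Q) + real (n mod Q)"
    by (metis mult_div_mod_eq of_nat_add of_nat_mult)
  have m: "real (n mod Q) < real Q" using assms by simp
  show "ceil_div Q n \<le> n"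
  proof (cases "Q dvd n")
    case False
    then have "2 \<le> Q" "0 < n" using assms by (auto intro: Nat.gr0I) (metis One_nat_def Suc_1 dual_order.antisym not_less_eq_eq one_dvd)
    then have "n div Q < n" by (intro div_less_dividend) auto
    then show ?thesis using False c by simp
  qed (use c in simp)
  show "1 / real Q * real n \<le> real (ceil_div Q n)"
  proof (cases "Q dvd n")
    case True
    then show ?thesis using c e assms by (simp add: dvd_eq_mod_eq_0)
  next
    case False
    then show ?thesis using c e m assms by (simp add: field_simps)
  qed
  show "real (ceil_div Q n) \<le> 1 / real Q * real n + 1" using c e assms by (simp add: field_simps)
qed

lemma ceil_div_tendsto:
  assumes "1 \<le> Q"
  shows "(\<lambda>n. real (ceil_div Q n) / real n) \<longlonglongrightarrow> 1 / real Q"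
proof (rule tendsto_sandwich[of "\<lambda>_. 1 / real Q"])
  show "\<forall>\<^sub>F n in sequentially. 1 / real Q \<le> real (ceil_div Q n) / real n"
    using eventually_gt_at_top[of 0]
  proof eventually_elim
    case (elim n)
    then show ?case using divide_right_mono[OF ceil_div_bounds(2)[OF assms, of n], of "real n"] by simp
  qed
  show "\<forall>\<^sub>F n in sequentially. real (ceil_div Q n) / real n \<le> 1 / real Q + 1 / real n"
    using eventually_gt_at_top[of 0]
  proof eventually_elim
    case (elim n)
    then show ?case using divide_right_mono[OF ceil_div_bounds(3)[OF assms, of n], of "real n"] by (simp add: add_divide_distrib)
  qed
  have "(\<lambda>n. 1 / real Q + 1 / real n) \<longlonglongrightarrow> 1 / real Q + 0"
    by (intro tendsto_add tendsto_const lim_1_over_n)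
  then show "(\<lambda>n. 1 / real Q + 1 / real n) \<longlonglongrightarrow> 1 / real Q" by simp
qed simp

context critical_offspring
begin

text \<open>The conditions under which the bridge is defined and \<open>slice_inversion\<close>
  applies to it.\<close>

definition admissible :: "nat \<Rightarrow> bool" where
  "admissible n \<longleftrightarrow> 1 \<le> n \<and> step_span dvd n - 1 \<and> set_pmf (W n) \<inter> slice n \<noteq> {}"

abbreviation bridge :: "nat \<Rightarrow> nat list pmf" where
  "bridge n \<equiv> cond_pmf (W n) (slice n)"

lemma prob_slice_pos: "admissible n \<Longrightarrow> 0 < measure_pmf.prob (W n) (slice n)"
proof -
  assume "admissible n"
  then have "measure_pmf.prob (W n) (slice n) \<noteq> 0" by (simp add: admissible_def measure_pmf_zero_iff)
  then show ?thesis by (simp add: less_le)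
qed

lemma set_bridge: "admissible n \<Longrightarrow> w \<in> set_pmf (bridge n) \<Longrightarrow> length w = n \<and> sum_list w + 1 = n"
  by (auto simp: admissible_def slice_def dest: length_replicate_pmf)

text \<open>Only a prefix of the bridge enters, so the conditional expectation is a quotient of two
  Fourier integrals. In the numerator, \<open>Z\<close> and the walk are asymptotically independent
  on the prefix. The factor in \<open>t\<close> therefore leaves the integral, and the remaining
  Gaussian integral cancels against the denominator.\<close>

lemma bridge_char:
  fixes \<sigma> t :: real
  assumes Z: "almost_additive Z"
    and var: "\<And>a b. (\<lambda>n. (sd (W n) (\<lambda>w. a * Z w + b * walk w) / sqrt n)\<^sup>2) \<longlonglongrightarrow> a\<^sup>2 * \<sigma>\<^sup>2 + b\<^sup>2 * step_var"
    and Q: "2 \<le> Q"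
  defines "L \<equiv> exp (complex_of_real (- ((1 - 1 / real Q) * \<sigma>\<^sup>2 * t\<^sup>2 / 2)))"
    and "m \<equiv> \<lambda>n. n - ceil_div Q n"
  shows "(\<lambda>n. if admissible n then measure_pmf.expectation (bridge n) (\<lambda>w. cis (t / sqrt n * (Z (take (m n) w) - E (m n) Z))) else L) \<longlonglongrightarrow> L"
proof -
  have Q1: "1 \<le> Q" using Q by simp
  define f where "f n x = cis (t / sqrt (real n) * (Z x - E (m n) Z))" for n x
  define I where "I n = (LINT v|lborel. fourier_integrand n (m n) (f n) v)" for n
  define J where "J n = (LINT v|lborel. fourier_integrand n 0 (\<lambda>_. 1) v)" for n
  define \<kappa> where "\<kappa> = 1 / real Q"
  define g where "g v = exp (complex_of_real (- (((t * sqrt (1 - \<kappa>))\<^sup>2 * \<sigma>\<^sup>2 + (v * sqrt (1 - \<kappa>))\<^sup>2 * step_var) / 2)))" for v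
  have \<kappa>: "0 < \<kappa>" "\<kappa> \<le> 1 / 2" using Q by (auto simp: \<kappa>_def field_simps)
  have klim: "(\<lambda>n. real (ceil_div Q n) / real n) \<longlonglongrightarrow> \<kappa>" unfolding \<kappa>_def by (rule ceil_div_tendsto[OF Q1])
  have mreal: "real (m n) = real n - real (ceil_div Q n)" for n
    unfolding m_def using ceil_div_bounds(1)[OF Q1] by (simp add: of_nat_diff)
  have mlim: "(\<lambda>n. real (m n) / real n) \<longlonglongrightarrow> 1 - \<kappa>"
  proof (rule Lim_transform_eventually[OF tendsto_diff[OF tendsto_const klim]])
    show "\<forall>\<^sub>F n in sequentially. 1 - real (ceil_div Q n) / real n = real (m n) / real n"
      using eventually_gt_at_top[of 0] by eventually_elim (simp add: mreal diff_divide_distrib)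
  qed
  have mtop: "filterlim m at_top sequentially"
  proof -
    have "filterlim (\<lambda>n. 1 / 2 * real n) at_top sequentially"
      by (intro filterlim_tendsto_pos_mult_at_top[OF tendsto_const] filterlim_real_sequentially) simp
    from filterlim_tendsto_add_at_top[OF tendsto_const[of "- 1 :: real"] this]
    have top2: "filterlim (\<lambda>n. - 1 + 1 / 2 * real n) at_top sequentially" .
    have "filterlim (\<lambda>n. real (m n)) at_top sequentially"
    proof (rule filterlim_at_top_mono[OF top2], intro always_eventually allI)
      fix n
      have "1 / real Q * real n \<le> 1 / 2 * real n" using \<kappa> unfolding \<kappa>_def by (intro mult_right_mono) auto
      then show "- 1 + 1 / 2 * real n \<le> real (m n)" using ceil_div_bounds(3)[OF Q1, of n] unfolding mreal by linarith
    qed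
    then show ?thesis by (simp add: filterlim_sequentially_iff_filterlim_real)
  qed
  have Ilim: "I \<longlonglongrightarrow> (LINT v|lborel. g v * exp (complex_of_real (- (\<kappa> * step_var / 2) * v\<^sup>2)))"
    unfolding I_def m_def
  proof (rule fourier_integral_tendsto[where \<kappa>'=\<kappa>])
    show "ceil_div Q n \<le> n" "\<kappa> * real n \<le> real (ceil_div Q n)" for n
      using ceil_div_bounds[OF Q1] by (auto simp: \<kappa>_def)
    show "cmod (f n x) \<le> 1" for n x by (simp add: f_def)
    fix v
    show "(\<lambda>n. measure_pmf.expectation (W (n - ceil_div Q n)) (\<lambda>x. f n x * cis (v / sqrt n * walk x))) \<longlonglongrightarrow> g v"
    proof (rule Lim_transform_eventually)
      have s: "(\<lambda>n. x * sqrt (real (m n) / real n)) \<longlonglongrightarrow> x * sqrt (1 - \<kappa>)" for x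
        by (intro tendsto_mult tendsto_const tendsto_real_sqrt mlim)
      show "(\<lambda>n. measure_pmf.expectation (W (m n)) (\<lambda>w. cis (t * sqrt (real (m n) / real n) / sqrt (m n) * (Z w - E (m n) Z)
          + v * sqrt (real (m n) / real n) / sqrt (m n) * walk w))) \<longlonglongrightarrow> g v"
        unfolding g_def by (rule joint_char[OF Z var mtop s s])
      have "\<forall>\<^sub>F n in sequentially. 0 < m n" 
        using filterlim_at_top[THEN iffD1, OF mtop, rule_format, of 1] by (simp add: Suc_le_eq)
      then show "\<forall>\<^sub>F n in sequentially. measure_pmf.expectation (W (m n)) (\<lambda>w. cis (t * sqrt (real (m n) / real n) / sqrt (m n) * (Z w - E (m n) Z)
          + v * sqrt (real (m n) / real n) / sqrt (m n) * walk w))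
        = measure_pmf.expectation (W (n - ceil_div Q n)) (\<lambda>x. f n x * cis (v / sqrt n * walk x))"
      proof eventually_elim
        case (elim n)
        then have "x * sqrt (real (m n) / real n) / sqrt (m n) = x / sqrt n" for x by (simp add: real_sqrt_divide)
        then show ?case by (simp only: f_def cis_mult m_def)
      qed
    qed
  qed (use \<kappa> klim in auto)
  \<comment> \<open>The prefix carries the proportion \<open>1 - \<kappa>\<close> of the variance of
    the walk and the cut letters the proportion \<open>\<kappa>\<close>; in the variable
    \<open>v\<close> the exponents add up to that of the complete walk.\<close>
  have "g v * exp (complex_of_real (- (\<kappa> * step_var / 2) * v\<^sup>2)) = L * complex_of_real (exp (- (step_var / 2) * v\<^sup>2))" for v
  proof -
    have "- (((t * sqrt (1 - \<kappa>))\<^sup>2 * \<sigma>\<^sup>2 + (v * sqrt (1 - \<kappa>))\<^sup>2 * step_var) / 2) + - (\<kappa> * step_var / 2) * v\<^sup>2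
        = - ((1 - \<kappa>) * \<sigma>\<^sup>2 * t\<^sup>2 / 2) + - (step_var / 2) * v\<^sup>2"
      using \<kappa> by (simp add: power_mult_distrib algebra_simps add_divide_distrib diff_divide_distrib)
    then show ?thesis
      unfolding g_def L_def \<kappa>_def[symmetric] exp_of_real[symmetric] exp_add[symmetric] of_real_add[symmetric] by simp
  qed
  then have "(LINT v|lborel. g v * exp (complex_of_real (- (\<kappa> * step_var / 2) * v\<^sup>2)))
      = L * complex_of_real (LINT v|lborel. exp (- (step_var / 2) * v\<^sup>2))"
    by (simp only: integral_mult_right_zero integral_complex_of_real)
  also have "(LINT v|lborel. exp (- (step_var / 2) * v\<^sup>2)) = sqrt (2 * pi / step_var)"
    using gaussian_integral(2)[of "step_var / 2"] step_var_pos by (simp add: mult.commute)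
  finally have Ilim': "I \<longlonglongrightarrow> L * complex_of_real (sqrt (2 * pi / step_var))" using Ilim by simp
  have Jlim: "J \<longlonglongrightarrow> complex_of_real (sqrt (2 * pi / step_var))" unfolding J_def by (rule slice_integral_tendsto)
  have ne: "complex_of_real (sqrt (2 * pi / step_var)) \<noteq> 0" using step_var_pos by simp
  have "(\<lambda>n. I n / J n) \<longlonglongrightarrow> L" using tendsto_divide[OF Ilim' Jlim ne] ne by simp
  from tendsto_if_const[OF this, of admissible]
  show ?thesis
  proof (rule Lim_transform_eventually)
    show "\<forall>\<^sub>F n in sequentially. (if admissible n then I n / J n else L) = (if admissible n
      then measure_pmf.expectation (bridge n) (\<lambda>w. cis (t / sqrt n * (Z (take (m n) w) - E (m n) Z))) else L)"
    proof (intro always_eventually allI)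
      fix n
      have "I n / J n = measure_pmf.expectation (bridge n) (\<lambda>w. f n (take (m n) w))" if adm: "admissible n"
      proof -
        define c where "c = complex_of_real (real step_span / (2 * pi))"
        have n: "1 \<le> n" "step_span dvd n - 1" and ne: "set_pmf (W n) \<inter> slice n \<noteq> {}" using adm by (auto simp: admissible_def)
        have c0: "c \<noteq> 0" using step_span_pos by (simp add: c_def)
        have 1: "sqrt n * measure_pmf.expectation (W n) (\<lambda>w. indicator (slice n) w *\<^sub>R f n (take (m n) w)) = c * I n"
          unfolding I_def c_def by (rule slice_inversion[OF n]) (auto simp: m_def f_def)
        have 2: "complex_of_real (sqrt n * measure_pmf.prob (W n) (slice n)) = c * J n"
          unfolding J_def c_def by (rule slice_prob(2)[OF n])
        have "I n / J n = (c * I n) / (c * J n)" using c0 by simp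
        also have "\<dots> = measure_pmf.expectation (W n) (\<lambda>w. indicator (slice n) w *\<^sub>R f n (take (m n) w)) /\<^sub>R measure_pmf.prob (W n) (slice n)"
          unfolding 1[symmetric] 2[symmetric] using n prob_slice_pos[OF adm] by (simp add: scaleR_conv_of_real field_simps)
        also have "\<dots> = measure_pmf.expectation (bridge n) (\<lambda>w. f n (take (m n) w))"
          by (rule expectation_cond_pmf[OF ne, symmetric])
        finally show ?thesis .
      qed
      then show "(if admissible n then I n / J n else L) = (if admissible n
        then measure_pmf.expectation (bridge n) (\<lambda>w. cis (t / sqrt n * (Z (take (m n) w) - E (m n) Z))) else L)"
        by (simp add: f_def)
    qed
  qed
qed

text \<open>A fixed proportion of a bridge has bounded density with respect to independent steps.\<close>
lemma bridge_density:
  "\<exists>K>0. \<exists>N. \<forall>n\<ge>N. admissible n \<longrightarrow> (\<forall>m\<le>n. \<forall>g. (\<forall>x. 0 \<le> g x) \<longrightarrow>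
    (n \<le> 4 * (n - m) \<longrightarrow> integrable (W m) g \<longrightarrow> measure_pmf.expectation (bridge n) (\<lambda>w. g (take m w)) \<le> K * E m g) \<and>
    (n \<le> 4 * m \<longrightarrow> integrable (W (n - m)) g \<longrightarrow> measure_pmf.expectation (bridge n) (\<lambda>w. g (drop m w)) \<le> K * E (n - m) g))"
proof -
  obtain C where C: "0 < C" "\<And>n j. 1 \<le> n \<Longrightarrow> measure_pmf.prob (W n) {w. sum_list w = j} \<le> C / sqrt n"
    using point_prob_bound by blast
  \<comment> \<open>Half of the limit of \<open>sqrt n\<close> times the probability of the slice,
    hence a lower bound for that product when \<open>n\<close> is large.\<close>
  define h where "h = real step_span / (2 * pi) * sqrt (2 * pi / step_var) / 2"
  have h: "0 < h" using step_span_pos step_var_pos by (simp add: h_def)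
  have "(\<lambda>n. real step_span / (2 * pi) * Re (LINT v|lborel. fourier_integrand n 0 (\<lambda>_. 1) v)) \<longlonglongrightarrow> real step_span / (2 * pi) * Re (complex_of_real (sqrt (2 * pi / step_var)))"
    by (intro tendsto_mult tendsto_const tendsto_Re slice_integral_tendsto)
  moreover have "h < real step_span / (2 * pi) * Re (complex_of_real (sqrt (2 * pi / step_var)))"
    using h unfolding h_def by simp
  ultimately have "\<forall>\<^sub>F n in sequentially. h < real step_span / (2 * pi) * Re (LINT v|lborel. fourier_integrand n 0 (\<lambda>_. 1) v)"
    by (rule order_tendstoD(1))
  then obtain N where N: "\<And>n. N \<le> n \<Longrightarrow> h < real step_span / (2 * pi) * Re (LINT v|lborel. fourier_integrand n 0 (\<lambda>_. 1) v)"
    by (auto simp: eventually_sequentially)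
  define K where "K = 2 * C / h"
  have K: "0 < K" using C h by (simp add: K_def)
  \<comment> \<open>Given one part of the word, the other part with its \<open>k\<close> free
    letters hits the required sum with probability at most \<open>C / sqrt k\<close>. The
    conditioning divides by at least \<open>h / sqrt n\<close>, and \<open>n \<le> 4 * k\<close>
    bounds the quotient of the square roots by 2.\<close>
  have main: "measure_pmf.expectation (W n) (\<lambda>w. indicator (slice n) w *\<^sub>R f w) / measure_pmf.prob (W n) (slice n) \<le> K * e"
    if adm: "admissible n" and n: "N \<le> n" and k: "1 \<le> k" "n \<le> 4 * k" and e: "0 \<le> e"
      and f: "measure_pmf.expectation (W n) (\<lambda>w. indicator (slice n) w *\<^sub>R f w) \<le> C / sqrt k * e" for n k f e
  proof -
    have n1: "1 \<le> n" "step_span dvd n - 1" using adm by (auto simp: admissible_def)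
    have hit: "h / sqrt n \<le> measure_pmf.prob (W n) (slice n)"
    proof -
      have "h \<le> sqrt n * measure_pmf.prob (W n) (slice n)"
        using N[OF n] unfolding slice_prob(1)[OF n1, symmetric] by simp
      then show ?thesis using n1 by (simp add: field_simps)
    qed
    have hp: "0 < h / sqrt n" using h n1 by simp
    have "measure_pmf.expectation (W n) (\<lambda>w. indicator (slice n) w *\<^sub>R f w) / measure_pmf.prob (W n) (slice n)
        \<le> (C / sqrt k * e) / measure_pmf.prob (W n) (slice n)"
      using f prob_slice_pos[OF adm] by (intro divide_right_mono) auto
    also have "\<dots> \<le> (C / sqrt k * e) / (h / sqrt n)"
      by (rule divide_left_mono[OF hit _ mult_pos_pos[OF prob_slice_pos[OF adm] hp]]) (use e C in simp)
    also have "\<dots> = C / h * e * (sqrt n / sqrt k)" using h n1 k by (simp add: field_simps)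
    also have "\<dots> \<le> C / h * e * 2"
    proof (rule mult_left_mono)
      have "sqrt n \<le> sqrt (4 * k)" using k by simp
      also have "\<dots> = 2 * sqrt k" by (simp add: real_sqrt_mult)
      finally show "sqrt n / sqrt k \<le> 2" using k by (simp add: field_simps)
    qed (use C h e in simp)
    finally show ?thesis by (simp add: K_def mult_ac)
  qed
  have pb: "measure_pmf.prob (W k) {y. sum_list x + sum_list y + 1 = n} \<le> C / sqrt k" if "1 \<le> k" for k n and x :: "nat list"
  proof -
    have "measure_pmf.prob (W k) {y. sum_list x + sum_list y + 1 = n} \<le> measure_pmf.prob (W k) {y. sum_list y = n - 1 - sum_list x}"
      by (intro measure_pmf.finite_measure_mono) auto
    then show ?thesis using C(2)[OF that, of "n - 1 - sum_list x"] by linarith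
  qed
  show ?thesis
  proof (intro exI[of _ K] exI[of _ N] conjI K allI impI)
    fix n m and g :: "nat list \<Rightarrow> real"
    assume n: "N \<le> n" and adm: "admissible n" and m: "m \<le> n" and g0: "\<forall>x. 0 \<le> g x"
    have n1: "1 \<le> n" and ne: "set_pmf (W n) \<inter> slice n \<noteq> {}" using adm by (auto simp: admissible_def)
    have nm: "n = m + (n - m)" using m by simp
    have pairE: "measure_pmf.expectation (W n) F = measure_pmf.expectation (pair_pmf (W m) (W (n - m))) (\<lambda>z. F (fst z @ snd z))" for F :: "nat list \<Rightarrow> real"
      by (subst nm) (rule expectation_append)
    have brE: "measure_pmf.expectation (bridge n) F = measure_pmf.expectation (W n) (\<lambda>w. indicator (slice n) w *\<^sub>R F w) / measure_pmf.prob (W n) (slice n)" for F :: "nat list \<Rightarrow> real"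
      unfolding expectation_cond_pmf[OF ne] by (simp add: divide_inverse mult.commute)
    {
      assume k: "n \<le> 4 * (n - m)" and int: "integrable (W m) g"
      have k1: "1 \<le> n - m" using k n1 by linarith
      have "measure_pmf.expectation (W n) (\<lambda>w. indicator (slice n) w *\<^sub>R g (take m w))
          = measure_pmf.expectation (pair_pmf (W m) (W (n - m))) (\<lambda>z. of_bool (sum_list (fst z) + sum_list (snd z) + 1 = n) * g (fst z))"
        unfolding pairE
      proof (rule integral_cong_AE)
        show "AE z in pair_pmf (W m) (W (n - m)). indicator (slice n) (fst z @ snd z) *\<^sub>R g (take m (fst z @ snd z))
          = of_bool (sum_list (fst z) + sum_list (snd z) + 1 = n) * g (fst z)"
          by (rule AE_pmfI) (auto dest!: length_replicate_pmf simp: slice_def indicator_def)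
      qed simp_all
      also have "\<dots> \<le> C / sqrt (n - m) * E m g"
        by (rule pair_relation_bound(1)[OF pb[OF k1]]) (use g0 int in auto)
      finally show "measure_pmf.expectation (bridge n) (\<lambda>w. g (take m w)) \<le> K * E m g"
        unfolding brE by (intro main[OF adm n k1 k]) (use g0 in auto)
    next
      assume k: "n \<le> 4 * m" and int: "integrable (W (n - m)) g"
      have k1: "1 \<le> m" using k n1 by linarith
      have "measure_pmf.expectation (W n) (\<lambda>w. indicator (slice n) w *\<^sub>R g (drop m w))
          = measure_pmf.expectation (pair_pmf (W m) (W (n - m))) (\<lambda>z. of_bool (sum_list (snd z) + sum_list (fst z) + 1 = n) * g (snd z))"
        unfolding pairE
      proof (rule integral_cong_AE)
        show "AE z in pair_pmf (W m) (W (n - m)). indicator (slice n) (fst z @ snd z) *\<^sub>R g (drop m (fst z @ snd z))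
          = of_bool (sum_list (snd z) + sum_list (fst z) + 1 = n) * g (snd z)"
          by (rule AE_pmfI) (auto dest!: length_replicate_pmf simp: slice_def indicator_def add.commute)
      qed simp_all
      also have "\<dots> \<le> C / sqrt m * E (n - m) g"
        by (rule pair_relation_bound(2)[OF pb[OF k1]]) (use g0 int in auto)
      finally show "measure_pmf.expectation (bridge n) (\<lambda>w. g (drop m w)) \<le> K * E (n - m) g"
        unfolding brE by (intro main[OF adm n k1 k]) (use g0 in auto)
    }
  qed
qed

end

lemma abs_sum5_le:
  fixes a b c d e :: real
  assumes "\<bar>a\<bar> \<le> A" "\<bar>b\<bar> \<le> B" "\<bar>c\<bar> \<le> C" "\<bar>d\<bar> \<le> D" "\<bar>e\<bar> \<le> E"
  shows "\<bar>a + b + c + d + e\<bar> \<le> A + B + C + D + E"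
  using assms unfolding abs_le_iff by linarith

context offspring_pmf
begin

lemma integrable_take_drop:
  fixes g :: "nat list \<Rightarrow> real"
  assumes m: "m \<le> n"
  shows "integrable (W m) g \<Longrightarrow> integrable (W n) (\<lambda>w. g (take m w))"
    and "integrable (W (n - m)) g \<Longrightarrow> integrable (W n) (\<lambda>w. g (drop m w))"
proof -
  have n: "n = m + (n - m)" using m by simp
  have len: "length (fst z) = m" if "z \<in> set_pmf (pair_pmf (W m) (W (n - m)))" for z
    using that by (auto dest: length_replicate_pmf)
  show "integrable (W n) (\<lambda>w. g (take m w))" if "integrable (W m) g"
  proof (subst n, subst replicate_pmf_add, subst integrable_map_pmf_eq, subst integrable_cong_AE)
    show "AE z in pair_pmf (W m) (W (n - m)). g (take m (fst z @ snd z)) = g (fst z)"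
      by (rule AE_pmfI) (simp add: len)
    show "integrable (pair_pmf (W m) (W (n - m))) (\<lambda>z. g (fst z))"
      using that by (rule integrable_pmf_fst_snd)
  qed simp_all
  show "integrable (W n) (\<lambda>w. g (drop m w))" if "integrable (W (n - m)) g"
  proof (subst n, subst replicate_pmf_add, subst integrable_map_pmf_eq, subst integrable_cong_AE)
    show "AE z in pair_pmf (W m) (W (n - m)). g (drop m (fst z @ snd z)) = g (snd z)"
      by (rule AE_pmfI) (simp add: len)
    show "integrable (pair_pmf (W m) (W (n - m))) (\<lambda>z. g (snd z))"
      using that by (rule integrable_pmf_fst_snd)
  qed simp_all
qed

end

context critical_offspring
begin

text \<open>On a bridge the walk equals \<open>- 1\<close>, so passing from \<open>G\<close> to
  \<open>Z\<close> changes only a constant. The suffix omitted in \<open>bridge_char\<close> has, by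
  the bounded density, a mean deviation of order \<open>sqrt (n / Q)\<close>. This gives the limit
  when \<open>n\<close> and afterwards \<open>Q\<close> tend to infinity. For the fourth moment of
  \<open>G\<close> the bridge is cut in the middle and both halves are compared with i.i.d.
  words.\<close>

lemma bridge_CLT:
  fixes G :: "nat list \<Rightarrow> real" and lam \<sigma> B :: real
  defines "Z \<equiv> \<lambda>w. G w - lam * walk w"
  assumes G: "almost_additive G" and B: "\<And>w. \<bar>G w\<bar> \<le> B * length w"
    and var: "\<And>a b. (\<lambda>n. (sd (W n) (\<lambda>w. a * Z w + b * walk w) / sqrt n)\<^sup>2) \<longlonglongrightarrow> a\<^sup>2 * \<sigma>\<^sup>2 + b\<^sup>2 * step_var"
    and mu: "\<And>n. \<bar>E n G - \<mu> * real n\<bar> \<le> K1 * fourth_root n"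
  shows "(\<lambda>n. if admissible n then measure_pmf.expectation (bridge n) (\<lambda>w. cis (t / sqrt n * (G w - \<mu> * n)))
      else exp (complex_of_real (- (\<sigma>\<^sup>2 * t\<^sup>2 / 2)))) \<longlonglongrightarrow> exp (complex_of_real (- (\<sigma>\<^sup>2 * t\<^sup>2 / 2)))"
    and "\<exists>K N. \<forall>n\<ge>N. admissible n \<longrightarrow> measure_pmf.expectation (bridge n) (\<lambda>w. (G w - \<mu> * n) ^ 4) \<le> K * (real n)\<^sup>2"
proof -
  have Z: "almost_additive Z"
    unfolding Z_def using almost_additive_combination[OF G almost_additive_walk, of 1 "- lam"] by simp
  have sqG: "sq_int (W n) G" and sqZ: "sq_int (W n) Z" for n
    using G Z by (auto simp: almost_additive_def intro: sq_int_linear_growth)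
  have EZ: "E n Z = E n G" for n
    unfolding Z_def using sq_int_integrable[OF sqG] sq_int_integrable[OF sq_int_walk] by (simp add: walk_law)
  obtain C where C: "\<And>x y. \<bar>Z (x @ y) - Z x - Z y\<bar> \<le> C * fourth_root (length x + length y)"
    using Z by (auto simp: almost_additive_def)
  have C0: "0 \<le> C" using order_trans[OF abs_ge_zero C[of "[0]" "[]"]] by (simp add: fourth_root_def)
  have K10: "0 \<le> K1" using order_trans[OF abs_ge_zero mu[of 1]] by (simp add: fourth_root_def)
  obtain S where S: "0 \<le> S" "\<And>n. sd (W n) Z \<le> S * sqrt n" using sd_le_sqrt[OF Z] by blast
  obtain K N where K: "0 < K"
    and dens: "\<And>n m g. N \<le> n \<Longrightarrow> admissible n \<Longrightarrow> m \<le> n \<Longrightarrow> (\<And>x. 0 \<le> g x) \<Longrightarrow> n \<le> 4 * (n - m) \<Longrightarrow> integrable (W m) g \<Longrightarrow>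
        measure_pmf.expectation (bridge n) (\<lambda>w. g (take m w)) \<le> K * E m g"
      "\<And>n m g. N \<le> n \<Longrightarrow> admissible n \<Longrightarrow> m \<le> n \<Longrightarrow> (\<And>x. 0 \<le> g x) \<Longrightarrow> n \<le> 4 * m \<Longrightarrow> integrable (W (n - m)) g \<Longrightarrow>
        measure_pmf.expectation (bridge n) (\<lambda>w. g (drop m w)) \<le> K * E (n - m) g"
    using bridge_density by metis
  \<comment> \<open>Five errors are collected: the cut, the constant \<open>lam\<close>, the
    fluctuation of the suffix, and the deviations of the two means from their linear
    approximations.\<close>
  have near: "\<bar>(G w - \<mu> * n) - (Z (take m w) - E m Z)\<bar> \<le> (\<bar>lam\<bar> + (C + 2 * K1) * fourth_root n) + \<bar>Z (drop m w) - E (n - m) Z\<bar>"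
    if adm: "admissible n" and w: "w \<in> set_pmf (bridge n)" and m: "m \<le> n" for n m w
  proof -
    have len: "length w = n" "sum_list w + 1 = n" using set_bridge[OF adm w] by auto
    have "real (sum_list w) + 1 = real n" using len(2) by (metis of_nat_1 of_nat_add)
    then have "walk w = - 1" using len(1) by (simp add: walk_def)
    then have Gw: "G w = Z w - lam" by (simp add: Z_def)
    have 1: "\<bar>Z w - Z (take m w) - Z (drop m w)\<bar> \<le> C * fourth_root n"
      using C[of "take m w" "drop m w"] len m by simp
    have 2: "\<bar>E m Z - \<mu> * real m\<bar> \<le> K1 * fourth_root n"
      using order_trans[OF mu[of m] mult_left_mono[OF fourth_root_mono[OF m] K10]] unfolding EZ .
    have 3: "\<bar>E (n - m) Z - \<mu> * real (n - m)\<bar> \<le> K1 * fourth_root n"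
      using order_trans[OF mu[of "n - m"] mult_left_mono[OF fourth_root_mono[of "n - m" n] K10]] unfolding EZ by simp
    have n: "\<mu> * real n = \<mu> * real m + \<mu> * real (n - m)" using m by (simp add: of_nat_diff algebra_simps)
    have "(G w - \<mu> * n) - (Z (take m w) - E m Z) = (Z w - Z (take m w) - Z (drop m w)) + (- lam) + (Z (drop m w) - E (n - m) Z)
        + (E m Z - \<mu> * real m) + (E (n - m) Z - \<mu> * real (n - m))"
      unfolding Gw n by simp
    also have "\<bar>\<dots>\<bar> \<le> C * fourth_root n + \<bar>lam\<bar> + \<bar>Z (drop m w) - E (n - m) Z\<bar> + K1 * fourth_root n + K1 * fourth_root n"
      by (rule abs_sum5_le[OF 1 _ _ 2 3]) simp_all
    finally show ?thesis by (simp add: algebra_simps)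
  qed
  define L where "L = exp (complex_of_real (- (\<sigma>\<^sup>2 * t\<^sup>2 / 2)))"
  define LQ where "LQ Q = exp (complex_of_real (- ((1 - 1 / real Q) * \<sigma>\<^sup>2 * t\<^sup>2 / 2)))" for Q
  define A where "A n = measure_pmf.expectation (bridge n) (\<lambda>w. cis (t / sqrt n * (G w - \<mu> * n)))" for n
  define BQ where "BQ Q n = measure_pmf.expectation (bridge n) (\<lambda>w. cis (t / sqrt n * (Z (take (n - ceil_div Q n) w) - E (n - ceil_div Q n) Z)))" for Q n
  define err where "err Q n = \<bar>t\<bar> * (\<bar>lam\<bar> / sqrt n + (C + 2 * K1) * (fourth_root n / sqrt n) + K * S * sqrt (real (ceil_div Q n) / real n))" for Q n
  have AB: "cmod (A n - BQ Q n) \<le> err Q n" if Q: "2 \<le> Q" and adm: "admissible n" and n: "N \<le> n" "4 \<le> n" for Q n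
  proof -
    have Q1: "1 \<le> Q" using Q by simp
    define m where "m = n - ceil_div Q n"
    have m: "m \<le> n" "n - m = ceil_div Q n" using ceil_div_bounds(1)[OF Q1, of n] by (auto simp: m_def)
    have ne: "set_pmf (W n) \<inter> slice n \<noteq> {}" using adm by (simp add: admissible_def)
    \<comment> \<open>At most \<open>n / 2 + 1\<close> letters are cut off, and for
      \<open>n \<ge> 4\<close> at least a quarter remains, as \<open>bridge_density\<close>
      demands.\<close>
    have n4: "n \<le> 4 * m"
    proof -
      have "1 / real Q * real n \<le> 1 / 2 * real n" using Q by (intro mult_right_mono) (auto simp: field_simps)
      then have "real (ceil_div Q n) \<le> 1 / 2 * real n + 1" using ceil_div_bounds(3)[OF Q1, of n] by linarith
      moreover have "real m = real n - real (ceil_div Q n)" using ceil_div_bounds(1)[OF Q1] by (simp add: m_def of_nat_diff)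
      ultimately have "real n \<le> 4 * real m" using n(2) by linarith
      then show ?thesis by linarith
    qed
    define h where "h y = \<bar>Z y - E (n - m) Z\<bar>" for y
    have ih: "integrable (W (n - m)) h"
      unfolding h_def using sq_int_integrable[OF sq_int_diff[OF sqZ sq_int_const]] by simp
    have ihb: "integrable (bridge n) (\<lambda>w. h (drop m w))"
      by (intro integrable_cond_pmf[OF ne] integrable_take_drop m ih)
    have hb: "measure_pmf.expectation (bridge n) (\<lambda>w. h (drop m w)) \<le> K * (S * sqrt (n - m))"
    proof -
      have "measure_pmf.expectation (bridge n) (\<lambda>w. h (drop m w)) \<le> K * E (n - m) h"
        by (rule dens(2)[OF n(1) adm m(1) _ n4 ih]) (simp add: h_def)
      also have "\<dots> \<le> K * (S * sqrt (n - m))"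
      proof (rule mult_left_mono)
        have "E (n - m) h \<le> sd (W (n - m)) Z"
          unfolding h_def sd_eq_l2 by (intro expectation_abs_le_l2 sq_int_diff sqZ sq_int_const)
        then show "E (n - m) h \<le> S * sqrt (n - m)" using S(2)[of "n - m"] by linarith
      qed (use K in simp)
      finally show ?thesis .
    qed
    let ?c = "\<bar>lam\<bar> + (C + 2 * K1) * fourth_root n"
    have diff: "A n - BQ Q n = measure_pmf.expectation (bridge n) (\<lambda>w. cis (t / sqrt n * (G w - \<mu> * n)) - cis (t / sqrt n * (Z (take m w) - E m Z)))"
      unfolding A_def BQ_def m_def by (subst Bochner_Integration.integral_diff) auto
    have "cmod (A n - BQ Q n) \<le> measure_pmf.expectation (bridge n) (\<lambda>w. cmod (cis (t / sqrt n * (G w - \<mu> * n)) - cis (t / sqrt n * (Z (take m w) - E m Z))))"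
      unfolding diff by (rule integral_norm_bound)
    also have "\<dots> \<le> measure_pmf.expectation (bridge n) (\<lambda>w. \<bar>t\<bar> / sqrt n * (?c + h (drop m w)))"
    proof (rule integral_mono_AE)
      show "AE w in bridge n. cmod (cis (t / sqrt n * (G w - \<mu> * n)) - cis (t / sqrt n * (Z (take m w) - E m Z))) \<le> \<bar>t\<bar> / sqrt n * (?c + h (drop m w))"
      proof (rule AE_pmfI)
        fix w assume w: "w \<in> set_pmf (bridge n)"
        have "cmod (cis (t / sqrt n * (G w - \<mu> * n)) - cis (t / sqrt n * (Z (take m w) - E m Z)))
            \<le> \<bar>t / sqrt n * (G w - \<mu> * n) - t / sqrt n * (Z (take m w) - E m Z)\<bar>" by (rule norm_cis_diff_le)
        also have "\<dots> = \<bar>t\<bar> / sqrt n * \<bar>(G w - \<mu> * n) - (Z (take m w) - E m Z)\<bar>"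
          unfolding right_diff_distrib[symmetric] abs_mult by (simp add: abs_divide)
        also have "\<dots> \<le> \<bar>t\<bar> / sqrt n * (?c + h (drop m w))"
          unfolding h_def by (intro mult_left_mono near[OF adm w m(1)]) simp
        finally show "cmod (cis (t / sqrt n * (G w - \<mu> * n)) - cis (t / sqrt n * (Z (take m w) - E m Z))) \<le> \<bar>t\<bar> / sqrt n * (?c + h (drop m w))" .
      qed
      show "integrable (bridge n) (\<lambda>w. cmod (cis (t / sqrt n * (G w - \<mu> * n)) - cis (t / sqrt n * (Z (take m w) - E m Z))))"
        by (intro integrable_norm Bochner_Integration.integrable_diff integrable_cis)
    qed (use ihb in auto)
    also have "\<dots> = \<bar>t\<bar> / sqrt n * (?c + measure_pmf.expectation (bridge n) (\<lambda>w. h (drop m w)))"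
      using ihb by simp
    also have "\<dots> \<le> \<bar>t\<bar> / sqrt n * (?c + K * (S * sqrt (n - m)))"
      using hb by (intro mult_left_mono add_left_mono) auto
    also have "\<dots> = err Q n"
      unfolding err_def m(2) by (simp add: real_sqrt_divide add_divide_distrib algebra_simps)
    finally show ?thesis .
  qed
  have errlim: "err Q \<longlonglongrightarrow> \<bar>t\<bar> * K * S * sqrt (1 / Q)" if "1 \<le> Q" for Q
  proof -
    have "(\<lambda>n. \<bar>lam\<bar> / sqrt (real n)) \<longlonglongrightarrow> 0"
      by (rule real_tendsto_divide_at_top[OF tendsto_const])
        (intro filterlim_compose[OF sqrt_at_top] filterlim_real_sequentially)
    then have "err Q \<longlonglongrightarrow> \<bar>t\<bar> * (0 + (C + 2 * K1) * 0 + K * S * sqrt (1 / Q))"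
      unfolding err_def
      by (intro tendsto_mult tendsto_add tendsto_const fourth_root_div_sqrt_tendsto tendsto_real_sqrt ceil_div_tendsto that)
    then show ?thesis by (simp add: mult.assoc)
  qed
  have inv0: "(\<lambda>Q. 1 / real Q) \<longlonglongrightarrow> 0" by (rule lim_1_over_n)
  have LQlim: "LQ \<longlonglongrightarrow> L"
  proof -
    have "LQ \<longlonglongrightarrow> exp (complex_of_real (- ((1 - 0) * \<sigma>\<^sup>2 * t\<^sup>2 / 2)))"
      unfolding LQ_def by (intro tendsto_exp tendsto_of_real tendsto_minus tendsto_divide tendsto_mult tendsto_diff tendsto_const inv0) simp
    then show ?thesis by (simp add: L_def)
  qed
  have elim0: "(\<lambda>Q. \<bar>t\<bar> * K * S * sqrt (1 / real Q)) \<longlonglongrightarrow> 0"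
  proof -
    have "(\<lambda>Q. \<bar>t\<bar> * K * S * sqrt (1 / real Q)) \<longlonglongrightarrow> \<bar>t\<bar> * K * S * sqrt 0"
      by (intro tendsto_mult tendsto_const tendsto_real_sqrt inv0)
    then show ?thesis by simp
  qed
  have "(\<lambda>n. if admissible n then A n else L) \<longlonglongrightarrow> L"
  proof (rule tendstoI)
    fix \<epsilon> :: real assume \<epsilon>: "0 < \<epsilon>"
    have "\<forall>\<^sub>F Q in sequentially. \<bar>t\<bar> * K * S * sqrt (1 / real Q) < \<epsilon> / 3"
      using elim0 \<epsilon> by (intro order_tendstoD(2)) auto
    moreover have "\<forall>\<^sub>F Q in sequentially. dist (LQ Q) L < \<epsilon> / 3" using tendstoD[OF LQlim, of "\<epsilon> / 3"] \<epsilon> by simp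
    ultimately have "\<forall>\<^sub>F Q in sequentially. \<bar>t\<bar> * K * S * sqrt (1 / real Q) < \<epsilon> / 3 \<and> dist (LQ Q) L < \<epsilon> / 3 \<and> 2 \<le> Q"
      using eventually_ge_at_top[of 2] by eventually_elim auto
    then obtain Q :: nat where Q: "\<bar>t\<bar> * K * S * sqrt (1 / real Q) < \<epsilon> / 3" "dist (LQ Q) L < \<epsilon> / 3" "2 \<le> Q"
      by (auto simp: eventually_sequentially)
    have "\<forall>\<^sub>F n in sequentially. err Q n < \<epsilon> / 3"
      using errlim[of Q] Q by (intro order_tendstoD(2)) auto
    moreover have "\<forall>\<^sub>F n in sequentially. dist (if admissible n then BQ Q n else LQ Q) (LQ Q) < \<epsilon> / 3"
      using tendstoD[OF bridge_char[OF Z var Q(3), of t], of "\<epsilon> / 3"] \<epsilon> unfolding BQ_def LQ_def by simp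
    ultimately show "\<forall>\<^sub>F n in sequentially. dist (if admissible n then A n else L) L < \<epsilon>"
      using eventually_ge_at_top[of N] eventually_ge_at_top[of 4]
    proof eventually_elim
      case (elim n)
      show ?case
      proof (cases "admissible n")
        case True
        have "dist (A n) L \<le> dist (A n) (BQ Q n) + dist (BQ Q n) (LQ Q) + dist (LQ Q) L"
          using dist_triangle[of "A n" L "BQ Q n"] dist_triangle[of "BQ Q n" L "LQ Q"] by linarith
        moreover have "dist (A n) (BQ Q n) \<le> err Q n" unfolding dist_norm by (rule AB[OF Q(3) True elim(3,4)])
        ultimately show ?thesis using elim Q True by simp
      qed (use \<epsilon> in simp)
    qed
  qed
  then show "(\<lambda>n. if admissible n then measure_pmf.expectation (bridge n) (\<lambda>w. cis (t / sqrt n * (G w - \<mu> * n)))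
      else exp (complex_of_real (- (\<sigma>\<^sup>2 * t\<^sup>2 / 2)))) \<longlonglongrightarrow> exp (complex_of_real (- (\<sigma>\<^sup>2 * t\<^sup>2 / 2)))"
    unfolding A_def L_def .
  obtain K4 where K4: "0 \<le> K4" "\<And>n. E n (\<lambda>w. (G w - E n G) ^ 4) \<le> K4 * (real n)\<^sup>2"
    using fourth_moment[OF G B] by blast
  obtain CG where CG: "\<And>x y. \<bar>G (x @ y) - G x - G y\<bar> \<le> CG * fourth_root (length x + length y)"
    using G by (auto simp: almost_additive_def)
  \<comment> \<open>The constant arises because \<open>power4_add_le\<close> is applied twice, to
    separate the two halves and then the remainder.\<close>
  define c4 where "c4 = 28561 * (28561 * (CG + 2 * K1) ^ 4)"
  have bddG: "\<bar>G w\<bar> \<le> \<bar>B\<bar> * n" if "length w = n" for w n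
    using B[of w] that by (intro order_trans[OF B]) (auto intro: mult_right_mono)
  have intG: "integrable (W n) (\<lambda>w. (G w - c) ^ 4)" for n c
  proof (rule integrable_pmf_bounded)
    fix w assume "w \<in> set_pmf (W n)"
    then have "\<bar>G w - c\<bar> \<le> \<bar>B\<bar> * n + \<bar>c\<bar>" using bddG[of w n] by (auto dest: length_replicate_pmf)
    then show "norm ((G w - c) ^ 4) \<le> (\<bar>B\<bar> * n + \<bar>c\<bar>) ^ 4" unfolding real_norm_def power_abs by (intro power_mono) auto
  qed
  have "measure_pmf.expectation (bridge n) (\<lambda>w. (G w - \<mu> * n) ^ 4) \<le> (3 / 2 * (K * K4) + 28561 * (3 / 2 * (K * K4)) + c4) * (real n)\<^sup>2"
    if adm: "admissible n" and n: "max N 2 \<le> n" for n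
  proof -
    have ne: "set_pmf (W n) \<inter> slice n \<noteq> {}" using adm by (simp add: admissible_def)
    define m where "m = n div 2"
    have m: "m \<le> n" "n \<le> 4 * (n - m)" "n \<le> 4 * m" using n by (auto simp: m_def)
    define a b where "a w = (G w - E m G) ^ 4" and "b w = (G w - E (n - m) G) ^ 4" for w
    have iab: "integrable (bridge n) (\<lambda>w. a (take m w))" "integrable (bridge n) (\<lambda>w. b (drop m w))"
      unfolding a_def b_def by (intro integrable_cond_pmf[OF ne] integrable_take_drop m intG)+
    have "measure_pmf.expectation (bridge n) (\<lambda>w. (G w - \<mu> * n) ^ 4)
        \<le> measure_pmf.expectation (bridge n) (\<lambda>w. 3 / 2 * a (take m w) + 28561 * (3 / 2 * b (drop m w)) + c4 * n)"
    proof (rule integral_mono_AE)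
      show "AE w in bridge n. (G w - \<mu> * n) ^ 4 \<le> 3 / 2 * a (take m w) + 28561 * (3 / 2 * b (drop m w)) + c4 * n"
      proof (rule AE_pmfI)
        fix w assume w: "w \<in> set_pmf (bridge n)"
        have len: "length w = n" using set_bridge[OF adm w] by simp
        define x y R where "x = G (take m w) - E m G" and "y = G (drop m w) - E (n - m) G" and "R = (G w - \<mu> * n) - x - y"
        have 1: "\<bar>G w - G (take m w) - G (drop m w)\<bar> \<le> CG * fourth_root n"
          using CG[of "take m w" "drop m w"] len m by simp
        have 2: "\<bar>E m G - \<mu> * real m\<bar> \<le> K1 * fourth_root n"
          by (rule order_trans[OF mu[of m] mult_left_mono[OF fourth_root_mono[OF m(1)] K10]])
        have 3: "\<bar>E (n - m) G - \<mu> * real (n - m)\<bar> \<le> K1 * fourth_root n"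
          by (rule order_trans[OF mu[of "n - m"] mult_left_mono[OF fourth_root_mono[of "n - m" n] K10]]) simp
        have nm: "\<mu> * real n = \<mu> * real m + \<mu> * real (n - m)" using m by (simp add: of_nat_diff algebra_simps)
        have "R = (G w - G (take m w) - G (drop m w)) + (E m G - \<mu> * real m) + (E (n - m) G - \<mu> * real (n - m)) + 0 + 0"
          unfolding R_def x_def y_def nm by simp
        also have "\<bar>\<dots>\<bar> \<le> CG * fourth_root n + K1 * fourth_root n + K1 * fourth_root n + 0 + 0"
          by (rule abs_sum5_le[OF 1 2 3]) simp_all
        finally have "\<bar>R\<bar> \<le> (CG + 2 * K1) * fourth_root n" by (simp add: algebra_simps)
        then have "\<bar>R\<bar> ^ 4 \<le> ((CG + 2 * K1) * fourth_root n) ^ 4" by (intro power_mono) auto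
        then have R4: "R ^ 4 \<le> (CG + 2 * K1) ^ 4 * n"
          by (simp only: power_mult_distrib fourth_root_pow4 power_even_abs_numeral even_numeral)
        have "G w - \<mu> * n = x + (y + R)" by (simp add: R_def)
        then have "(G w - \<mu> * n) ^ 4 \<le> 3 / 2 * x ^ 4 + 28561 * (y + R) ^ 4" by (simp only: power4_add_le)
        also have "\<dots> \<le> 3 / 2 * x ^ 4 + 28561 * (3 / 2 * y ^ 4 + 28561 * R ^ 4)"
          using power4_add_le[of y R] by simp
        also have "\<dots> \<le> 3 / 2 * x ^ 4 + 28561 * (3 / 2 * y ^ 4 + 28561 * ((CG + 2 * K1) ^ 4 * n))"
          using R4 by simp
        also have "\<dots> = 3 / 2 * a (take m w) + 28561 * (3 / 2 * b (drop m w)) + c4 * n"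
          by (simp add: a_def b_def x_def y_def c4_def algebra_simps)
        finally show "(G w - \<mu> * n) ^ 4 \<le> 3 / 2 * a (take m w) + 28561 * (3 / 2 * b (drop m w)) + c4 * n" .
      qed
      show "integrable (bridge n) (\<lambda>w. (G w - \<mu> * n) ^ 4)" by (intro integrable_cond_pmf[OF ne] intG)
    qed (use iab in auto)
    also have "\<dots> = 3 / 2 * measure_pmf.expectation (bridge n) (\<lambda>w. a (take m w))
        + 28561 * (3 / 2 * measure_pmf.expectation (bridge n) (\<lambda>w. b (drop m w))) + c4 * n"
      using iab by simp
    also have "\<dots> \<le> 3 / 2 * (K * (K4 * (real n)\<^sup>2)) + 28561 * (3 / 2 * (K * (K4 * (real n)\<^sup>2))) + c4 * (real n)\<^sup>2"
    proof (intro add_mono mult_left_mono)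
      have le: "K4 * (real k)\<^sup>2 \<le> K4 * (real n)\<^sup>2" if "k \<le> n" for k
        using that K4(1) by (intro mult_left_mono power_mono) auto
      have "measure_pmf.expectation (bridge n) (\<lambda>w. a (take m w)) \<le> K * E m a"
        by (rule dens(1)) (use n adm m intG in \<open>auto simp: a_def\<close>)
      also have "\<dots> \<le> K * (K4 * (real n)\<^sup>2)"
        unfolding a_def using K by (intro mult_left_mono order_trans[OF K4(2) le] m) auto
      finally show "measure_pmf.expectation (bridge n) (\<lambda>w. a (take m w)) \<le> K * (K4 * (real n)\<^sup>2)" .
      have "measure_pmf.expectation (bridge n) (\<lambda>w. b (drop m w)) \<le> K * E (n - m) b"
        by (rule dens(2)) (use n adm m intG in \<open>auto simp: b_def\<close>)
      also have "\<dots> \<le> K * (K4 * (real n)\<^sup>2)"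
        unfolding b_def using K by (intro mult_left_mono order_trans[OF K4(2) le]) auto
      finally show "measure_pmf.expectation (bridge n) (\<lambda>w. b (drop m w)) \<le> K * (K4 * (real n)\<^sup>2)" .
      show "real n \<le> (real n)\<^sup>2" using n by (simp add: power2_eq_square)
    qed (auto simp: c4_def)
    finally show ?thesis by (simp add: algebra_simps)
  qed
  then show "\<exists>K N. \<forall>n\<ge>N. admissible n \<longrightarrow> measure_pmf.expectation (bridge n) (\<lambda>w. (G w - \<mu> * n) ^ 4) \<le> K * (real n)\<^sup>2"
    by blast
qed

text \<open>The means are superadditive, and a word of one letter gains \<open>ln 2\<close> if the
  letter is 0, since a leaf has \<open>R = 1\<close>, and nothing otherwise.\<close>

lemma word_total_mean_pos: "real n * (pmf p 0 * ln 2) \<le> E n word_total"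
proof (induction n)
  case (Suc n)
  have int: "integrable (W k) word_total" for k by (rule integrable_word_gain) simp
  have E1: "E 1 word_total = pmf p 0 * ln 2"
  proof -
    have "word_total [d] = ln 2 * indicator {0} d" for d
      by (auto simp: step_gain_def)
    then have "E 1 word_total = measure_pmf.expectation p (\<lambda>d. ln 2 * indicator {0} d)"
      unfolding replicate_pmf_1 integral_map_pmf by simp
    also have "\<dots> = ln 2 * measure_pmf.prob p {0}" by simp
    finally show ?thesis by (simp add: measure_pmf_single)
  qed
  have super: "E n word_total + E k word_total \<le> E (n + k) word_total" for n k
  proof -
    have i: "integrable (pair_pmf (W n) (W k)) (\<lambda>z. word_total (fst z))" "integrable (pair_pmf (W n) (W k)) (\<lambda>z. word_total (snd z))"
      using integrable_pmf_fst_snd(1)[OF int[of n]] integrable_pmf_fst_snd(2)[OF int[of k]] by auto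
    have "E n word_total + E k word_total = measure_pmf.expectation (pair_pmf (W n) (W k)) (\<lambda>z. word_total (fst z) + word_total (snd z))"
      using i expectation_pair_pmf_fst[of "W n" "W k" word_total] expectation_pair_pmf_snd[of "W n" "W k" word_total] by simp
    also have "\<dots> \<le> measure_pmf.expectation (pair_pmf (W n) (W k)) (\<lambda>z. word_total (fst z @ snd z))"
    proof (rule integral_mono)
      show "integrable (pair_pmf (W n) (W k)) (\<lambda>z. word_total (fst z @ snd z))"
        using int[of "n + k"] unfolding replicate_pmf_add integrable_map_pmf_eq .
    qed (use i word_gain_almost_additive in auto)
    also have "\<dots> = E (n + k) word_total" by (rule expectation_append[symmetric])
    finally show ?thesis .
  qed
  show ?case using Suc E1 super[of n 1] by (simp add: algebra_simps del: replicate_pmf.simps)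
qed simp

end

section \<open>Rotation of bridges and weak convergence\<close>

abbreviation centered_normal :: "real \<Rightarrow> real measure" where
  "centered_normal \<sigma> \<equiv> density lborel (normal_density 0 \<sigma>)"

lemma centered_normal_eq:
  assumes "0 < \<sigma>"
  shows "centered_normal \<sigma> = distr std_normal_distribution borel (\<lambda>x. \<sigma> * x)"
proof -
  interpret prob_space std_normal_distribution by (rule prob_space_normal_density) simp
  have "distributed std_normal_distribution lborel (\<lambda>x. x) std_normal_density"
    unfolding distributed_def by (auto simp: distr_id2[of lborel] intro!: distr_cong)
  from normal_density_affine[OF this, of \<sigma> 0]
  have "distributed std_normal_distribution lborel (\<lambda>x. 0 + \<sigma> * x) (normal_density (0 + \<sigma> * 0) (\<bar>\<sigma>\<bar> * 1))"
    using assms by simp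
  then have "centered_normal \<sigma> = distr std_normal_distribution lborel (\<lambda>x. \<sigma> * x)"
    using assms by (auto dest!: distributed_distr_eq_density)
  also have "\<dots> = distr std_normal_distribution borel (\<lambda>x. \<sigma> * x)" by (rule distr_cong) simp_all
  finally show ?thesis .
qed

lemma centered_normal_facts:
  assumes "0 < \<sigma>"
  shows "real_distribution (centered_normal \<sigma>)"
    and "char (centered_normal \<sigma>) t = exp (complex_of_real (- (\<sigma>\<^sup>2 * t\<^sup>2 / 2)))"
    and "(LINT x|centered_normal \<sigma>. x) = 0" and "(LINT x|centered_normal \<sigma>. x\<^sup>2) = \<sigma>\<^sup>2"
    and "integrable (centered_normal \<sigma>) (\<lambda>x. x ^ 4)"
proof -
  interpret S: real_distribution std_normal_distribution by (rule real_dist_normal_dist)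
  note eq = centered_normal_eq[OF assms]
  show "real_distribution (centered_normal \<sigma>)" unfolding eq by (rule S.real_distribution_distr) simp
  have "char (centered_normal \<sigma>) t = char std_normal_distribution (t * \<sigma>)"
    unfolding eq char_def by (subst integral_distr) (auto simp: mult_ac)
  then show "char (centered_normal \<sigma>) t = exp (complex_of_real (- (\<sigma>\<^sup>2 * t\<^sup>2 / 2)))"
    unfolding exp_of_real by (simp add: char_std_normal_distribution power_mult_distrib mult.commute)
  have "(LINT x|centered_normal \<sigma>. x) = \<sigma> * (LINT x|std_normal_distribution. x ^ 1)"
    unfolding eq by (subst integral_distr) auto
  also have "(LINT x|std_normal_distribution. x ^ 1) = 0"
    by (rule integral_std_normal_distribution_moment_odd) simp
  finally show "(LINT x|centered_normal \<sigma>. x) = 0" by simp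
  have "(LINT x|centered_normal \<sigma>. x\<^sup>2) = \<sigma>\<^sup>2 * (LINT x|std_normal_distribution. x ^ (2 * 1))"
    unfolding eq by (subst integral_distr) (auto simp: power_mult_distrib)
  also have "(LINT x|std_normal_distribution. x ^ (2 * 1)) = fact (2 * 1) / (2 ^ 1 * fact 1)"
    by (rule std_normal_distribution_even_moments)
  finally show "(LINT x|centered_normal \<sigma>. x\<^sup>2) = \<sigma>\<^sup>2" by (simp add: fact_numeral)
  show "integrable (centered_normal \<sigma>) (\<lambda>x. x ^ 4)"
    unfolding eq by (subst integrable_distr_eq)
      (use integrable_std_normal_distribution_moment[of 4] in \<open>auto simp: power_mult_distrib\<close>)
qed

text \<open>Uniform integrability from fourth moments: replacing \<open>f\<close> by its truncation
  at level \<open>A\<close> costs at most \<open>K / (A + 1) ^ 2\<close>, uniformly in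
  \<open>n\<close>, and weak convergence handles bounded continuous functions.\<close>

lemma weak_conv_integral_truncation:
  fixes f :: "real \<Rightarrow> real" and fA :: "nat \<Rightarrow> real \<Rightarrow> real"
  assumes M: "\<And>n. real_distribution (\<nu> n)" and N: "real_distribution N" and conv: "weak_conv_m \<nu> N"
    and m4: "\<And>n. integrable (\<nu> n) (\<lambda>x. x ^ 4)" "\<And>n. (LINT x|\<nu> n. x ^ 4) \<le> K" "integrable N (\<lambda>x. x ^ 4)" "(LINT x|N. x ^ 4) \<le> K"
    and f: "f \<in> borel_measurable borel"
    and fA: "\<And>A x. isCont (fA A) x" "\<And>A x. \<bar>fA A x\<bar> \<le> B A" "\<And>A x. \<bar>f x - fA A x\<bar> \<le> x ^ 4 / (real A + 1)\<^sup>2"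
  shows "(\<lambda>n. LINT x|\<nu> n. f x) \<longlonglongrightarrow> (LINT x|N. f x)"
proof -
  have fA_meas: "fA A \<in> borel_measurable borel" for A
    by (intro borel_measurable_continuous_onI continuous_at_imp_continuous_on) (use fA(1) in auto)
  have trunc: "\<bar>(LINT x|M. f x) - (LINT x|M. fA A x)\<bar> \<le> K / (real A + 1)\<^sup>2"
    if M: "real_distribution M" and i4: "integrable M (\<lambda>x. x ^ 4)" and k4: "(LINT x|M. x ^ 4) \<le> K" for M A
  proof -
    interpret real_distribution M by fact
    have meas: "f \<in> borel_measurable M" "fA A \<in> borel_measurable M"
      using f fA_meas by (simp_all cong: measurable_cong_sets)
    have iA: "integrable M (fA A)"
      by (rule integrable_const_bound[of _ "B A"]) (use fA(2) meas in auto)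
    have i: "integrable M f"
    proof (rule Bochner_Integration.integrable_bound)
      show "integrable M (\<lambda>x. B A + x ^ 4 / (real A + 1)\<^sup>2)" using i4 by simp
      have "\<bar>f x\<bar> \<le> \<bar>B A + x ^ 4 / (real A + 1)\<^sup>2\<bar>" for x
        using fA(2)[of A x] fA(3)[of x A] by linarith
      then show "AE x in M. norm (f x) \<le> norm (B A + x ^ 4 / (real A + 1)\<^sup>2)" by simp
    qed (rule meas)
    have "\<bar>(LINT x|M. f x) - (LINT x|M. fA A x)\<bar> = \<bar>LINT x|M. f x - fA A x\<bar>" using i iA by simp
    also have "\<dots> \<le> (LINT x|M. \<bar>f x - fA A x\<bar>)" by (rule integral_abs_bound)
    also have "\<dots> \<le> (LINT x|M. x ^ 4 / (real A + 1)\<^sup>2)"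
      by (rule integral_mono) (use i iA i4 fA(3) in auto)
    also have "\<dots> \<le> K / (real A + 1)\<^sup>2" using k4 by (simp add: divide_right_mono)
    finally show ?thesis .
  qed
  have small: "(\<lambda>A. K / (real A + 1)\<^sup>2) \<longlonglongrightarrow> 0"
  proof -
    have "(\<lambda>A. K * (inverse (real (Suc A)))\<^sup>2) \<longlonglongrightarrow> K * 0\<^sup>2"
      by (intro tendsto_mult tendsto_power tendsto_const LIMSEQ_inverse_real_of_nat)
    then show ?thesis by (simp add: divide_inverse power_inverse add.commute)
  qed
  show ?thesis
  proof (rule tendstoI)
    fix \<epsilon> :: real assume \<epsilon>: "0 < \<epsilon>"
    have "\<forall>\<^sub>F A in sequentially. K / (real A + 1)\<^sup>2 < \<epsilon> / 3" using small \<epsilon> by (intro order_tendstoD(2)) auto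
    then obtain A where A: "K / (real A + 1)\<^sup>2 < \<epsilon> / 3" by (auto simp: eventually_sequentially)
    have "(\<lambda>n. LINT x|\<nu> n. fA A x) \<longlonglongrightarrow> (LINT x|N. fA A x)"
      by (rule weak_conv_imp_integral_bdd_continuous_conv[OF M N conv fA(1)]) (use fA(2) in auto)
    then have "\<forall>\<^sub>F n in sequentially. dist (LINT x|\<nu> n. fA A x) (LINT x|N. fA A x) < \<epsilon> / 3"
      using \<epsilon> by (intro tendstoD) auto
    then show "\<forall>\<^sub>F n in sequentially. dist (LINT x|\<nu> n. f x) (LINT x|N. f x) < \<epsilon>"
    proof eventually_elim
      case (elim n)
      then show ?case
        using trunc[OF M m4(1,2), of n A] trunc[OF N m4(3,4), of A] A unfolding dist_real_def abs_le_iff abs_less_iff by linarith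
    qed
  qed
qed

text \<open>Beyond the level \<open>A + 1 \<ge> 1\<close> both \<open>|x|\<close> and
  \<open>x ^ 2\<close> are at most \<open>x ^ 4 / (A + 1) ^ 2\<close>, and up to that level the
  truncations change nothing.\<close>

lemma weak_conv_moments:
  assumes M: "\<And>n. real_distribution (\<nu> n)" and N: "real_distribution N" and conv: "weak_conv_m \<nu> N"
    and m4: "\<And>n. integrable (\<nu> n) (\<lambda>x. x ^ 4)" "\<And>n. (LINT x|\<nu> n. x ^ 4) \<le> K" "integrable N (\<lambda>x. x ^ 4)" "(LINT x|N. x ^ 4) \<le> K"
  shows "(\<lambda>n. LINT x|\<nu> n. x) \<longlonglongrightarrow> (LINT x|N. x)" and "(\<lambda>n. LINT x|\<nu> n. x\<^sup>2) \<longlonglongrightarrow> (LINT x|N. x\<^sup>2)"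
proof -
  have large: "1 \<le> \<bar>x\<bar> ^ k / (real A + 1) ^ k" if "real A + 1 < \<bar>x\<bar>" for x A k
    using power_mono[of "real A + 1" "\<bar>x\<bar>" k] that by (simp add: le_divide_eq_1_pos)
  show "(\<lambda>n. LINT x|\<nu> n. x) \<longlonglongrightarrow> (LINT x|N. x)"
  proof (rule weak_conv_integral_truncation[OF M N conv m4, where fA="\<lambda>A x. max (- (real A + 1)) (min (real A + 1) x)" and B="\<lambda>A. real A + 1"])
    show "\<bar>x - max (- (real A + 1)) (min (real A + 1) x)\<bar> \<le> x ^ 4 / (real A + 1)\<^sup>2" for A x
    proof (cases "\<bar>x\<bar> \<le> real A + 1")
      case False
      have l: "1 \<le> \<bar>x\<bar> ^ 2 / (real A + 1) ^ 2" by (rule large) (use False in simp)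
      have "\<bar>x - max (- (real A + 1)) (min (real A + 1) x)\<bar> \<le> \<bar>x\<bar>" using False by (auto simp: max_def min_def)
      also have "\<dots> \<le> \<bar>x\<bar>\<^sup>2" by (rule self_le_power) (use False in auto)
      also have "\<dots> \<le> \<bar>x\<bar>\<^sup>2 * (\<bar>x\<bar> ^ 2 / (real A + 1) ^ 2)" using mult_left_mono[OF l, of "\<bar>x\<bar>\<^sup>2"] by simp
      also have "\<dots> = x ^ 4 / (real A + 1)\<^sup>2" by (simp add: power4_eq_xxxx power2_eq_square)
      finally show ?thesis .
    qed (auto simp: max_def min_def)
  qed (auto intro!: continuous_intros)
  show "(\<lambda>n. LINT x|\<nu> n. x\<^sup>2) \<longlonglongrightarrow> (LINT x|N. x\<^sup>2)"
  proof (rule weak_conv_integral_truncation[OF M N conv m4, where fA="\<lambda>A x. min ((real A + 1)\<^sup>2) (x\<^sup>2)" and B="\<lambda>A. (real A + 1)\<^sup>2"])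
    show "\<bar>x\<^sup>2 - min ((real A + 1)\<^sup>2) (x\<^sup>2)\<bar> \<le> x ^ 4 / (real A + 1)\<^sup>2" for A x
    proof (cases "\<bar>x\<bar> \<le> real A + 1")
      case True
      then have "x\<^sup>2 \<le> (real A + 1)\<^sup>2" using power_mono[OF True, of 2] by simp
      then show ?thesis by (simp add: min_def)
    next
      case False
      have l: "1 \<le> \<bar>x\<bar> ^ 2 / (real A + 1) ^ 2" by (rule large) (use False in simp)
      have "\<bar>x\<^sup>2 - min ((real A + 1)\<^sup>2) (x\<^sup>2)\<bar> \<le> \<bar>x\<bar>\<^sup>2" by (auto simp: min_def)
      also have "\<dots> \<le> \<bar>x\<bar>\<^sup>2 * (\<bar>x\<bar> ^ 2 / (real A + 1) ^ 2)" using mult_left_mono[OF l, of "\<bar>x\<bar>\<^sup>2"] by simp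
      also have "\<dots> = x ^ 4 / (real A + 1)\<^sup>2" by (simp add: power4_eq_xxxx power2_eq_square)
      finally show ?thesis .
    qed
  qed (auto intro!: continuous_intros simp: abs_of_nonneg)
qed

text \<open>Meaningful for words of excess 1, for which the cycle lemma provides a unique valid
  rotation.\<close>

definition canonical_rotation :: "nat list \<Rightarrow> nat list" where
  "canonical_rotation w = rotate (THE j. j < length w \<and> valid_from (rotate j w) 0) w"

lemma canonical_rotation:
  assumes "excess w = 1"
  shows "valid_from (canonical_rotation w) 0" "length (canonical_rotation w) = length w"
    and "\<bar>word_total (canonical_rotation w) - word_total w\<bar> \<le> ln (1 + real (length w))"
  using theI'[OF cycle_lemma[OF assms]] word_gain_rotate by (auto simp: canonical_rotation_def)

context offspring_pmf
begin

text \<open>Rotation by one letter exchanges two independent factors of the product law.\<close>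

lemma map_rotate_replicate_pmf: "map_pmf (rotate j) (W n) = W n"
proof (induction j)
  case 0
  show ?case by (simp add: rotate_def)
next
  case (Suc j)
  have "map_pmf rotate1 (W n) = W n"
  proof (cases n)
    case 0
    then show ?thesis by simp
  next
    case n: (Suc k)
    have "map_pmf rotate1 (W n) = map_pmf (\<lambda>z. snd z @ [fst z]) (pair_pmf p (W k))"
      unfolding n replicate_pmf_Suc by (simp add: map_pmf_comp)
    also have "\<dots> = map_pmf (\<lambda>z. fst z @ [snd z]) (pair_pmf (W k) p)"
      by (subst pair_commute_pmf) (simp add: map_pmf_comp case_prod_beta)
    also have "\<dots> = map_pmf (\<lambda>z. fst z @ snd z) (pair_pmf (W k) (map_pmf (\<lambda>x. [x]) p))"
      by (simp add: pair_map_pmf2 map_pmf_comp apsnd_def map_prod_def case_prod_beta)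
    also have "\<dots> = map_pmf (\<lambda>z. fst z @ snd z) (pair_pmf (W k) (W 1))" by (simp only: replicate_pmf_1)
    also have "\<dots> = W (k + 1)" by (rule replicate_pmf_add[symmetric])
    finally show ?thesis using n by simp
  qed
  then have "map_pmf rotate1 (map_pmf (rotate j) (W n)) = W n" using Suc by simp
  then show ?case by (simp add: map_pmf_comp rotate_def o_def)
qed

end

lemma valid_from_excess: "valid_from w 0 \<Longrightarrow> excess w = 1"
  by (simp add: valid_from_iff)

lemma excess_rotate: "excess (rotate j w) = excess w"
proof (induction j)
  case (Suc j)
  then show ?case by (cases "rotate j w") auto
qed simp

context critical_offspring
begin

abbreviation codes :: "nat \<Rightarrow> nat list pmf" where
  "codes n \<equiv> cond_pmf (W n) {w. valid_from w 0}"

definition feasible :: "nat \<Rightarrow> bool" where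
  "feasible n \<longleftrightarrow> set_pmf (W n) \<inter> {w. valid_from w 0} \<noteq> {}"

lemma feasible_admissible:
  assumes "feasible n"
  shows "admissible n"
proof -
  obtain w where w: "w \<in> set_pmf (W n)" "valid_from w 0" using assms by (auto simp: feasible_def)
  have len: "length w = n" using w(1) by (rule length_replicate_pmf)
  have "sum_list w + 1 = n" using valid_from_excess[OF w(2)] len by (simp add: excess_eq)
  moreover from this have "step_span dvd n - 1" using step_span_dvd_sum_list[OF w(1)] by auto
  ultimately show ?thesis using w(1) by (auto simp: admissible_def slice_def)
qed

text \<open>Of the \<open>n\<close> rotations of a word, exactly one is valid if the word lies in
  the slice and none otherwise. Summation over the rotations and the rotation invariance of the law
  of i.i.d. words give the factor \<open>n\<close>.\<close>

lemma cycle_lemma_expectation: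
  fixes h :: "nat list \<Rightarrow> real"
  assumes h: "\<And>w. \<bar>h w\<bar> \<le> 1"
  shows "E n (\<lambda>w. indicator (slice n) w * h (canonical_rotation w)) = n * E n (\<lambda>w. indicator {w. valid_from w 0} w * h w)"
proof -
  let ?V = "{w. valid_from w 0}"
  have pointwise: "indicator (slice n) w * h (canonical_rotation w) = (\<Sum>j<n. indicator ?V (rotate j w) * h (rotate j w))"
    if w: "w \<in> set_pmf (W n)" for w
  proof -
    have len: "length w = n" using w by (rule length_replicate_pmf)
    show ?thesis
    proof (cases "w \<in> slice n")
      case True
      then have ex: "excess w = 1" using len by (simp add: slice_def excess_eq)
      define i where "i = (THE j. j < length w \<and> valid_from (rotate j w) 0)"
      have i: "i < n" "valid_from (rotate i w) 0" "\<And>j. j < n \<Longrightarrow> valid_from (rotate j w) 0 \<Longrightarrow> j = i"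
        using theI'[OF cycle_lemma[OF ex]] cycle_lemma[OF ex] len unfolding i_def by blast+
      have "(\<Sum>j<n. indicator ?V (rotate j w) * h (rotate j w)) = (\<Sum>j<n. if j = i then h (rotate i w) else 0)"
      proof (intro sum.cong refl)
        fix j assume "j \<in> {..<n}"
        then have "valid_from (rotate j w) 0 \<longleftrightarrow> j = i" using i(2) i(3)[of j] by blast
        then show "indicator ?V (rotate j w) * h (rotate j w) = (if j = i then h (rotate i w) else 0)"
          by (cases "j = i") simp_all
      qed
      also have "\<dots> = h (rotate i w)" using i(1) by simp
      finally show ?thesis using True unfolding canonical_rotation_def i_def[symmetric] by simp
    next
      case False
      have "\<not> valid_from (rotate j w) 0" for j
      proof
        assume "valid_from (rotate j w) 0"
        then have "excess w = 1" using valid_from_excess excess_rotate by metis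
        then show False using False len by (simp add: slice_def excess_eq)
      qed
      then show ?thesis using False by simp
    qed
  qed
  have int: "integrable (W n) (\<lambda>w. indicator ?V (rotate j w) * h (rotate j w))" for j
    by (rule integrable_pmf_bounded[of _ _ 1]) (use h in \<open>auto simp: indicator_def\<close>)
  have "E n (\<lambda>w. indicator (slice n) w * h (canonical_rotation w)) = E n (\<lambda>w. \<Sum>j<n. indicator ?V (rotate j w) * h (rotate j w))"
  proof (rule integral_cong_AE)
    show "AE w in W n. indicator (slice n) w * h (canonical_rotation w) = (\<Sum>j<n. indicator ?V (rotate j w) * h (rotate j w))"
      by (rule AE_pmfI) (rule pointwise)
  qed simp_all
  also have "\<dots> = (\<Sum>j<n. E n (\<lambda>w. indicator ?V (rotate j w) * h (rotate j w)))"
    by (rule Bochner_Integration.integral_sum) (rule int)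
  also have "\<dots> = (\<Sum>j<n. E n (\<lambda>w. indicator ?V w * h w))"
  proof (intro sum.cong refl)
    fix j
    have "E n (\<lambda>w. indicator ?V w * h w) = measure_pmf.expectation (map_pmf (rotate j) (W n)) (\<lambda>w. indicator ?V w * h w)"
      by (simp only: map_rotate_replicate_pmf)
    then show "E n (\<lambda>w. indicator ?V (rotate j w) * h (rotate j w)) = E n (\<lambda>w. indicator ?V w * h w)" by simp
  qed
  finally show ?thesis by simp
qed

text \<open>\<open>cycle_lemma_expectation\<close> with the constant 1 compares the normalising
  probabilities, and with the indicator of a single word the masses; the factor \<open>n\<close>
  cancels.\<close>

lemma codes_eq_rotated_bridge:
  assumes "feasible n"
  shows "codes n = map_pmf canonical_rotation (bridge n)"
proof (rule pmf_eqI)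
  fix c
  have adm: "admissible n" by (rule feasible_admissible[OF assms])
  have neV: "set_pmf (W n) \<inter> {w. valid_from w 0} \<noteq> {}" using assms by (simp add: feasible_def)
  have neS: "set_pmf (W n) \<inter> slice n \<noteq> {}" and n: "1 \<le> n" using adm by (auto simp: admissible_def)
  have "measure_pmf.prob (W n) (slice n) = n * measure_pmf.prob (W n) {w. valid_from w 0}"
    using cycle_lemma_expectation[of "\<lambda>_. 1" n] by simp
  moreover have "pmf (codes n) c = E n (\<lambda>w. indicator {w. valid_from w 0} w * indicator {c} w) / measure_pmf.prob (W n) {w. valid_from w 0}"
    using expectation_cond_pmf[OF neV, of "indicator {c} :: _ \<Rightarrow> real"] by (simp add: measure_pmf_single divide_inverse mult.commute)
  moreover have "pmf (map_pmf canonical_rotation (bridge n)) c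
    = E n (\<lambda>w. indicator (slice n) w * indicator {c} (canonical_rotation w)) / measure_pmf.prob (W n) (slice n)"
  proof -
    have "pmf (map_pmf canonical_rotation (bridge n)) c
        = measure_pmf.expectation (map_pmf canonical_rotation (bridge n)) (indicator {c})" by (simp add: measure_pmf_single)
    also have "\<dots> = measure_pmf.expectation (bridge n) (\<lambda>w. indicator {c} (canonical_rotation w))" by (rule integral_map_pmf)
    also have "\<dots> = E n (\<lambda>w. indicator (slice n) w * indicator {c} (canonical_rotation w)) / measure_pmf.prob (W n) (slice n)"
      unfolding expectation_cond_pmf[OF neS] by (simp add: divide_inverse mult.commute)
    finally show ?thesis .
  qed
  ultimately show "pmf (codes n) c = pmf (map_pmf canonical_rotation (bridge n)) c"
    using cycle_lemma_expectation[of "indicator {c}" n] n by (simp add: indicator_def)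
qed

end

lemma tendsto_along:
  assumes "g \<longlonglongrightarrow> L" "\<And>n. N \<le> n \<Longrightarrow> P n \<Longrightarrow> f n = g n"
  shows "(f \<longlongrightarrow> L) (inf sequentially (principal {n. P n}))"
proof -
  have "(g \<longlongrightarrow> L) (inf sequentially (principal {n. P n}))" by (rule tendsto_mono[OF inf_le1 assms(1)])
  moreover have "\<forall>\<^sub>F n in inf sequentially (principal {n. P n}). f n = g n"
    unfolding eventually_inf_principal using eventually_ge_at_top[of N] by eventually_elim (use assms(2) in auto)
  ultimately show ?thesis by (simp cong: tendsto_cong)
qed

context critical_offspring
begin

text \<open>The error of the linear approximation of the mean is of smaller order than
  \<open>n\<close>, so \<open>\<mu>\<close> is at least the linear lower bound
  \<open>pmf p 0 * ln 2\<close>. The positivity of \<open>\<sigma>\<close> comes from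
  \<open>asymptotic_sd_pos\<close>, which holds for whatever \<open>lam\<close> the decorrelation
  selects.\<close>

lemma word_total_constants:
  "\<exists>\<mu> K lam \<sigma>. 0 < \<mu> \<and> 0 < \<sigma> \<and> (\<forall>n. \<bar>E n word_total - \<mu> * real n\<bar> \<le> K * fourth_root n) \<and>
    (\<forall>a b. (\<lambda>n. (sd (W n) (\<lambda>w. a * (word_total w - lam * walk w) + b * walk w) / sqrt n)\<^sup>2)
      \<longlonglongrightarrow> a\<^sup>2 * \<sigma>\<^sup>2 + b\<^sup>2 * step_var)"
proof -
  obtain \<mu> K where mu: "\<And>n. \<bar>E n word_total - \<mu> * real n\<bar> \<le> K * fourth_root n"
    using mean_almost_additive[OF almost_additive_word_total] by blast
  define q where "q = pmf p 0 * ln 2"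
  have q: "0 < q" unfolding q_def using pmf_positive[OF zero_in_support] by simp
  have "q - \<mu> \<le> K * (fourth_root n / sqrt n)" if n: "1 \<le> n" "0 \<le> q - \<mu>" for n
  proof -
    have "(q - \<mu>) * sqrt n \<le> (q - \<mu>) * real n"
      using n(1) by (intro mult_left_mono n(2)) (simp add: sqrt_le_D real_le_lsqrt power2_eq_square)
    also have "\<dots> \<le> K * fourth_root n" using mu[of n] word_total_mean_pos[of n] by (simp add: q_def algebra_simps)
    finally show ?thesis using n(1) by (simp add: pos_le_divide_eq)
  qed
  then have "0 \<le> q - \<mu> \<Longrightarrow> q - \<mu> \<le> K * 0"
    by (intro LIMSEQ_le_const[OF tendsto_mult[OF tendsto_const fourth_root_div_sqrt_tendsto]]) auto
  then have \<mu>: "0 < \<mu>" using q by linarith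
  obtain lam \<sigma> where \<sigma>: "0 \<le> \<sigma>" and var: "\<And>a b. (\<lambda>n. (sd (W n) (\<lambda>w. a * (word_total w - lam * walk w) + b * walk w) / sqrt n)\<^sup>2)
      \<longlonglongrightarrow> a\<^sup>2 * \<sigma>\<^sup>2 + b\<^sup>2 * step_var"
    using decorrelation[OF almost_additive_word_total] by blast
  have "(\<lambda>n. sqrt ((sd (W n) (\<lambda>w. word_total w - lam * walk w) / sqrt n)\<^sup>2)) \<longlonglongrightarrow> sqrt (\<sigma>\<^sup>2)"
    using tendsto_real_sqrt[OF var[of 1 0]] by (simp del: real_sqrt_abs)
  then have "(\<lambda>n. sd (W n) (\<lambda>w. word_total w - lam * walk w) / sqrt n) \<longlonglongrightarrow> \<sigma>"
    using \<sigma> by (simp add: abs_divide)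
  from asymptotic_sd_pos[OF this] \<mu> mu var show ?thesis by blast
qed

definition feasible_sizes :: "nat filter" where
  "feasible_sizes = inf sequentially (principal {n. feasible n})"

text \<open>Formulated for every \<open>H\<close> within order \<open>fourth_root\<close> of the
  gain, so that both tree statistics are covered with the same constants. The limit for bridges
  passes to codes because the canonical rotation and the replacement of the gain by \<open>H\<close>
  change the normalised value by at most a multiple of
  \<open>fourth_root n / sqrt n\<close>.\<close>

theorem functional_limits:
  "\<exists>\<mu> \<sigma>. 0 < \<mu> \<and> 0 < \<sigma> \<and> (\<forall>H c. (\<forall>w. valid_from w 0 \<longrightarrow> \<bar>H w - word_total w\<bar> \<le> c * fourth_root (length w)) \<longrightarrow>
    weak_conv_along feasible_sizes (\<lambda>n. distr (codes n) borel (\<lambda>w. (H w - \<mu> * real n) / sqrt (real n))) (centered_normal \<sigma>) \<and>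
    ((\<lambda>n. (measure_pmf.expectation (codes n) H - \<mu> * real n) / sqrt (real n)) \<longlongrightarrow> 0) feasible_sizes \<and>
    ((\<lambda>n. measure_pmf.variance (codes n) H / real n) \<longlongrightarrow> \<sigma>\<^sup>2) feasible_sizes)"
proof -
  obtain \<mu> K lam \<sigma> where \<mu>: "0 < \<mu>" and \<sigma>: "0 < \<sigma>"
    and mean_bound: "\<And>n. \<bar>E n word_total - \<mu> * real n\<bar> \<le> K * fourth_root n"
    and var_lim: "\<And>a b. (\<lambda>n. (sd (W n) (\<lambda>w. a * (word_total w - lam * walk w) + b * walk w) / sqrt n)\<^sup>2)
      \<longlonglongrightarrow> a\<^sup>2 * \<sigma>\<^sup>2 + b\<^sup>2 * step_var"
    using word_total_constants by blast
  have bnd: "0 \<le> word_total w" "word_total w \<le> real (length w)" for w using word_gain_bounds[of "[]" w] by auto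
  then have Bb: "\<bar>word_total w\<bar> \<le> 1 * real (length w)" for w by (simp add: abs_of_nonneg)
  note clt = bridge_CLT(1)[OF almost_additive_word_total Bb var_lim mean_bound]
  obtain K4 N where K4: "\<And>n. N \<le> n \<Longrightarrow> admissible n \<Longrightarrow>
      measure_pmf.expectation (bridge n) (\<lambda>w. (word_total w - \<mu> * n) ^ 4) \<le> K4 * (real n)\<^sup>2"
    using bridge_CLT(2)[OF almost_additive_word_total Bb var_lim mean_bound] by blast
  show ?thesis
  proof (rule exI[of _ \<mu>], rule exI[of _ \<sigma>], intro conjI allI impI \<mu> \<sigma>)
    fix H :: "nat list \<Rightarrow> real" and c :: real
    assume H: "\<forall>w. valid_from w 0 \<longrightarrow> \<bar>H w - word_total w\<bar> \<le> c * fourth_root (length w)"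
    \<comment> \<open>The summand 4 is the price of the rotation, from the bound of the logarithm by
      \<open>4 * fourth_root n\<close>.\<close>
    define D where "D = c + 4"
    define X where "X n w = (H w - \<mu> * real n) / sqrt (real n)" for n w
    define V where "V n w = X n (canonical_rotation w)" for n w
    define U where "U n w = (word_total w - \<mu> * real n) / sqrt (real n)" for n w
    have near: "\<bar>V n w - U n w\<bar> \<le> D * (fourth_root n / sqrt n)"
      if n: "feasible n" and w: "w \<in> set_pmf (bridge n)" for n w
    proof -
      have len: "length w = n" "sum_list w + 1 = n" using set_bridge[OF feasible_admissible[OF n] w] by auto
      then have ex: "excess w = 1" by (simp add: excess_eq)
      have "\<bar>H (canonical_rotation w) - word_total (canonical_rotation w)\<bar> \<le> c * fourth_root n"
        using H canonical_rotation(1,2)[OF ex] len(1) by metis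
      moreover have "\<bar>word_total (canonical_rotation w) - word_total w\<bar> \<le> 4 * fourth_root n"
        using canonical_rotation(3)[OF ex] ln_le_fourth_root[of n] len(1) by simp
      ultimately have "\<bar>H (canonical_rotation w) - word_total w\<bar> \<le> D * fourth_root n"
        unfolding D_def distrib_right by linarith
      moreover have "V n w - U n w = (H (canonical_rotation w) - word_total w) / sqrt n"
        by (simp add: V_def U_def X_def diff_divide_distrib)
      ultimately show ?thesis by (simp add: abs_divide divide_right_mono)
    qed
    have U_bound: "\<bar>U n w\<bar> \<le> (real n + \<mu> * real n) / sqrt n" if "feasible n" "w \<in> set_pmf (bridge n)" for n w
    proof -
      have "length w = n" using set_bridge[OF feasible_admissible[OF that(1)] that(2)] by auto
      then have "\<bar>word_total w - \<mu> * real n\<bar> \<le> real n + \<mu> * real n"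
        using bnd[of w] mult_nonneg_nonneg[of \<mu> "real n"] \<mu> unfolding abs_le_iff by linarith
      then show ?thesis by (simp add: U_def abs_divide divide_right_mono)
    qed
    have V_bound: "\<exists>B. \<forall>w\<in>set_pmf (bridge n). \<bar>V n w\<bar> \<le> B" if "feasible n" for n
    proof (intro exI ballI)
      fix w assume "w \<in> set_pmf (bridge n)"
      with near[OF that this] U_bound[OF that this]
      show "\<bar>V n w\<bar> \<le> (real n + \<mu> * real n) / sqrt n + D * (fourth_root n / sqrt n)" by linarith
    qed
    have X_bridge: "measure_pmf.expectation (codes n) (\<lambda>w. g (X n w)) = measure_pmf.expectation (bridge n) (\<lambda>w. g (V n w))"
      if "feasible n" for n and g :: "real \<Rightarrow> 'z :: {banach, second_countable_topology}"
      unfolding codes_eq_rotated_bridge[OF that] V_def by (rule integral_map_pmf)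
    have X_bound: "\<exists>B. \<forall>w\<in>set_pmf (codes n). \<bar>X n w\<bar> \<le> B" if "feasible n" for n
      using V_bound[OF that] unfolding codes_eq_rotated_bridge[OF that] V_def by simp
    define good where "good n \<longleftrightarrow> feasible n \<and> max N 1 \<le> n" for n
    \<comment> \<open>For all other sizes the limit law itself is inserted. This yields a sequence
      of laws over all \<open>n\<close>, to which the continuity theorem and the convergence of
      moments apply.\<close>
    define \<nu> where "\<nu> n = (if good n then distr (codes n) borel (X n) else centered_normal \<sigma>)" for n
    note normal = centered_normal_facts[OF \<sigma>]
    have integral_\<nu>: "(LINT x|\<nu> n. g x) = measure_pmf.expectation (codes n) (\<lambda>w. g (X n w))"
      if "good n" "g \<in> borel_measurable borel" for n and g :: "real \<Rightarrow> 'z :: {banach, second_countable_topology}"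
      using that unfolding \<nu>_def by (simp add: integral_distr)
    have rd: "real_distribution (\<nu> n)" for n
      unfolding \<nu>_def using normal(1) by (auto intro!: prob_space.real_distribution_distr measure_pmf.prob_space_axioms)
    have char_lim: "(\<lambda>n. char (\<nu> n) t) \<longlonglongrightarrow> char (centered_normal \<sigma>) t" for t
    proof -
      let ?L = "exp (complex_of_real (- (\<sigma>\<^sup>2 * t\<^sup>2 / 2)))"
      define bc where "bc n = measure_pmf.expectation (bridge n) (\<lambda>w. cis (t / sqrt n * (word_total w - \<mu> * n)))" for n
      have close: "cmod (char (\<nu> n) t - (if good n then bc n else ?L))
        \<le> \<bar>t\<bar> * (\<bar>D\<bar> * (fourth_root n / sqrt n))" for n
      proof (cases "good n")
        case True
        then have f: "feasible n" by (simp add: good_def)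
        have "char (\<nu> n) t = measure_pmf.expectation (codes n) (\<lambda>w. cis (t * X n w))"
          unfolding char_def by (subst integral_\<nu>[OF True]) (simp_all add: cis_conv_exp)
        also have "\<dots> = measure_pmf.expectation (bridge n) (\<lambda>w. cis (t * V n w))"
          by (rule X_bridge[OF f, of "\<lambda>x. cis (t * x)"])
        finally have c: "char (\<nu> n) t = measure_pmf.expectation (bridge n) (\<lambda>w. cis (t * V n w))" .
        have u: "t / sqrt n * (word_total w - \<mu> * n) = t * U n w" for w by (simp add: U_def)
        have "cmod (measure_pmf.expectation (bridge n) (\<lambda>w. cis (t * V n w)) - measure_pmf.expectation (bridge n) (\<lambda>w. cis (t * U n w)))
          = cmod (measure_pmf.expectation (bridge n) (\<lambda>w. cis (t * V n w) - cis (t * U n w)))"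
          by (simp add: Bochner_Integration.integral_diff)
        also have "\<dots> \<le> measure_pmf.expectation (bridge n) (\<lambda>w. cmod (cis (t * V n w) - cis (t * U n w)))"
          by (rule integral_norm_bound)
        also have "\<dots> \<le> measure_pmf.expectation (bridge n) (\<lambda>w. \<bar>t\<bar> * (\<bar>D\<bar> * (fourth_root n / sqrt n)))"
        proof (rule integral_mono_AE)
          show "AE w in bridge n. cmod (cis (t * V n w) - cis (t * U n w)) \<le> \<bar>t\<bar> * (\<bar>D\<bar> * (fourth_root n / sqrt n))"
          proof (rule AE_pmfI)
            fix w assume w: "w \<in> set_pmf (bridge n)"
            have "\<bar>V n w - U n w\<bar> \<le> \<bar>D\<bar> * (fourth_root n / sqrt n)"
              by (rule order_trans[OF near[OF f w]]) (intro mult_right_mono, auto)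
            then have "\<bar>t\<bar> * \<bar>V n w - U n w\<bar> \<le> \<bar>t\<bar> * (\<bar>D\<bar> * (fourth_root n / sqrt n))" by (rule mult_left_mono) simp
            then show "cmod (cis (t * V n w) - cis (t * U n w)) \<le> \<bar>t\<bar> * (\<bar>D\<bar> * (fourth_root n / sqrt n))"
              using norm_cis_diff_le[of "t * V n w" "t * U n w"] unfolding right_diff_distrib[symmetric] abs_mult by linarith
          qed
        qed (auto intro!: integrable_norm Bochner_Integration.integrable_diff)
        finally show ?thesis using True unfolding c bc_def u by simp
      next
        case False
        then have "char (\<nu> n) t = ?L" unfolding \<nu>_def by (simp only: if_False normal(2))
        then show ?thesis using False by simp
      qed
      have "(\<lambda>n. \<bar>t\<bar> * (\<bar>D\<bar> * (fourth_root n / sqrt n))) \<longlonglongrightarrow> \<bar>t\<bar> * (\<bar>D\<bar> * 0)"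
        by (intro tendsto_mult tendsto_const fourth_root_div_sqrt_tendsto)
      then have null: "(\<lambda>n. \<bar>t\<bar> * (\<bar>D\<bar> * (fourth_root n / sqrt n))) \<longlonglongrightarrow> 0" by simp
      have diff: "(\<lambda>n. char (\<nu> n) t - (if good n then bc n else ?L)) \<longlonglongrightarrow> 0"
        by (rule Lim_null_comparison[OF always_eventually null]) (rule allI, rule close)
      have "(\<lambda>n. if good n then if admissible n then bc n else ?L else ?L) \<longlonglongrightarrow> ?L"
        unfolding bc_def by (rule tendsto_if_const) (rule clt)
      moreover have "(if good n then if admissible n then bc n else ?L else ?L) = (if good n then bc n else ?L)" for n
        using feasible_admissible[of n] good_def[of n] by argo
      ultimately have "(\<lambda>n. if good n then bc n else ?L) \<longlonglongrightarrow> ?L" by (simp only:)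
      from tendsto_add[OF diff this] have "(\<lambda>n. char (\<nu> n) t) \<longlonglongrightarrow> 0 + ?L" by (simp only: diff_add_cancel)
      then show ?thesis unfolding normal(2) by (simp only: add_0)
    qed
    have conv: "weak_conv_m \<nu> (centered_normal \<sigma>)"
      by (rule levy_continuity[OF rd normal(1) char_lim])
    define M4 where "M4 = max (3 / 2 * K4 + 28561 * D ^ 4) (LINT x|centered_normal \<sigma>. x ^ 4)"
    have m4: "integrable (\<nu> n) (\<lambda>x. x ^ 4) \<and> (LINT x|\<nu> n. x ^ 4) \<le> M4" for n
    proof (cases "good n")
      case False
      then show ?thesis using normal(5) by (simp add: \<nu>_def M4_def)
    next
      case True
      then have f: "feasible n" and n: "N \<le> n" "1 \<le> n" by (auto simp: good_def)
      obtain B where B: "\<And>w. w \<in> set_pmf (codes n) \<Longrightarrow> \<bar>X n w\<bar> \<le> B" using X_bound[OF f] by blast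
      obtain B' where B': "\<And>w. w \<in> set_pmf (bridge n) \<Longrightarrow> \<bar>V n w\<bar> \<le> B'" using V_bound[OF f] by blast
      have i: "integrable (codes n) (\<lambda>w. X n w ^ 4)"
        by (rule integrable_pmf_bounded[of _ _ "B ^ 4"]) (use power_mono[OF B, of _ 4] in simp)
      have iV: "integrable (bridge n) (\<lambda>w. V n w ^ 4)"
        by (rule integrable_pmf_bounded[of _ _ "B' ^ 4"]) (use power_mono[OF B', of _ 4] in simp)
      have iU: "integrable (bridge n) (\<lambda>w. U n w ^ 4)"
        by (rule integrable_pmf_bounded[of _ _ "((real n + \<mu> * real n) / sqrt n) ^ 4"])
          (use power_mono[OF U_bound[OF f], of _ 4] in simp)
      have sq: "sqrt (real n) ^ 4 = (real n)\<^sup>2"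
        using power_mult[of "sqrt (real n)" 2 2] by simp
      have "measure_pmf.expectation (bridge n) (\<lambda>w. V n w ^ 4) \<le> measure_pmf.expectation (bridge n) (\<lambda>w. 3 / 2 * U n w ^ 4 + 28561 * D ^ 4)"
      proof (rule integral_mono_AE)
        show "AE w in bridge n. V n w ^ 4 \<le> 3 / 2 * U n w ^ 4 + 28561 * D ^ 4"
        proof (rule AE_pmfI)
          fix w assume w: "w \<in> set_pmf (bridge n)"
          have D0: "0 \<le> D * (fourth_root n / sqrt n)" using order_trans[OF abs_ge_zero near[OF f w]] .
          have "\<bar>V n w - U n w\<bar> ^ 4 \<le> (D * (fourth_root n / sqrt n)) ^ 4" by (rule power_mono[OF near[OF f w]]) simp
          also have "\<dots> = D ^ 4 * (real n / (real n)\<^sup>2)"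
            by (simp add: power_mult_distrib power_divide fourth_root_pow4 sq)
          also have "\<dots> \<le> D ^ 4 * 1" using n(2) by (intro mult_left_mono) (auto simp: power2_eq_square)
          finally have "(V n w - U n w) ^ 4 \<le> D ^ 4" by (simp add: power_abs)
          then show "V n w ^ 4 \<le> 3 / 2 * U n w ^ 4 + 28561 * D ^ 4"
            using power4_add_le[of "U n w" "V n w - U n w"] by simp
        qed
      qed (use iU iV in auto)
      also have "\<dots> = 3 / 2 * measure_pmf.expectation (bridge n) (\<lambda>w. U n w ^ 4) + 28561 * D ^ 4" using iU by simp
      also have "measure_pmf.expectation (bridge n) (\<lambda>w. U n w ^ 4)
          = measure_pmf.expectation (bridge n) (\<lambda>w. (word_total w - \<mu> * n) ^ 4) / (real n)\<^sup>2"
        by (simp add: U_def power_divide sq)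
      also have "\<dots> \<le> K4" using K4[OF n(1) feasible_admissible[OF f]] n(2) by (simp add: pos_divide_le_eq)
      finally have "measure_pmf.expectation (bridge n) (\<lambda>w. V n w ^ 4) \<le> 3 / 2 * K4 + 28561 * D ^ 4" by simp
      moreover have "(LINT x|\<nu> n. x ^ 4) = measure_pmf.expectation (bridge n) (\<lambda>w. V n w ^ 4)"
        using integral_\<nu>[OF True, of "\<lambda>x. x ^ 4"] X_bridge[OF f, of "\<lambda>x. x ^ 4"] by simp
      moreover have "integrable (\<nu> n) (\<lambda>x. x ^ 4)"
        using True i unfolding \<nu>_def by (simp add: integrable_distr_eq)
      ultimately show ?thesis by (simp add: M4_def)
    qed
    have m4N: "(LINT x|centered_normal \<sigma>. x ^ 4) \<le> M4" by (simp add: M4_def)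
    have mom1: "(\<lambda>n. LINT x|\<nu> n. x) \<longlonglongrightarrow> 0"
      using weak_conv_moments(1)[OF rd normal(1) conv _ _ normal(5) m4N] m4 normal(3) by simp
    have mom2: "(\<lambda>n. LINT x|\<nu> n. x\<^sup>2) \<longlonglongrightarrow> \<sigma>\<^sup>2"
      using weak_conv_moments(2)[OF rd normal(1) conv _ _ normal(5) m4N] m4 normal(4) by simp
    have goodI: "good n" if "max N 1 \<le> n" "feasible n" for n using that by (simp add: good_def)
    have moments: "(LINT x|\<nu> n. x) = (measure_pmf.expectation (codes n) H - \<mu> * real n) / sqrt (real n)
        \<and> (LINT x|\<nu> n. x\<^sup>2) - (LINT x|\<nu> n. x)\<^sup>2 = measure_pmf.variance (codes n) H / real n" if g: "good n" for n
    proof -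
      have f: "feasible n" and n: "1 \<le> n" using g by (auto simp: good_def)
      obtain B where B: "\<And>w. w \<in> set_pmf (codes n) \<Longrightarrow> \<bar>X n w\<bar> \<le> B" using X_bound[OF f] by blast
      have HX: "H w = sqrt n * X n w + \<mu> * n" for w using n by (simp add: X_def)
      have sqX: "sq_int (codes n) (X n)" unfolding sq_int_def
        by (rule integrable_pmf_bounded[of _ _ "B ^ 2"]) (use power_mono[OF B, of _ 2] in simp)
      note iX = sq_int_integrable[OF sqX]
      have e1: "(LINT x|\<nu> n. x) = measure_pmf.expectation (codes n) (X n)"
        using integral_\<nu>[OF g, of "\<lambda>x. x"] by simp
      have e2: "(LINT x|\<nu> n. x\<^sup>2) = measure_pmf.expectation (codes n) (\<lambda>w. (X n w)\<^sup>2)"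
        using integral_\<nu>[OF g, of "\<lambda>x. x\<^sup>2"] by simp
      have EH: "measure_pmf.expectation (codes n) H = sqrt n * measure_pmf.expectation (codes n) (X n) + \<mu> * n"
        unfolding HX using iX by simp
      have d: "H w - measure_pmf.expectation (codes n) H = sqrt n * (X n w - measure_pmf.expectation (codes n) (X n))" for w
        unfolding EH by (simp add: HX right_diff_distrib)
      have "measure_pmf.variance (codes n) H = real n * measure_pmf.variance (codes n) (X n)"
        unfolding d by (simp add: power_mult_distrib)
      then show ?thesis unfolding e1 e2 using variance_eq_sq[OF sqX] n EH by simp
    qed
    show "weak_conv_along feasible_sizes (\<lambda>n. distr (codes n) borel (\<lambda>w. (H w - \<mu> * real n) / sqrt (real n))) (centered_normal \<sigma>)"
      unfolding weak_conv_along_def feasible_sizes_def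
    proof (intro allI impI)
      fix x assume "isCont (cdf (centered_normal \<sigma>)) x"
      then have lim: "(\<lambda>n. cdf (\<nu> n) x) \<longlonglongrightarrow> cdf (centered_normal \<sigma>) x" using conv unfolding weak_conv_m_def weak_conv_def by blast
      show "((\<lambda>n. cdf (distr (codes n) borel (\<lambda>w. (H w - \<mu> * real n) / sqrt (real n))) x) \<longlongrightarrow> cdf (centered_normal \<sigma>) x)
          (inf sequentially (principal {n. feasible n}))"
        by (rule tendsto_along[OF lim, of "max N 1"]) (use goodI in \<open>simp add: \<nu>_def X_def[abs_def]\<close>)
    qed
    show "((\<lambda>n. (measure_pmf.expectation (codes n) H - \<mu> * real n) / sqrt (real n)) \<longlongrightarrow> 0) feasible_sizes"
      unfolding feasible_sizes_def by (rule tendsto_along[OF mom1, of "max N 1"]) (rule moments[OF goodI, THEN conjunct1, symmetric])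
    have "(\<lambda>n. (LINT x|\<nu> n. x\<^sup>2) - (LINT x|\<nu> n. x)\<^sup>2) \<longlonglongrightarrow> \<sigma>\<^sup>2 - 0\<^sup>2"
      by (intro tendsto_diff tendsto_power mom1 mom2)
    then have v: "(\<lambda>n. (LINT x|\<nu> n. x\<^sup>2) - (LINT x|\<nu> n. x)\<^sup>2) \<longlonglongrightarrow> \<sigma>\<^sup>2" by simp
    show "((\<lambda>n. measure_pmf.variance (codes n) H / real n) \<longlongrightarrow> \<sigma>\<^sup>2) feasible_sizes"
      unfolding feasible_sizes_def by (rule tendsto_along[OF v, of "max N 1"]) (rule moments[OF goodI, THEN conjunct2, symmetric])
  qed
qed

end

section \<open>Transfer to the conditioned tree\<close>

text \<open>The gain is \<open>ln (1 + R)\<close>, which exceeds \<open>ln R\<close> by at most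
  \<open>ln 2 \<le> 1\<close>, and \<open>ln S\<close> exceeds \<open>ln R\<close> by at most
  \<open>ln n \<le> 4 * fourth_root n\<close>. The constant 5 covers both deviations.\<close>

lemma code_subtrees_near_word_total:
  assumes "valid_from w 0"
  shows "0 \<le> ln (real (code_root_subtrees w))"
    and "ln (real (code_root_subtrees w)) \<le> ln (real (code_subtrees w))"
    and "ln (real (code_subtrees w)) \<le> ln (real (length w)) + ln (real (code_root_subtrees w))"
    and "\<bar>ln (real (code_root_subtrees w)) - word_total w\<bar> \<le> 5 * fourth_root (length w)"
    and "\<bar>ln (real (code_subtrees w)) - word_total w\<bar> \<le> 5 * fourth_root (length w)"
proof -
  let ?R = "code_root_subtrees w" and ?S = "code_subtrees w" and ?n = "length w"
  note b = code_subtrees_bounds[OF assms]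
  have n: "1 \<le> ?n" using b(1-3) by (cases w) auto
  show 1: "0 \<le> ln (real ?R)" using b(1) by simp
  show 2: "ln (real ?R) \<le> ln (real ?S)" using b(1,2) by simp
  have "real ?S \<le> real ?n * real ?R" using b(3) by (metis of_nat_le_iff of_nat_mult)
  then have "ln (real ?S) \<le> ln (real ?n * real ?R)" using b(1,2) n by (subst ln_le_cancel_iff) auto
  also have "\<dots> = ln (real ?n) + ln (real ?R)" using b(1) n by (intro ln_mult_pos) auto
  finally show 3: "ln (real ?S) \<le> ln (real ?n) + ln (real ?R)" .
  have "ln (1 + real ?R) \<le> ln (2 * real ?R)" using b(1) by (subst ln_le_cancel_iff) auto
  also have "\<dots> = ln 2 + ln (real ?R)" using b(1) by (intro ln_mult_pos) auto
  also have "ln 2 \<le> (1 :: real)" using ln_add_one_self_le_self[of 1] by simp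
  finally have 4: "word_total w \<le> 1 + ln (real ?R)" unfolding b(4) by simp
  have 5: "ln (real ?R) \<le> word_total w" unfolding b(4) using b(1) by simp
  have 6: "ln (real ?n) \<le> 4 * fourth_root ?n"
  proof (rule order_trans[OF _ ln_le_fourth_root])
    have "0 < real ?n" using n by linarith
    then show "ln (real ?n) \<le> ln (1 + real ?n)" by (subst ln_le_cancel_iff) linarith+
  qed
  show "\<bar>ln (real ?R) - word_total w\<bar> \<le> 5 * fourth_root ?n" "\<bar>ln (real ?S) - word_total w\<bar> \<le> 5 * fourth_root ?n"
    using 1 2 3 4 5 6 fourth_root_ge_1[OF n] unfolding abs_le_iff by linarith+
qed

lemma conditioned_space_transfer:
  assumes "0 < measure (offspring_space p) (size_event p n)"
  shows "distr (conditioned_space p n) borel (\<lambda>c. g (tree_code c))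
      = distr (cond_pmf (replicate_pmf n p) {w. valid_from w 0}) borel (g :: nat list \<Rightarrow> real)"
    and "(LINT c|conditioned_space p n. g (tree_code c))
      = measure_pmf.expectation (cond_pmf (replicate_pmf n p) {w. valid_from w 0}) g"
proof -
  have meas: "tree_code \<in> measurable (conditioned_space p n) (count_space UNIV)"
    unfolding conditioned_space_def using measurable_tree_code by (simp cong: measurable_cong_sets)
  show "distr (conditioned_space p n) borel (\<lambda>c. g (tree_code c))
      = distr (cond_pmf (replicate_pmf n p) {w. valid_from w 0}) borel g"
    unfolding conditioned_law(2)[OF assms, symmetric] by (subst distr_distr) (use meas in \<open>auto simp: o_def\<close>)
  show "(LINT c|conditioned_space p n. g (tree_code c))
      = measure_pmf.expectation (cond_pmf (replicate_pmf n p) {w. valid_from w 0}) g"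
    unfolding conditioned_law(2)[OF assms, symmetric] by (subst integral_distr) (use meas in auto)
qed

lemma weak_conv_along_transfer:
  assumes "weak_conv_along F Ns M" "G \<le> F" "\<forall>\<^sub>F n in G. Ms n = Ns n"
  shows "weak_conv_along G Ms M"
  unfolding weak_conv_along_def
proof (intro allI impI)
  fix x assume "isCont (cdf M) x"
  then have "((\<lambda>n. cdf (Ns n) x) \<longlongrightarrow> cdf M x) G"
    using assms(1,2) unfolding weak_conv_along_def by (blast intro: tendsto_mono)
  moreover have "\<forall>\<^sub>F n in G. cdf (Ns n) x = cdf (Ms n) x" using assms(3) by eventually_elim simp
  ultimately show "((\<lambda>n. cdf (Ms n) x) \<longlongrightarrow> cdf M x) G" by (rule Lim_transform_eventually)
qed

theorem theorem2p1:
  fixes p :: "nat pmf"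
  assumes mean: "measure_pmf.expectation p real = 1"
    and second_moment: "integrable (measure_pmf p) (\<lambda>k. (real k)\<^sup>2)"
    and var_pos: "measure_pmf.variance p real > 0"
  shows "\<exists>\<mu> \<sigma> :: real. \<mu> > 0 \<and> \<sigma> > 0 \<and>
    weak_conv_along (sizes_at_top p)
      (\<lambda>n. distr (conditioned_space p n) borel
             (\<lambda>c. (ln (real (num_root_subtrees (tree_of c))) - \<mu> * real n) / sqrt (real n)))
      (density lborel (normal_density 0 \<sigma>)) \<and>
    weak_conv_along (sizes_at_top p)
      (\<lambda>n. distr (conditioned_space p n) borel
             (\<lambda>c. (ln (real (num_subtrees (tree_of c))) - \<mu> * real n) / sqrt (real n)))
      (density lborel (normal_density 0 \<sigma>)) \<and>
    (\<lambda>n. prob_space.expectation (conditioned_space p n)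
             (\<lambda>c. ln (real (num_root_subtrees (tree_of c))))
          - prob_space.expectation (conditioned_space p n)
             (\<lambda>c. ln (real (num_subtrees (tree_of c)))))
      \<in> O[sizes_at_top p](\<lambda>n. ln (real n)) \<and>
    (\<lambda>n. prob_space.expectation (conditioned_space p n)
             (\<lambda>c. ln (real (num_root_subtrees (tree_of c)))) - real n * \<mu>)
      \<in> o[sizes_at_top p](\<lambda>n. sqrt (real n)) \<and>
    (\<lambda>n. prob_space.variance (conditioned_space p n)
             (\<lambda>c. ln (real (num_root_subtrees (tree_of c))))
          - prob_space.variance (conditioned_space p n)
             (\<lambda>c. ln (real (num_subtrees (tree_of c)))))
      \<in> o[sizes_at_top p](\<lambda>n. real n) \<and>
    (\<lambda>n. prob_space.variance (conditioned_space p n)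
             (\<lambda>c. ln (real (num_root_subtrees (tree_of c)))) - real n * \<sigma>\<^sup>2)
      \<in> o[sizes_at_top p](\<lambda>n. real n)"
proof -
  interpret critical_offspring p by unfold_locales fact+
  define HR HS where "HR w = ln (real (code_root_subtrees w))" and "HS w = ln (real (code_subtrees w))" for w
  define F where "F = sizes_at_top p"
  obtain \<mu> \<sigma> where \<mu>: "0 < \<mu>" and \<sigma>: "0 < \<sigma>" and limits: "\<And>H c. (\<forall>w. valid_from w 0 \<longrightarrow> \<bar>H w - word_total w\<bar> \<le> c * fourth_root (length w)) \<Longrightarrow>
    weak_conv_along feasible_sizes (\<lambda>n. distr (codes n) borel (\<lambda>w. (H w - \<mu> * real n) / sqrt (real n))) (centered_normal \<sigma>) \<and>
    ((\<lambda>n. (measure_pmf.expectation (codes n) H - \<mu> * real n) / sqrt (real n)) \<longlongrightarrow> 0) feasible_sizes \<and>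
    ((\<lambda>n. measure_pmf.variance (codes n) H / real n) \<longlongrightarrow> \<sigma>\<^sup>2) feasible_sizes"
    using functional_limits by blast
  have HR: "\<forall>w. valid_from w 0 \<longrightarrow> \<bar>HR w - word_total w\<bar> \<le> 5 * fourth_root (length w)"
    and HS: "\<forall>w. valid_from w 0 \<longrightarrow> \<bar>HS w - word_total w\<bar> \<le> 5 * fourth_root (length w)"
    using code_subtrees_near_word_total(4,5) by (simp_all add: HR_def HS_def)
  \<comment> \<open>A positive probability of the size yields a tree word of that length in the
    support, so the filter of possible sizes is finer than that of the feasible ones.\<close>
  have F: "F \<le> feasible_sizes"
    unfolding F_def sizes_at_top_def feasible_sizes_def
    by (intro inf_mono order_refl) (use conditioned_law(1) in \<open>auto simp: feasible_def\<close>)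
  have size: "\<forall>\<^sub>F n in F. 0 < measure (offspring_space p) (size_event p n)"
    by (simp add: F_def sizes_at_top_def eventually_inf_principal)
  have feas: "feasible n" "1 \<le> n" if "0 < measure (offspring_space p) (size_event p n)" for n
  proof -
    show "feasible n" using conditioned_law(1)[OF that] by (simp add: feasible_def)
    then show "1 \<le> n" using feasible_admissible by (auto simp: admissible_def)
  qed
  have pos: "\<forall>\<^sub>F n in F. 0 < n" using size by eventually_elim (use feas in force)
  define eR eS where "eR n = (LINT c|conditioned_space p n. ln (real (num_root_subtrees (tree_of c))))"
    and "eS n = (LINT c|conditioned_space p n. ln (real (num_subtrees (tree_of c))))" for n
  define vR vS where "vR n = (LINT c|conditioned_space p n. (ln (real (num_root_subtrees (tree_of c))) - eR n)\<^sup>2)"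
    and "vS n = (LINT c|conditioned_space p n. (ln (real (num_subtrees (tree_of c))) - eS n)\<^sup>2)" for n
  have e: "eR n = measure_pmf.expectation (codes n) HR" "eS n = measure_pmf.expectation (codes n) HS"
    if "0 < measure (offspring_space p) (size_event p n)" for n
    unfolding eR_def eS_def num_subtrees_tree_code HR_def[symmetric] HS_def[symmetric]
    by (rule conditioned_space_transfer(2)[OF that])+
  have v: "vR n = measure_pmf.variance (codes n) HR" "vS n = measure_pmf.variance (codes n) HS"
    if "0 < measure (offspring_space p) (size_event p n)" for n
    unfolding vR_def vS_def num_subtrees_tree_code HR_def[symmetric] HS_def[symmetric] e[OF that, symmetric]
    by (rule conditioned_space_transfer(2)[OF that])+
  have eR_lim: "((\<lambda>n. (eR n - \<mu> * real n) / sqrt (real n)) \<longlongrightarrow> 0) F"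
    by (rule Lim_transform_eventually[OF tendsto_mono[OF F]], rule limits[OF HR, THEN conjunct2, THEN conjunct1])
      (use size in \<open>eventually_elim, simp add: e\<close>)
  have vR_lim: "((\<lambda>n. vR n / real n) \<longlongrightarrow> \<sigma>\<^sup>2) F"
    by (rule Lim_transform_eventually[OF tendsto_mono[OF F]], rule limits[OF HR, THEN conjunct2, THEN conjunct2])
      (use size in \<open>eventually_elim, simp only: v\<close>)
  have vS_lim: "((\<lambda>n. vS n / real n) \<longlongrightarrow> \<sigma>\<^sup>2) F"
    by (rule Lim_transform_eventually[OF tendsto_mono[OF F]], rule limits[OF HS, THEN conjunct2, THEN conjunct2])
      (use size in \<open>eventually_elim, simp only: v\<close>)
  have weakR: "weak_conv_along F (\<lambda>n. distr (conditioned_space p n) borel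
      (\<lambda>c. (ln (real (num_root_subtrees (tree_of c))) - \<mu> * real n) / sqrt (real n))) (centered_normal \<sigma>)"
    by (rule weak_conv_along_transfer[OF limits[OF HR, THEN conjunct1] F], use size in eventually_elim,
        unfold num_subtrees_tree_code HR_def[symmetric])
      (rule conditioned_space_transfer(1))
  have weakS: "weak_conv_along F (\<lambda>n. distr (conditioned_space p n) borel
      (\<lambda>c. (ln (real (num_subtrees (tree_of c))) - \<mu> * real n) / sqrt (real n))) (centered_normal \<sigma>)"
    by (rule weak_conv_along_transfer[OF limits[OF HS, THEN conjunct1] F], use size in eventually_elim,
        unfold num_subtrees_tree_code HS_def[symmetric])
      (rule conditioned_space_transfer(1))
  \<comment> \<open>The limits only show that the two means differ by \<open>o(sqrt n)\<close>; the
    logarithmic bound comes from integrating the pointwise comparison of \<open>HR\<close> and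
    \<open>HS\<close>.\<close>
  have diff: "\<bar>eR n - eS n\<bar> \<le> ln (real n)" if n: "0 < measure (offspring_space p) (size_event p n)" for n
  proof -
    have set: "valid_from w 0" "length w = n" if "w \<in> set_pmf (codes n)" for w
      using that set_cond_pmf[of "W n" "{w. valid_from w 0}"] feas(1)[OF n] length_replicate_pmf unfolding feasible_def by auto
    have b: "0 \<le> HR w" "HR w \<le> HS w" "HS w \<le> ln (real n) + HR w" "HR w \<le> real n" if w: "w \<in> set_pmf (codes n)" for w
    proof -
      note c = code_subtrees_near_word_total[OF set(1)[OF w], folded HR_def HS_def]
      show "0 \<le> HR w" "HR w \<le> HS w" "HS w \<le> ln (real n) + HR w" using c(1-3) set(2)[OF w] by auto
      have "HR w \<le> word_total w"
        unfolding code_subtrees_bounds(4)[OF set(1)[OF w]] HR_def using code_subtrees_bounds(1)[OF set(1)[OF w]] by simp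
      also have "\<dots> \<le> real n" using word_gain_bounds[of "[]" w] set(2)[OF w] by simp
      finally show "HR w \<le> real n" .
    qed
    have iR: "integrable (codes n) HR" by (rule integrable_pmf_bounded[of _ _ "real n"]) (use b in fastforce)
    have iS: "integrable (codes n) HS"
    proof (rule integrable_pmf_bounded[of _ _ "ln (real n) + real n"])
      fix w assume "w \<in> set_pmf (codes n)"
      from b[OF this] show "norm (HS w) \<le> ln (real n) + real n" by simp
    qed
    have "measure_pmf.expectation (codes n) HR \<le> measure_pmf.expectation (codes n) HS"
      by (rule integral_mono_AE[OF iR iS]) (use b in \<open>auto simp: AE_measure_pmf_iff\<close>)
    moreover have "measure_pmf.expectation (codes n) HS \<le> measure_pmf.expectation (codes n) (\<lambda>w. ln (real n) + HR w)"
      by (rule integral_mono_AE[OF iS]) (use iR b in \<open>auto simp: AE_measure_pmf_iff\<close>)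
    moreover have "measure_pmf.expectation (codes n) (\<lambda>w. ln (real n) + HR w) = ln (real n) + measure_pmf.expectation (codes n) HR"
      using iR by simp
    ultimately show ?thesis unfolding e[OF n] by linarith
  qed
  have bigO: "(\<lambda>n. eR n - eS n) \<in> O[F](\<lambda>n. ln (real n))"
  proof (rule bigoI[where c=1])
    show "\<forall>\<^sub>F n in F. norm (eR n - eS n) \<le> 1 * norm (ln (real n))"
      using size by eventually_elim (use diff in force)
  qed
  have o_mean: "(\<lambda>n. eR n - real n * \<mu>) \<in> o[F](\<lambda>n. sqrt (real n))"
    by (rule smalloI_tendsto) (use eR_lim pos in \<open>simp_all add: mult.commute eventually_mono\<close>)
  have "((\<lambda>n. vR n / real n - vS n / real n) \<longlongrightarrow> \<sigma>\<^sup>2 - \<sigma>\<^sup>2) F" by (intro tendsto_diff vR_lim vS_lim)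
  then have o_var: "(\<lambda>n. vR n - vS n) \<in> o[F](\<lambda>n. real n)"
    by (intro smalloI_tendsto) (use pos in \<open>simp_all add: diff_divide_distrib eventually_mono\<close>)
  have "((\<lambda>n. vR n / real n - \<sigma>\<^sup>2) \<longlongrightarrow> \<sigma>\<^sup>2 - \<sigma>\<^sup>2) F" by (intro tendsto_diff vR_lim tendsto_const)
  moreover have "\<forall>\<^sub>F n in F. vR n / real n - \<sigma>\<^sup>2 = (vR n - real n * \<sigma>\<^sup>2) / real n"
    using pos by eventually_elim (simp add: diff_divide_distrib)
  ultimately have "((\<lambda>n. (vR n - real n * \<sigma>\<^sup>2) / real n) \<longlongrightarrow> \<sigma>\<^sup>2 - \<sigma>\<^sup>2) F"
    by (rule Lim_transform_eventually)
  then have "((\<lambda>n. (vR n - real n * \<sigma>\<^sup>2) / real n) \<longlongrightarrow> 0) F" by simp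
  then have o_var_lim: "(\<lambda>n. vR n - real n * \<sigma>\<^sup>2) \<in> o[F](\<lambda>n. real n)"
    by (rule smalloI_tendsto) (use pos in \<open>simp add: eventually_mono\<close>)
  show ?thesis
    using \<mu> \<sigma> weakR weakS bigO o_mean o_var o_var_lim
    unfolding F_def vR_def vS_def eR_def eS_def by blast
qed

end
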